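(* (Generalized second Ray–Knight theorem.) Let $X$ be a symmetric Markov process on $S$ as described in the context, let $0\in S$ be a fixed point, and assume that the $\alpha$-potential densities $u^{\alpha}(x,y)$ are continuous on $S\times S$ for every $\alpha>0$, that $u(0,0)=\infty$, and that $P^{0}(T_{x}<\infty)=P^{x}(T_{0}<\infty)=1$ for all $x\in S$. Let $\eta=\{\eta_{x},x\in S\}$ be the mean zero Gaussian process, independent of $X$, with covariance $$u_{T_{0}}(x,y)=E^{x}\left(L^{y}_{T_{0}}\right),\qquad x,y\in S.$$ Then for every $t>0$, every sequence $x_1,x_2,\ldots$ in $S$ and every bounded measurable function $F$ on $\mathbb{R}^{\infty}$, $$E_{\eta}P^{0}\left(F\left(L^{x_{i}}_{\tau(t)}+\tfrac12\eta^{2}_{x_{i}}\right)\right)=E_{\eta}\left(F\left(\tfrac12\left(\eta_{x_{i}}+\sqrt{2t}\right)^{2}\right)\right).$$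
   Context: $S$ is a locally compact topological space with countable base, $m$ is a measure on $S$, and $p_t(x,y)\ge 0$, $t>0$, $x,y\in S$, are transition densities with respect to $m$: $\int p_t(x,y)\,dm(y)\le 1$ and $\int p_t(x,y)p_s(y,z)\,dm(y)=p_{t+s}(x,z)$. A cemetery state $\Delta\notin S$ is adjoined in the usual way, and functions on $S$ are extended by $f(\Delta)=0$. $X=\{X_t,t\ge0\}$ is a Markov process with transition densities $p_t(x,y)$, with right continuous paths and satisfying the strong Markov property; $P^x$ (and $E^x$) is the law (expectation) of $X$ started at $x$; $P^x(\cdot)$ applied to a random variable also denotes expectation. $X$ is symmetric: $p_t(x,y)=p_t(y,x)$. The $\alpha$-potential densities are $u^{\alpha}(x,y)=\int_0^\infty e^{-\alpha t}p_t(x,y)\,dt$, $\alpha\ge0$, and $u=u^{0}$. The local time is $L^{y}_{t}=\lim_{\epsilon\to0}\int_0^t f_{\epsilon,y}(X_r)\,dr$, where $f_{\epsilon,y}\ge 0$ is supported in the ball $B(y,\epsilon)$ with $\int f_{\epsilon,y}\,dm=1$; under the continuity of $u^\alpha$ for some $\alpha$ the limit exists locally uniformly in $t$, $P^x$-almost surely, and $t\mapsto L^y_t$ is continuous, increasing, with $L^y_0=0$ and $L^{y}_{t+s}=L^{y}_{t}+L^{y}_{s}\circ\theta_{t}$, where $\theta_t$ is the shift operator. $T_{y}=\inf\{s: X_{s}=y\}$ is the first hitting time of $y$, and $\tau(t)=\inf\{s: L^{0}_{s}>t\}$ is the right continuous inverse local time at $0$. Under the stated hypotheses the function $u_{T_0}(x,y)$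 is symmetric and positive definite, so the Gaussian process $\eta$ exists. $E_\eta$ is expectation with respect to $\eta$. For a sequence $h_{x_1},h_{x_2},\dots$ of real numbers, $F(h_{x_i})$ abbreviates $F(h_{x_1},h_{x_2},h_{x_3},\ldots)$. *)

theory Defs
  imports "HOL-Probability.Probability"
begin

text \<open>
  The state space is a type \<open>'s\<close>, a separable metric space (a locally compact Hausdorff space with
  countable base is metrizable; the metric provides the balls used for the local times). The
  cemetery state is \<^term>\<open>None\<close> in \<open>'s option\<close>. The Alexandroff compactification is the usual
  topology there: the cemetery is the point at infinity, isolated if \<open>'s\<close> is compact.
\<close>

definition cemetery_topology :: "'s::topological_space option topology" where
  "cemetery_topology = Alexandroff_compactification euclidean"

definition cemetery_borel :: "'s::topological_space option measure" where
  "cemetery_borel = sigma UNIV {U. openin cemetery_topology U}"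

definition cemetery_extend :: "('s \<Rightarrow> real) \<Rightarrow> 's option \<Rightarrow> real" where
  "cemetery_extend g \<xi> = (case \<xi> of None \<Rightarrow> 0 | Some x \<Rightarrow> g x)"

text \<open>
  Filtrations are indexed by \<open>[0,\<infinity>]\<close>, so that the library notions of stopping time and of the
  sigma-algebra of a stopping time apply to stopping times that may be infinite.
\<close>

definition natural_filtration ::
    "'w measure \<Rightarrow> (real \<Rightarrow> 'w \<Rightarrow> 's::topological_space option) \<Rightarrow> ennreal \<Rightarrow> 'w measure" where
  "natural_filtration W X t = sigma (space W)
     {X s -` A \<inter> space W | s A. 0 \<le> s \<and> ennreal s \<le> t \<and> A \<in> sets cemetery_borel}"

text \<open>The alternative \<open>u = \<top>\<close> only matters for \<open>t = \<top>\<close>, where no \<open>u > t\<close> exists.\<close>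

definition right_filtration ::
    "'w measure \<Rightarrow> (real \<Rightarrow> 'w \<Rightarrow> 's::topological_space option) \<Rightarrow> ennreal \<Rightarrow> 'w measure" where
  "right_filtration W X t =
     sigma (space W) (\<Inter>u\<in>{u. t < u \<or> u = \<top>}. sets (natural_filtration W X u))"

lemma filtration_right_filtration: "filtration (space W) (right_filtration W X)"
proof
  have n: "space (natural_filtration W X u) = space W" for u
    unfolding natural_filtration_def by (rule space_measure_of) auto
  have Pow: "(\<Inter>u\<in>{u. t < u \<or> u = \<top>}. sets (natural_filtration W X u)) \<subseteq> Pow (space W)" for t
    using sets.space_closed[of "natural_filtration W X \<top>"] n by fastforce
  show "space (right_filtration W X t) = space W" for t
    unfolding right_filtration_def using Pow by (rule space_measure_of)
  have sets: "sets (right_filtration W X t)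
      = sigma_sets (space W) (\<Inter>u\<in>{u. t < u \<or> u = \<top>}. sets (natural_filtration W X u))" for t
    unfolding right_filtration_def using Pow by (rule sets_measure_of)
  show "sets (right_filtration W X s) \<subseteq> sets (right_filtration W X t)" if "s \<le> t" for s t
    unfolding sets using that by (intro sigma_sets_mono') auto
qed

locale transition_densities =
  fixes m :: "'s::{metric_space, second_countable_topology} measure"
    and p :: "real \<Rightarrow> 's \<Rightarrow> 's \<Rightarrow> real"
  assumes sets_m: "sets m = sets borel"
    and p_nonneg: "\<And>t x y. 0 < t \<Longrightarrow> 0 \<le> p t x y"
    and p_measurable: "(\<lambda>(t, x, y). p t x y)
      \<in> borel_measurable (restrict_space borel {0<..} \<Otimes>\<^sub>M borel \<Otimes>\<^sub>M borel)"
    and p_sub_markov: "\<And>t x. 0 < t \<Longrightarrow> (\<integral>\<^sup>+y. ennreal (p t x y) \<partial>m) \<le> 1"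
    and chapman_kolmogorov: "\<And>t s x z. 0 < t \<Longrightarrow> 0 < s \<Longrightarrow>
      (\<integral>\<^sup>+y. ennreal (p t x y * p s y z) \<partial>m) = ennreal (p (t + s) x z)"

definition transition_prob ::
    "'s measure \<Rightarrow> (real \<Rightarrow> 's \<Rightarrow> 's \<Rightarrow> real) \<Rightarrow> real \<Rightarrow> 's option \<Rightarrow> 's set \<Rightarrow> ennreal" where
  "transition_prob m p t \<xi> B =
     (case \<xi> of None \<Rightarrow> 0 | Some x \<Rightarrow> (\<integral>\<^sup>+y\<in>B. ennreal (p t x y) \<partial>m))"

locale strong_markov_process = transition_densities m p
  for m :: "'s::{metric_space, second_countable_topology} measure"
    and p :: "real \<Rightarrow> 's \<Rightarrow> 's \<Rightarrow> real" +
  fixes W :: "'w measure"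
    and X :: "real \<Rightarrow> 'w \<Rightarrow> 's option"
    and \<theta> :: "real \<Rightarrow> 'w \<Rightarrow> 'w"
    and P :: "'s \<Rightarrow> 'w measure"
  assumes prob_space_P: "\<And>x. prob_space (P x)"
    and sets_P: "\<And>x. sets (P x) = sets W"
    and X_measurable: "\<And>t. 0 \<le> t \<Longrightarrow> X t \<in> measurable W cemetery_borel"
    and P_measurable: "\<And>E. E \<in> sets (natural_filtration W X \<top>) \<Longrightarrow>
      (\<lambda>x. emeasure (P x) E) \<in> borel_measurable borel"
    and shift: "\<And>t \<omega>. 0 \<le> t \<Longrightarrow> \<omega> \<in> space W \<Longrightarrow>
      \<theta> t \<omega> \<in> space W \<and> (\<forall>s\<ge>0. X s (\<theta> t \<omega>) = X (s + t) \<omega>)"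
    and right_continuous: "\<And>t \<omega>. 0 \<le> t \<Longrightarrow> \<omega> \<in> space W \<Longrightarrow>
      limitin cemetery_topology (\<lambda>s. X s \<omega>) (X t \<omega>) (at_right t)"
    and cemetery: "\<And>s t \<omega>. 0 \<le> s \<Longrightarrow> s \<le> t \<Longrightarrow> \<omega> \<in> space W \<Longrightarrow> X s \<omega> = None \<Longrightarrow> X t \<omega> = None"
    and start: "\<And>x. AE \<omega> in P x. X 0 \<omega> = Some x"
    and transition: "\<And>x t B. 0 < t \<Longrightarrow> B \<in> sets borel \<Longrightarrow>
      emeasure (P x) {\<omega> \<in> space W. X t \<omega> \<in> Some ` B} = transition_prob m p t (Some x) B"
    and strong_markov: "\<And>x T A s B.
      stopping_time (right_filtration W X) T \<Longrightarrow>
      A \<in> sets (filtration.pre_sigma (space W) (right_filtration W X) T) \<Longrightarrow>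
      0 < s \<Longrightarrow> B \<in> sets borel \<Longrightarrow>
      emeasure (P x) {\<omega> \<in> A. T \<omega> < \<top> \<and> X (enn2real (T \<omega>) + s) \<omega> \<in> Some ` B} =
      (\<integral>\<^sup>+\<omega>\<in>{\<omega> \<in> A. T \<omega> < \<top>}. transition_prob m p s (X (enn2real (T \<omega>)) \<omega>) B \<partial>P x)"

locale symmetric_markov_process = strong_markov_process m p W X \<theta> P
  for m :: "'s::{metric_space, second_countable_topology} measure"
    and p :: "real \<Rightarrow> 's \<Rightarrow> 's \<Rightarrow> real"
    and W :: "'w measure"
    and X :: "real \<Rightarrow> 'w \<Rightarrow> 's option"
    and \<theta> :: "real \<Rightarrow> 'w \<Rightarrow> 'w"
    and P :: "'s \<Rightarrow> 'w measure" +
  assumes p_symmetric: "\<And>t x y. 0 < t \<Longrightarrow> p t x y = p t y x"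

definition potential_density ::
    "(real \<Rightarrow> 's \<Rightarrow> 's \<Rightarrow> real) \<Rightarrow> real \<Rightarrow> 's \<Rightarrow> 's \<Rightarrow> ennreal" where
  "potential_density p \<alpha> x y = (\<integral>\<^sup>+t\<in>{0<..}. ennreal (exp (- \<alpha> * t) * p t x y) \<partial>lborel)"

definition approximate_deltas ::
    "'s::metric_space measure \<Rightarrow> (real \<Rightarrow> 's \<Rightarrow> 's \<Rightarrow> real) \<Rightarrow> bool" where
  "approximate_deltas m f \<longleftrightarrow> (\<forall>\<epsilon>>0. \<forall>y. f \<epsilon> y \<in> borel_measurable m \<and> (\<forall>x. 0 \<le> f \<epsilon> y x) \<and>
     (\<forall>x. x \<notin> ball y \<epsilon> \<longrightarrow> f \<epsilon> y x = 0) \<and> (\<integral>\<^sup>+x. ennreal (f \<epsilon> y x) \<partial>m) = 1)"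

definition occupation ::
    "(real \<Rightarrow> 's \<Rightarrow> 's \<Rightarrow> real) \<Rightarrow> (real \<Rightarrow> 'w \<Rightarrow> 's option) \<Rightarrow> real \<Rightarrow> 's \<Rightarrow> real \<Rightarrow> 'w \<Rightarrow> real" where
  "occupation f X \<epsilon> y t \<omega> = (LINT r:{0..t}|lborel. cemetery_extend (f \<epsilon> y) (X r \<omega>))"

definition local_time ::
    "(real \<Rightarrow> 's \<Rightarrow> 's \<Rightarrow> real) \<Rightarrow> (real \<Rightarrow> 'w \<Rightarrow> 's option) \<Rightarrow> 's \<Rightarrow> real \<Rightarrow> 'w \<Rightarrow> real" where
  "local_time f X y t \<omega> = Lim (at_right 0) (\<lambda>\<epsilon>. occupation f X \<epsilon> y t \<omega>)"

definition hitting_time :: "(real \<Rightarrow> 'w \<Rightarrow> 's option) \<Rightarrow> 's \<Rightarrow> 'w \<Rightarrow> ennreal" where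
  "hitting_time X y \<omega> = Inf (ennreal ` {s. 0 \<le> s \<and> X s \<omega> = Some y})"

definition inverse_local_time ::
    "(real \<Rightarrow> 's \<Rightarrow> 's \<Rightarrow> real) \<Rightarrow> (real \<Rightarrow> 'w \<Rightarrow> 's option) \<Rightarrow> 's \<Rightarrow> real \<Rightarrow> 'w \<Rightarrow> ennreal" where
  "inverse_local_time f X y t \<omega> = Inf (ennreal ` {s. 0 \<le> s \<and> t < local_time f X y s \<omega>})"

text \<open>
  Hitting times of points are in general measurable only after completion, and so are the local
  times, being limits that exist almost surely. Expectations of functionals of the process are
  therefore taken with respect to the completion of its law. In the next definition, the
  convention \<^term>\<open>enn2real \<top> = 0\<close> is immaterial as soon as the point \<open>a\<close> is hit almost surely.
\<close>

definition killed_potential_density ::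
    "(real \<Rightarrow> 's \<Rightarrow> 's \<Rightarrow> real) \<Rightarrow> (real \<Rightarrow> 'w \<Rightarrow> 's option) \<Rightarrow> ('s \<Rightarrow> 'w measure) \<Rightarrow> 's
      \<Rightarrow> 's \<Rightarrow> 's \<Rightarrow> real" where
  "killed_potential_density f X P a x y =
     (\<integral>\<omega>. local_time f X y (enn2real (hitting_time X a \<omega>)) \<omega> \<partial>completion (P x))"

text \<open>Constants count as (degenerate) normal random variables.\<close>

definition normal_rv :: "'g measure \<Rightarrow> ('g \<Rightarrow> real) \<Rightarrow> bool" where
  "normal_rv N Z \<longleftrightarrow> Z \<in> borel_measurable N \<and>
     ((\<exists>\<mu>. AE v in N. Z v = \<mu>) \<or>
      (\<exists>\<mu> \<sigma>. 0 < \<sigma> \<and> distributed N lborel Z (\<lambda>z. ennreal (normal_density \<mu> \<sigma> z))))"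

definition gaussian_process :: "'g measure \<Rightarrow> ('s \<Rightarrow> 'g \<Rightarrow> real) \<Rightarrow> bool" where
  "gaussian_process N \<eta> \<longleftrightarrow> prob_space N \<and>
     (\<forall>I c. finite I \<longrightarrow> normal_rv N (\<lambda>v. \<Sum>x\<in>I. c x * \<eta> x v))"

definition centered_gaussian_process ::
    "'g measure \<Rightarrow> ('s \<Rightarrow> 'g \<Rightarrow> real) \<Rightarrow> ('s \<Rightarrow> 's \<Rightarrow> real) \<Rightarrow> bool" where
  "centered_gaussian_process N \<eta> C \<longleftrightarrow> gaussian_process N \<eta> \<and>
     (\<forall>x. (\<integral>v. \<eta> x v \<partial>N) = 0) \<and> (\<forall>x y. (\<integral>v. \<eta> x v * \<eta> y v \<partial>N) = C x y)"

end

theory Submission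
  imports Defs "HOL-Real_Asymp.Real_Asymp"
begin

text \<open>
  Fix points \<open>x\<^sub>k\<close> and masses \<open>\<lambda>\<^sub>k \<ge> 0\<close>, and let \<open>A\<close> be the sum of the \<open>\<lambda>\<^sub>k L\<close> at \<open>x\<^sub>k\<close>. By the strong Markov
  property at inverse local times, the expectation of \<open>exp (- A)\<close> at \<open>\<tau>(t)\<close>, started at the base point, is
  multiplicative in \<open>t\<close>, hence equal to \<open>exp (- t \<kappa>)\<close>. Resolvent equations for the process killed at
  rate \<open>dA\<close>, first discounted at rate \<open>\<alpha> > 0\<close> and then in the limit \<open>\<alpha> \<rightarrow> 0\<close>, where the potential at
  the base point explodes, show that \<open>\<kappa>\<close> is the sum of the \<open>\<lambda>\<^sub>k w(x\<^sub>k)\<close>, where \<open>w\<close> solves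
  \<open>w(z) = 1 - (\<Sum>k. \<lambda>\<^sub>k C(z, x\<^sub>k) w(x\<^sub>k))\<close> with \<open>C\<close> the potential density of the process killed at the base
  point. Weighting a centered Gaussian measure with covariance \<open>C\<close> by \<open>exp (- (\<Sum>k. \<lambda>\<^sub>k (\<eta>(x\<^sub>k) + s)\<^sup>2) / 2)\<close>
  gives total mass \<open>exp (- s\<^sup>2 \<kappa> / 2)\<close> times its value at \<open>s = 0\<close>, with the same \<open>\<kappa>\<close>. For \<open>s\<^sup>2 = 2 t\<close> the
  Laplace transforms of the two sides agree, and these determine the joint laws.
\<close>

section \<open>Measurability of the process\<close>

text \<open>The limit of vanishing discount cannot be taken in the resolvent equations as they
  stand, since the potential at the base point \<open>a\<close> diverges. Symmetry helps: for
  \<alpha> > 0 the density is \<open>U(x,y) + h(x) \<gamma> h(y)\<close>, where \<gamma> is its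
  value at \<open>(a, a)\<close>, \<open>h\<close> is the expected discount until local time at
  \<open>a\<close> starts to grow, and \<open>U\<close> stays bounded. So only the scalar \<gamma>
  diverges, and in the final identities it survives as \<open>1 / \<gamma>\<close>. The rate
  \<kappa> is found because a multiplicative function with integral \<rho> over the half-line is
  \<open>exp (- t / \<rho>)\<close>, and here \<rho> is the killed potential at \<open>a\<close>.
  Both halves add the points one at a time, which avoids inverting matrices. The two solutions w
  agree since masses are nonnegative and C is positive semidefinite. The other obstacle is
  measurability. Hitting times of points and local times are measurable only after completion,
  whereas the strong Markov property concerns stopping times of the uncompleted filtration. Hence
  measurable versions are used (lower limits along a sequence, infima over rationals, entrance times
  of open sets), tied to the given objects on almost every path.\<close>

lemma openin_cemetery_Some: "open U \<Longrightarrow> openin cemetery_topology (Some ` U)"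
  unfolding cemetery_topology_def openin_Alexandroff_compactification by auto

lemma space_cemetery_borel [simp]: "space cemetery_borel = UNIV"
  by (simp add: cemetery_borel_def space_measure_of_conv)

text \<open>A neighbourhood of the cemetery is the union of \<open>{None}\<close> and the image of
  an open set, and \<open>{None}\<close> is itself the complement of \<open>range Some\<close>. So
  compactness at infinity leaves no trace in the sigma-algebra.\<close>

lemma sets_cemetery_borel:
  "sets (cemetery_borel :: 's::t2_space option measure) = sigma_sets UNIV {Some ` U | U. open U}"
proof -
  let ?G = "{Some ` U | U :: 's set. open U}"
  have 1: "V \<in> sigma_sets UNIV ?G" if V: "openin cemetery_topology V" for V :: "'s option set"
  proof -
    consider U where "open U" "V = Some ` U" | C where "closed C" "V = insert None (Some ` (- C))"
      using V by (auto simp: cemetery_topology_def openin_Alexandroff_compactification Compl_eq_Diff_UNIV)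
    then show ?thesis
    proof cases
      case 1
      then show ?thesis by blast
    next
      case 2
      have eq: "V = (UNIV - Some ` UNIV) \<union> Some ` (- C)"
        using 2 by (auto simp: notin_range_Some)
      have a: "UNIV - Some ` UNIV \<in> sigma_sets UNIV ?G"
        by (rule sigma_sets.Compl) (use open_UNIV in blast)
      have b: "Some ` (- C) \<in> sigma_sets UNIV ?G"
        using 2 by (blast intro: sigma_sets.Basic)
      show ?thesis unfolding eq using a b by (rule sigma_sets_Un)
    qed
  qed
  show ?thesis
  proof -
    have "sets (cemetery_borel :: 's option measure) = sigma_sets UNIV {U. openin cemetery_topology U}"
      unfolding cemetery_borel_def by (rule sets_measure_of) simp
    also have "\<dots> = sigma_sets UNIV ?G"
    proof (rule sigma_sets_eqI)
      fix V :: "'s option set" assume "V \<in> ?G"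
      then show "V \<in> sigma_sets UNIV {U. openin cemetery_topology U}"
        using openin_cemetery_Some by blast
    qed (use 1 in blast)
    finally show ?thesis .
  qed
qed

lemma measurable_cemeteryI:
  fixes g :: "'a \<Rightarrow> 's::t2_space option"
  assumes "\<And>U. open U \<Longrightarrow> {x \<in> space K. g x \<in> Some ` U} \<in> sets K"
  shows "g \<in> measurable K cemetery_borel"
proof (rule measurable_sigma_sets[OF sets_cemetery_borel])
  fix A :: "'s option set" assume "A \<in> {Some ` U | U. open U}"
  then obtain U where "A = Some ` U" "open U" by blast
  moreover have "g -` (Some ` U) \<inter> space K = {x \<in> space K. g x \<in> Some ` U}" by auto
  ultimately show "g -` A \<inter> space K \<in> sets K" using assms by simp
qed auto

lemma Some_measurable: "Some \<in> measurable borel (cemetery_borel :: 's::t2_space option measure)"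
  by (rule measurable_cemeteryI) (auto simp: image_iff)

lemma Some_image_sets:
  fixes B :: "'s::t2_space set"
  assumes "B \<in> sets borel" shows "Some ` B \<in> sets cemetery_borel"
proof -
  have "B \<in> sigma_sets UNIV {U. open U}" using assms by (simp add: borel_def)
  then show ?thesis
  proof induct
    case (Basic a)
    then show ?case by (auto simp: sets_cemetery_borel)
  next
    case (Compl a)
    have "Some ` (UNIV - a) = Some ` UNIV - Some ` a" by auto
    moreover have "Some ` (UNIV :: 's set) \<in> sets cemetery_borel"
      using open_UNIV by (auto simp: sets_cemetery_borel)
    ultimately show ?case using Compl by simp
  next
    case (Union a)
    then show ?case by (simp add: image_UN sets.countable_nat_UN)
  qed simp
qed

lemma None_sets: "{None :: 's::t2_space option} \<in> sets cemetery_borel"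
proof -
  have "{None :: 's option} = space cemetery_borel - Some ` UNIV" by (auto simp: notin_range_Some)
  also have "\<dots> \<in> sets cemetery_borel" by (intro sets.compl_sets Some_image_sets) simp
  finally show ?thesis .
qed

lemma measurable_case_option_cemetery:
  fixes k :: "'s::t2_space \<Rightarrow> 'b"
  assumes k: "k \<in> measurable borel K" and d: "d \<in> space K"
  shows "case_option d k \<in> measurable cemetery_borel K"
proof (rule measurableI)
  fix \<xi> :: "'s option"
  show "case_option d k \<xi> \<in> space K" using d measurable_space[OF k] by (cases \<xi>) auto
next
  fix A assume A: "A \<in> sets K"
  have "case_option d k -` A \<inter> space cemetery_borel = Some ` (k -` A) \<union> (if d \<in> A then {None} else {})"
    by (auto split: option.splits if_splits)
  moreover have "k -` A \<in> sets borel" using measurable_sets[OF k A] by simp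
  ultimately show "case_option d k -` A \<inter> space cemetery_borel \<in> sets cemetery_borel"
    using Some_image_sets[of "k -` A"] None_sets by (cases "d \<in> A") (auto simp del: Un_insert_right)
qed

text \<open>Up to complements only sets of live states remain, the ones for which transition
  probabilities are given.\<close>

lemma cemetery_borel_cases:
  fixes A :: "'s::t2_space option set"
  assumes "A \<in> sets cemetery_borel"
  obtains B where "B \<in> sets borel" "A = Some ` B \<or> A = - (Some ` B)"
proof -
  define C where "C = Some -` A"
  have C: "C \<in> sets borel"
    using measurable_sets[OF Some_measurable assms] by (simp add: C_def)
  show thesis
  proof (cases "None \<in> A")
    case True
    have "A = - (Some ` (- C))"
      using True unfolding C_def by (auto simp: set_eq_iff image_iff split_option_all)
    then show thesis using C that[of "- C"] by (auto simp: Compl_eq_Diff_UNIV)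
  next
    case False
    then have "A = Some ` C" 
      unfolding C_def by (simp add: set_eq_iff image_iff split_option_all)
    then show thesis using C that by auto
  qed
qed

lemma open_countable_closure_cover:
  fixes U :: "'s::{metric_space, second_countable_topology} set"
  assumes "open U"
  obtains \<V> where "countable \<V>" "\<And>V. V \<in> \<V> \<Longrightarrow> open V \<and> closure V \<subseteq> U" "U = \<Union>\<V>"
proof -
  obtain \<B> :: "'s set set" where B: "countable \<B>" "topological_basis \<B>"
    using ex_countable_basis by auto
  define \<V> where "\<V> = {V \<in> \<B>. closure V \<subseteq> U}"
  have "\<exists>V\<in>\<V>. x \<in> V" if x: "x \<in> U" for x
  proof -
    obtain e where e: "e > 0" "cball x e \<subseteq> U" using assms x open_contains_cball by blast
    obtain V where V: "V \<in> \<B>" "x \<in> V" "V \<subseteq> ball x e"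
      using topological_basisE[OF B(2) open_ball, of x x e] e by auto
    have "closure V \<subseteq> cball x e"
      using V(3) ball_subset_cball[of x e] by (intro closure_minimal) auto
    then show ?thesis using V e by (auto simp: \<V>_def)
  qed
  moreover have "V \<subseteq> U" if "V \<in> \<V>" for V using that closure_subset by (auto simp: \<V>_def)
  ultimately have "U = \<Union>\<V>" by blast
  moreover have "countable \<V>" using B(1) by (auto simp: \<V>_def intro: countable_subset)
  moreover have "open V \<and> closure V \<subseteq> U" if "V \<in> \<V>" for V
    using that topological_basis_open[OF B(2)] by (simp add: \<V>_def)
  ultimately show thesis by (rule that[rotated 2])
qed

context strong_markov_process
begin

abbreviation F :: "ennreal \<Rightarrow> 'w measure" where "F \<equiv> natural_filtration W X"

abbreviation stops :: "('w \<Rightarrow> ennreal) \<Rightarrow> bool" where "stops \<equiv> stopping_time (right_filtration W X)"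

abbreviation pre :: "('w \<Rightarrow> ennreal) \<Rightarrow> 'w measure" where
  "pre \<equiv> filtration.pre_sigma (space W) (right_filtration W X)"

lemma space_F [simp]: "space (F u) = space W"
  unfolding natural_filtration_def by (rule space_measure_of) auto

lemma sets_F: "sets (F u) = sigma_sets (space W)
     {X s -` A \<inter> space W | s A. 0 \<le> s \<and> ennreal s \<le> u \<and> A \<in> sets cemetery_borel}"
  unfolding natural_filtration_def by (rule sets_measure_of) auto

lemma X_measurable_F: "0 \<le> s \<Longrightarrow> ennreal s \<le> u \<Longrightarrow> X s \<in> measurable (F u) cemetery_borel"
  by (rule measurableI) (auto simp: sets_F intro!: sigma_sets.Basic)

lemma sets_F_mono: "u \<le> v \<Longrightarrow> sets (F u) \<subseteq> sets (F v)"
proof -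
  assume uv: "u \<le> v"
  show ?thesis
    unfolding sets_F
  proof (rule sigma_sets_mono', rule subsetI, clarify)
    fix s and A :: "'s option set" assume sA: "0 \<le> s" "ennreal s \<le> u" "A \<in> sets cemetery_borel"
    have "ennreal s \<le> v" using sA(2) uv by (rule order_trans)
    then show "\<exists>t B. X s -` A \<inter> space W = X t -` B \<inter> space W \<and> 0 \<le> t \<and> ennreal t \<le> v \<and> B \<in> sets cemetery_borel"
      using sA by blast
  qed
qed

lemma sets_F_W: "sets (F u) \<subseteq> sets W"
  unfolding sets_F using X_measurable
  by (intro sets.sigma_sets_subset) (auto intro: measurable_sets)

lemma space_P [simp]: "space (P z) = space W"
  using sets_P sets_eq_imp_space_eq by blast

lemma measurable_F_P: "g \<in> measurable (F u) K \<Longrightarrow> g \<in> measurable (P z) K"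
  using sets_F_W[of u] by (auto simp: measurable_def sets_P)

section \<open>Right-continuous paths and joint measurability\<close>

lemma eventually_in_open:
  assumes "0 \<le> t" "\<omega> \<in> space W" "X t \<omega> = Some y" "open U" "y \<in> U"
  obtains \<delta> where "\<delta> > 0" "\<And>s. t < s \<Longrightarrow> s < t + \<delta> \<Longrightarrow> X s \<omega> \<in> Some ` U"
proof -
  have "eventually (\<lambda>s. X s \<omega> \<in> Some ` U) (at_right t)"
    using right_continuous[OF assms(1,2)] assms(3-5) openin_cemetery_Some[OF \<open>open U\<close>]
    unfolding limitin_def by auto
  then obtain b where "b > t" "\<And>s. t < s \<Longrightarrow> s < b \<Longrightarrow> X s \<omega> \<in> Some ` U"
    unfolding eventually_at_right_field by auto
  then show thesis using that[of "b - t"] by auto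
qed

text \<open>\<open>None\<close> is the delicate state: it is close to everything near infinity, so
  the topology alone would not always exclude it as the value at t. It is excluded because it is
  absorbing and the path is still in \<open>V\<close> at later times.\<close>

lemma in_closure:
  assumes "0 \<le> t" "\<omega> \<in> space W" "\<And>\<delta>. \<delta> > 0 \<Longrightarrow> \<exists>s. t < s \<and> s < t + \<delta> \<and> X s \<omega> \<in> Some ` V"
  shows "X t \<omega> \<in> Some ` closure V"
proof (cases "X t \<omega>")
  case None
  obtain s where "t < s" "X s \<omega> \<in> Some ` V" using assms(3)[of 1] by auto
  then show ?thesis using cemetery[of t s \<omega>] None assms by auto
next
  case (Some y)
  have "y \<in> closure V"
  proof (rule ccontr)
    assume "y \<notin> closure V"
    then obtain \<delta> where d: "\<delta> > 0" "\<And>s. t < s \<Longrightarrow> s < t + \<delta> \<Longrightarrow> X s \<omega> \<in> Some ` (- closure V)"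
      using eventually_in_open[OF assms(1,2) Some, of "- closure V"]
      by (metis ComplI closed_closure open_Compl)
    obtain s where "t < s" "s < t + \<delta>" "X s \<omega> \<in> Some ` V" using assms(3)[of \<delta>] d by auto
    then show False using d(2)[of s] closure_subset[of V] by auto
  qed
  then show ?thesis using Some by auto
qed

text \<open>Right continuity reduces membership in an open set at a real time to membership at rational
  times just after it, in one of countably many open sets whose closures fill the given one.\<close>

lemma X_jointly:
  "(\<lambda>x. if 0 \<le> fst x \<and> ennreal (fst x) < u then X (fst x) (snd x) else None)
    \<in> measurable (borel \<Otimes>\<^sub>M F u) cemetery_borel"
proof (rule measurable_cemeteryI)
  fix U :: "'s set" assume "open U"
  then obtain \<V> where V: "countable \<V>" "\<And>V. V \<in> \<V> \<Longrightarrow> open V \<and> closure V \<subseteq> U" "U = \<Union>\<V>"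
    using open_countable_closure_cover by blast
  let ?Q = "{q. q \<in> \<rat> \<and> 0 \<le> q \<and> ennreal q < u}"
  define R where "R V n x \<longleftrightarrow> (\<forall>q\<in>?Q. fst x < q \<longrightarrow> q < fst x + 1 / real (Suc n) \<longrightarrow>
    X q (snd x) \<in> Some ` V)" for V n x
  have eq: "(if 0 \<le> fst x \<and> ennreal (fst x) < u then X (fst x) (snd x) else None) \<in> Some ` U
    \<longleftrightarrow> (0 \<le> fst x \<and> ennreal (fst x) < u) \<and> (\<exists>V\<in>\<V>. \<exists>n. R V n x)"
    if x: "x \<in> space (borel \<Otimes>\<^sub>M F u)" for x
  proof (cases "0 \<le> fst x \<and> ennreal (fst x) < u")
    case True
    let ?r = "fst x" and ?\<omega> = "snd x"
    have w: "?\<omega> \<in> space W" using x by (auto simp: space_pair_measure)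
    have "X ?r ?\<omega> \<in> Some ` U \<longleftrightarrow> (\<exists>V\<in>\<V>. \<exists>n. R V n x)"
    proof
      assume "X ?r ?\<omega> \<in> Some ` U"
      then obtain y V where y: "X ?r ?\<omega> = Some y" "V \<in> \<V>" "y \<in> V" using V(3) by auto
      then obtain \<delta> where d: "\<delta> > 0" "\<And>s. ?r < s \<Longrightarrow> s < ?r + \<delta> \<Longrightarrow> X s ?\<omega> \<in> Some ` V"
        using eventually_in_open[of ?r ?\<omega> y V] V(2) True w by auto
      obtain n where "1 / real (Suc n) < \<delta>" using d(1) nat_approx_posE by blast
      then have "R V n x" using d(2) unfolding R_def by auto
      then show "\<exists>V\<in>\<V>. \<exists>n. R V n x" using y by blast
    next
      assume "\<exists>V\<in>\<V>. \<exists>n. R V n x"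
      then obtain V n where n: "V \<in> \<V>" "R V n x" by blast
      have "X ?r ?\<omega> \<in> Some ` closure V"
      proof (rule in_closure)
        fix \<delta> :: real assume d: "\<delta> > 0"
        \<comment> \<open>Since \<open>?r\<close> lies strictly below u, there are rational times
          just after it that \<open>F u\<close> still sees.\<close>
        obtain v where v: "?r < v" "ennreal v \<le> u" 
        proof (cases u)
          case (real u')
          then show thesis using that[of u'] True by (auto simp: ennreal_less_iff)
        next
          case top
          then show thesis using that[of "?r + 1"] by auto
        qed
        obtain q where q: "q \<in> \<rat>" "?r < q" "q < min v (?r + min \<delta> (1 / real (Suc n)))"
          using Rats_dense_in_real[of ?r "min v (?r + min \<delta> (1 / real (Suc n)))"] d v by auto
        have "ennreal q < ennreal v" using q True by (intro ennreal_lessI) auto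
        then have "q \<in> ?Q" using q True v by auto
        then have "X q ?\<omega> \<in> Some ` V" using n(2) q unfolding R_def by auto
        then show "\<exists>s>?r. s < ?r + \<delta> \<and> X s ?\<omega> \<in> Some ` V" using q by auto
      qed (use True w in auto)
      then show "X ?r ?\<omega> \<in> Some ` U" using V(2)[OF n(1)] by auto
    qed
    then show ?thesis using True by simp
  qed auto
  have Q: "countable ?Q" by (rule countable_subset[OF _ countable_rat]) auto
  have R: "Measurable.pred (borel \<Otimes>\<^sub>M F u) (R V n)" if "V \<in> \<V>" for V n
    unfolding R_def
  proof (rule measurable_pred_countable(1)[OF Q])
    fix q assume q: "q \<in> ?Q"
    have [measurable]: "X q \<in> measurable (F u) cemetery_borel"
      using q by (intro X_measurable_F) auto
    have [measurable]: "Some ` V \<in> sets cemetery_borel"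
      using V(2)[OF that] by (intro Some_image_sets) auto
    show "Measurable.pred (borel \<Otimes>\<^sub>M F u) (\<lambda>x. fst x < q \<longrightarrow> q < fst x + 1 / real (Suc n) \<longrightarrow>
      X q (snd x) \<in> Some ` V)" by measurable
  qed
  have "Measurable.pred (borel \<Otimes>\<^sub>M F u) (\<lambda>x. \<exists>V\<in>\<V>. \<exists>n. R V n x)"
    using R by (intro measurable_pred_countable(2)[OF V(1)] pred_intros_countable)
  moreover have "Measurable.pred (borel \<Otimes>\<^sub>M F u) (\<lambda>x. 0 \<le> fst x \<and> ennreal (fst x) < u)"
    by measurable
  ultimately have "Measurable.pred (borel \<Otimes>\<^sub>M F u)
      (\<lambda>x. (\<exists>V\<in>\<V>. \<exists>n. R V n x) \<and> (0 \<le> fst x \<and> ennreal (fst x) < u))"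
    by (rule pred_intros_logic(3))
  moreover have "{x \<in> space (borel \<Otimes>\<^sub>M F u). (if 0 \<le> fst x \<and> ennreal (fst x) < u
      then X (fst x) (snd x) else None) \<in> Some ` U} =
      {x \<in> space (borel \<Otimes>\<^sub>M F u). (\<exists>V\<in>\<V>. \<exists>n. R V n x) \<and> 0 \<le> fst x \<and> ennreal (fst x) < u}"
    using eq by blast
  ultimately show "{x \<in> space (borel \<Otimes>\<^sub>M F u). (if 0 \<le> fst x \<and> ennreal (fst x) < u
      then X (fst x) (snd x) else None) \<in> Some ` U} \<in> sets (borel \<Otimes>\<^sub>M F u)"
    by (simp only: pred_def)
qed

section \<open>Stopping times of the right-continuous filtration\<close>

lemma sets_right_filtration:
  "A \<in> sets (right_filtration W X t) \<longleftrightarrow> (\<forall>u. t < u \<or> u = \<top> \<longrightarrow> A \<in> sets (F u))"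
proof -
  have Pow: "(\<Inter>u\<in>{u. t < u \<or> u = \<top>}. sets (F u)) \<subseteq> Pow (space W)"
    using sets.space_closed[of "F \<top>"] by fastforce
  \<comment> \<open>The intersection is a sigma-algebra already, so membership can be tested one
    \<open>u\<close> at a time.\<close>
  have "sigma_sets (space W) (\<Inter>u\<in>{u. t < u \<or> u = \<top>}. sets (F u))
    = (\<Inter>u\<in>{u. t < u \<or> u = \<top>}. sets (F u))"
  proof (rule sigma_algebra.sigma_sets_eq, unfold sigma_algebra_iff2, intro conjI ballI allI impI)
    fix A assume "A \<in> (\<Inter>u\<in>{u. t < u \<or> u = \<top>}. sets (F u))"
    then show "space W - A \<in> (\<Inter>u\<in>{u. t < u \<or> u = \<top>}. sets (F u))"
      using sets.compl_sets[of A "F _"] by auto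
  qed (use Pow in \<open>auto intro!: sets.countable_nat_UN\<close>)
  then show ?thesis
    unfolding right_filtration_def using Pow by (subst sets_measure_of) auto
qed

lemma space_right_filtration [simp]: "space (right_filtration W X t) = space W"
  using filtration.space_F[OF filtration_right_filtration] .

lemma space_pre [simp]: "space (pre T) = space W"
  using filtration.space_pre_sigma[OF filtration_right_filtration] .

lemma pre_setsI:
  assumes "stops T"
    and "\<And>t u. t < u \<or> u = \<top> \<Longrightarrow> {\<omega> \<in> A. T \<omega> \<le> t} \<in> sets (F u)"
  shows "A \<in> sets (pre T)"
  using assms by (intro filtration.sets_pre_sigmaI[OF filtration_right_filtration])
    (auto simp: sets_right_filtration)

lemma pre_setsD:
  assumes "stops T" "A \<in> sets (pre T)" "t < u \<or> u = \<top>"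
  shows "{\<omega> \<in> A. T \<omega> \<le> t} \<in> sets (F u)"
  using filtration.sets_pre_sigmaD[OF filtration_right_filtration assms(1,2), of t] assms(3)
  by (auto simp: sets_right_filtration)

lemma sets_pre_F: assumes "stops T" shows "sets (pre T) \<subseteq> sets (F \<top>)"
  using pre_setsD[OF assms, of _ \<top> \<top>] by auto

lemma measurable_pre_P: "stops T \<Longrightarrow> g \<in> measurable (pre T) K \<Longrightarrow> g \<in> measurable (P z) K"
  using sets_pre_F[of T] sets_F_W[of \<top>] by (auto simp: measurable_def sets_P)

lemma stops_measurable:
  assumes "stops T" shows "T \<in> borel_measurable (F \<top>)"
  by (rule measurable_stopping_time[OF assms]) (auto simp: sets_right_filtration)

lemma stops_measurable_pre: "stops T \<Longrightarrow> T \<in> borel_measurable (pre T)"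
  by (rule filtration.measurable_stopping_time_pre_sigma[OF filtration_right_filtration])

text \<open>In a right-continuous filtration the strict events suffice: \<open>T \<le> t\<close> is
  the intersection of the events \<open>T < v n\<close> for times \<open>v n\<close> decreasing to
  t.\<close>

lemma stopsI:
  assumes T: "\<And>u. {\<omega> \<in> space W. T \<omega> < u} \<in> sets (F u)"
  shows "stops T"
proof (rule stopping_timeI)
  fix t
  have "{\<omega> \<in> space W. T \<omega> \<le> t} \<in> sets (F u)" if u: "t < u \<or> u = \<top>" for u
  proof (cases "t = \<top>")
    case True
    then show ?thesis using sets.top[of "F u"] by simp
  next
    case False
    \<comment> \<open>The cap at \<open>u\<close> puts all these events into \<open>F u\<close>;
      because \<open>t < u\<close> or \<open>u = \<top>\<close>, the times still stay above
      t.\<close>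
    define v where "v n = min u (t + ennreal (1 / real (Suc n)))" for n
    have tv: "t < v n" for n
      using u False by (cases t) (auto simp: v_def less_top[symmetric] simp flip: ennreal_plus
          intro!: ennreal_lessI add_nonneg_pos)
    have le: "T \<omega> \<le> t \<longleftrightarrow> (\<forall>n. T \<omega> < v n)" for \<omega>
    proof
      assume "T \<omega> \<le> t" then show "\<forall>n. T \<omega> < v n" using tv by (auto intro: le_less_trans)
    next
      assume l: "\<forall>n. T \<omega> < v n"
      show "T \<omega> \<le> t"
      proof (rule ennreal_le_epsilon)
        fix e :: real assume "e > 0"
        then obtain n where "1 / real (Suc n) < e" using nat_approx_posE by blast
        then have "v n \<le> t + ennreal e" unfolding v_def
          by (intro min.coboundedI2 add_left_mono ennreal_leI) auto
        then show "T \<omega> \<le> t + ennreal e" using l by (meson less_imp_le less_le_trans)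
      qed
    qed
    have "{\<omega> \<in> space W. T \<omega> \<le> t} = (\<Inter>n. {\<omega> \<in> space W. T \<omega> < v n})"
      using le by auto
    moreover have "{\<omega> \<in> space W. T \<omega> < v n} \<in> sets (F u)" for n
      using T[of "v n"] sets_F_mono[of "v n" u] by (auto simp: v_def)
    ultimately show ?thesis by (simp add: sets.countable_INT')
  qed
  then show "Measurable.pred (right_filtration W X t) (\<lambda>\<omega>. T \<omega> \<le> t)"
    by (simp add: pred_def sets_right_filtration)
qed

lemma stops_min_measurable:
  assumes "stops T" shows "(\<lambda>\<omega>. min (T \<omega>) u) \<in> borel_measurable (F u)"
proof (rule borel_measurableI_le)
  fix c
  show "{\<omega> \<in> space (F u). min (T \<omega>) u \<le> c} \<in> sets (F u)"
  proof (cases "u \<le> c")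
    case True
    then show ?thesis using sets.top[of "F u"] by (simp add: min_le_iff_disj)
  next
    case False
    then have "{\<omega> \<in> space (F u). min (T \<omega>) u \<le> c} = {\<omega> \<in> space W. T \<omega> \<le> c}"
      by (auto simp: min_le_iff_disj)
    moreover have "{\<omega> \<in> space W. T \<omega> \<le> c} \<in> sets (right_filtration W X c)"
      using stopping_timeD[OF assms, of c] by (simp add: pred_def)
    ultimately show ?thesis using False by (simp add: sets_right_filtration)
  qed
qed

text \<open>On \<open>T < u\<close> the stopped value is a composition: \<open>min T u\<close> is
  \<open>F u\<close> measurable, and the progressive map is jointly measurable there. The default
  \<open>d\<close> at infinite \<open>T\<close> has to be the one used outside the progressive
  range.\<close>

lemma progressive_at_stopping:
  fixes \<Phi> :: "real \<Rightarrow> 'w \<Rightarrow> 'b"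
  assumes T: "stops T"
    and \<Phi>: "\<And>u. (\<lambda>x. if 0 \<le> fst x \<and> ennreal (fst x) < u then \<Phi> (fst x) (snd x) else d)
      \<in> measurable (borel \<Otimes>\<^sub>M F u) K"
  shows "(\<lambda>\<omega>. if T \<omega> < \<top> then \<Phi> (enn2real (T \<omega>)) \<omega> else d) \<in> measurable (pre T) K" (is "?g \<in> _")
proof -
  have gu: "(\<lambda>\<omega>. if T \<omega> < u then \<Phi> (enn2real (T \<omega>)) \<omega> else d) \<in> measurable (F u) K" for u
  proof -
    \<comment> \<open>The dummy time \<open>-1\<close> fails the test \<open>0 \<le> s\<close>, so
      paths with \<open>T \<omega> \<ge> u\<close> receive the default \<open>d\<close>.\<close>
    define s where "s \<omega> = (if min (T \<omega>) u < u then enn2real (min (T \<omega>) u) else -1)" for \<omega>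
    have "(\<lambda>x::ennreal. if x < u then enn2real x else -1) \<in> borel_measurable borel"
      by measurable
    from measurable_compose[OF stops_min_measurable[OF T] this]
    have s: "s \<in> borel_measurable (F u)" unfolding s_def .
    have "(\<lambda>\<omega>. (s \<omega>, \<omega>)) \<in> measurable (F u) (borel \<Otimes>\<^sub>M F u)"
      by (intro measurable_Pair s) simp
    note measurable_compose[OF this \<Phi>[of u]]
    moreover have "(if 0 \<le> s \<omega> \<and> ennreal (s \<omega>) < u then \<Phi> (s \<omega>) \<omega> else d) =
      (if T \<omega> < u then \<Phi> (enn2real (T \<omega>)) \<omega> else d)" for \<omega>
    proof (cases "T \<omega> < u")
      case True
      then have "T \<omega> < \<top>" using order.strict_trans2[of "T \<omega>" u \<top>] by simp
      then show ?thesis using True by (simp add: s_def min_absorb1)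
    next
      case False
      then show ?thesis by (simp add: s_def min_absorb2)
    qed
    ultimately show ?thesis by (simp only: fst_conv snd_conv)
  qed
  show ?thesis
  proof (rule measurableI)
    fix \<omega> assume "\<omega> \<in> space (pre T)"
    then have "\<omega> \<in> space (F \<top>)" by simp
    then show "?g \<omega> \<in> space K" by (rule measurable_space[OF gu[of \<top>]])
  next
    fix B assume B: "B \<in> sets K"
    show "?g -` B \<inter> space (pre T) \<in> sets (pre T)"
    proof (rule pre_setsI[OF T])
      fix t u :: ennreal assume tu: "t < u \<or> u = \<top>"
      have "{\<omega> \<in> ?g -` B \<inter> space (pre T). T \<omega> \<le> t} =
        ((\<lambda>\<omega>. if T \<omega> < u then \<Phi> (enn2real (T \<omega>)) \<omega> else d) -` B \<inter> space (F u)) \<inter> {\<omega> \<in> space W. T \<omega> \<le> t}"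
      proof -
        have "T \<omega> < u \<longleftrightarrow> T \<omega> < \<top>" if "T \<omega> \<le> t" for \<omega>
          using that tu order.strict_trans1[of "T \<omega>" t u] order.strict_trans2[of "T \<omega>" u \<top>] by auto
        then show ?thesis by auto
      qed
      moreover have "{\<omega> \<in> space W. T \<omega> \<le> t} \<in> sets (F u)"
        using stopping_timeD[OF T, of t] tu by (auto simp: pred_def sets_right_filtration)
      ultimately show "{\<omega> \<in> ?g -` B \<inter> space (pre T). T \<omega> \<le> t} \<in> sets (F u)"
        using measurable_sets[OF gu B] by simp
    qed
  qed
qed

lemma X_at_stopping:
  assumes "stops T"
  shows "(\<lambda>\<omega>. if T \<omega> < \<top> then X (enn2real (T \<omega>)) \<omega> else None) \<in> measurable (pre T) cemetery_borel"
  by (rule progressive_at_stopping[OF assms X_jointly])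

end

section \<open>The strong Markov property for functionals of the path\<close>

context strong_markov_process
begin

text \<open>Sending infinite stopping times to the cemetery makes \<open>alive\<close> the event on
  which there is a future to speak of.\<close>

definition Xat :: "('w \<Rightarrow> ennreal) \<Rightarrow> 'w \<Rightarrow> 's option" where
  "Xat T \<omega> = (if T \<omega> < \<top> then X (enn2real (T \<omega>)) \<omega> else None)"

lemma Xat_measurable: "stops T \<Longrightarrow> Xat T \<in> measurable (pre T) cemetery_borel"
  using X_at_stopping unfolding Xat_def[abs_def] .

definition alive :: "('w \<Rightarrow> ennreal) \<Rightarrow> 'w set" where
  "alive T = {\<omega> \<in> space W. Xat T \<omega> \<noteq> None}"

lemma alive_sets: assumes "stops T" shows "alive T \<in> sets (pre T)"
proof -
  have "alive T = space (pre T) - Xat T -` {None} \<inter> space (pre T)" by (auto simp: alive_def)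
  then show ?thesis
    using sets.compl_sets[OF measurable_sets[OF Xat_measurable[OF assms] None_sets]] by simp
qed

lemma aliveD: "\<omega> \<in> alive T \<Longrightarrow> T \<omega> < \<top> \<and> Xat T \<omega> = X (enn2real (T \<omega>)) \<omega> \<and> X (enn2real (T \<omega>)) \<omega> \<noteq> None \<and> \<omega> \<in> space W"
  by (auto simp: alive_def Xat_def split: if_splits)

lemma stops_const: "stops (\<lambda>_. c)"
  by (rule stopping_time_const)

lemma stops_add:
  assumes T: "stops T" and h: "0 \<le> h" shows "stops (\<lambda>\<omega>. T \<omega> + ennreal h)"
proof (rule stopsI)
  fix u
  have eq: "T \<omega> + ennreal h < u \<longleftrightarrow> min (T \<omega>) u + ennreal h < u" for \<omega>
  proof (cases "T \<omega> < u")
    case True then show ?thesis by (simp add: min_absorb1)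
  next
    case False
    have "\<not> c + ennreal h < u" if "u \<le> c" for c
      using that add_increasing2[of "ennreal h" u c] by (simp add: not_less)
    then show ?thesis using False by (simp add: min_absorb2 not_less)
  qed
  have "(\<lambda>\<omega>. min (T \<omega>) u + ennreal h) \<in> borel_measurable (F u)"
    by (intro borel_measurable_add stops_min_measurable[OF T]) simp
  then have "{\<omega> \<in> space (F u). min (T \<omega>) u + ennreal h < u} \<in> sets (F u)" by measurable
  then show "{\<omega> \<in> space W. T \<omega> + ennreal h < u} \<in> sets (F u)" by (simp add: eq)
qed

lemma emeasure_P_space [simp]: "emeasure (P z) (space W) = 1"
  using prob_space.emeasure_space_1[OF prob_space_P, of z] by simp

lemma nn_integral_P_measurable:
  assumes "G \<in> borel_measurable (F \<top>)"
  shows "(\<lambda>x. \<integral>\<^sup>+\<omega>. G \<omega> \<partial>P x) \<in> borel_measurable borel"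
  using assms
proof (induct rule: borel_measurable_induct)
  case (cong f g)
  have "(\<integral>\<^sup>+\<omega>. f \<omega> \<partial>P x) = (\<integral>\<^sup>+\<omega>. g \<omega> \<partial>P x)" for x
    using cong(3) by (intro nn_integral_cong) auto
  then show ?case using cong by simp
next
  case (set A)
  have "A \<in> sets (P x)" for x using set sets_F_W sets_P by blast
  then show ?case using P_measurable[OF set] by (simp add: nn_integral_indicator)
next
  case (mult u c)
  then show ?case using measurable_F_P[OF mult(2)] by (simp add: nn_integral_cmult)
next
  case (add u v)
  then show ?case using measurable_F_P[OF add(1)] measurable_F_P[OF add(4)]
    by (simp add: nn_integral_add)
next
  case (seq U)
  have "(\<integral>\<^sup>+\<omega>. (SUP i. U i) \<omega> \<partial>P x) = (SUP i. \<integral>\<^sup>+\<omega>. U i \<omega> \<partial>P x)" for x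
    unfolding SUP_apply
    by (rule nn_integral_monotone_convergence_SUP[OF seq(4) measurable_F_P[OF seq(1)]])
  then show ?case using seq(3) by simp
qed

definition at_state :: "('s \<Rightarrow> ennreal) \<Rightarrow> 's option \<Rightarrow> ennreal" where
  "at_state g = case_option 0 g"

lemma at_state_simps [simp]: "at_state g None = 0" "at_state g (Some x) = g x"
  by (auto simp: at_state_def)

lemma at_state_measurable: "g \<in> borel_measurable borel \<Longrightarrow> at_state g \<in> borel_measurable cemetery_borel"
  unfolding at_state_def by (rule measurable_case_option_cemetery) auto

lemma at_state_X_measurable:
  assumes "g \<in> borel_measurable borel" "0 \<le> h"
  shows "(\<lambda>\<omega>. at_state g (X h \<omega>)) \<in> borel_measurable (F \<top>)"
  by (rule measurable_compose[OF X_measurable_F at_state_measurable]) (use assms in auto)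

lemma Xat_add:
  assumes "\<omega> \<in> alive T" "0 \<le> h"
  shows "Xat (\<lambda>\<omega>. T \<omega> + ennreal h) \<omega> = X (enn2real (T \<omega>) + h) \<omega>"
    and "enn2real (T \<omega> + ennreal h) = enn2real (T \<omega>) + h" and "T \<omega> + ennreal h < \<top>"
proof -
  have T: "T \<omega> < \<top>" using aliveD[OF assms(1)] by simp
  then show "enn2real (T \<omega> + ennreal h) = enn2real (T \<omega>) + h" "T \<omega> + ennreal h < \<top>"
    using assms(2) by (auto simp: enn2real_plus)
  then show "Xat (\<lambda>\<omega>. T \<omega> + ennreal h) \<omega> = X (enn2real (T \<omega>) + h) \<omega>"
    by (simp add: Xat_def)
qed

lemma strong_markov_state_set:
  assumes T: "stops T" and A: "A \<in> sets (pre T)" "A \<subseteq> alive T" and h: "0 \<le> h"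
    and B: "B \<in> sets borel"
  shows "(\<integral>\<^sup>+\<omega>. indicator A \<omega> * at_state (indicator B) (Xat (\<lambda>\<omega>. T \<omega> + ennreal h) \<omega>) \<partial>P z)
    = (\<integral>\<^sup>+\<omega>. indicator A \<omega> * at_state (\<lambda>x. \<integral>\<^sup>+\<omega>'. at_state (indicator B) (X h \<omega>') \<partial>P x) (Xat T \<omega>) \<partial>P z)"
\<comment> \<open>The strong Markov property is assumed for strictly positive delays; delay 0 rests
  on the starting condition \<open>X 0 \<omega> = Some x\<close> instead.\<close>
proof (cases "h = 0")
  case True
  have "(\<integral>\<^sup>+\<omega>'. at_state (indicator B) (X 0 \<omega>') \<partial>P x) = indicator B x" for x
  proof -
    interpret prob_space "P x" by (rule prob_space_P)
    have "(\<integral>\<^sup>+\<omega>'. at_state (indicator B) (X 0 \<omega>') \<partial>P x) = (\<integral>\<^sup>+\<omega>'. indicator B x \<partial>P x)"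
      using start[of x] by (intro nn_integral_cong_AE) auto
    then show ?thesis by (simp add: emeasure_space_1)
  qed
  then show ?thesis using True by (simp add: Xat_def)
next
  case False
  then have h: "0 < h" using h by simp
  let ?S = "\<lambda>\<omega>. T \<omega> + ennreal h"
  have AW: "A \<subseteq> space W" using A(2) by (auto simp: alive_def)
  have SB: "Some ` B \<in> sets cemetery_borel" by (rule Some_image_sets[OF B])
  have tp: "transition_prob m p h (Some x) B = (\<integral>\<^sup>+\<omega>'. at_state (indicator B) (X h \<omega>') \<partial>P x)" for x
  proof -
    have "{\<omega> \<in> space W. X h \<omega> \<in> Some ` B} \<in> sets (P x)"
      using measurable_sets[OF X_measurable[of h] SB] h by (simp add: sets_P Int_def vimage_def conj_commute)
    moreover
    have "at_state (indicator B) (X h \<omega>') = indicator {\<omega> \<in> space W. X h \<omega> \<in> Some ` B} \<omega>'"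
      if "\<omega>' \<in> space W" for \<omega>'
      using that by (cases "X h \<omega>'") (auto simp: indicator_def)
    then have "(\<integral>\<^sup>+\<omega>'. at_state (indicator B) (X h \<omega>') \<partial>P x)
        = (\<integral>\<^sup>+\<omega>'. indicator {\<omega> \<in> space W. X h \<omega> \<in> Some ` B} \<omega>' \<partial>P x)"
      by (intro nn_integral_cong) auto
    ultimately have "(\<integral>\<^sup>+\<omega>'. at_state (indicator B) (X h \<omega>') \<partial>P x) = emeasure (P x) {\<omega> \<in> space W. X h \<omega> \<in> Some ` B}"
      by simp
    then show ?thesis using transition[OF h B, of x] by simp
  qed
  have mS: "Xat ?S \<in> measurable (P z) cemetery_borel"
    by (rule measurable_pre_P[OF _ Xat_measurable]) (use stops_add[OF T] h in auto)
  have AP: "A \<in> sets (P z)" using A(1) sets_pre_F[OF T] sets_F_W sets_P by blast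
  have eA: "{\<omega> \<in> A. T \<omega> < \<top>} = A" using A(2) aliveD by blast
  have eB: "{\<omega> \<in> A. T \<omega> < \<top> \<and> X (enn2real (T \<omega>) + h) \<omega> \<in> Some ` B} = A \<inter> (Xat ?S -` (Some ` B) \<inter> space (P z))"
    using A(2) Xat_add(1)[of _ T h] h aliveD by fastforce
  have "(\<integral>\<^sup>+\<omega>. indicator A \<omega> * at_state (indicator B) (Xat ?S \<omega>) \<partial>P z)
    = (\<integral>\<^sup>+\<omega>. indicator (A \<inter> (Xat ?S -` (Some ` B) \<inter> space (P z))) \<omega> \<partial>P z)"
  proof (rule nn_integral_cong)
    fix \<omega> assume "\<omega> \<in> space (P z)"
    then show "indicator A \<omega> * at_state (indicator B) (Xat ?S \<omega>)
      = (indicator (A \<inter> (Xat ?S -` (Some ` B) \<inter> space (P z))) \<omega> :: ennreal)"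
      by (cases "Xat ?S \<omega>") (auto simp: indicator_def)
  qed
  also have "\<dots> = emeasure (P z) {\<omega> \<in> A. T \<omega> < \<top> \<and> X (enn2real (T \<omega>) + h) \<omega> \<in> Some ` B}"
    unfolding eB using measurable_sets[OF mS SB] AP by (intro nn_integral_indicator) auto
  also have "\<dots> = (\<integral>\<^sup>+\<omega>\<in>{\<omega> \<in> A. T \<omega> < \<top>}. transition_prob m p h (X (enn2real (T \<omega>)) \<omega>) B \<partial>P z)"
    by (rule strong_markov[OF T A(1) h B])
  also have "\<dots> = (\<integral>\<^sup>+\<omega>. indicator A \<omega> * at_state (\<lambda>x. \<integral>\<^sup>+\<omega>'. at_state (indicator B) (X h \<omega>') \<partial>P x) (Xat T \<omega>) \<partial>P z)"
    unfolding eA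
  proof (rule nn_integral_cong)
    fix \<omega> assume "\<omega> \<in> space (P z)"
    show "transition_prob m p h (X (enn2real (T \<omega>)) \<omega>) B * indicator A \<omega>
      = indicator A \<omega> * at_state (\<lambda>x. \<integral>\<^sup>+\<omega>'. at_state (indicator B) (X h \<omega>') \<partial>P x) (Xat T \<omega>)"
    proof (cases "\<omega> \<in> A")
      case True
      then have "\<omega> \<in> alive T" using A by auto
      from aliveD[OF this] True show ?thesis by (auto simp: tp)
    qed simp
  qed
  finally show ?thesis .
qed

lemma strong_markov_state:
  assumes T: "stops T" and A: "A \<in> sets (pre T)" "A \<subseteq> alive T" and h: "0 \<le> h"
    and g: "g \<in> borel_measurable borel"
  shows "(\<integral>\<^sup>+\<omega>. indicator A \<omega> * at_state g (Xat (\<lambda>\<omega>. T \<omega> + ennreal h) \<omega>) \<partial>P z)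
    = (\<integral>\<^sup>+\<omega>. indicator A \<omega> * at_state (\<lambda>x. \<integral>\<^sup>+\<omega>'. at_state g (X h \<omega>') \<partial>P x) (Xat T \<omega>) \<partial>P z)"
  using g
proof (induct rule: borel_measurable_induct)
  case (cong f g)
  then have "f = g" by auto
  then show ?case using cong by simp
next
  case (set B)
  then show ?case using strong_markov_state_set[OF T A h] by simp
next
  case (mult u c)
  let ?S = "\<lambda>\<omega>. T \<omega> + ennreal h"
  note [measurable] = measurable_pre_P[OF stops_add[OF T h] Xat_measurable[OF stops_add[OF T h]]]
    measurable_pre_P[OF T Xat_measurable[OF T]]
  have [measurable]: "A \<in> sets (P z)" using A(1) sets_pre_F[OF T] sets_F_W sets_P by blast
  have [measurable]: "at_state u \<in> borel_measurable cemetery_borel"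
    "at_state (\<lambda>x. \<integral>\<^sup>+\<omega>'. at_state u (X h \<omega>') \<partial>P x) \<in> borel_measurable cemetery_borel"
    by (intro at_state_measurable nn_integral_P_measurable at_state_X_measurable mult h)+
  have 1: "at_state (\<lambda>x. c * u x) \<xi> = c * at_state u \<xi>" for \<xi> by (cases \<xi>) auto
  have 2: "(\<integral>\<^sup>+\<omega>'. c * at_state u (X h \<omega>') \<partial>P x) = c * (\<integral>\<^sup>+\<omega>'. at_state u (X h \<omega>') \<partial>P x)" for x
    by (intro nn_integral_cmult measurable_F_P[OF at_state_X_measurable] mult h)
  have 3: "at_state (\<lambda>x. c * (\<integral>\<^sup>+\<omega>'. at_state u (X h \<omega>') \<partial>P x)) \<xi>
      = c * at_state (\<lambda>x. \<integral>\<^sup>+\<omega>'. at_state u (X h \<omega>') \<partial>P x) \<xi>" for \<xi> by (cases \<xi>) auto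
  show ?case unfolding 1 2 3
    using mult(4) by (simp add: mult.left_commute[of _ c] nn_integral_cmult)
next
  case (add u v)
  note [measurable] = measurable_pre_P[OF stops_add[OF T h] Xat_measurable[OF stops_add[OF T h]]]
    measurable_pre_P[OF T Xat_measurable[OF T]]
  have [measurable]: "A \<in> sets (P z)" using A(1) sets_pre_F[OF T] sets_F_W sets_P by blast
  have [measurable]: "at_state u \<in> borel_measurable cemetery_borel"
    "at_state (\<lambda>x. \<integral>\<^sup>+\<omega>'. at_state u (X h \<omega>') \<partial>P x) \<in> borel_measurable cemetery_borel"
    "at_state v \<in> borel_measurable cemetery_borel"
    "at_state (\<lambda>x. \<integral>\<^sup>+\<omega>'. at_state v (X h \<omega>') \<partial>P x) \<in> borel_measurable cemetery_borel"
    by (intro at_state_measurable nn_integral_P_measurable at_state_X_measurable add h)+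
  have 1: "at_state (\<lambda>x. v x + u x) \<xi> = at_state v \<xi> + at_state u \<xi>" for \<xi> by (cases \<xi>) auto
  have 2: "(\<integral>\<^sup>+\<omega>'. at_state v (X h \<omega>') + at_state u (X h \<omega>') \<partial>P x)
     = (\<integral>\<^sup>+\<omega>'. at_state v (X h \<omega>') \<partial>P x) + (\<integral>\<^sup>+\<omega>'. at_state u (X h \<omega>') \<partial>P x)" for x
    by (intro nn_integral_add measurable_F_P[OF at_state_X_measurable] add h)
  have 3: "at_state (\<lambda>x. (\<integral>\<^sup>+\<omega>'. at_state v (X h \<omega>') \<partial>P x) + (\<integral>\<^sup>+\<omega>'. at_state u (X h \<omega>') \<partial>P x)) \<xi>
      = at_state (\<lambda>x. \<integral>\<^sup>+\<omega>'. at_state v (X h \<omega>') \<partial>P x) \<xi> + at_state (\<lambda>x. \<integral>\<^sup>+\<omega>'. at_state u (X h \<omega>') \<partial>P x) \<xi>"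
      for \<xi> by (cases \<xi>) auto
  show ?case unfolding 1 2 3
    using add(3,7) by (simp add: distrib_left nn_integral_add)
next
  case (seq U)
  let ?S = "\<lambda>\<omega>. T \<omega> + ennreal h"
  note [measurable] = measurable_pre_P[OF stops_add[OF T h] Xat_measurable[OF stops_add[OF T h]]]
    measurable_pre_P[OF T Xat_measurable[OF T]]
  have [measurable]: "A \<in> sets (P z)" using A(1) sets_pre_F[OF T] sets_F_W sets_P by blast
  have [measurable]: "at_state (U i) \<in> borel_measurable cemetery_borel"
    "at_state (\<lambda>x. \<integral>\<^sup>+\<omega>'. at_state (U i) (X h \<omega>') \<partial>P x) \<in> borel_measurable cemetery_borel" for i
    by (intro at_state_measurable nn_integral_P_measurable at_state_X_measurable seq h)+
  have inc: "incseq (\<lambda>i. at_state (U i) \<xi>)" for \<xi>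
    using seq(4) by (cases \<xi>) (auto simp: incseq_def le_fun_def)
  have inc2: "incseq (\<lambda>i. at_state (\<lambda>x. \<integral>\<^sup>+\<omega>'. at_state (U i) (X h \<omega>') \<partial>P x) \<xi>)" for \<xi>
    using inc by (cases \<xi>) (auto simp: incseq_def intro!: nn_integral_mono)
  have 1: "at_state (SUP i. U i) \<xi> = (SUP i. at_state (U i) \<xi>)" for \<xi>
    by (cases \<xi>) (auto simp: image_comp o_def)
  have 2: "(\<integral>\<^sup>+\<omega>'. (SUP i. at_state (U i) (X h \<omega>')) \<partial>P x) = (SUP i. \<integral>\<^sup>+\<omega>'. at_state (U i) (X h \<omega>') \<partial>P x)" for x
    using inc by (intro nn_integral_monotone_convergence_SUP measurable_F_P[OF at_state_X_measurable] seq h)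
      (auto simp: incseq_def le_fun_def)
  have 3: "at_state (\<lambda>x. SUP i. \<integral>\<^sup>+\<omega>'. at_state (U i) (X h \<omega>') \<partial>P x) \<xi>
      = (SUP i. at_state (\<lambda>x. \<integral>\<^sup>+\<omega>'. at_state (U i) (X h \<omega>') \<partial>P x) \<xi>)" for \<xi>
    by (cases \<xi>) auto
  have 4: "indicator A \<omega> * (SUP i. V i) = (SUP i. indicator A \<omega> * V i)" for V :: "nat \<Rightarrow> ennreal" and \<omega> :: 'w
    by (rule SUP_mult_left_ennreal)
  have a: "(\<integral>\<^sup>+\<omega>. (SUP i. indicator A \<omega> * at_state (U i) (Xat ?S \<omega>)) \<partial>P z)
     = (SUP i. \<integral>\<^sup>+\<omega>. indicator A \<omega> * at_state (U i) (Xat ?S \<omega>) \<partial>P z)"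
    using inc by (intro nn_integral_monotone_convergence_SUP)
      (auto simp: incseq_def le_fun_def intro!: mult_left_mono)
  have b: "(\<integral>\<^sup>+\<omega>. (SUP i. indicator A \<omega> * at_state (\<lambda>x. \<integral>\<^sup>+\<omega>'. at_state (U i) (X h \<omega>') \<partial>P x) (Xat T \<omega>)) \<partial>P z)
     = (SUP i. \<integral>\<^sup>+\<omega>. indicator A \<omega> * at_state (\<lambda>x. \<integral>\<^sup>+\<omega>'. at_state (U i) (X h \<omega>') \<partial>P x) (Xat T \<omega>) \<partial>P z)"
    using inc2 by (intro nn_integral_monotone_convergence_SUP)
      (auto simp: incseq_def le_fun_def intro!: mult_left_mono)
  show ?case unfolding 1 2 3 4 a b using seq(3) by simp
qed

section \<open>Finite-dimensional events\<close>

primrec fd :: "(real \<times> 's set) list \<Rightarrow> real \<Rightarrow> 'w \<Rightarrow> bool" where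
  "fd [] s \<omega> = True"
| "fd (k # l) s \<omega> = (X (s + fst k) \<omega> \<in> Some ` snd k \<and> fd l (s + fst k) \<omega>)"

primrec fd_prob :: "(real \<times> 's set) list \<Rightarrow> 's \<Rightarrow> ennreal" where
  "fd_prob [] x = 1"
| "fd_prob (k # l) x = (\<integral>\<^sup>+\<omega>. at_state (\<lambda>y. indicator (snd k) y * fd_prob l y) (X (fst k) \<omega>) \<partial>P x)"

definition valid :: "(real \<times> 's set) list \<Rightarrow> bool" where
  "valid l \<longleftrightarrow> (\<forall>k\<in>set l. 0 \<le> fst k \<and> snd k \<in> sets borel)"

lemma fd_prob_measurable: "valid l \<Longrightarrow> fd_prob l \<in> borel_measurable borel"
proof (induct l)
  case (Cons k l)
  then have [measurable]: "fd_prob l \<in> borel_measurable borel" "snd k \<in> sets borel"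
    by (auto simp: valid_def)
  have "(\<lambda>y. indicator (snd k) y * fd_prob l y) \<in> borel_measurable borel" by measurable
  then show ?case using Cons by (auto simp: valid_def intro!: nn_integral_P_measurable at_state_X_measurable)
next
  case Nil
  have "fd_prob [] = (\<lambda>_. 1)" by auto
  then show ?case by simp
qed

text \<open>Events are listed by time increments because the induction restarts at the next
  observation: \<open>T + h\<close> is again a stopping time, and the past together with the first
  observation is known at that time. For this the stopping time and the event must be general in the
  induction.\<close>

lemma strong_markov_fd:
  assumes "stops T" "A \<in> sets (pre T)" "A \<subseteq> alive T" "valid l"
  shows "emeasure (P z) {\<omega> \<in> A. fd l (enn2real (T \<omega>)) \<omega>}
    = (\<integral>\<^sup>+\<omega>. indicator A \<omega> * at_state (fd_prob l) (Xat T \<omega>) \<partial>P z)"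
  using assms
proof (induct l arbitrary: T A)
  case Nil
  have "A \<in> sets (P z)" using Nil(2) sets_pre_F[OF Nil(1)] sets_F_W sets_P by blast
  moreover have "indicator A \<omega> * at_state (fd_prob []) (Xat T \<omega>) = indicator A \<omega>" for \<omega>
    using Nil(3) by (cases "Xat T \<omega>") (auto simp: indicator_def alive_def)
  ultimately show ?case by (simp del: fd_prob.simps)
next
  case (Cons k l)
  obtain h B where k: "k = (h, B)" by (cases k)
  have h: "0 \<le> h" and B: "B \<in> sets borel" and vl: "valid l" using Cons(5) by (auto simp: valid_def k)
  let ?S = "\<lambda>\<omega>. T \<omega> + ennreal h"
  have S: "stops ?S" by (rule stops_add[OF Cons(2) h])
  let ?A = "A \<inter> (Xat ?S -` (Some ` B) \<inter> space (pre ?S))"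
  have "sets (pre T) \<subseteq> sets (pre ?S)"
    by (rule filtration.mono_pre_sigma[OF filtration_right_filtration Cons(2) S]) auto
  then have A': "?A \<in> sets (pre ?S)"
    using Cons(3) measurable_sets[OF Xat_measurable[OF S] Some_image_sets[OF B]] by auto
  have A'a: "?A \<subseteq> alive ?S" by (auto simp: alive_def)
  have e: "{\<omega> \<in> A. fd (k # l) (enn2real (T \<omega>)) \<omega>} = {\<omega> \<in> ?A. fd l (enn2real (?S \<omega>)) \<omega>}"
    using Xat_add[of _ T h] h Cons(4) by (auto simp: k alive_def)
  have "emeasure (P z) {\<omega> \<in> A. fd (k # l) (enn2real (T \<omega>)) \<omega>}
    = (\<integral>\<^sup>+\<omega>. indicator ?A \<omega> * at_state (fd_prob l) (Xat ?S \<omega>) \<partial>P z)"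
    unfolding e by (rule Cons(1)[OF S A' A'a vl])
  also have "\<dots> = (\<integral>\<^sup>+\<omega>. indicator A \<omega> * at_state (\<lambda>y. indicator B y * fd_prob l y) (Xat ?S \<omega>) \<partial>P z)"
  proof (rule nn_integral_cong)
    fix \<omega> assume "\<omega> \<in> space (P z)"
    then show "indicator ?A \<omega> * at_state (fd_prob l) (Xat ?S \<omega>)
      = indicator A \<omega> * at_state (\<lambda>y. indicator B y * fd_prob l y) (Xat ?S \<omega>)"
      by (cases "Xat ?S \<omega>") (auto simp: indicator_def)
  qed
  also have "\<dots> = (\<integral>\<^sup>+\<omega>. indicator A \<omega> * at_state (\<lambda>x. \<integral>\<^sup>+\<omega>'. at_state (\<lambda>y. indicator B y * fd_prob l y) (X h \<omega>') \<partial>P x) (Xat T \<omega>) \<partial>P z)"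
    using fd_prob_measurable[OF vl] B
    by (intro strong_markov_state Cons h borel_measurable_times_ennreal borel_measurable_indicator)
  also have "(\<lambda>x. \<integral>\<^sup>+\<omega>'. at_state (\<lambda>y. indicator B y * fd_prob l y) (X h \<omega>') \<partial>P x) = fd_prob (k # l)"
    by (auto simp: k)
  finally show ?case .
qed

text \<open>Only visits to live states are prescribed, which matches \<open>fd\<close>; the cemetery
  comes in through complements.\<close>

definition cylinders :: "'w set set" where
  "cylinders = {{\<omega> \<in> space W. \<forall>i\<in>I. X i \<omega> \<in> Some ` B i} | I B. finite I \<and> I \<subseteq> {0..} \<and> (\<forall>i. B i \<in> sets borel)}"

lemma X_sets_F:
  assumes "0 \<le> s" "ennreal s \<le> u" "B \<in> sets borel" shows "{\<omega> \<in> space W. X s \<omega> \<in> Some ` B} \<in> sets (F u)"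
proof -
  have "{\<omega> \<in> space W. X s \<omega> \<in> Some ` B} = X s -` (Some ` B) \<inter> space (F u)" by auto
  also have "\<dots> \<in> sets (F u)" by (rule measurable_sets[OF X_measurable_F Some_image_sets]) (use assms in auto)
  finally show ?thesis .
qed

lemma cylinders_F: "cylinders \<subseteq> sets (F \<top>)"
proof
  fix E assume "E \<in> cylinders"
  then obtain I B where I: "finite I" "I \<subseteq> {0..}" "\<And>i. B i \<in> sets borel"
    "E = {\<omega> \<in> space W. \<forall>i\<in>I. X i \<omega> \<in> Some ` B i}" unfolding cylinders_def by blast
  have "{\<omega> \<in> space (F \<top>). \<forall>i\<in>I. X i \<omega> \<in> Some ` B i} \<in> sets (F \<top>)"
    using I X_sets_F[of _ \<top>] by (intro sets.sets_Collect_finite_All) auto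
  then show "E \<in> sets (F \<top>)" using I by simp
qed

lemma Int_stable_cylinders: "Int_stable cylinders"
proof (rule Int_stableI)
  fix E E' assume "E \<in> cylinders" "E' \<in> cylinders"
  then obtain I B J C where I: "finite I" "I \<subseteq> {0..}" "\<And>i. B i \<in> sets borel"
    "E = {\<omega> \<in> space W. \<forall>i\<in>I. X i \<omega> \<in> Some ` B i}"
    and J: "finite J" "J \<subseteq> {0..}" "\<And>i. C i \<in> sets borel"
    "E' = {\<omega> \<in> space W. \<forall>i\<in>J. X i \<omega> \<in> Some ` C i}" unfolding cylinders_def by blast
  let ?D = "\<lambda>i. (if i \<in> I then B i else UNIV) \<inter> (if i \<in> J then C i else UNIV)"
  have "E \<inter> E' = {\<omega> \<in> space W. \<forall>i\<in>I \<union> J. X i \<omega> \<in> Some ` ?D i}"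
    unfolding I(4) J(4) by (auto simp: image_iff) force+
  moreover have "\<forall>i. ?D i \<in> sets borel" using I J by auto
  ultimately show "E \<inter> E' \<in> cylinders" unfolding cylinders_def
    using I J by (intro CollectI exI[of _ "I \<union> J"] exI[of _ ?D]) auto
qed

lemma sets_F_cylinders: "sets (F \<top>) = sigma_sets (space W) cylinders"
  unfolding sets_F
proof (rule sigma_sets_eqI)
  fix a assume "a \<in> {X s -` A \<inter> space W |s A. 0 \<le> s \<and> ennreal s \<le> \<top> \<and> A \<in> sets cemetery_borel}"
  then obtain s A where sA: "a = X s -` A \<inter> space W" "0 \<le> s" "A \<in> sets cemetery_borel" by blast
  obtain B where B: "B \<in> sets borel" "A = Some ` B \<or> A = - (Some ` B)"
    using cemetery_borel_cases[OF sA(3)] by blast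
  have "{\<omega> \<in> space W. \<forall>i\<in>{s}. X i \<omega> \<in> Some ` B} \<in> cylinders"
    unfolding cylinders_def using sA B by (intro CollectI exI[of _ "{s}"] exI[of _ "\<lambda>_. B"]) auto
  then have 1: "{\<omega> \<in> space W. X s \<omega> \<in> Some ` B} \<in> sigma_sets (space W) cylinders" by auto
  from sigma_sets.Compl[OF this] have 2: "space W - {\<omega> \<in> space W. X s \<omega> \<in> Some ` B} \<in> sigma_sets (space W) cylinders" .
  have "a = {\<omega> \<in> space W. X s \<omega> \<in> Some ` B} \<or> a = space W - {\<omega> \<in> space W. X s \<omega> \<in> Some ` B}"
    using B sA by auto
  then show "a \<in> sigma_sets (space W) cylinders" using 1 2 by auto
next
  fix b assume "b \<in> cylinders"
  then show "b \<in> sigma_sets (space W) {X s -` A \<inter> space W |s A. 0 \<le> s \<and> ennreal s \<le> \<top> \<and> A \<in> sets cemetery_borel}"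
    using cylinders_F unfolding sets_F by blast
qed

text \<open>An induction in which every new time precedes the earlier ones turns a set of times into
  nonnegative increments measured from \<open>c\<close>.\<close>

lemma cylinder_fd:
  fixes B :: "real \<Rightarrow> 's set"
  assumes "finite I" "I \<subseteq> {c..}" "\<And>i. B i \<in> sets borel"
  shows "\<exists>l. valid l \<and> (\<forall>s \<omega>. (\<forall>i\<in>I. X (s + (i - c)) \<omega> \<in> Some ` B i) \<longleftrightarrow> fd l s \<omega>)"
  using assms(1,2)
proof (induct arbitrary: c rule: finite_linorder_min_induct)
  case empty
  then show ?case by (intro exI[of _ "[]"]) (simp add: valid_def)
next
  case (insert b A)
  obtain l where l: "valid l" "\<And>s \<omega>. (\<forall>i\<in>A. X (s + (i - b)) \<omega> \<in> Some ` B i) \<longleftrightarrow> fd l s \<omega>"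
    using insert(3)[of b] insert(2) by (force simp: less_imp_le)
  have "(\<forall>i\<in>insert b A. X (s + (i - c)) \<omega> \<in> Some ` B i) \<longleftrightarrow> fd ((b - c, B b) # l) s \<omega>" for s \<omega>
    using l(2)[of "s + (b - c)" \<omega>] by simp
  moreover have "valid ((b - c, B b) # l)" using l insert(4) assms(3) by (auto simp: valid_def)
  ultimately show ?case by blast
qed

lemma X_joint_measurable:
  assumes "r \<in> borel_measurable (F \<top>)" "\<And>\<omega>. \<omega> \<in> space W \<Longrightarrow> 0 \<le> r \<omega>"
  shows "(\<lambda>\<omega>. X (r \<omega>) \<omega>) \<in> measurable (F \<top>) cemetery_borel"
proof -
  have "(\<lambda>\<omega>. (r \<omega>, \<omega>)) \<in> measurable (F \<top>) (borel \<Otimes>\<^sub>M F \<top>)"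
    by (intro measurable_Pair assms) simp
  from measurable_compose[OF this X_jointly[of \<top>]] show ?thesis
    by (rule measurable_cong[THEN iffD1, rotated]) (use assms in auto)
qed

lemma shift_measurable:
  assumes T: "T \<in> borel_measurable (F \<top>)"
  shows "(\<lambda>\<omega>. \<theta> (enn2real (T \<omega>)) \<omega>) \<in> measurable (F \<top>) (F \<top>)"
proof (rule measurable_sigma_sets[OF sets_F])
  fix a assume "a \<in> {X s -` A \<inter> space W |s A. 0 \<le> s \<and> ennreal s \<le> \<top> \<and> A \<in> sets cemetery_borel}"
  then obtain s A where sA: "a = X s -` A \<inter> space W" "0 \<le> s" "A \<in> sets cemetery_borel" by blast
  have "(\<lambda>\<omega>. X (s + enn2real (T \<omega>)) \<omega>) \<in> measurable (F \<top>) cemetery_borel"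
    using sA(2) T by (intro X_joint_measurable) auto
  from measurable_sets[OF this sA(3)]
  show "(\<lambda>\<omega>. \<theta> (enn2real (T \<omega>)) \<omega>) -` a \<inter> space (F \<top>) \<in> sets (F \<top>)"
    by (rule back_subst[of "\<lambda>A. A \<in> sets (F \<top>)"]) (use sA shift in auto)
qed (use shift in auto)

text \<open>Dynkin argument: both sides are additive over disjoint events and compatible with
  complements, and the cylinders form an intersection-stable generator.\<close>

lemma strong_markov_sets:
  assumes T: "stops T" and A: "A \<in> sets (pre T)" "A \<subseteq> alive T" and E: "E \<in> sets (F \<top>)"
  shows "emeasure (P z) {\<omega> \<in> A. \<theta> (enn2real (T \<omega>)) \<omega> \<in> E}
    = (\<integral>\<^sup>+\<omega>. indicator A \<omega> * at_state (\<lambda>x. emeasure (P x) E) (Xat T \<omega>) \<partial>P z)"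
proof -
  have AP: "A \<in> sets (P z)" using A(1) sets_pre_F[OF T] sets_F_W sets_P by blast
  have AW: "A \<subseteq> space W" using A(2) by (auto simp: alive_def)
  have th: "(\<lambda>\<omega>. \<theta> (enn2real (T \<omega>)) \<omega>) \<in> measurable (P z) (F \<top>)"
    by (rule measurable_F_P[OF shift_measurable[OF stops_measurable[OF T]]])
  have eq: "{\<omega> \<in> A. \<theta> (enn2real (T \<omega>)) \<omega> \<in> E} = A \<inter> ((\<lambda>\<omega>. \<theta> (enn2real (T \<omega>)) \<omega>) -` E \<inter> space (P z))" for E
    using AW by auto
  have XT [measurable]: "Xat T \<in> measurable (P z) cemetery_borel"
    by (rule measurable_pre_P[OF T Xat_measurable[OF T]])
  have mP [measurable]: "at_state (\<lambda>x. emeasure (P x) E) \<in> borel_measurable cemetery_borel" if "E \<in> sets (F \<top>)" for E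
    using that by (intro at_state_measurable P_measurable)
  interpret Pz: prob_space "P z" by (rule prob_space_P)
  have al: "indicator A \<omega> * at_state (\<lambda>x. 1) (Xat T \<omega>) = indicator A \<omega>" for \<omega>
    using A(2) by (cases "Xat T \<omega>") (auto simp: indicator_def alive_def)
  have Ec: "E \<in> sigma_sets (space W) cylinders" using E sets_F_cylinders by simp
  have cP: "cylinders \<subseteq> Pow (space W)" by (auto simp: cylinders_def)
  show ?thesis
    using Int_stable_cylinders cP Ec
  proof (induct rule: sigma_sets_induct_disjoint)
    case (basic E)
    note E = basic
    then obtain I B where I: "finite I" "I \<subseteq> {0..}" "\<And>i. B i \<in> sets borel"
      "E = {\<omega> \<in> space W. \<forall>i\<in>I. X i \<omega> \<in> Some ` B i}" unfolding cylinders_def by blast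
    obtain l where l: "valid l" "\<And>s \<omega>. (\<forall>i\<in>I. X (s + (i - 0)) \<omega> \<in> Some ` B i) \<longleftrightarrow> fd l s \<omega>"
      using cylinder_fd[of I 0 B] I by blast
    have 1: "{\<omega> \<in> A. \<theta> (enn2real (T \<omega>)) \<omega> \<in> E} = {\<omega> \<in> A. fd l (enn2real (T \<omega>)) \<omega>}"
    proof -
      have "\<theta> (enn2real (T \<omega>)) \<omega> \<in> E \<longleftrightarrow> fd l (enn2real (T \<omega>)) \<omega>" if "\<omega> \<in> A" for \<omega>
        using shift[of "enn2real (T \<omega>)" \<omega>] that AW I(2) l(2)[of "enn2real (T \<omega>)" \<omega>]
        by (auto simp: I(4) add.commute subset_iff)
      then show ?thesis by auto
    qed
    \<comment> \<open>The finite-dimensional formula at the constant time 0, where the path sits at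
      x, identifies the law started at x with the iterated integral.\<close>
    have 2: "emeasure (P x) E = fd_prob l x" for x
    proof -
      interpret prob_space "P x" by (rule prob_space_P)
      have "alive (\<lambda>_. 0) \<in> sets (pre (\<lambda>_. 0))" by (rule alive_sets[OF stops_const])
      note * = strong_markov_fd[OF stops_const this subset_refl l(1), of x]
      have EP: "E \<in> sets (P x)" using E cylinders_F sets_F_W sets_P by blast
      have al0: "AE \<omega> in P x. \<omega> \<in> alive (\<lambda>_. 0) \<and> Xat (\<lambda>_. 0) \<omega> = Some x"
        using start[of x] by (rule AE_mp) (auto simp: alive_def Xat_def)
      have a0: "alive (\<lambda>_. 0) \<in> sets (P x)"
        using alive_sets[OF stops_const] sets_pre_F[OF stops_const] sets_F_W sets_P by blast
      have "emeasure (P x) E = emeasure (P x) {\<omega> \<in> alive (\<lambda>_. 0). fd l (enn2real 0) \<omega>}"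
      proof (rule emeasure_eq_AE)
        have eqE: "{\<omega> \<in> alive (\<lambda>_. 0). fd l (enn2real 0) \<omega>} = alive (\<lambda>_. 0) \<inter> E"
          using l(2)[of 0] by (auto simp: I(4) alive_def)
        show "{\<omega> \<in> alive (\<lambda>_. 0). fd l (enn2real 0) \<omega>} \<in> sets (P x)"
          unfolding eqE using EP a0 by auto
        show "AE \<omega> in P x. \<omega> \<in> E \<longleftrightarrow> \<omega> \<in> {\<omega> \<in> alive (\<lambda>_. 0). fd l (enn2real 0) \<omega>}"
          unfolding eqE using al0 by auto
      qed (rule EP)
      also have "\<dots> = (\<integral>\<^sup>+\<omega>. fd_prob l x \<partial>P x)"
        unfolding * using al0 by (intro nn_integral_cong_AE) auto
      finally show ?thesis by (simp add: emeasure_space_1)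
    qed
    show "emeasure (P z) {\<omega> \<in> A. \<theta> (enn2real (T \<omega>)) \<omega> \<in> E}
      = (\<integral>\<^sup>+\<omega>. indicator A \<omega> * at_state (\<lambda>x. emeasure (P x) E) (Xat T \<omega>) \<partial>P z)"
      unfolding 1 2 by (rule strong_markov_fd[OF T A l(1)])
  next
    case empty
    show ?case
    proof -
      have "at_state (\<lambda>x. 0) \<xi> = 0" for \<xi> by (cases \<xi>) auto
      then show ?thesis by simp
    qed
  next
    case (compl E)
    note E = compl(1) and IH = compl(2)
    have EF: "E \<in> sets (F \<top>)" using E sets_F_cylinders by simp
    have EP: "E \<in> sets (P x)" for x using EF sets_F_W sets_P by blast
    have mE: "{\<omega> \<in> A. \<theta> (enn2real (T \<omega>)) \<omega> \<in> E} \<in> sets (P z)"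
      unfolding eq using measurable_sets[OF th EF] AP by auto
    have "{\<omega> \<in> A. \<theta> (enn2real (T \<omega>)) \<omega> \<in> space W - E} = A - {\<omega> \<in> A. \<theta> (enn2real (T \<omega>)) \<omega> \<in> E}"
      using AW shift by auto
    then have "emeasure (P z) {\<omega> \<in> A. \<theta> (enn2real (T \<omega>)) \<omega> \<in> space W - E}
      = emeasure (P z) A - emeasure (P z) {\<omega> \<in> A. \<theta> (enn2real (T \<omega>)) \<omega> \<in> E}"
      using emeasure_Diff[of "P z" "{\<omega> \<in> A. \<theta> (enn2real (T \<omega>)) \<omega> \<in> E}" A] mE AP by auto
    also have "\<dots> = (\<integral>\<^sup>+\<omega>. indicator A \<omega> \<partial>P z)
      - (\<integral>\<^sup>+\<omega>. indicator A \<omega> * at_state (\<lambda>x. emeasure (P x) E) (Xat T \<omega>) \<partial>P z)"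
      using IH AP by simp
    also have "\<dots> = (\<integral>\<^sup>+\<omega>. indicator A \<omega> - indicator A \<omega> * at_state (\<lambda>x. emeasure (P x) E) (Xat T \<omega>) \<partial>P z)"
    proof (rule nn_integral_diff[symmetric])
      show "(\<integral>\<^sup>+\<omega>. indicator A \<omega> * at_state (\<lambda>x. emeasure (P x) E) (Xat T \<omega>) \<partial>P z) \<noteq> \<infinity>"
        unfolding IH[symmetric] by simp
      have le1: "at_state (\<lambda>x. emeasure (P x) E) \<xi> \<le> 1" for \<xi>
      proof (cases \<xi>)
        case (Some y)
        interpret prob_space "P y" by (rule prob_space_P)
        show ?thesis using Some by (simp add: emeasure_le_1)
      qed simp
      show "AE \<omega> in P z. indicator A \<omega> * at_state (\<lambda>x. emeasure (P x) E) (Xat T \<omega>) \<le> indicator A \<omega>"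
        using le1 by (auto simp: indicator_def)
    qed (use AP mP[OF EF] in \<open>auto intro!: borel_measurable_times_ennreal\<close>)
    also have "\<dots> = (\<integral>\<^sup>+\<omega>. indicator A \<omega> * at_state (\<lambda>x. emeasure (P x) (space W - E)) (Xat T \<omega>) \<partial>P z)"
    proof (rule nn_integral_cong)
      fix \<omega> assume "\<omega> \<in> space (P z)"
      have "emeasure (P x) (space W - E) = 1 - emeasure (P x) E" for x
      proof -
        interpret prob_space "P x" by (rule prob_space_P)
        show ?thesis using emeasure_compl[of E "P x"] EP by (simp add: emeasure_space_1)
      qed
      then show "indicator A \<omega> - indicator A \<omega> * at_state (\<lambda>x. emeasure (P x) E) (Xat T \<omega>)
        = indicator A \<omega> * at_state (\<lambda>x. emeasure (P x) (space W - E)) (Xat T \<omega>)"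
        using A(2) by (cases "Xat T \<omega>") (auto simp: indicator_def alive_def)
    qed
    finally show "emeasure (P z) {\<omega> \<in> A. \<theta> (enn2real (T \<omega>)) \<omega> \<in> space W - E}
      = (\<integral>\<^sup>+\<omega>. indicator A \<omega> * at_state (\<lambda>x. emeasure (P x) (space W - E)) (Xat T \<omega>) \<partial>P z)" .
  next
    case (union E)
    note dj = union(1) and E = union(2) and IH = union(3)
    have EF: "E i \<in> sets (F \<top>)" for i using E sets_F_cylinders by auto
    have EP: "range E \<subseteq> sets (P x)" for x using EF sets_F_W sets_P by blast
    have mE: "{\<omega> \<in> A. \<theta> (enn2real (T \<omega>)) \<omega> \<in> E i} \<in> sets (P z)" for i
      unfolding eq using measurable_sets[OF th EF[of i]] AP by auto
    have "{\<omega> \<in> A. \<theta> (enn2real (T \<omega>)) \<omega> \<in> (\<Union>i. E i)} = (\<Union>i. {\<omega> \<in> A. \<theta> (enn2real (T \<omega>)) \<omega> \<in> E i})"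
      by auto
    moreover have "disjoint_family (\<lambda>i. {\<omega> \<in> A. \<theta> (enn2real (T \<omega>)) \<omega> \<in> E i})"
      using dj by (auto simp: disjoint_family_on_def)
    ultimately have "emeasure (P z) {\<omega> \<in> A. \<theta> (enn2real (T \<omega>)) \<omega> \<in> (\<Union>i. E i)}
      = (\<Sum>i. emeasure (P z) {\<omega> \<in> A. \<theta> (enn2real (T \<omega>)) \<omega> \<in> E i})"
      using suminf_emeasure[of "\<lambda>i. {\<omega> \<in> A. \<theta> (enn2real (T \<omega>)) \<omega> \<in> E i}" "P z"] mE
      by (simp add: image_subset_iff)
    also have "\<dots> = (\<integral>\<^sup>+\<omega>. (\<Sum>i. indicator A \<omega> * at_state (\<lambda>x. emeasure (P x) (E i)) (Xat T \<omega>)) \<partial>P z)"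
      unfolding IH using AP mP[OF EF]
      by (intro nn_integral_suminf[symmetric] borel_measurable_times_ennreal) auto
    also have "\<dots> = (\<integral>\<^sup>+\<omega>. indicator A \<omega> * at_state (\<lambda>x. emeasure (P x) (\<Union>i. E i)) (Xat T \<omega>) \<partial>P z)"
    proof (rule nn_integral_cong)
      fix \<omega>
      have "emeasure (P x) (\<Union>i. E i) = (\<Sum>i. emeasure (P x) (E i))" for x
        using suminf_emeasure[OF EP dj] by simp
      then show "(\<Sum>i. indicator A \<omega> * at_state (\<lambda>x. emeasure (P x) (E i)) (Xat T \<omega>))
        = indicator A \<omega> * at_state (\<lambda>x. emeasure (P x) (\<Union>i. E i)) (Xat T \<omega>)"
        by (cases "Xat T \<omega>") (auto simp: indicator_def)
    qed
    finally show "emeasure (P z) {\<omega> \<in> A. \<theta> (enn2real (T \<omega>)) \<omega> \<in> (\<Union>i. E i)}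
        = (\<integral>\<^sup>+\<omega>. indicator A \<omega> * at_state (\<lambda>x. emeasure (P x) (\<Union>i. E i)) (Xat T \<omega>) \<partial>P z)" .
  qed
qed

section \<open>From path events to path functionals\<close>

lemma strong_markov_indicator:
  assumes T: "stops T" and A: "A \<in> sets (pre T)" "A \<subseteq> alive T" and H: "H \<in> borel_measurable (F \<top>)"
  shows "(\<integral>\<^sup>+\<omega>. indicator A \<omega> * H (\<theta> (enn2real (T \<omega>)) \<omega>) \<partial>P z)
    = (\<integral>\<^sup>+\<omega>. indicator A \<omega> * at_state (\<lambda>x. \<integral>\<^sup>+\<omega>'. H \<omega>' \<partial>P x) (Xat T \<omega>) \<partial>P z)"
proof -
  have A_P [measurable]: "A \<in> sets (P z)" using A(1) sets_pre_F[OF T] sets_F_W sets_P by blast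
  have th: "(\<lambda>\<omega>. \<theta> (enn2real (T \<omega>)) \<omega>) \<in> measurable (P z) (F \<top>)"
    by (rule measurable_F_P[OF shift_measurable[OF stops_measurable[OF T]]])
  note [measurable] = measurable_pre_P[OF T Xat_measurable[OF T]]
  have ths: "\<theta> (enn2real (T \<omega>)) \<omega> \<in> space W" if "\<omega> \<in> space W" for \<omega>
    using shift[of "enn2real (T \<omega>)" \<omega>] that by simp
  have mH [measurable]: "at_state (\<lambda>x. \<integral>\<^sup>+\<omega>'. u \<omega>' \<partial>P x) \<in> borel_measurable cemetery_borel"
    if "u \<in> borel_measurable (F \<top>)" for u
    using that by (intro at_state_measurable nn_integral_P_measurable)
  show ?thesis
    using H
  proof (induct rule: borel_measurable_induct)
    case (cong f g)
    have "(\<integral>\<^sup>+\<omega>'. f \<omega>' \<partial>P x) = (\<integral>\<^sup>+\<omega>'. g \<omega>' \<partial>P x)" for x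
      using cong(3) by (intro nn_integral_cong) auto
    moreover have "(\<integral>\<^sup>+\<omega>. indicator A \<omega> * f (\<theta> (enn2real (T \<omega>)) \<omega>) \<partial>P z) = (\<integral>\<^sup>+\<omega>. indicator A \<omega> * g (\<theta> (enn2real (T \<omega>)) \<omega>) \<partial>P z)"
      using cong(3) ths by (intro nn_integral_cong) auto
    ultimately show ?case using cong by simp
  next
    case (set E)
    have EP: "E \<in> sets (P x)" for x using set sets_F_W sets_P by blast
    have mE: "{\<omega> \<in> A. \<theta> (enn2real (T \<omega>)) \<omega> \<in> E} \<in> sets (P z)"
    proof -
      have "{\<omega> \<in> A. \<theta> (enn2real (T \<omega>)) \<omega> \<in> E} = A \<inter> ((\<lambda>\<omega>. \<theta> (enn2real (T \<omega>)) \<omega>) -` E \<inter> space (P z))"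
        using A by (auto simp: alive_def)
      then show ?thesis using measurable_sets[OF th set] A_P by auto
    qed
    have "(\<integral>\<^sup>+\<omega>. indicator A \<omega> * indicator E (\<theta> (enn2real (T \<omega>)) \<omega>) \<partial>P z)
      = (\<integral>\<^sup>+\<omega>. indicator {\<omega> \<in> A. \<theta> (enn2real (T \<omega>)) \<omega> \<in> E} \<omega> \<partial>P z)"
      by (intro nn_integral_cong) (auto simp: indicator_def)
    then show ?case using strong_markov_sets[OF T A set, of z] mE EP by simp
  next
    case (mult u c)
    have 1: "(\<integral>\<^sup>+\<omega>'. c * u \<omega>' \<partial>P x) = c * (\<integral>\<^sup>+\<omega>'. u \<omega>' \<partial>P x)" for x
      by (intro nn_integral_cmult measurable_F_P[OF mult(2)])
    have 2: "at_state (\<lambda>x. c * (\<integral>\<^sup>+\<omega>'. u \<omega>' \<partial>P x)) \<xi> = c * at_state (\<lambda>x. \<integral>\<^sup>+\<omega>'. u \<omega>' \<partial>P x) \<xi>" for \<xi>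
      by (cases \<xi>) auto
    note [measurable] = mH[OF mult(2)] measurable_compose[OF th mult(2)]
    show ?case unfolding 1 2 using mult(4) by (simp add: mult.left_commute[of _ c] nn_integral_cmult)
  next
    case (add u v)
    have 1: "(\<integral>\<^sup>+\<omega>'. v \<omega>' + u \<omega>' \<partial>P x) = (\<integral>\<^sup>+\<omega>'. v \<omega>' \<partial>P x) + (\<integral>\<^sup>+\<omega>'. u \<omega>' \<partial>P x)" for x
      by (intro nn_integral_add measurable_F_P[OF add(1)] measurable_F_P[OF add(4)])
    have 2: "at_state (\<lambda>x. (\<integral>\<^sup>+\<omega>'. v \<omega>' \<partial>P x) + (\<integral>\<^sup>+\<omega>'. u \<omega>' \<partial>P x)) \<xi>
      = at_state (\<lambda>x. \<integral>\<^sup>+\<omega>'. v \<omega>' \<partial>P x) \<xi> + at_state (\<lambda>x. \<integral>\<^sup>+\<omega>'. u \<omega>' \<partial>P x) \<xi>" for \<xi>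
      by (cases \<xi>) auto
    note [measurable] = mH[OF add(1)] measurable_compose[OF th add(1)] mH[OF add(4)] measurable_compose[OF th add(4)]
    show ?case unfolding 1 2 using add(3,7) by (simp add: distrib_left nn_integral_add)
  next
    case (seq U)
    have 1: "(\<integral>\<^sup>+\<omega>'. (SUP i. U i) \<omega>' \<partial>P x) = (SUP i. \<integral>\<^sup>+\<omega>'. U i \<omega>' \<partial>P x)" for x
      unfolding SUP_apply
      by (rule nn_integral_monotone_convergence_SUP[OF seq(4) measurable_F_P[OF seq(1)]])
    have 2: "at_state (\<lambda>x. SUP i. \<integral>\<^sup>+\<omega>'. U i \<omega>' \<partial>P x) \<xi> = (SUP i. at_state (\<lambda>x. \<integral>\<^sup>+\<omega>'. U i \<omega>' \<partial>P x) \<xi>)" for \<xi>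
      by (cases \<xi>) auto
    have 3: "indicator A \<omega> * (SUP i. V i) = (SUP i. indicator A \<omega> * V i)" for V :: "nat \<Rightarrow> ennreal" and \<omega> :: 'w
      by (rule SUP_mult_left_ennreal)
    have inc2: "incseq (\<lambda>i. at_state (\<lambda>x. \<integral>\<^sup>+\<omega>'. U i \<omega>' \<partial>P x) \<xi>)" for \<xi>
      using seq(4) by (cases \<xi>) (auto simp: incseq_def le_fun_def intro!: nn_integral_mono)
    note [measurable] = mH[OF seq(1)] measurable_compose[OF th seq(1)]
    have a: "(\<integral>\<^sup>+\<omega>. (SUP i. indicator A \<omega> * U i (\<theta> (enn2real (T \<omega>)) \<omega>)) \<partial>P z)
       = (SUP i. \<integral>\<^sup>+\<omega>. indicator A \<omega> * U i (\<theta> (enn2real (T \<omega>)) \<omega>) \<partial>P z)"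
      using seq(4) by (intro nn_integral_monotone_convergence_SUP)
        (auto simp: incseq_def le_fun_def intro!: mult_left_mono)
    have b: "(\<integral>\<^sup>+\<omega>. (SUP i. indicator A \<omega> * at_state (\<lambda>x. \<integral>\<^sup>+\<omega>'. U i \<omega>' \<partial>P x) (Xat T \<omega>)) \<partial>P z)
       = (SUP i. \<integral>\<^sup>+\<omega>. indicator A \<omega> * at_state (\<lambda>x. \<integral>\<^sup>+\<omega>'. U i \<omega>' \<partial>P x) (Xat T \<omega>) \<partial>P z)"
      using inc2 by (intro nn_integral_monotone_convergence_SUP)
        (auto simp: incseq_def le_fun_def intro!: mult_left_mono)
    show ?case unfolding 1 unfolding 2 SUP_apply 3 a b using seq(3) by simp
  qed
qed

text \<open>Stated for nonnegative extended functionals, so that no integrability has to be carried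
  along. The factor \<open>alive T\<close> removes the paths on which the shift by
  \<open>enn2real (T \<omega>)\<close> has no meaning as a future.\<close>

theorem strong_markov_functional:
  assumes T: "stops T" and Z: "Z \<in> borel_measurable (pre T)" and H: "H \<in> borel_measurable (F \<top>)"
  shows "(\<integral>\<^sup>+\<omega>. Z \<omega> * (indicator (alive T) \<omega> * H (\<theta> (enn2real (T \<omega>)) \<omega>)) \<partial>P z)
    = (\<integral>\<^sup>+\<omega>. Z \<omega> * (indicator (alive T) \<omega> * at_state (\<lambda>x. \<integral>\<^sup>+\<omega>'. H \<omega>' \<partial>P x) (Xat T \<omega>)) \<partial>P z)"
proof -
  have al [measurable]: "alive T \<in> sets (P z)" using alive_sets[OF T] sets_pre_F[OF T] sets_F_W sets_P by blast
  have th: "(\<lambda>\<omega>. \<theta> (enn2real (T \<omega>)) \<omega>) \<in> measurable (P z) (F \<top>)"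
    by (rule measurable_F_P[OF shift_measurable[OF stops_measurable[OF T]]])
  define g1 where "g1 \<omega> = indicator (alive T) \<omega> * H (\<theta> (enn2real (T \<omega>)) \<omega>)" for \<omega>
  define g2 where "g2 \<omega> = indicator (alive T) \<omega> * at_state (\<lambda>x. \<integral>\<^sup>+\<omega>'. H \<omega>' \<partial>P x) (Xat T \<omega>)" for \<omega>
  have g [measurable]: "g1 \<in> borel_measurable (P z)" "g2 \<in> borel_measurable (P z)"
    unfolding g1_def g2_def
    by (intro borel_measurable_times_ennreal borel_measurable_indicator al measurable_compose[OF th H]
        measurable_compose[OF measurable_pre_P[OF T Xat_measurable[OF T]]] at_state_measurable
        nn_integral_P_measurable H)+
  have "(\<integral>\<^sup>+\<omega>. Z \<omega> * g1 \<omega> \<partial>P z) = (\<integral>\<^sup>+\<omega>. Z \<omega> * g2 \<omega> \<partial>P z)"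
    using Z
  proof (induct rule: borel_measurable_induct)
    case (cong f g)
    have "(\<integral>\<^sup>+\<omega>. f \<omega> * h \<omega> \<partial>P z) = (\<integral>\<^sup>+\<omega>. g \<omega> * h \<omega> \<partial>P z)" for h
      using cong(3) by (intro nn_integral_cong) auto
    then show ?case using cong by simp
  next
    case (set A)
    have A: "A \<inter> alive T \<in> sets (pre T)" using set alive_sets[OF T] by auto
    have i: "indicator A \<omega> * (indicator (alive T) \<omega> * c) = indicator (A \<inter> alive T) \<omega> * (c :: ennreal)" for \<omega> c
      by (auto simp: indicator_def)
    show ?case unfolding g1_def g2_def i by (rule strong_markov_indicator[OF T A _ H]) auto
  next
    case (mult u c)
    note [measurable] = measurable_pre_P[OF T mult(2)]
    show ?case using mult(4) by (simp add: mult.assoc nn_integral_cmult)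
  next
    case (add u v)
    note [measurable] = measurable_pre_P[OF T add(1)] measurable_pre_P[OF T add(4)]
    show ?case using add(3,7) by (simp add: distrib_right nn_integral_add)
  next
    case (seq U)
    note [measurable] = measurable_pre_P[OF T seq(1)]
    have 3: "(SUP i. V i) * c = (SUP i. V i * c)" for V :: "nat \<Rightarrow> ennreal" and c
      by (rule SUP_mult_right_ennreal)
    have a: "(\<integral>\<^sup>+\<omega>. (SUP i. U i \<omega> * h \<omega>) \<partial>P z) = (SUP i. \<integral>\<^sup>+\<omega>. U i \<omega> * h \<omega> \<partial>P z)"
      if [measurable]: "h \<in> borel_measurable (P z)" for h
      using seq(4) by (intro nn_integral_monotone_convergence_SUP)
        (auto simp: incseq_def le_fun_def intro!: mult_right_mono)
    show ?case unfolding SUP_apply 3 a[OF g(1)] a[OF g(2)] using seq(3) by simp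
  qed
  then show ?thesis unfolding g1_def g2_def .
qed

text \<open>If the state at a finite \<open>T\<close> is almost surely the one point y, the
  conditional expectation is a constant, and past and future factorise. This is the form used at
  inverse local times.\<close>

corollary strong_markov_at:
  assumes T: "stops T" and Z: "Z \<in> borel_measurable (pre T)" and H: "H \<in> borel_measurable (F \<top>)"
    and y: "AE \<omega> in P z. T \<omega> < \<top> \<longrightarrow> X (enn2real (T \<omega>)) \<omega> = Some y"
    and Z0: "\<And>\<omega>. T \<omega> = \<top> \<Longrightarrow> Z \<omega> = 0"
  shows "(\<integral>\<^sup>+\<omega>. Z \<omega> * H (\<theta> (enn2real (T \<omega>)) \<omega>) \<partial>P z) = (\<integral>\<^sup>+\<omega>. Z \<omega> \<partial>P z) * (\<integral>\<^sup>+\<omega>. H \<omega> \<partial>P y)"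
proof -
  have y: "AE \<omega> in P z. \<omega> \<in> space W \<and> (T \<omega> < \<top> \<longrightarrow> X (enn2real (T \<omega>)) \<omega> = Some y)"
    using y AE_space[of "P z"] by eventually_elim auto
  have "(\<integral>\<^sup>+\<omega>. Z \<omega> * H (\<theta> (enn2real (T \<omega>)) \<omega>) \<partial>P z)
    = (\<integral>\<^sup>+\<omega>. Z \<omega> * (indicator (alive T) \<omega> * H (\<theta> (enn2real (T \<omega>)) \<omega>)) \<partial>P z)"
    using y
  proof (intro nn_integral_cong_AE, eventually_elim)
    case (elim \<omega>)
    then show ?case
      using Z0[of \<omega>] by (cases "T \<omega> = \<top>") (auto simp: Xat_def alive_def indicator_def less_top[symmetric])
  qed
  also have "\<dots> = (\<integral>\<^sup>+\<omega>. Z \<omega> * (indicator (alive T) \<omega> * at_state (\<lambda>x. \<integral>\<^sup>+\<omega>'. H \<omega>' \<partial>P x) (Xat T \<omega>)) \<partial>P z)"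
    by (rule strong_markov_functional[OF T Z H])
  also have "\<dots> = (\<integral>\<^sup>+\<omega>. Z \<omega> * (\<integral>\<^sup>+\<omega>'. H \<omega>' \<partial>P y) \<partial>P z)"
    using y
  proof (intro nn_integral_cong_AE, eventually_elim)
    case (elim \<omega>)
    then show ?case
      using Z0[of \<omega>] by (cases "T \<omega> = \<top>") (auto simp: Xat_def alive_def indicator_def less_top[symmetric])
  qed
  also have "\<dots> = (\<integral>\<^sup>+\<omega>. Z \<omega> \<partial>P z) * (\<integral>\<^sup>+\<omega>. H \<omega> \<partial>P y)"
    using measurable_pre_P[OF T Z] by (rule nn_integral_multc)
  finally show ?thesis .
qed

end

section \<open>Occupation times\<close>

context strong_markov_process
begin

text \<open>The half-open interval keeps \<open>occ g t\<close> a function of the path strictly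
  before t, and splits without overlap at an intermediate time.\<close>

definition occ :: "('s \<Rightarrow> ennreal) \<Rightarrow> real \<Rightarrow> 'w \<Rightarrow> ennreal" where
  "occ g t \<omega> = (\<integral>\<^sup>+r. at_state g (X r \<omega>) * indicator {0..<t} r \<partial>lborel)"

definition disc :: "real \<Rightarrow> ('s \<Rightarrow> ennreal) \<Rightarrow> 'w \<Rightarrow> ennreal" where
  "disc \<alpha> g \<omega> = (\<integral>\<^sup>+r. at_state g (X r \<omega>) * (ennreal (exp (- \<alpha> * r)) * indicator {0..} r) \<partial>lborel)"

text \<open>Sending the path to the cemetery from time u on makes the integrand jointly measurable
  with respect to \<open>F u\<close>; up to a time \<open>t \<le> u\<close> nothing changes.\<close>

lemma occ_measurable_upto:
  assumes g: "g \<in> borel_measurable borel"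
  shows "(\<lambda>x. \<integral>\<^sup>+r. at_state g (if 0 \<le> r \<and> ennreal r < u then X r (snd x) else None) * indicator {0..<fst x} r \<partial>lborel)
    \<in> borel_measurable (borel \<Otimes>\<^sub>M F u)"
proof -
  note [measurable] = at_state_measurable[OF g]
  have [measurable]: "(\<lambda>y. (snd y, snd (fst y))) \<in> measurable ((borel \<Otimes>\<^sub>M F u) \<Otimes>\<^sub>M lborel) (borel \<Otimes>\<^sub>M F u)"
    by measurable
  have [measurable]: "(\<lambda>y. if 0 \<le> snd y \<and> ennreal (snd y) < u then X (snd y) (snd (fst y)) else None)
      \<in> measurable ((borel \<Otimes>\<^sub>M F u) \<Otimes>\<^sub>M (lborel :: real measure)) cemetery_borel"
    using measurable_compose[OF _ X_jointly[of u], of "\<lambda>y. (snd y, snd (fst y))" "(borel \<Otimes>\<^sub>M F u) \<Otimes>\<^sub>M lborel"]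
    by (simp only: fst_conv snd_conv) simp
  have i: "indicator {0..<fst (fst y)} (snd y) = (if 0 \<le> snd y \<and> snd y < fst (fst y) then 1 else (0::ennreal))"
    for y :: "(real \<times> 'w) \<times> real" by (auto simp: indicator_def)
  have "(\<lambda>y. at_state g (if 0 \<le> snd y \<and> ennreal (snd y) < u then X (snd y) (snd (fst y)) else None)
      * indicator {0..<fst (fst y)} (snd y)) \<in> borel_measurable ((borel \<Otimes>\<^sub>M F u) \<Otimes>\<^sub>M lborel)"
    unfolding i by measurable
  then show ?thesis
    by (intro lborel.borel_measurable_nn_integral) (simp add: case_prod_beta)
qed

lemma occ_upto:
  assumes "ennreal t \<le> u"
  shows "(\<integral>\<^sup>+r. at_state g (if 0 \<le> r \<and> ennreal r < u then X r \<omega> else None) * indicator {0..<t} r \<partial>lborel) = occ g t \<omega>"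
  unfolding occ_def
proof (rule nn_integral_cong)
  fix r :: real
  have "ennreal r < u" if "0 \<le> r" "r < t" using that assms by (meson ennreal_lessI order.strict_trans2 le_less_trans)
  then show "at_state g (if 0 \<le> r \<and> ennreal r < u then X r \<omega> else None) * indicator {0..<t} r
    = at_state g (X r \<omega>) * indicator {0..<t} r" by (auto simp: indicator_def)
qed

lemma occ_progressive:
  assumes g: "g \<in> borel_measurable borel"
  shows "(\<lambda>x. if 0 \<le> fst x \<and> ennreal (fst x) < u then occ g (fst x) (snd x) else 0) \<in> borel_measurable (borel \<Otimes>\<^sub>M F u)"
proof -
  have "(\<lambda>x. if 0 \<le> fst x \<and> ennreal (fst x) < u then (\<integral>\<^sup>+r. at_state g (if 0 \<le> r \<and> ennreal r < u then X r (snd x) else None)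
      * indicator {0..<fst x} r \<partial>lborel) else 0) \<in> borel_measurable (borel \<Otimes>\<^sub>M F u)"
    by (intro measurable_If occ_measurable_upto[OF g]) measurable
  moreover have "(if 0 \<le> fst x \<and> ennreal (fst x) < u then (\<integral>\<^sup>+r. at_state g (if 0 \<le> r \<and> ennreal r < u then X r (snd x) else None)
      * indicator {0..<fst x} r \<partial>lborel) else 0) = (if 0 \<le> fst x \<and> ennreal (fst x) < u then occ g (fst x) (snd x) else 0)" for x
    using occ_upto[of "fst x" u g "snd x"] by auto
  ultimately show ?thesis by simp
qed

lemma occ_measurable_F:
  assumes g: "g \<in> borel_measurable borel" and t: "ennreal t \<le> u"
  shows "occ g t \<in> borel_measurable (F u)"
proof -
  have "(\<lambda>\<omega>. (t, \<omega>)) \<in> measurable (F u) (borel \<Otimes>\<^sub>M F u)" by measurable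
  from measurable_compose[OF this occ_measurable_upto[OF g]] show ?thesis
    by (simp add: occ_upto[OF t])
qed

lemma path_measurable:
  assumes g: "g \<in> borel_measurable borel" and w: "\<omega> \<in> space W"
  shows "(\<lambda>r. at_state g (if 0 \<le> r then X r \<omega> else None)) \<in> borel_measurable borel"
proof -
  have "(\<lambda>r. (r, \<omega>)) \<in> measurable borel (borel \<Otimes>\<^sub>M F \<top>)"
    using w by (intro measurable_Pair) auto
  from measurable_compose[OF measurable_compose[OF this X_jointly[of \<top>]] at_state_measurable[OF g]]
  show ?thesis by (simp only: fst_conv snd_conv ennreal_less_top simp_thms)
qed

lemma path_measurable_indicator:
  assumes g: "g \<in> borel_measurable borel" and w: "\<omega> \<in> space W" and [measurable]: "A \<in> sets borel" and A: "A \<subseteq> {0..}"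
  shows "(\<lambda>r. at_state g (X r \<omega>) * indicator A r) \<in> borel_measurable borel"
proof -
  note [measurable] = path_measurable[OF g w]
  have "(\<lambda>r. at_state g (if 0 \<le> r then X r \<omega> else None) * indicator A r) \<in> borel_measurable borel" by measurable
  moreover have "at_state g (if 0 \<le> r then X r \<omega> else None) * indicator A r = at_state g (X r \<omega>) * indicator A r" for r
    using A by (auto simp: indicator_def)
  ultimately show ?thesis by simp
qed

lemma nn_integral_path_shift:
  assumes g: "g \<in> borel_measurable borel" and w: "\<omega> \<in> space W" and k: "k \<in> borel_measurable borel" and s: "0 \<le> s"
  shows "(\<integral>\<^sup>+r. at_state g (X r \<omega>) * (k r * indicator {s..} r) \<partial>lborel)
    = (\<integral>\<^sup>+r. at_state g (X r (\<theta> s \<omega>)) * (k (s + r) * indicator {0..} r) \<partial>lborel)"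
proof -
  note [measurable] = k path_measurable[OF g w]
  have e: "at_state g (X r \<omega>) * (k r * indicator {s..} r) = at_state g (if 0 \<le> r then X r \<omega> else None) * (k r * indicator {s..} r)" for r
    using s by (auto simp: indicator_def)
  have "(\<integral>\<^sup>+r. at_state g (X r \<omega>) * (k r * indicator {s..} r) \<partial>lborel)
    = (\<integral>\<^sup>+r. at_state g (if 0 \<le> s + 1 * r then X (s + 1 * r) \<omega> else None) * (k (s + 1 * r) * indicator {s..} (s + 1 * r)) \<partial>lborel)"
    unfolding e by (subst nn_integral_real_affine[of _ 1 s]) auto
  also have "\<dots> = (\<integral>\<^sup>+r. at_state g (X r (\<theta> s \<omega>)) * (k (s + r) * indicator {0..} r) \<partial>lborel)"
    using shift[OF s w] s by (intro nn_integral_cong) (auto simp: indicator_def add.commute)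
  finally show ?thesis .
qed

lemma occ_add:
  assumes g: "g \<in> borel_measurable borel" and w: "\<omega> \<in> space W" and s: "0 \<le> s" and t: "0 \<le> t"
  shows "occ g (s + t) \<omega> = occ g s \<omega> + occ g t (\<theta> s \<omega>)"
proof -
  have 1: "at_state g (X r \<omega>) * indicator {0..<s + t} r
    = at_state g (X r \<omega>) * indicator {0..<s} r + at_state g (X r \<omega>) * indicator {s..<s + t} r" for r
    using s t by (auto simp: indicator_def)
  have 2: "(\<integral>\<^sup>+r. at_state g (X r \<omega>) * indicator {s..<s + t} r \<partial>lborel)
    = (\<integral>\<^sup>+r. at_state g (X r \<omega>) * (indicator {..<s + t} r * indicator {s..} r) \<partial>lborel)"
    by (intro nn_integral_cong) (auto simp: indicator_def)
  have 3: "(\<integral>\<^sup>+r. at_state g (X r (\<theta> s \<omega>)) * (indicator {..<s + t} (s + r) * indicator {0..} r) \<partial>lborel)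
    = occ g t (\<theta> s \<omega>)"
    unfolding occ_def by (intro nn_integral_cong) (auto simp: indicator_def)
  have "occ g (s + t) \<omega> = occ g s \<omega> + (\<integral>\<^sup>+r. at_state g (X r \<omega>) * indicator {s..<s + t} r \<partial>lborel)"
    unfolding occ_def 1 using s
    by (intro nn_integral_add) (auto intro!: path_measurable_indicator[OF g w])
  then show ?thesis
    unfolding 2 using nn_integral_path_shift[OF g w _ s, of "indicator {..<s + t}"] 3 by simp
qed

lemma occ_mono: "s \<le> t \<Longrightarrow> occ g s \<omega> \<le> occ g t \<omega>"
  unfolding occ_def by (intro nn_integral_mono mult_left_mono) (auto simp: indicator_def)

lemma disc_shift:
  assumes g: "g \<in> borel_measurable borel" and w: "\<omega> \<in> space W" and s: "0 \<le> s"
  shows "(\<integral>\<^sup>+r. at_state g (X r \<omega>) * (ennreal (exp (- \<alpha> * r)) * indicator {s..} r) \<partial>lborel)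
    = ennreal (exp (- \<alpha> * s)) * disc \<alpha> g (\<theta> s \<omega>)"
proof -
  have ws: "\<theta> s \<omega> \<in> space W" using shift[OF s w] by simp
  note [measurable] = path_measurable[OF g ws]
  have e: "at_state g (X r (\<theta> s \<omega>)) * (c * indicator {0..} r) = at_state g (if 0 \<le> r then X r (\<theta> s \<omega>) else None) * (c * indicator {0..} r)" for r c
    by (auto simp: indicator_def)
  have "(\<integral>\<^sup>+r. at_state g (X r (\<theta> s \<omega>)) * (ennreal (exp (- \<alpha> * (s + r))) * indicator {0..} r) \<partial>lborel)
    = (\<integral>\<^sup>+r. ennreal (exp (- \<alpha> * s)) * (at_state g (if 0 \<le> r then X r (\<theta> s \<omega>) else None) * (ennreal (exp (- \<alpha> * r)) * indicator {0..} r)) \<partial>lborel)"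
    unfolding e
  proof (intro nn_integral_cong)
    fix r
    have "ennreal (exp (- \<alpha> * (s + r))) = ennreal (exp (- \<alpha> * s)) * ennreal (exp (- \<alpha> * r))"
      by (simp add: ennreal_mult[symmetric] exp_add[symmetric] distrib_left)
    then show "at_state g (if 0 \<le> r then X r (\<theta> s \<omega>) else None) * (ennreal (exp (- \<alpha> * (s + r))) * indicator {0..} r)
      = ennreal (exp (- \<alpha> * s)) * (at_state g (if 0 \<le> r then X r (\<theta> s \<omega>) else None) * (ennreal (exp (- \<alpha> * r)) * indicator {0..} r))"
      by (simp only: mult_ac)
  qed
  also have "\<dots> = ennreal (exp (- \<alpha> * s)) * (\<integral>\<^sup>+r. at_state g (if 0 \<le> r then X r (\<theta> s \<omega>) else None) * (ennreal (exp (- \<alpha> * r)) * indicator {0..} r) \<partial>lborel)"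
    by (intro nn_integral_cmult) measurable
  finally show ?thesis
    unfolding disc_def e by (subst nn_integral_path_shift[OF g w _ s]) (auto simp: e)
qed

lemma X_product_measurable:
  assumes g: "g \<in> borel_measurable borel"
  shows "(\<lambda>x. at_state g (if 0 \<le> snd x then X (snd x) (fst x) else None)) \<in> borel_measurable (F \<top> \<Otimes>\<^sub>M lborel)"
proof -
  have "(\<lambda>x. (snd x, fst x)) \<in> measurable (F \<top> \<Otimes>\<^sub>M lborel) (borel \<Otimes>\<^sub>M F \<top>)" by measurable
  from measurable_compose[OF measurable_compose[OF this X_jointly[of \<top>]] at_state_measurable[OF g]]
  show ?thesis by (simp only: fst_conv snd_conv ennreal_less_top simp_thms)
qed

lemma measurable_F_P_pair: "g \<in> measurable (F \<top> \<Otimes>\<^sub>M K) K' \<Longrightarrow> g \<in> measurable (P z \<Otimes>\<^sub>M K) K'"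
proof -
  assume g: "g \<in> measurable (F \<top> \<Otimes>\<^sub>M K) K'"
  have [measurable]: "(\<lambda>\<omega>. \<omega>) \<in> measurable (P z) (F \<top>)" by (rule measurable_F_P[of _ \<top>]) simp
  have "(\<lambda>x. (fst x, snd x)) \<in> measurable (P z \<Otimes>\<^sub>M K) (F \<top> \<Otimes>\<^sub>M K)" by measurable
  from measurable_compose[OF this g] show ?thesis by simp
qed

lemma disc_eq: "disc \<alpha> g \<omega> = (\<integral>\<^sup>+r. at_state g (if 0 \<le> r then X r \<omega> else None) * (ennreal (exp (- \<alpha> * r)) * indicator {0..} r) \<partial>lborel)"
  unfolding disc_def by (intro nn_integral_cong) (auto simp: indicator_def)

lemma disc_measurable:
  assumes g: "g \<in> borel_measurable borel"
  shows "disc \<alpha> g \<in> borel_measurable (F \<top>)"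
proof -
  note [measurable] = X_product_measurable[OF g]
  have "(\<lambda>\<omega>. \<integral>\<^sup>+r. at_state g (if 0 \<le> r then X r \<omega> else None) * (ennreal (exp (- \<alpha> * r)) * indicator {0..} r) \<partial>lborel) \<in> borel_measurable (F \<top>)"
    by (intro lborel.borel_measurable_nn_integral) (simp add: case_prod_beta)
  then show ?thesis by (simp add: disc_eq[abs_def])
qed

section \<open>Expected occupation and potential densities\<close>

lemma measurable_m_iff: "measurable m K = measurable borel K"
  by (rule measurable_cong_sets) (auto simp: sets_m)

lemma p_section_measurable: "0 < r \<Longrightarrow> p r z \<in> borel_measurable borel"
proof -
  assume r: "0 < r"
  have "(\<lambda>y. (r, z, y)) \<in> measurable borel (restrict_space borel {0<..} \<Otimes>\<^sub>M borel \<Otimes>\<^sub>M borel)"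
    using r by (intro measurable_Pair) (auto simp: space_restrict_space)
  from measurable_compose[OF this p_measurable] show ?thesis by simp
qed

lemma expectation_state:
  assumes r: "0 < r" and g: "g \<in> borel_measurable borel"
  shows "(\<integral>\<^sup>+\<omega>. at_state g (X r \<omega>) \<partial>P z) = (\<integral>\<^sup>+y. g y * ennreal (p r z y) \<partial>m)"
proof -
  define A where "A = {\<omega> \<in> space W. X r \<omega> \<in> Some ` UNIV}"
  \<comment> \<open>\<open>z\<close> is an arbitrary stand-in for the cemetery; the density
    \<open>indicator A\<close> removes the paths that use it.\<close>
  define k where "k \<omega> = case_option z id (X r \<omega>)" for \<omega>
  have AP [measurable]: "A \<in> sets (P z)"
    unfolding A_def using X_sets_F[of r \<top> UNIV] r sets_F_W sets_P by auto
  have k: "k \<in> measurable (P z) borel" unfolding k_def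
    by (rule measurable_compose[OF measurable_F_P[OF X_measurable_F[of r \<top>]] measurable_case_option_cemetery]) (use r in auto)
  have [measurable]: "p r z \<in> borel_measurable m" using p_section_measurable[OF r] by (simp add: measurable_m_iff)
  have k' [measurable]: "k \<in> measurable (density (P z) (indicator A)) borel" using k by simp
  have g': "g \<in> borel_measurable m" using g by (simp add: measurable_m_iff)
  have sm: "sets borel = sets m" using sets_m by simp
  have eq: "distr (density (P z) (indicator A)) borel k = density m (\<lambda>y. ennreal (p r z y))"
  proof (rule measure_eqI)
    fix B assume "B \<in> sets (distr (density (P z) (indicator A)) borel k)"
    then have B: "B \<in> sets borel" by simp
    have kB: "k -` B \<inter> space (P z) \<in> sets (P z)" using measurable_sets[OF k B] .
    have "emeasure (distr (density (P z) (indicator A)) borel k) B = emeasure (density (P z) (indicator A)) (k -` B \<inter> space (P z))"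
      using B by (simp add: emeasure_distr)
    also have "\<dots> = (\<integral>\<^sup>+\<omega>. indicator A \<omega> * indicator (k -` B \<inter> space (P z)) \<omega> \<partial>P z)"
      using kB by (intro emeasure_density) auto
    also have "\<dots> = (\<integral>\<^sup>+\<omega>. indicator (A \<inter> (k -` B \<inter> space (P z))) \<omega> \<partial>P z)"
      by (intro nn_integral_cong) (auto simp: indicator_def)
    also have "\<dots> = emeasure (P z) (A \<inter> (k -` B \<inter> space (P z)))"
      using kB AP by (intro nn_integral_indicator) auto
    also have "A \<inter> (k -` B \<inter> space (P z)) = {\<omega> \<in> space W. X r \<omega> \<in> Some ` B}"
      by (auto simp: A_def k_def)
    also have "emeasure (P z) \<dots> = (\<integral>\<^sup>+y\<in>B. ennreal (p r z y) \<partial>m)"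
      using transition[OF r B, of z] by (simp add: transition_prob_def)
    also have "\<dots> = emeasure (density m (\<lambda>y. ennreal (p r z y))) B"
      using B sets_m by (intro emeasure_density[symmetric]) auto
    finally show "emeasure (distr (density (P z) (indicator A)) borel k) B = emeasure (density m (\<lambda>y. ennreal (p r z y))) B" .
  qed (simp add: sets_m)
  have "(\<integral>\<^sup>+\<omega>. at_state g (X r \<omega>) \<partial>P z) = (\<integral>\<^sup>+\<omega>. indicator A \<omega> * g (k \<omega>) \<partial>P z)"
  proof (rule nn_integral_cong)
    fix \<omega> assume "\<omega> \<in> space (P z)"
    then show "at_state g (X r \<omega>) = indicator A \<omega> * g (k \<omega>)"
      by (cases "X r \<omega>") (auto simp: A_def k_def)
  qed
  also have "\<dots> = (\<integral>\<^sup>+y. g y \<partial>distr (density (P z) (indicator A)) borel k)"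
    using measurable_compose[OF k g] by (subst nn_integral_distr[OF k']) (simp_all add: g nn_integral_density)
  also have "\<dots> = (\<integral>\<^sup>+y. g y * ennreal (p r z y) \<partial>m)"
    unfolding eq using g' by (subst nn_integral_density) (auto simp: mult.commute)
  finally show ?thesis .
qed

text \<open>\<open>m\<close> is not assumed sigma-finite. Finiteness of the integral of g makes
  \<open>density m g\<close> a finite measure, and Fubini is applied with that one.\<close>

lemma expectation_disc:
  assumes g: "g \<in> borel_measurable borel" and fin: "(\<integral>\<^sup>+y. g y \<partial>m) < \<infinity>"
  shows "(\<integral>\<^sup>+\<omega>. disc \<alpha> g \<omega> \<partial>P z) = (\<integral>\<^sup>+y. g y * potential_density p \<alpha> z y \<partial>m)"
proof -
  have g' [measurable]: "g \<in> borel_measurable m" using g by (simp add: measurable_m_iff)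
  interpret Pz: prob_space "P z" by (rule prob_space_P)
  interpret pair_sigma_finite "P z" "lborel :: real measure" ..
  define D where "D = density m g"
  have "finite_measure D"
    unfolding D_def using fin by (intro finite_measureI) (simp add: emeasure_density cong: nn_integral_cong)
  then interpret D: finite_measure D .
  have sD: "sets D = sets borel" unfolding D_def using sets_m by simp
  interpret DL: pair_sigma_finite "lborel :: real measure" D ..
  define q where "q r y = (if 0 < r then ennreal (exp (- \<alpha> * r) * p r z y) else 0)" for r y
  have q: "(\<lambda>x. q (fst x) (snd x)) \<in> borel_measurable (borel \<Otimes>\<^sub>M borel)"
  proof -
    have "(\<lambda>x. (fst x, z, snd x)) \<in> measurable (restrict_space (borel \<Otimes>\<^sub>M borel) {x. 0 < fst x}) (restrict_space borel {0<..} \<Otimes>\<^sub>M borel \<Otimes>\<^sub>M borel)"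
      by (intro measurable_Pair measurable_restrict_space2)
        (auto simp: space_restrict_space intro!: measurable_restrict_space1)
    from measurable_compose[OF this p_measurable]
    have [measurable]: "(\<lambda>x. p (fst x) z (snd x)) \<in> borel_measurable (restrict_space (borel \<Otimes>\<^sub>M borel) {x. 0 < fst x})" by simp
    have [measurable]: "(\<lambda>x. fst x) \<in> borel_measurable (restrict_space (borel \<Otimes>\<^sub>M (borel :: 's measure)) {x. 0 < (fst x :: real)})"
      by (rule measurable_restrict_space1) measurable
    have "(\<lambda>x. ennreal (exp (- \<alpha> * fst x) * p (fst x) z (snd x))) \<in> borel_measurable (restrict_space (borel \<Otimes>\<^sub>M borel) {x. 0 < fst x})"
      by measurable
    then show ?thesis unfolding q_def
      by (subst (asm) measurable_restrict_space_iff[where c=0]) auto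
  qed
  have qD [measurable]: "case_prod q \<in> borel_measurable (lborel \<Otimes>\<^sub>M D)"
  proof -
    have "sets (lborel \<Otimes>\<^sub>M D) = sets (borel \<Otimes>\<^sub>M borel)" by (rule sets_pair_measure_cong) (auto simp: sD)
    then have "measurable ((lborel :: real measure) \<Otimes>\<^sub>M D) (borel :: ennreal measure) = measurable (borel \<Otimes>\<^sub>M borel) borel"
      by (rule measurable_cong_sets) simp
    moreover have "case_prod q = (\<lambda>x. q (fst x) (snd x))" by (simp add: fun_eq_iff)
    ultimately show ?thesis using q by (simp only:)
  qed
  have "(\<integral>\<^sup>+\<omega>. disc \<alpha> g \<omega> \<partial>P z) = (\<integral>\<^sup>+r. \<integral>\<^sup>+\<omega>. at_state g (if 0 \<le> r then X r \<omega> else None) * (ennreal (exp (- \<alpha> * r)) * indicator {0..} r) \<partial>P z \<partial>lborel)"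
    unfolding disc_eq
  proof (rule Fubini'[symmetric])
    note [measurable] = measurable_F_P_pair[OF X_product_measurable[OF g], of z]
    show "(\<lambda>(\<omega>, r). at_state g (if 0 \<le> r then X r \<omega> else None) * (ennreal (exp (- \<alpha> * r)) * indicator {0..} r)) \<in> borel_measurable (P z \<Otimes>\<^sub>M lborel)"
      unfolding case_prod_beta by measurable
  qed
  also have "\<dots> = (\<integral>\<^sup>+r. \<integral>\<^sup>+y. q r y \<partial>D \<partial>lborel)"
  proof (rule nn_integral_cong_AE)
    \<comment> \<open>Time 0 has no transition density, but it is a null set for the time
      integral.\<close>
    have "AE r in lborel. r \<noteq> (0::real)" by (rule AE_lborel_singleton)
    then show "AE r in lborel. (\<integral>\<^sup>+\<omega>. at_state g (if 0 \<le> r then X r \<omega> else None) * (ennreal (exp (- \<alpha> * r)) * indicator {0..} r) \<partial>P z) = (\<integral>\<^sup>+y. q r y \<partial>D)"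
    proof eventually_elim
      case (elim r)
      show ?case
      proof (cases "0 < r")
        case True
        have [measurable]: "p r z \<in> borel_measurable m" using p_section_measurable[OF True] by (simp add: measurable_m_iff)
        have "(\<integral>\<^sup>+\<omega>. at_state g (if 0 \<le> r then X r \<omega> else None) * (ennreal (exp (- \<alpha> * r)) * indicator {0..} r) \<partial>P z)
          = (\<integral>\<^sup>+\<omega>. at_state g (X r \<omega>) \<partial>P z) * ennreal (exp (- \<alpha> * r))"
          using True by (simp add: nn_integral_multc measurable_F_P[OF at_state_X_measurable[OF g]])
        also have "\<dots> = (\<integral>\<^sup>+y. g y * ennreal (p r z y) * ennreal (exp (- \<alpha> * r)) \<partial>m)"
          unfolding expectation_state[OF True g] by (intro nn_integral_multc[symmetric]) measurable
        also have "\<dots> = (\<integral>\<^sup>+y. g y * q r y \<partial>m)"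
          using True p_nonneg[OF True] by (intro nn_integral_cong) (simp add: q_def ennreal_mult mult_ac)
        also have "\<dots> = (\<integral>\<^sup>+y. q r y \<partial>D)"
          unfolding D_def using True by (intro nn_integral_density[symmetric]) (auto simp: q_def)
        finally show ?thesis .
      next
        case False
        then show ?thesis using elim by (simp add: q_def)
      qed
    qed
  qed
  also have "\<dots> = (\<integral>\<^sup>+y. \<integral>\<^sup>+r. q r y \<partial>lborel \<partial>D)"
    using qD by (rule DL.Fubini'[symmetric])
  also have "\<dots> = (\<integral>\<^sup>+y. g y * (\<integral>\<^sup>+r. q r y \<partial>lborel) \<partial>m)"
  proof -
    have "(\<lambda>y. \<integral>\<^sup>+r. q r y \<partial>lborel) \<in> borel_measurable borel"
    proof (rule lborel.borel_measurable_nn_integral)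
      have "(\<lambda>x. (snd x, fst x)) \<in> measurable (borel \<Otimes>\<^sub>M lborel) (borel \<Otimes>\<^sub>M borel)" by measurable
      from measurable_compose[OF this q] show "(\<lambda>(y, r). q r y) \<in> borel_measurable (borel \<Otimes>\<^sub>M lborel)"
        by (simp add: case_prod_beta)
    qed
    then have "(\<lambda>y. \<integral>\<^sup>+r. q r y \<partial>lborel) \<in> borel_measurable m" by (simp add: measurable_m_iff)
    then show ?thesis unfolding D_def by (intro nn_integral_density) auto
  qed
  also have "\<dots> = (\<integral>\<^sup>+y. g y * potential_density p \<alpha> z y \<partial>m)"
    unfolding potential_density_def
    by (intro nn_integral_cong arg_cong2[where f="(*)"] refl) (auto simp: q_def)
  finally show ?thesis .
qed

text \<open>The square is at most twice the integral over ordered pairs of times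
  \<open>s \<le> r\<close>. Given the path up to s, the later part is a discounted occupation
  started at \<open>X s\<close>. If the earlier factor is nonzero, this point lies where
  \<open>g\<close> is nonzero, so \<open>C\<close> bounds the later part.\<close>

lemma disc_second_moment:
  assumes g: "g \<in> borel_measurable borel"
    and C: "\<And>x. g x \<noteq> 0 \<Longrightarrow> (\<integral>\<^sup>+\<omega>. disc \<alpha> g \<omega> \<partial>P x) \<le> C" and \<alpha>: "0 \<le> \<alpha>"
  shows "(\<integral>\<^sup>+\<omega>. disc \<alpha> g \<omega> * disc \<alpha> g \<omega> \<partial>P z) \<le> 2 * C * (\<integral>\<^sup>+\<omega>. disc \<alpha> g \<omega> \<partial>P z)"
proof -
  interpret Pz: prob_space "P z" by (rule prob_space_P)
  interpret pair_sigma_finite "P z" "lborel :: real measure" ..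
  define k where "k r \<omega> = at_state g (if 0 \<le> r then X r \<omega> else None) * (ennreal (exp (- \<alpha> * r)) * indicator {0..} r)" for r \<omega>
  define G where "G s \<omega> = (\<integral>\<^sup>+r. k r \<omega> * indicator {s..} r \<partial>lborel)" for s \<omega>
  have J: "disc \<alpha> g \<omega> = (\<integral>\<^sup>+r. k r \<omega> \<partial>lborel)" for \<omega> by (simp add: disc_eq k_def)
  have kr [measurable]: "(\<lambda>r. k r \<omega>) \<in> borel_measurable borel" if "\<omega> \<in> space W" for \<omega>
  proof -
    note [measurable] = path_measurable[OF g that]
    show ?thesis unfolding k_def by measurable
  qed
  note [measurable] = measurable_F_P_pair[OF X_product_measurable[OF g], of z]
  have kp [measurable]: "(\<lambda>x. k (snd x) (fst x)) \<in> borel_measurable (P z \<Otimes>\<^sub>M lborel)" unfolding k_def by measurable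
  have [measurable]: "(\<lambda>y. k (snd y) (fst (fst y))) \<in> borel_measurable ((P z \<Otimes>\<^sub>M (lborel :: real measure)) \<Otimes>\<^sub>M (lborel :: real measure))"
  proof -
    have "(\<lambda>y. (fst (fst y), snd y)) \<in> measurable ((P z \<Otimes>\<^sub>M (lborel :: real measure)) \<Otimes>\<^sub>M (lborel :: real measure)) (P z \<Otimes>\<^sub>M lborel)" by measurable
    from measurable_compose[OF this kp] show ?thesis by simp
  qed
  have i: "indicator {snd (fst y)..} (snd y) = (if snd (fst y) \<le> snd y then 1 else (0::ennreal))" for y :: "('w \<times> real) \<times> real"
    by (auto simp: indicator_def)
  have Gp [measurable]: "(\<lambda>x. G (snd x) (fst x)) \<in> borel_measurable (P z \<Otimes>\<^sub>M lborel)"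
  proof -
    have "(\<lambda>y. k (snd y) (fst (fst y)) * indicator {snd (fst y)..} (snd y)) \<in> borel_measurable ((P z \<Otimes>\<^sub>M lborel) \<Otimes>\<^sub>M lborel)"
      unfolding i by measurable
    then show ?thesis unfolding G_def by (intro lborel.borel_measurable_nn_integral) (simp add: case_prod_beta)
  qed
  have sq: "disc \<alpha> g \<omega> * disc \<alpha> g \<omega> \<le> 2 * (\<integral>\<^sup>+s. k s \<omega> * G s \<omega> \<partial>lborel)" if w: "\<omega> \<in> space W" for \<omega>
  proof -
    note [measurable] = kr[OF w]
    have kk [measurable]: "(\<lambda>x. k (fst x) \<omega> * (k (snd x) \<omega> * indicator {fst x..} (snd x))) \<in> borel_measurable (lborel \<Otimes>\<^sub>M lborel)"
      "(\<lambda>x. k (fst x) \<omega> * (k (snd x) \<omega> * indicator {snd x..} (fst x))) \<in> borel_measurable (lborel \<Otimes>\<^sub>M lborel)"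
    proof -
      have i1: "indicator {fst x..} (snd x) = (if fst x \<le> snd x then 1 else (0::ennreal))"
        "indicator {snd x..} (fst x) = (if snd x \<le> fst x then 1 else (0::ennreal))" for x :: "real \<times> real" by (auto simp: indicator_def)
      show "(\<lambda>x. k (fst x) \<omega> * (k (snd x) \<omega> * indicator {fst x..} (snd x))) \<in> borel_measurable (lborel \<Otimes>\<^sub>M lborel)"
        "(\<lambda>x. k (fst x) \<omega> * (k (snd x) \<omega> * indicator {snd x..} (fst x))) \<in> borel_measurable (lborel \<Otimes>\<^sub>M lborel)"
        unfolding i1 by measurable
    qed
    have "disc \<alpha> g \<omega> * disc \<alpha> g \<omega> = (\<integral>\<^sup>+s. \<integral>\<^sup>+r. k s \<omega> * k r \<omega> \<partial>lborel \<partial>lborel)"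
      unfolding J by (simp add: nn_integral_cmult nn_integral_multc)
    also have "\<dots> \<le> (\<integral>\<^sup>+s. \<integral>\<^sup>+r. k s \<omega> * (k r \<omega> * indicator {s..} r) + k s \<omega> * (k r \<omega> * indicator {r..} s) \<partial>lborel \<partial>lborel)"
      by (intro nn_integral_mono) (auto simp: indicator_def)
    also have "\<dots> = (\<integral>\<^sup>+s. \<integral>\<^sup>+r. k s \<omega> * (k r \<omega> * indicator {s..} r) \<partial>lborel \<partial>lborel)
        + (\<integral>\<^sup>+s. \<integral>\<^sup>+r. k s \<omega> * (k r \<omega> * indicator {r..} s) \<partial>lborel \<partial>lborel)"
    proof -
      have a: "(\<lambda>s. \<integral>\<^sup>+r. k s \<omega> * (k r \<omega> * indicator {s..} r) \<partial>lborel) \<in> borel_measurable lborel"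
        "(\<lambda>s. \<integral>\<^sup>+r. k s \<omega> * (k r \<omega> * indicator {r..} s) \<partial>lborel) \<in> borel_measurable lborel"
        using kk by (intro lborel.borel_measurable_nn_integral; simp add: case_prod_beta)+
      have b: "(\<lambda>r. k s \<omega> * (k r \<omega> * indicator {r..} s)) \<in> borel_measurable lborel" for s
      proof -
        have "indicator {r..} s = (if r \<le> s then 1 else (0::ennreal))" for r by (auto simp: indicator_def)
        then show ?thesis by simp
      qed
      show ?thesis using a b by (simp add: nn_integral_add)
    qed
    also have "(\<integral>\<^sup>+s. \<integral>\<^sup>+r. k s \<omega> * (k r \<omega> * indicator {r..} s) \<partial>lborel \<partial>lborel)
      = (\<integral>\<^sup>+r. \<integral>\<^sup>+s. k s \<omega> * (k r \<omega> * indicator {r..} s) \<partial>lborel \<partial>lborel)"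
      using kk(2) by (intro lborel_pair.Fubini'[symmetric]) (simp add: case_prod_beta)
    also have "\<dots> = (\<integral>\<^sup>+s. \<integral>\<^sup>+r. k s \<omega> * (k r \<omega> * indicator {s..} r) \<partial>lborel \<partial>lborel)"
      by (intro nn_integral_cong) (simp add: mult.left_commute)
    also have "(\<integral>\<^sup>+s. \<integral>\<^sup>+r. k s \<omega> * (k r \<omega> * indicator {s..} r) \<partial>lborel \<partial>lborel) = (\<integral>\<^sup>+s. k s \<omega> * G s \<omega> \<partial>lborel)"
      unfolding G_def by (intro nn_integral_cong nn_integral_cmult) measurable
    finally show ?thesis by (simp add: mult_2)
  qed
  \<comment> \<open>The Markov property at the fixed time s, taken as a constant stopping
    time.\<close>
  have Es: "(\<integral>\<^sup>+\<omega>. k s \<omega> * G s \<omega> \<partial>P z) \<le> (\<integral>\<^sup>+\<omega>. k s \<omega> * C \<partial>P z)" for s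
  proof (cases "0 \<le> s")
    case True
    let ?T = "\<lambda>_. ennreal s"
    have Xs: "Xat ?T = X s" using True by (simp add: Xat_def fun_eq_iff)
    have km: "k s \<in> borel_measurable (pre ?T)"
      using measurable_compose[OF Xat_measurable[OF stops_const[of "ennreal s"]] at_state_measurable[OF g]] True
      by (simp add: k_def[abs_def] Xs)
    have al: "k s \<omega> * (indicator (alive ?T) \<omega> * c) = k s \<omega> * c" if "\<omega> \<in> space W" for \<omega> c
      using that True by (cases "X s \<omega>") (auto simp: k_def alive_def Xs)
    have "(\<integral>\<^sup>+\<omega>. k s \<omega> * G s \<omega> \<partial>P z) = (\<integral>\<^sup>+\<omega>. k s \<omega> * (indicator (alive ?T) \<omega> * (ennreal (exp (- \<alpha> * s)) * disc \<alpha> g (\<theta> (enn2real (?T \<omega>)) \<omega>))) \<partial>P z)"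
    proof (rule nn_integral_cong)
      fix \<omega> assume "\<omega> \<in> space (P z)"
      then have w: "\<omega> \<in> space W" by simp
      have "G s \<omega> = ennreal (exp (- \<alpha> * s)) * disc \<alpha> g (\<theta> s \<omega>)"
        unfolding disc_shift[OF g w True, symmetric] G_def k_def
        using True by (intro nn_integral_cong) (auto simp: indicator_def)
      then show "k s \<omega> * G s \<omega> = k s \<omega> * (indicator (alive ?T) \<omega> * (ennreal (exp (- \<alpha> * s)) * disc \<alpha> g (\<theta> (enn2real (?T \<omega>)) \<omega>)))"
        using al[OF w] True by simp
    qed
    also have "\<dots> = (\<integral>\<^sup>+\<omega>. k s \<omega> * (indicator (alive ?T) \<omega> * at_state (\<lambda>x. \<integral>\<^sup>+\<omega>'. ennreal (exp (- \<alpha> * s)) * disc \<alpha> g \<omega>' \<partial>P x) (Xat ?T \<omega>)) \<partial>P z)"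
      by (rule strong_markov_functional[OF stops_const km]) (use disc_measurable[OF g] in measurable)
    also have "\<dots> \<le> (\<integral>\<^sup>+\<omega>. k s \<omega> * C \<partial>P z)"
    proof (rule nn_integral_mono)
      fix \<omega> assume "\<omega> \<in> space (P z)"
      show "k s \<omega> * (indicator (alive ?T) \<omega> * at_state (\<lambda>x. \<integral>\<^sup>+\<omega>'. ennreal (exp (- \<alpha> * s)) * disc \<alpha> g \<omega>' \<partial>P x) (Xat ?T \<omega>)) \<le> k s \<omega> * C"
      proof (cases "X s \<omega>")
        case (Some x)
        show ?thesis
        proof (cases "g x = 0")
          case False
          have "(\<integral>\<^sup>+\<omega>'. ennreal (exp (- \<alpha> * s)) * disc \<alpha> g \<omega>' \<partial>P x) \<le> (\<integral>\<^sup>+\<omega>'. 1 * disc \<alpha> g \<omega>' \<partial>P x)"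
            using True \<alpha> by (intro nn_integral_mono mult_right_mono) auto
          also have "\<dots> \<le> C" using C[OF False] by simp
          finally have "(\<integral>\<^sup>+\<omega>'. ennreal (exp (- \<alpha> * s)) * disc \<alpha> g \<omega>' \<partial>P x) \<le> C" .
          then show ?thesis using Some by (intro mult_left_mono) (auto simp: Xs indicator_def)
        qed (use Some True in \<open>simp add: k_def\<close>)
      qed (use True in \<open>simp add: k_def\<close>)
    qed
    finally show ?thesis .
  qed (simp add: k_def)
  have "(\<integral>\<^sup>+\<omega>. disc \<alpha> g \<omega> * disc \<alpha> g \<omega> \<partial>P z) \<le> (\<integral>\<^sup>+\<omega>. 2 * (\<integral>\<^sup>+s. k s \<omega> * G s \<omega> \<partial>lborel) \<partial>P z)"
    using sq by (intro nn_integral_mono) auto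
  also have "\<dots> = 2 * (\<integral>\<^sup>+\<omega>. \<integral>\<^sup>+s. k s \<omega> * G s \<omega> \<partial>lborel \<partial>P z)"
    by (intro nn_integral_cmult lborel.borel_measurable_nn_integral) (simp add: case_prod_beta)
  also have "(\<integral>\<^sup>+\<omega>. \<integral>\<^sup>+s. k s \<omega> * G s \<omega> \<partial>lborel \<partial>P z) = (\<integral>\<^sup>+s. \<integral>\<^sup>+\<omega>. k s \<omega> * G s \<omega> \<partial>P z \<partial>lborel)"
    by (rule Fubini'[symmetric]) (simp add: case_prod_beta)
  finally have "(\<integral>\<^sup>+\<omega>. disc \<alpha> g \<omega> * disc \<alpha> g \<omega> \<partial>P z) \<le> 2 * (\<integral>\<^sup>+s. \<integral>\<^sup>+\<omega>. k s \<omega> * G s \<omega> \<partial>P z \<partial>lborel)" .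
  moreover have "(\<integral>\<^sup>+s. \<integral>\<^sup>+\<omega>. k s \<omega> * G s \<omega> \<partial>P z \<partial>lborel) \<le> (\<integral>\<^sup>+\<omega>. disc \<alpha> g \<omega> \<partial>P z) * C"
  proof -
  have "(\<integral>\<^sup>+s. \<integral>\<^sup>+\<omega>. k s \<omega> * G s \<omega> \<partial>P z \<partial>lborel) \<le> (\<integral>\<^sup>+s. \<integral>\<^sup>+\<omega>. k s \<omega> * C \<partial>P z \<partial>lborel)"
    by (intro nn_integral_mono Es)
  also have "\<dots> = (\<integral>\<^sup>+\<omega>. \<integral>\<^sup>+s. k s \<omega> * C \<partial>lborel \<partial>P z)"
    by (rule Fubini') (simp add: case_prod_beta)
  also have "\<dots> = (\<integral>\<^sup>+\<omega>. disc \<alpha> g \<omega> * C \<partial>P z)"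
    unfolding J by (intro nn_integral_cong nn_integral_multc) (use kr in auto)
  also have "\<dots> = (\<integral>\<^sup>+\<omega>. disc \<alpha> g \<omega> \<partial>P z) * C"
    by (intro nn_integral_multc measurable_F_P[OF disc_measurable[OF g]])
  finally show ?thesis .
  qed
  ultimately have "(\<integral>\<^sup>+\<omega>. disc \<alpha> g \<omega> * disc \<alpha> g \<omega> \<partial>P z) \<le> 2 * ((\<integral>\<^sup>+\<omega>. disc \<alpha> g \<omega> \<partial>P z) * C)"
    by (meson mult_left_mono order_trans zero_le)
  then show ?thesis by (simp only: mult_ac)
qed

lemma nn_integral_exp_tail:
  assumes "0 < \<alpha>"
  shows "(\<integral>\<^sup>+s. ennreal (\<alpha> * exp (- \<alpha> * s)) * indicator {r..} s \<partial>lborel) = ennreal (exp (- \<alpha> * r))"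
proof -
  have "(\<integral>\<^sup>+s. ennreal (\<alpha> * exp (- \<alpha> * s)) * indicator {r..} s \<partial>lborel) = ennreal (0 - - exp (- \<alpha> * r))"
  proof (rule nn_integral_FTC_atLeast)
    show "((\<lambda>s. - exp (- \<alpha> * s)) \<longlongrightarrow> 0) at_top" using assms by real_asymp
    fix x assume "r \<le> x"
    show "((\<lambda>s. - exp (- \<alpha> * s)) has_real_derivative \<alpha> * exp (- \<alpha> * x)) (at x)"
      by (auto intro!: derivative_eq_intros)
  qed (use assms in auto)
  then show ?thesis by simp
qed

text \<open>Write \<open>exp (- \<alpha> * r)\<close> as the mass beyond r of an exponential law of
  rate \<alpha>, then exchange: discounted occupation is occupation averaged over an independent
  exponential time.\<close>

lemma disc_eq_occ:
  assumes g: "g \<in> borel_measurable borel" and w: "\<omega> \<in> space W" and \<alpha>: "0 < \<alpha>"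
  shows "disc \<alpha> g \<omega> = (\<integral>\<^sup>+s. ennreal (\<alpha> * exp (- \<alpha> * s)) * indicator {0..} s * occ g s \<omega> \<partial>lborel)"
proof -
  define k where "k r = at_state g (if 0 \<le> r then X r \<omega> else None)" for r
  have [measurable]: "k \<in> borel_measurable borel" unfolding k_def[abs_def] by (rule path_measurable[OF g w])
  define h where "h r s = k r * (ennreal (\<alpha> * exp (- \<alpha> * s)) * (if 0 \<le> r \<and> r < s then 1 else 0))" for r s
  have h: "case_prod h \<in> borel_measurable (lborel \<Otimes>\<^sub>M lborel)" unfolding case_prod_beta h_def by measurable
  have "disc \<alpha> g \<omega> = (\<integral>\<^sup>+r. \<integral>\<^sup>+s. h r s \<partial>lborel \<partial>lborel)"
    unfolding disc_eq
  proof (rule nn_integral_cong)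
    fix r :: real
    show "at_state g (if 0 \<le> r then X r \<omega> else None) * (ennreal (exp (- \<alpha> * r)) * indicator {0..} r) = (\<integral>\<^sup>+s. h r s \<partial>lborel)"
    proof (cases "0 \<le> r")
      case True
      have "(\<integral>\<^sup>+s. h r s \<partial>lborel) = (\<integral>\<^sup>+s. k r * (ennreal (\<alpha> * exp (- \<alpha> * s)) * indicator {r..} s) \<partial>lborel)"
        using AE_lborel_singleton[of r] True
        by (intro nn_integral_cong_AE, elim AE_mp, intro AE_I2) (auto simp: h_def indicator_def)
      also have "\<dots> = k r * ennreal (exp (- \<alpha> * r))"
        using nn_integral_exp_tail[OF \<alpha>, of r] by (simp add: nn_integral_cmult)
      finally show ?thesis using True by (simp add: k_def)
    qed (simp add: h_def)
  qed
  also have "\<dots> = (\<integral>\<^sup>+s. \<integral>\<^sup>+r. h r s \<partial>lborel \<partial>lborel)"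
    by (rule lborel_pair.Fubini'[symmetric, OF h])
  also have "\<dots> = (\<integral>\<^sup>+s. ennreal (\<alpha> * exp (- \<alpha> * s)) * indicator {0..} s * occ g s \<omega> \<partial>lborel)"
  proof (rule nn_integral_cong)
    fix s :: real
    have "(\<integral>\<^sup>+r. h r s \<partial>lborel) = (\<integral>\<^sup>+r. ennreal (\<alpha> * exp (- \<alpha> * s)) * indicator {0..} s * (k r * indicator {0..<s} r) \<partial>lborel)"
      by (intro nn_integral_cong) (auto simp: h_def indicator_def mult_ac)
    also have "\<dots> = ennreal (\<alpha> * exp (- \<alpha> * s)) * indicator {0..} s * (\<integral>\<^sup>+r. k r * indicator {0..<s} r \<partial>lborel)"
      by (intro nn_integral_cmult) measurable
    also have "(\<integral>\<^sup>+r. k r * indicator {0..<s} r \<partial>lborel) = occ g s \<omega>"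
      unfolding occ_def by (intro nn_integral_cong) (auto simp: k_def indicator_def)
    finally show "(\<integral>\<^sup>+r. h r s \<partial>lborel) = ennreal (\<alpha> * exp (- \<alpha> * s)) * indicator {0..} s * occ g s \<omega>" .
  qed
  finally show ?thesis .
qed

lemma occ_le_disc:
  assumes g: "g \<in> borel_measurable borel" and w: "\<omega> \<in> space W" and b: "0 \<le> \<beta>"
  shows "occ g s \<omega> \<le> ennreal (exp (\<beta> * s)) * disc \<beta> g \<omega>"
proof -
  note [measurable] = path_measurable[OF g w]
  have "ennreal (exp (\<beta> * s)) * disc \<beta> g \<omega> = (\<integral>\<^sup>+r. ennreal (exp (\<beta> * s)) * (at_state g (if 0 \<le> r then X r \<omega> else None) * (ennreal (exp (- \<beta> * r)) * indicator {0..} r)) \<partial>lborel)"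
    unfolding disc_eq by (intro nn_integral_cmult[symmetric]) measurable
  moreover have "occ g s \<omega> \<le> \<dots>"
    unfolding occ_def
  proof (rule nn_integral_mono)
    fix r :: real
    show "at_state g (X r \<omega>) * indicator {0..<s} r \<le> ennreal (exp (\<beta> * s)) * (at_state g (if 0 \<le> r then X r \<omega> else None) * (ennreal (exp (- \<beta> * r)) * indicator {0..} r))"
    proof (cases "0 \<le> r \<and> r < s")
      case True
      have "\<beta> * r \<le> \<beta> * s" using True b by (intro mult_left_mono) auto
      then have "1 \<le> ennreal (exp (\<beta> * s) * exp (- \<beta> * r))"
        by (simp add: exp_add[symmetric])
      from mult_left_mono[OF this, of "at_state g (X r \<omega>)"] show ?thesis
        using True by (simp add: ennreal_mult mult_ac)
    qed auto
  qed
  ultimately show ?thesis by simp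
qed

end

text \<open>Fatou gives the lower bound. For the upper one,
  \<open>y \<le> min y K + y * y / K\<close> splits off a bounded part, which converges by
  domination, and a rest that the second moments control uniformly in n.\<close>

lemma (in finite_measure) nn_integral_tendsto_of_second_moment:
  fixes f :: "nat \<Rightarrow> 'a \<Rightarrow> ennreal"
  assumes f [measurable]: "\<And>n. f n \<in> borel_measurable M" and g [measurable]: "g \<in> borel_measurable M"
    and lim: "AE x in M. (\<lambda>n. f n x) \<longlonglongrightarrow> g x"
    and C: "\<forall>\<^sub>F n in sequentially. (\<integral>\<^sup>+x. f n x * f n x \<partial>M) \<le> ennreal C"
  shows "(\<lambda>n. \<integral>\<^sup>+x. f n x \<partial>M) \<longlonglongrightarrow> (\<integral>\<^sup>+x. g x \<partial>M)"
proof -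
  have "(\<integral>\<^sup>+x. g x \<partial>M) = (\<integral>\<^sup>+x. liminf (\<lambda>n. f n x) \<partial>M)"
    using lim by (intro nn_integral_cong_AE) (auto elim!: eventually_mono simp: lim_imp_Liminf)
  also have "\<dots> \<le> liminf (\<lambda>n. \<integral>\<^sup>+x. f n x \<partial>M)" by (rule nn_integral_liminf) measurable
  finally have low: "(\<integral>\<^sup>+x. g x \<partial>M) \<le> liminf (\<lambda>n. \<integral>\<^sup>+x. f n x \<partial>M)" .
  have up: "limsup (\<lambda>n. \<integral>\<^sup>+x. f n x \<partial>M) \<le> (\<integral>\<^sup>+x. g x \<partial>M) + ennreal (C / K)" if K: "0 < K" for K
  proof -
    have pt: "y \<le> min y (ennreal K) + ennreal (1 / K) * (y * y)" for y :: ennreal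
    proof (cases y)
      case (real r)
      show ?thesis
      proof (cases "r \<le> K")
        case True
        then show ?thesis using real by (simp add: min_absorb1 ennreal_leI)
      next
        case False
        then have "r \<le> 1 / K * (r * r)" using K mult_right_mono[of K r r] by (simp add: field_simps)
        then have "y \<le> ennreal (1 / K) * (y * y)"
          using real K by (simp add: ennreal_mult[symmetric] ennreal_leI)
        then show ?thesis by (rule add_increasing[OF zero_le])
      qed
    next
      case top
      then show ?thesis using K by (simp add: ennreal_mult_top)
    qed
    have "(\<lambda>n. \<integral>\<^sup>+x. min (f n x) (ennreal K) \<partial>M) \<longlonglongrightarrow> (\<integral>\<^sup>+x. min (g x) (ennreal K) \<partial>M)"
    proof (rule nn_integral_dominated_convergence[where w="\<lambda>_. ennreal K"])
      show "(\<integral>\<^sup>+x. ennreal K \<partial>M) < \<infinity>" 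
        using emeasure_finite[of "space M"] by (simp add: ennreal_mult_eq_top_iff less_top[symmetric])
      show "AE x in M. (\<lambda>n. min (f n x) (ennreal K)) \<longlonglongrightarrow> min (g x) (ennreal K)"
        using lim by eventually_elim (intro tendsto_min tendsto_const)
    qed auto
    then have "(\<lambda>n. (\<integral>\<^sup>+x. min (f n x) (ennreal K) \<partial>M) + ennreal (C / K)) \<longlonglongrightarrow> (\<integral>\<^sup>+x. min (g x) (ennreal K) \<partial>M) + ennreal (C / K)"
      by (intro tendsto_add tendsto_const)
    from lim_imp_Limsup[OF _ this]
    have 1: "limsup (\<lambda>n. (\<integral>\<^sup>+x. min (f n x) (ennreal K) \<partial>M) + ennreal (C / K)) = (\<integral>\<^sup>+x. min (g x) (ennreal K) \<partial>M) + ennreal (C / K)"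
      by simp
    have "limsup (\<lambda>n. \<integral>\<^sup>+x. f n x \<partial>M) \<le> limsup (\<lambda>n. (\<integral>\<^sup>+x. min (f n x) (ennreal K) \<partial>M) + ennreal (C / K))"
    proof (rule Limsup_mono)
      show "\<forall>\<^sub>F n in sequentially. (\<integral>\<^sup>+x. f n x \<partial>M) \<le> (\<integral>\<^sup>+x. min (f n x) (ennreal K) \<partial>M) + ennreal (C / K)"
        using C
      proof eventually_elim
        case (elim n)
        have "(\<integral>\<^sup>+x. f n x \<partial>M) \<le> (\<integral>\<^sup>+x. min (f n x) (ennreal K) + ennreal (1 / K) * (f n x * f n x) \<partial>M)"
          by (intro nn_integral_mono pt)
        also have "\<dots> = (\<integral>\<^sup>+x. min (f n x) (ennreal K) \<partial>M) + ennreal (1 / K) * (\<integral>\<^sup>+x. f n x * f n x \<partial>M)"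
          by (simp add: nn_integral_add nn_integral_cmult)
        also have "\<dots> \<le> (\<integral>\<^sup>+x. min (f n x) (ennreal K) \<partial>M) + ennreal (1 / K) * ennreal C"
          by (intro add_left_mono mult_left_mono elim) auto
        also have "ennreal (1 / K) * ennreal C = ennreal (C / K)" using K by (simp add: ennreal_mult'[symmetric])
        finally show ?case .
      qed
    qed
    also have "\<dots> \<le> (\<integral>\<^sup>+x. g x \<partial>M) + ennreal (C / K)"
      unfolding 1 by (intro add_right_mono nn_integral_mono) auto
    finally show ?thesis .
  qed
  have "limsup (\<lambda>n. \<integral>\<^sup>+x. f n x \<partial>M) \<le> (\<integral>\<^sup>+x. g x \<partial>M)"
  proof (rule ennreal_le_epsilon)
    fix e :: real assume e: "0 < e"
    \<comment> \<open>The truncation level \<open>(\<bar>C\<bar> + 1) / e\<close> is positive for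
      every real C and makes the rest at most e.\<close>
    have "ennreal (C / ((\<bar>C\<bar> + 1) / e)) \<le> ennreal e"
    proof (rule ennreal_leI)
      have "C * e \<le> e * (\<bar>C\<bar> + 1)" using e by (simp add: mult.commute[of C] mult_left_mono)
      then show "C / ((\<bar>C\<bar> + 1) / e) \<le> e" using e by (simp add: field_simps)
    qed
    then have "(\<integral>\<^sup>+x. g x \<partial>M) + ennreal (C / ((\<bar>C\<bar> + 1) / e)) \<le> (\<integral>\<^sup>+x. g x \<partial>M) + ennreal e"
      by (rule add_left_mono)
    then show "limsup (\<lambda>n. \<integral>\<^sup>+x. f n x \<partial>M) \<le> (\<integral>\<^sup>+x. g x \<partial>M) + ennreal e"
      using up[of "(\<bar>C\<bar> + 1) / e"] e by (auto intro: order_trans)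
  qed
  with low Liminf_le_Limsup[of sequentially "\<lambda>n. \<integral>\<^sup>+x. f n x \<partial>M"] show ?thesis
    by (intro Liminf_eq_Limsup) auto
qed

section \<open>Local times\<close>

locale local_time_process = symmetric_markov_process m p W X \<theta> P
  for m :: "'s::{metric_space, second_countable_topology} measure"
    and p :: "real \<Rightarrow> 's \<Rightarrow> 's \<Rightarrow> real"
    and W :: "'w measure"
    and X :: "real \<Rightarrow> 'w \<Rightarrow> 's option"
    and \<theta> :: "real \<Rightarrow> 'w \<Rightarrow> 'w"
    and P :: "'s \<Rightarrow> 'w measure" +
  fixes f :: "real \<Rightarrow> 's \<Rightarrow> 's \<Rightarrow> real"
  assumes pot_finite: "\<And>\<alpha> y z. 0 < \<alpha> \<Longrightarrow> potential_density p \<alpha> y z < \<infinity>"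
    and pot_cont: "\<And>\<alpha>. 0 < \<alpha> \<Longrightarrow> continuous_on UNIV (\<lambda>(y, z). enn2real (potential_density p \<alpha> y z))"
    and deltas: "approximate_deltas m f"
    and conv: "\<And>y z. AE \<omega> in P z. \<forall>K. uniform_limit {0..K}
           (\<lambda>\<epsilon> s. occupation f X \<epsilon> y s \<omega>) (\<lambda>s. local_time f X y s \<omega>) (at_right 0)"
begin

abbreviation u :: "real \<Rightarrow> 's \<Rightarrow> 's \<Rightarrow> ennreal" where "u \<equiv> potential_density p"

definition eps :: "nat \<Rightarrow> real" where "eps n = 1 / real (Suc n)"

definition fe :: "nat \<Rightarrow> 's \<Rightarrow> 's \<Rightarrow> ennreal" where "fe n y x = ennreal (f (eps n) y x)"

text \<open>Unlike \<^const>\<open>local_time\<close>, the lower limit along a fixed sequence is measurable without completion.\<close>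

definition ell :: "'s \<Rightarrow> real \<Rightarrow> 'w \<Rightarrow> ennreal" where
  "ell y t \<omega> = liminf (\<lambda>n. occ (fe n y) t \<omega>)"

definition LT :: "'s \<Rightarrow> real \<Rightarrow> 'w \<Rightarrow> real" where "LT y t \<omega> = enn2real (ell y t \<omega>)"

text \<open>Bundles the almost sure pathwise facts in a form that passes to shifted paths, so that
  the identities below hold exactly on such paths. The limit \<open>L\<close> is only asserted to
  exist here; \<open>goodD\<close> identifies it with \<open>LT\<close>.\<close>

definition good :: "'s \<Rightarrow> 'w \<Rightarrow> bool" where
  "good y \<omega> \<longleftrightarrow> \<omega> \<in> space W \<and> (\<exists>L :: real \<Rightarrow> real. (\<forall>K. continuous_on {0..K} L) \<and>
     (\<forall>s t. 0 \<le> s \<longrightarrow> s \<le> t \<longrightarrow> L s \<le> L t) \<and> L 0 = 0 \<and>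
     (\<forall>t\<ge>0. (\<lambda>n. occ (fe n y) t \<omega>) \<longlonglongrightarrow> ennreal (L t)))"

lemma eps_pos [simp]: "0 < eps n" by (simp add: eps_def)

lemma eps_lim: "filterlim eps (at_right 0) sequentially"
  unfolding eps_def by real_asymp

lemma eps_eventually: "0 < \<delta> \<Longrightarrow> \<forall>\<^sub>F n in sequentially. eps n < \<delta>"
  unfolding eps_def by real_asymp

lemma f_props:
  shows "f (eps n) y \<in> borel_measurable borel" "0 \<le> f (eps n) y x" "x \<notin> ball y (eps n) \<Longrightarrow> f (eps n) y x = 0"
    "(\<integral>\<^sup>+x. ennreal (f (eps n) y x) \<partial>m) = 1"
  using deltas unfolding approximate_deltas_def by (auto simp: measurable_m_iff)

lemma fe_measurable: "fe n y \<in> borel_measurable borel"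
  unfolding fe_def[abs_def] using f_props(1) by measurable

lemma fe_support: "fe n y x \<noteq> 0 \<Longrightarrow> x \<in> ball y (eps n)"
  using f_props(3) unfolding fe_def by force

lemma fe_integral: "(\<integral>\<^sup>+x. fe n y x \<partial>m) = 1"
  using f_props(4) by (simp add: fe_def)

section \<open>Symmetry and continuity of the potential densities\<close>

lemma u_sym: "u \<alpha> y z = u \<alpha> z y"
  unfolding potential_density_def
  by (intro nn_integral_cong) (auto simp: indicator_def p_symmetric[of _ y z])

lemma u_real: "0 < \<alpha> \<Longrightarrow> u \<alpha> y z = ennreal (enn2real (u \<alpha> y z))"
  using pot_finite[of \<alpha> y z] by simp

lemma u_near:
  assumes a: "0 < \<alpha>" and e: "0 < e"
  obtains \<delta> where "0 < \<delta>"
    "\<And>z y. dist z z0 < \<delta> \<Longrightarrow> dist y y0 < \<delta> \<Longrightarrow> \<bar>enn2real (u \<alpha> z y) - enn2real (u \<alpha> z0 y0)\<bar> < e"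
proof -
  let ?\<phi> = "\<lambda>(y, z). enn2real (u \<alpha> y z)"
  have "isCont ?\<phi> (z0, y0)" using pot_cont[OF a] by (simp add: continuous_on_eq_continuous_at)
  then obtain d where d: "d > 0" "\<And>v. dist v (z0, y0) < d \<Longrightarrow> dist (?\<phi> v) (?\<phi> (z0, y0)) < e"
    using e unfolding continuous_at_eps_delta by blast
  show thesis
  proof (rule that[of "d / 2"])
    fix z y assume "dist z z0 < d / 2" "dist y y0 < d / 2"
    then have "dist (z, y) (z0, y0) < d"
      unfolding dist_Pair_Pair by (intro le_less_trans[OF sqrt_sum_squares_le_sum]) auto
    from d(2)[OF this] show "\<bar>enn2real (u \<alpha> z y) - enn2real (u \<alpha> z0 y0)\<bar> < e"
      by (simp add: dist_real_def)
  qed (use d in auto)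
qed

lemma u_bound:
  assumes a: "0 < \<alpha>"
  obtains \<delta> C where "0 < \<delta>" "0 \<le> C" "\<And>z y. dist z z0 < \<delta> \<Longrightarrow> dist y y0 < \<delta> \<Longrightarrow> u \<alpha> z y \<le> ennreal C"
proof -
  obtain \<delta> where d: "0 < \<delta>" "\<And>z y. dist z z0 < \<delta> \<Longrightarrow> dist y y0 < \<delta> \<Longrightarrow> \<bar>enn2real (u \<alpha> z y) - enn2real (u \<alpha> z0 y0)\<bar> < 1"
    using u_near[OF a, of 1] by auto
  show thesis
  proof (rule that[OF d(1)])
    show "0 \<le> enn2real (u \<alpha> z0 y0) + 1" by simp
    fix z y assume "dist z z0 < \<delta>" "dist y y0 < \<delta>"
    from d(2)[OF this] show "u \<alpha> z y \<le> ennreal (enn2real (u \<alpha> z0 y0) + 1)"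
      by (subst u_real[OF a]) (intro ennreal_leI, auto)
  qed
qed

lemma u_lim:
  assumes a: "0 < \<alpha>"
  shows "(\<lambda>n. \<integral>\<^sup>+x. fe n y x * u \<alpha> z x \<partial>m) \<longlonglongrightarrow> u \<alpha> z y"
proof -
  let ?U = "enn2real (u \<alpha> z y)"
  have fm [measurable]: "fe n y \<in> borel_measurable m" for n using fe_measurable by (simp add: measurable_m_iff)
  have ev: "\<forall>\<^sub>F n in sequentially. ennreal (?U - e) \<le> (\<integral>\<^sup>+x. fe n y x * u \<alpha> z x \<partial>m)
      \<and> (\<integral>\<^sup>+x. fe n y x * u \<alpha> z x \<partial>m) \<le> ennreal (?U + e)" if e: "0 < e" for e
  proof -
    obtain \<delta> where d: "0 < \<delta>" "\<And>z' y'. dist z' z < \<delta> \<Longrightarrow> dist y' y < \<delta> \<Longrightarrow> \<bar>enn2real (u \<alpha> z' y') - ?U\<bar> < e"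
      using u_near[OF a e, of z y] by blast
    show ?thesis
      using eps_eventually[OF d(1)]
    proof eventually_elim
      case (elim n)
      have near: "ennreal (?U - e) \<le> u \<alpha> z x \<and> u \<alpha> z x \<le> ennreal (?U + e)" if "fe n y x \<noteq> 0" for x
      proof -
        have "dist x y < \<delta>" using fe_support[OF that] elim by (simp add: dist_commute)
        from d(2)[of z, OF _ this] d(1) show ?thesis
          by (subst (1 2) u_real[OF a]) (auto intro!: ennreal_leI simp del: ennreal_plus)
      qed
      have c: "(\<integral>\<^sup>+x. fe n y x * c \<partial>m) = c" for c
        using nn_integral_multc[OF fm, of n c] by (simp add: fe_integral)
      have "(\<integral>\<^sup>+x. fe n y x * ennreal (?U - e) \<partial>m) \<le> (\<integral>\<^sup>+x. fe n y x * u \<alpha> z x \<partial>m)"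
        using near by (intro nn_integral_mono) (metis mult_left_mono mult_zero_left order_refl zero_le)
      moreover have "(\<integral>\<^sup>+x. fe n y x * u \<alpha> z x \<partial>m) \<le> (\<integral>\<^sup>+x. fe n y x * ennreal (?U + e) \<partial>m)"
        using near by (intro nn_integral_mono) (metis mult_left_mono mult_zero_left order_refl zero_le)
      ultimately show ?case by (simp add: c)
    qed
  qed
  have fin: "\<forall>\<^sub>F n in sequentially. (\<integral>\<^sup>+x. fe n y x * u \<alpha> z x \<partial>m) = ennreal (enn2real (\<integral>\<^sup>+x. fe n y x * u \<alpha> z x \<partial>m))"
    using ev[of 1, OF zero_less_one]
  proof eventually_elim
    case (elim n)
    then have "(\<integral>\<^sup>+x. fe n y x * u \<alpha> z x \<partial>m) < \<top>" by (meson ennreal_less_top le_less_trans)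
    then show ?case by simp
  qed
  have "(\<lambda>n. enn2real (\<integral>\<^sup>+x. fe n y x * u \<alpha> z x \<partial>m)) \<longlonglongrightarrow> ?U"
  proof (rule tendstoI)
    fix e :: real assume e: "0 < e"
    have "\<forall>\<^sub>F n in sequentially. ennreal (?U - e / 2) \<le> (\<integral>\<^sup>+x. fe n y x * u \<alpha> z x \<partial>m)
      \<and> (\<integral>\<^sup>+x. fe n y x * u \<alpha> z x \<partial>m) \<le> ennreal (?U + e / 2)" using ev[of "e / 2"] e by simp
    then show "\<forall>\<^sub>F n in sequentially. dist (enn2real (\<integral>\<^sup>+x. fe n y x * u \<alpha> z x \<partial>m)) ?U < e"
      using fin
    proof eventually_elim
      case (elim n)
      define I where "I = enn2real (\<integral>\<^sup>+x. fe n y x * u \<alpha> z x \<partial>m)"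
      have I: "ennreal (?U - e / 2) \<le> ennreal I" "ennreal I \<le> ennreal (?U + e / 2)" "0 \<le> I"
        using elim by (auto simp: I_def simp del: ennreal_plus)
      then have "?U - e / 2 \<le> I" "I \<le> ?U + e / 2"
        using e by (auto simp: ennreal_le_iff2 simp del: ennreal_plus)
      then show ?case using e by (simp add: I_def[symmetric] dist_real_def)
    qed
  qed
  then have "(\<lambda>n. ennreal (enn2real (\<integral>\<^sup>+x. fe n y x * u \<alpha> z x \<partial>m))) \<longlonglongrightarrow> ennreal ?U" by (rule tendsto_ennrealI)
  then have "(\<lambda>n. \<integral>\<^sup>+x. fe n y x * u \<alpha> z x \<partial>m) \<longlonglongrightarrow> ennreal ?U"
    by (rule Lim_transform_eventually) (use fin in \<open>auto elim!: eventually_mono\<close>)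
  then show ?thesis using u_real[OF a, of z y] by simp
qed

lemma expectation_disc_fe: "(\<integral>\<^sup>+\<omega>. disc \<alpha> (fe n y) \<omega> \<partial>P z) = (\<integral>\<^sup>+x. fe n y x * u \<alpha> z x \<partial>m)"
  using expectation_disc[OF fe_measurable] by (simp add: fe_integral)

lemma disc_fe_le:
  assumes "0 < \<delta>" "\<And>x. dist x y < \<delta> \<Longrightarrow> u \<alpha> z x \<le> C" "eps n < \<delta>"
  shows "(\<integral>\<^sup>+\<omega>. disc \<alpha> (fe n y) \<omega> \<partial>P z) \<le> C"
proof -
  have [measurable]: "fe n y \<in> borel_measurable m" using fe_measurable by (simp add: measurable_m_iff)
  have "(\<integral>\<^sup>+x. fe n y x * u \<alpha> z x \<partial>m) \<le> (\<integral>\<^sup>+x. fe n y x * C \<partial>m)"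
  proof (rule nn_integral_mono)
    fix x
    show "fe n y x * u \<alpha> z x \<le> fe n y x * C"
    proof (cases "fe n y x = 0")
      case False
      from fe_support[OF this] have "dist x y < \<delta>" using assms(3) by (simp add: dist_commute)
      from assms(2)[OF this] show ?thesis by (rule mult_left_mono) simp
    qed simp
  qed
  also have "\<dots> = C" by (simp add: nn_integral_multc fe_integral)
  finally show ?thesis by (simp add: expectation_disc_fe)
qed

text \<open>The Bochner integral \<open>occupation\<close> is 0 where the integrand is not
  integrable, so it can be compared with \<open>occ\<close> only once finiteness is known.
  Discounted occupations of finite expectation give it for all t at once.\<close>

lemma AE_occ_finite: "AE \<omega> in P z. \<forall>\<^sub>F n in sequentially. \<forall>t. occ (fe n y) t \<omega> < \<infinity>"
proof -
  obtain \<delta> C where d: "0 < \<delta>" "0 \<le> C" "\<And>z' y'. dist z' z < \<delta> \<Longrightarrow> dist y' y < \<delta> \<Longrightarrow> u 1 z' y' \<le> ennreal C"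
    using u_bound[of 1 z y] by auto
  obtain n0 where n0: "\<And>n. n \<ge> n0 \<Longrightarrow> eps n < \<delta>"
    using eps_eventually[OF d(1)] unfolding eventually_sequentially by blast
  have "AE \<omega> in P z. \<forall>n\<ge>n0. disc 1 (fe n y) \<omega> \<noteq> \<infinity>"
    unfolding AE_all_countable
  proof (intro allI)
    fix n
    show "AE \<omega> in P z. n0 \<le> n \<longrightarrow> disc 1 (fe n y) \<omega> \<noteq> \<infinity>"
    proof (cases "n0 \<le> n")
      case True
      have "(\<integral>\<^sup>+\<omega>. disc 1 (fe n y) \<omega> \<partial>P z) \<le> ennreal C"
        by (rule disc_fe_le[OF d(1) _ n0[OF True]]) (use d in auto)
      then have "(\<integral>\<^sup>+\<omega>. disc 1 (fe n y) \<omega> \<partial>P z) \<noteq> \<infinity>" by (auto simp: top_unique)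
      from nn_integral_PInf_AE[OF measurable_F_P[OF disc_measurable[OF fe_measurable]] this]
      show ?thesis by eventually_elim auto
    qed simp
  qed
  then show ?thesis
    using AE_space
  proof eventually_elim
    case (elim \<omega>)
    then have w: "\<omega> \<in> space W" by simp
    have "occ (fe n y) t \<omega> < \<infinity>" if "n \<ge> n0" for n t
    proof -
      have "occ (fe n y) t \<omega> \<le> ennreal (exp (1 * t)) * disc 1 (fe n y) \<omega>"
        by (rule occ_le_disc[OF fe_measurable w]) simp
      also have "\<dots> < \<infinity>" using elim(1) that by (auto simp: ennreal_mult_eq_top_iff less_top[symmetric])
      finally show ?thesis .
    qed
    then show ?case unfolding eventually_sequentially by blast
  qed
qed

section \<open>Local times along almost every path\<close>

lemma occupation_eq:
  assumes w: "\<omega> \<in> space W" and fin: "occ (fe n y) t \<omega> < \<infinity>"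
  shows "set_integrable lborel {0..t} (\<lambda>r. cemetery_extend (f (eps n) y) (X r \<omega>))"
    and "occupation f X (eps n) y t \<omega> = enn2real (occ (fe n y) t \<omega>)"
proof -
  let ?h = "\<lambda>r. indicator {0..t} r *\<^sub>R cemetery_extend (f (eps n) y) (X r \<omega>)"
  have ce: "cemetery_extend (f (eps n) y) \<xi> = enn2real (at_state (fe n y) \<xi>)" for \<xi>
    by (cases \<xi>) (auto simp: cemetery_extend_def fe_def f_props(2))
  have ce2: "ennreal (cemetery_extend (f (eps n) y) \<xi>) = at_state (fe n y) \<xi>" for \<xi>
    by (cases \<xi>) (auto simp: cemetery_extend_def fe_def)
  have nn: "0 \<le> ?h r" for r by (simp add: ce)
  have m: "?h \<in> borel_measurable lborel"
  proof -
    have "(\<lambda>r. enn2real (at_state (fe n y) (X r \<omega>) * indicator {0..t} r)) \<in> borel_measurable borel"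
      using path_measurable_indicator[OF fe_measurable w, of "{0..t}" n y] by (intro measurable_compose[OF _ borel_measurable_enn2real]) auto
    moreover have "enn2real (at_state (fe n y) (X r \<omega>) * indicator {0..t} r) = ?h r" for r
      by (auto simp: ce indicator_def)
    ultimately show ?thesis by simp
  qed
  have I: "(\<integral>\<^sup>+r. ennreal (?h r) \<partial>lborel) = occ (fe n y) t \<omega>"
    unfolding occ_def
  proof (rule nn_integral_cong_AE)
    show "AE r in lborel. ennreal (?h r) = at_state (fe n y) (X r \<omega>) * indicator {0..<t} r"
      using AE_lborel_singleton[of t] by eventually_elim (auto simp: indicator_def ce2)
  qed
  show "set_integrable lborel {0..t} (\<lambda>r. cemetery_extend (f (eps n) y) (X r \<omega>))"
    unfolding set_integrable_def by (rule integrableI_nonneg[OF m]) (use nn I fin in auto)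
  show "occupation f X (eps n) y t \<omega> = enn2real (occ (fe n y) t \<omega>)"
    unfolding occupation_def set_lebesgue_integral_def I[symmetric]
    by (rule integral_eq_nn_integral[OF m]) (use nn in auto)
qed

lemma goodD:
  assumes "good y \<omega>"
  shows "\<omega> \<in> space W" and "0 \<le> t \<Longrightarrow> ell y t \<omega> = ennreal (LT y t \<omega>)"
    and "0 \<le> t \<Longrightarrow> (\<lambda>n. occ (fe n y) t \<omega>) \<longlonglongrightarrow> ennreal (LT y t \<omega>)"
    and "continuous_on {0..K} (\<lambda>t. LT y t \<omega>)" and "0 \<le> s \<Longrightarrow> s \<le> t \<Longrightarrow> LT y s \<omega> \<le> LT y t \<omega>"
    and "LT y 0 \<omega> = 0" and "0 \<le> LT y t \<omega>"
proof -
  obtain L where L: "\<And>K. continuous_on {0..K} L" "\<And>s t. 0 \<le> s \<Longrightarrow> s \<le> t \<Longrightarrow> L s \<le> L t" "L 0 = 0"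
    "\<And>t. 0 \<le> t \<Longrightarrow> (\<lambda>n. occ (fe n y) t \<omega>) \<longlonglongrightarrow> ennreal (L t)" and w: "\<omega> \<in> space W"
    using assms unfolding good_def by blast
  have nn: "0 \<le> L t" if "0 \<le> t" for t using L(2)[of 0 t] L(3) that by simp
  have e: "ell y t \<omega> = ennreal (L t)" if "0 \<le> t" for t
    unfolding ell_def using L(4)[OF that] by (rule lim_imp_Liminf[rotated]) simp
  have LT: "LT y t \<omega> = L t" if "0 \<le> t" for t using e[OF that] nn[OF that] by (simp add: LT_def)
  show "\<omega> \<in> space W" by (rule w)
  show "0 \<le> t \<Longrightarrow> ell y t \<omega> = ennreal (LT y t \<omega>)" using e LT by simp
  show "0 \<le> t \<Longrightarrow> (\<lambda>n. occ (fe n y) t \<omega>) \<longlonglongrightarrow> ennreal (LT y t \<omega>)" using L(4) LT by simp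
  show "continuous_on {0..K} (\<lambda>t. LT y t \<omega>)" by (rule continuous_on_eq[OF L(1)]) (simp add: LT)
  show "0 \<le> s \<Longrightarrow> s \<le> t \<Longrightarrow> LT y s \<omega> \<le> LT y t \<omega>" using L(2) LT by simp
  show "LT y 0 \<omega> = 0" using LT L(3) by simp
  show "0 \<le> LT y t \<omega>" by (simp add: LT_def)
qed

lemma goodI:
  assumes "\<omega> \<in> space W" "\<And>K. continuous_on {0..K} L" "\<And>s t. 0 \<le> s \<Longrightarrow> s \<le> t \<Longrightarrow> L s \<le> L t" "L 0 = 0"
    "\<And>t. 0 \<le> t \<Longrightarrow> (\<lambda>n. occ (fe n y) t \<omega>) \<longlonglongrightarrow> ennreal (L t)"
  shows "good y \<omega>" and "0 \<le> t \<Longrightarrow> LT y t \<omega> = (L t :: real)"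
proof -
  show "good y \<omega>" unfolding good_def using assms by blast
  show "LT y t \<omega> = L t" if "0 \<le> t"
  proof -
    have "ell y t \<omega> = ennreal (L t)"
      unfolding ell_def using assms(5)[OF that] by (rule lim_imp_Liminf[rotated]) simp
    moreover have "0 \<le> L t" using assms(3)[of 0 t] assms(4) that by simp
    ultimately show ?thesis by (simp add: LT_def)
  qed
qed

text \<open>Each \<open>occupation\<close> is an indefinite integral, hence continuous in time, and
  the locally uniform limit inherits this. Monotonicity and the value at time 0 come from pointwise
  convergence.\<close>

lemma AE_good: "AE \<omega> in P z. good y \<omega> \<and> (\<forall>t\<ge>0. local_time f X y t \<omega> = LT y t \<omega>)"
  using conv[of y z] AE_occ_finite[of y z] AE_space[of "P z"]
proof eventually_elim
  case (elim \<omega>)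
  then have w: "\<omega> \<in> space W" by simp
  obtain n0 where n0: "\<And>n t. n \<ge> n0 \<Longrightarrow> occ (fe n y) t \<omega> < \<infinity>"
    using elim(2) unfolding eventually_sequentially by blast
  let ?L = "\<lambda>t. local_time f X y t \<omega>"
  have ul: "uniform_limit {0..K} (\<lambda>n s. occupation f X (eps n) y s \<omega>) ?L sequentially" for K
    using filterlim_compose[OF elim(1)[rule_format, of K] eps_lim] .
  have cont: "continuous_on {0..K} ?L" for K
  proof (rule uniform_limit_theorem[OF _ ul])
    have "continuous_on {0..K} (\<lambda>s. occupation f X (eps n) y s \<omega>)" if "n \<ge> n0" for n
    proof -
      let ?h = "\<lambda>r. cemetery_extend (f (eps n) y) (X r \<omega>)"
      have "occupation f X (eps n) y s \<omega> = integral {0..s} ?h" for s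
        unfolding occupation_def by (rule set_borel_integral_eq_integral(2)[OF occupation_eq(1)[OF w n0[OF that]]])
      moreover have "continuous_on {0..K} (\<lambda>s. integral {0..s} ?h)"
        by (intro indefinite_integral_continuous_1 set_borel_integral_eq_integral(1)[OF occupation_eq(1)[OF w n0[OF that]]])
      ultimately show ?thesis by simp
    qed
    then show "\<forall>\<^sub>F n in sequentially. continuous_on {0..K} (\<lambda>s. occupation f X (eps n) y s \<omega>)"
      unfolding eventually_sequentially by blast
  qed simp
  have lim: "(\<lambda>n. occupation f X (eps n) y t \<omega>) \<longlonglongrightarrow> ?L t" if "0 \<le> t" for t
    by (rule tendsto_uniform_limitI[OF ul[of t]]) (use that in auto)
  have ev: "\<forall>\<^sub>F n in sequentially. occ (fe n y) t \<omega> = ennreal (occupation f X (eps n) y t \<omega>)" for t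
  proof -
    have "occ (fe n y) t \<omega> = ennreal (occupation f X (eps n) y t \<omega>)" if "n \<ge> n0" for n
      using occupation_eq(2)[OF w n0[OF that]] n0[OF that, of t] by simp
    then show ?thesis unfolding eventually_sequentially by blast
  qed
  have lim2: "(\<lambda>n. occ (fe n y) t \<omega>) \<longlonglongrightarrow> ennreal (?L t)" if "0 \<le> t" for t
    by (rule Lim_transform_eventually[OF tendsto_ennrealI[OF lim[OF that]] eventually_mono[OF ev[of t]]]) simp
  have mono: "?L s \<le> ?L t" if "0 \<le> s" "s \<le> t" for s t
  proof (rule LIMSEQ_le[OF lim lim])
    have "occupation f X (eps n) y s \<omega> \<le> occupation f X (eps n) y t \<omega>" if "n \<ge> n0" for n
      unfolding occupation_eq(2)[OF w n0[OF that]]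
      using n0[OF that, of t] occ_mono[OF \<open>s \<le> t\<close>, of "fe n y" \<omega>] by (intro enn2real_mono) auto
    then show "\<exists>N. \<forall>n\<ge>N. occupation f X (eps n) y s \<omega> \<le> occupation f X (eps n) y t \<omega>" by blast
  qed (use that in auto)
  have zero: "?L 0 = 0"
  proof (rule LIMSEQ_unique[OF lim])
    have "occ (fe n y) 0 \<omega> = 0" for n by (simp add: occ_def)
    then have "occupation f X (eps n) y 0 \<omega> = 0" for n using occupation_eq(2)[OF w, of n y 0] by simp
    then show "(\<lambda>n. occupation f X (eps n) y 0 \<omega>) \<longlonglongrightarrow> 0" by simp
  qed simp
  show ?case using goodI[OF w cont mono zero lim2] by auto
qed

text \<open>Additivity of occupation passes to the limit. It is used as a difference, which is
  legitimate in the extended reals because the occupation up to s is eventually finite.\<close>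

lemma good_shift:
  assumes g: "good y \<omega>" and s: "0 \<le> s"
  shows "good y (\<theta> s \<omega>)" and "0 \<le> t \<Longrightarrow> LT y (s + t) \<omega> = LT y s \<omega> + LT y t (\<theta> s \<omega>)"
proof -
  let ?L = "\<lambda>t. LT y (s + t) \<omega> - LT y s \<omega>"
  have w: "\<omega> \<in> space W" using goodD(1)[OF g] .
  have 1: "\<theta> s \<omega> \<in> space W" using shift[OF s w] by simp
  have 2: "continuous_on {0..K} ?L" for K
    by (intro continuous_intros continuous_on_compose2[OF goodD(4)[OF g, of "s + K"]]) (use s in auto)
  have 5: "(\<lambda>n. occ (fe n y) t (\<theta> s \<omega>)) \<longlonglongrightarrow> ennreal (?L t)" if t: "0 \<le> t" for t
  proof -
    have "(\<lambda>n. occ (fe n y) (s + t) \<omega> - occ (fe n y) s \<omega>) \<longlonglongrightarrow> ennreal (LT y (s + t) \<omega>) - ennreal (LT y s \<omega>)"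
      using s t by (intro tendsto_diff_ennreal goodD(3)[OF g]) auto
    moreover have "ennreal (LT y (s + t) \<omega>) - ennreal (LT y s \<omega>) = ennreal (?L t)"
      using goodD(7)[OF g] by (simp add: ennreal_minus)
    moreover have "\<forall>\<^sub>F n in sequentially. occ (fe n y) s \<omega> < \<top>"
      using goodD(3)[OF g s] by (rule order_tendstoD) simp
    then have "\<forall>\<^sub>F n in sequentially. occ (fe n y) (s + t) \<omega> - occ (fe n y) s \<omega> = occ (fe n y) t (\<theta> s \<omega>)"
    proof eventually_elim
      case (elim n)
      then show ?case by (simp add: occ_add[OF fe_measurable w s t] less_top)
    qed
    ultimately show ?thesis by (auto intro: Lim_transform_eventually)
  qed
  have 3: "?L t \<le> ?L t'" if "0 \<le> t" "t \<le> t'" for t t' using goodD(5)[OF g, of "s + t" "s + t'"] that s by simp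
  note * = goodI[OF 1 2 3 _ 5]
  show "good y (\<theta> s \<omega>)" by (rule *(1)) auto
  show "LT y (s + t) \<omega> = LT y s \<omega> + LT y t (\<theta> s \<omega>)" if t: "0 \<le> t"
    using *(2)[of t] t by simp
qed

text \<open>Otherwise right continuity keeps the path off a ball around y during some
  \<open>[s, s + \<delta>)\<close>; the occupation of smaller balls does not change there, hence
  neither does its limit.\<close>

lemma growth_point:
  assumes g: "good y \<omega>" and s: "0 \<le> s" and inc: "\<And>\<delta>. 0 < \<delta> \<Longrightarrow> LT y s \<omega> < LT y (s + \<delta>) \<omega>"
  shows "X s \<omega> = Some y"
proof (rule ccontr)
  assume ne: "X s \<omega> \<noteq> Some y"
  have w: "\<omega> \<in> space W" using goodD(1)[OF g] .
  obtain e \<delta> where e: "0 < e" "0 < \<delta>" "\<And>r. s \<le> r \<Longrightarrow> r < s + \<delta> \<Longrightarrow> X r \<omega> \<notin> Some ` ball y e"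
  proof (cases "X s \<omega>")
    case None
    then have "X r \<omega> = None" if "s \<le> r" for r using cemetery[of s r \<omega>] s w that by simp
    then show thesis using that[of 1 1] by auto
  next
    case (Some x)
    then have xy: "0 < dist y x" using ne by auto
    let ?e = "dist y x / 2"
    have "x \<in> - cball y ?e" using xy by simp
    then obtain \<delta> where d: "\<delta> > 0" "\<And>r. s < r \<Longrightarrow> r < s + \<delta> \<Longrightarrow> X r \<omega> \<in> Some ` (- cball y ?e)"
      using eventually_in_open[OF s w Some, of "- cball y ?e"] by (metis closed_cball open_Compl)
    have "X r \<omega> \<notin> Some ` ball y ?e" if "s \<le> r" "r < s + \<delta>" for r
    proof (cases "r = s")
      case True
      then show ?thesis using Some xy by auto
    next
      case False
      then show ?thesis using d(2)[of r] that by force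
    qed
    then show thesis using that[of ?e \<delta>] xy d by auto
  qed
  have "\<forall>\<^sub>F n in sequentially. occ (fe n y) (s + \<delta>) \<omega> = occ (fe n y) s \<omega>"
    using eps_eventually[OF e(1)]
  proof eventually_elim
    case (elim n)
    show ?case unfolding occ_def
    proof (rule nn_integral_cong)
      fix r
      have "at_state (fe n y) (X r \<omega>) = 0" if "s \<le> r" "r < s + \<delta>"
      proof (cases "X r \<omega>")
        case (Some x)
        then have "x \<notin> ball y e" using e(3)[OF that] by auto
        then show ?thesis using fe_support[of n y x] elim Some by force
      qed simp
      then show "at_state (fe n y) (X r \<omega>) * indicator {0..<s + \<delta>} r = at_state (fe n y) (X r \<omega>) * indicator {0..<s} r"
        using e(2) s by (auto simp: indicator_def)
    qed
  qed
  moreover have "(\<lambda>n. occ (fe n y) (s + \<delta>) \<omega>) \<longlonglongrightarrow> ennreal (LT y (s + \<delta>) \<omega>)"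
    using goodD(3)[OF g, of "s + \<delta>"] s e by simp
  ultimately have "(\<lambda>n. occ (fe n y) s \<omega>) \<longlonglongrightarrow> ennreal (LT y (s + \<delta>) \<omega>)"
    by (rule Lim_transform_eventually[rotated])
  then have "ennreal (LT y (s + \<delta>) \<omega>) = ennreal (LT y s \<omega>)"
    using goodD(3)[OF g s] LIMSEQ_unique by blast
  then show False using inc[OF e(2)] goodD(7)[OF g] by simp
qed

lemma ell_progressive:
  "(\<lambda>x. if 0 \<le> fst x \<and> ennreal (fst x) < v then ell y (fst x) (snd x) else 0) \<in> borel_measurable (borel \<Otimes>\<^sub>M F v)"
proof -
  have "(\<lambda>x. liminf (\<lambda>n. if 0 \<le> fst x \<and> ennreal (fst x) < v then occ (fe n y) (fst x) (snd x) else 0)) \<in> borel_measurable (borel \<Otimes>\<^sub>M F v)"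
    by (intro borel_measurable_liminf occ_progressive fe_measurable)
  moreover have "liminf (\<lambda>n. if 0 \<le> fst x \<and> ennreal (fst x) < v then occ (fe n y) (fst x) (snd x) else 0)
    = (if 0 \<le> fst x \<and> ennreal (fst x) < v then ell y (fst x) (snd x) else 0)" for x
    by (auto simp: ell_def Liminf_const)
  ultimately show ?thesis by simp
qed

lemma ell_measurable_F: "ennreal t \<le> v \<Longrightarrow> ell y t \<in> borel_measurable (F v)"
  unfolding ell_def[abs_def] by (intro borel_measurable_liminf occ_measurable_F fe_measurable)

text \<open>The two sides are the limits of the two expressions for the expected discounted occupation of
  small balls. Second moments make these occupations uniformly integrable.\<close>

lemma expected_discounted_local_time:
  assumes a: "0 < \<alpha>"
  shows "(\<integral>\<^sup>+\<omega>. \<integral>\<^sup>+s. ennreal (\<alpha> * exp (- \<alpha> * s)) * indicator {0..} s * ell y s \<omega> \<partial>lborel \<partial>P z) = u \<alpha> z y"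
proof -
  interpret Pz: prob_space "P z" by (rule prob_space_P)
  define k where "k s = ennreal (\<alpha> * exp (- \<alpha> * s)) * indicator {0..} s" for s :: real
  have [measurable]: "k \<in> borel_measurable borel" unfolding k_def by measurable
  \<comment> \<open>\<open>E\<close> is the law of an exponential time of rate \<alpha>. Together
    with the path it gives a product probability space, on which both integrals are single
    expectations.\<close>
  define E where "E = density lborel k"
  have "prob_space E"
  proof
    show "emeasure E (space E) = 1"
      unfolding E_def using nn_integral_exp_tail[OF a, of 0] by (simp add: emeasure_density k_def cong: nn_integral_cong)
  qed
  then interpret E: prob_space E .
  interpret Q: pair_prob_space "P z" E ..
  define h where "h n x = (if 0 \<le> snd x then occ (fe n y) (snd x) (fst x) else 0)" for n x
  define l where "l x = (if 0 \<le> snd x then ell y (snd x) (fst x) else 0)" for x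
  have sE: "sets (P z \<Otimes>\<^sub>M E) = sets (P z \<Otimes>\<^sub>M borel)" unfolding E_def by (intro sets_pair_measure_cong) auto
  have mE: "g \<in> borel_measurable (F \<top> \<Otimes>\<^sub>M borel) \<Longrightarrow> g \<in> borel_measurable (P z \<Otimes>\<^sub>M E)" for g :: "'w \<times> real \<Rightarrow> ennreal"
    using measurable_F_P_pair[of g borel borel z] measurable_cong_sets[OF sE refl, of "borel :: ennreal measure"] by blast
  have swap: "(\<lambda>x. (snd x, fst x)) \<in> measurable (F \<top> \<Otimes>\<^sub>M borel) (borel \<Otimes>\<^sub>M F \<top>)" by measurable
  have hF: "h n \<in> borel_measurable (F \<top> \<Otimes>\<^sub>M borel)" for n
    using measurable_compose[OF swap occ_progressive[OF fe_measurable[of n y], of \<top>]] unfolding h_def[abs_def]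
    by (simp only: fst_conv snd_conv ennreal_less_top simp_thms)
  have lF: "l \<in> borel_measurable (F \<top> \<Otimes>\<^sub>M borel)"
    using measurable_compose[OF swap ell_progressive[of \<top> y]] unfolding l_def[abs_def]
    by (simp only: fst_conv snd_conv ennreal_less_top simp_thms)
  note hm [measurable] = mE[OF hF] and lm [measurable] = mE[OF lF]
  have nnE: "(\<integral>\<^sup>+x. g x \<partial>(P z \<Otimes>\<^sub>M E)) = (\<integral>\<^sup>+\<omega>. \<integral>\<^sup>+s. k s * g (\<omega>, s) \<partial>lborel \<partial>P z)"
    if g: "g \<in> borel_measurable (F \<top> \<Otimes>\<^sub>M borel)" for g
  proof -
    have "(\<integral>\<^sup>+x. g x \<partial>(P z \<Otimes>\<^sub>M E)) = (\<integral>\<^sup>+\<omega>. \<integral>\<^sup>+s. g (\<omega>, s) \<partial>E \<partial>P z)"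
      by (rule E.nn_integral_fst[OF mE[OF g], symmetric])
    also have "\<dots> = (\<integral>\<^sup>+\<omega>. \<integral>\<^sup>+s. k s * g (\<omega>, s) \<partial>lborel \<partial>P z)"
    proof (rule nn_integral_cong)
      fix \<omega> assume "\<omega> \<in> space (P z)"
      then have "(\<lambda>s. (\<omega>, s)) \<in> measurable borel (F \<top> \<Otimes>\<^sub>M borel)" by (intro measurable_Pair) auto
      from measurable_compose[OF this g] show "(\<integral>\<^sup>+s. g (\<omega>, s) \<partial>E) = (\<integral>\<^sup>+s. k s * g (\<omega>, s) \<partial>lborel)"
        unfolding E_def by (intro nn_integral_density) auto
    qed
    finally show ?thesis .
  qed
  have k0: "k s = 0" if "s < 0" for s using that by (simp add: k_def)
  have hI: "(\<integral>\<^sup>+x. h n x \<partial>(P z \<Otimes>\<^sub>M E)) = (\<integral>\<^sup>+x. fe n y x * u \<alpha> z x \<partial>m)" for n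
  proof -
    have "(\<integral>\<^sup>+x. h n x \<partial>(P z \<Otimes>\<^sub>M E)) = (\<integral>\<^sup>+\<omega>. disc \<alpha> (fe n y) \<omega> \<partial>P z)"
      unfolding nnE[OF hF]
    proof (rule nn_integral_cong)
      fix \<omega> assume "\<omega> \<in> space (P z)"
      then have w: "\<omega> \<in> space W" by simp
      show "(\<integral>\<^sup>+s. k s * h n (\<omega>, s) \<partial>lborel) = disc \<alpha> (fe n y) \<omega>"
        unfolding disc_eq_occ[OF fe_measurable w a] by (intro nn_integral_cong) (auto simp: h_def k_def)
    qed
    then show ?thesis by (simp add: expectation_disc_fe)
  qed
  have lI: "(\<integral>\<^sup>+x. l x \<partial>(P z \<Otimes>\<^sub>M E)) = (\<integral>\<^sup>+\<omega>. \<integral>\<^sup>+s. ennreal (\<alpha> * exp (- \<alpha> * s)) * indicator {0..} s * ell y s \<omega> \<partial>lborel \<partial>P z)"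
    unfolding nnE[OF lF] by (intro nn_integral_cong) (auto simp: l_def k_def indicator_def)
  have lim: "AE x in (P z \<Otimes>\<^sub>M E). (\<lambda>n. h n x) \<longlonglongrightarrow> l x"
  proof -
    \<comment> \<open>Almost sure convergence on the product is phrased by lower and upper limits,
      which make the set of convergence measurable.\<close>
    have "AE x in (P z \<Otimes>\<^sub>M E). liminf (\<lambda>n. h n x) = l x \<and> limsup (\<lambda>n. h n x) = l x"
    proof (rule Q.AE_pair_measure)
      show "{x \<in> space (P z \<Otimes>\<^sub>M E). liminf (\<lambda>n. h n x) = l x \<and> limsup (\<lambda>n. h n x) = l x} \<in> sets (P z \<Otimes>\<^sub>M E)"
        by measurable
      show "AE \<omega> in P z. AE s in E. liminf (\<lambda>n. h n (\<omega>, s)) = l (\<omega>, s) \<and> limsup (\<lambda>n. h n (\<omega>, s)) = l (\<omega>, s)"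
        using AE_good[of y z]
      proof eventually_elim
        case (elim \<omega>)
        then have g: "good y \<omega>" by simp
        have "(\<lambda>n. h n (\<omega>, s)) \<longlonglongrightarrow> l (\<omega>, s)" for s
          using goodD(2,3)[OF g, of s] by (cases "0 \<le> s") (auto simp: h_def l_def)
        then have "liminf (\<lambda>n. h n (\<omega>, s)) = l (\<omega>, s) \<and> limsup (\<lambda>n. h n (\<omega>, s)) = l (\<omega>, s)" for s
          using lim_imp_Liminf[OF trivial_limit_sequentially, of "\<lambda>n. h n (\<omega>, s)"]
            lim_imp_Limsup[OF trivial_limit_sequentially, of "\<lambda>n. h n (\<omega>, s)"] by blast
        then show ?case by simp
      qed
    qed
    then show ?thesis by eventually_elim (intro Liminf_eq_Limsup, auto)
  qed
  have bd: "\<exists>C. \<forall>\<^sub>F n in sequentially. (\<integral>\<^sup>+x. h n x * h n x \<partial>(P z \<Otimes>\<^sub>M E)) \<le> ennreal C"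
  proof -
    \<comment> \<open>Bounding the occupation up to s by \<open>exp (\<beta> * s)\<close> times the
      \<beta>-discounted one costs \<open>exp (2 * \<beta> * s)\<close> in the square. With
      \<open>\<beta> = \<alpha> / 4\<close> an exponential density of rate
      \<open>\<alpha> / 2\<close> is left, up to a factor 2.\<close>
    define \<beta> where "\<beta> = \<alpha> / 4"
    have b: "0 < \<beta>" using a by (simp add: \<beta>_def)
    obtain \<delta>1 C1 where d1: "0 < \<delta>1" "0 \<le> C1" "\<And>z' y'. dist z' z < \<delta>1 \<Longrightarrow> dist y' y < \<delta>1 \<Longrightarrow> u \<beta> z' y' \<le> ennreal C1"
      using u_bound[OF b, of z y] by blast
    obtain \<delta>2 C2 where d2: "0 < \<delta>2" "0 \<le> C2" "\<And>z' y'. dist z' y < \<delta>2 \<Longrightarrow> dist y' y < \<delta>2 \<Longrightarrow> u \<beta> z' y' \<le> ennreal C2"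
      using u_bound[OF b, of y y] by blast
    have "\<forall>\<^sub>F n in sequentially. eps n < min \<delta>1 \<delta>2" using d1 d2 by (intro eps_eventually) auto
    then have "\<forall>\<^sub>F n in sequentially. (\<integral>\<^sup>+x. h n x * h n x \<partial>(P z \<Otimes>\<^sub>M E)) \<le> ennreal (2 * (2 * C2 * C1))"
    proof eventually_elim
      case (elim n)
      have D1: "(\<integral>\<^sup>+\<omega>. disc \<beta> (fe n y) \<omega> \<partial>P z) \<le> ennreal C1"
        by (rule disc_fe_le[OF d1(1)]) (use d1 elim in auto)
      have D2: "(\<integral>\<^sup>+\<omega>. disc \<beta> (fe n y) \<omega> \<partial>P x) \<le> ennreal C2" if "fe n y x \<noteq> 0" for x
        using fe_support[OF that] elim by (intro disc_fe_le[OF d2(1)] d2(3)) (auto simp: dist_commute)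
      have dm: "disc \<beta> (fe n y) \<in> borel_measurable (P z)" by (rule measurable_F_P[OF disc_measurable[OF fe_measurable]])
      have "(\<lambda>x. h n x * h n x) \<in> borel_measurable (F \<top> \<Otimes>\<^sub>M borel)" using hF[of n] by measurable
      from nnE[OF this] have "(\<integral>\<^sup>+x. h n x * h n x \<partial>(P z \<Otimes>\<^sub>M E)) = (\<integral>\<^sup>+\<omega>. \<integral>\<^sup>+s. k s * (h n (\<omega>, s) * h n (\<omega>, s)) \<partial>lborel \<partial>P z)" .
      also have "\<dots> \<le> (\<integral>\<^sup>+\<omega>. 2 * (disc \<beta> (fe n y) \<omega> * disc \<beta> (fe n y) \<omega>) \<partial>P z)"
      proof (rule nn_integral_mono)
        fix \<omega> assume "\<omega> \<in> space (P z)"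
        then have w: "\<omega> \<in> space W" by simp
        let ?J = "disc \<beta> (fe n y) \<omega>"
        have "k s * (h n (\<omega>, s) * h n (\<omega>, s)) \<le> 2 * (ennreal (\<alpha> / 2 * exp (- (\<alpha> / 2) * s)) * indicator {0..} s) * (?J * ?J)" for s
        proof (cases "0 \<le> s")
          case True
          have "h n (\<omega>, s) \<le> ennreal (exp (\<beta> * s)) * ?J"
            using True b by (simp add: h_def occ_le_disc[OF fe_measurable w])
          then have "k s * (h n (\<omega>, s) * h n (\<omega>, s)) \<le> k s * ((ennreal (exp (\<beta> * s)) * ?J) * (ennreal (exp (\<beta> * s)) * ?J))"
            by (intro mult_left_mono mult_mono) auto
          also have "\<dots> = ennreal (\<alpha> * exp (- \<alpha> * s) * (exp (\<beta> * s) * exp (\<beta> * s))) * (?J * ?J)"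
            using True a by (simp add: k_def ennreal_mult mult_ac)
          also have "\<alpha> * exp (- \<alpha> * s) * (exp (\<beta> * s) * exp (\<beta> * s)) = 2 * (\<alpha> / 2 * exp (- (\<alpha> / 2) * s))"
            by (simp add: \<beta>_def exp_add[symmetric])
          also have "ennreal \<dots> = 2 * ennreal (\<alpha> / 2 * exp (- (\<alpha> / 2) * s))"
            using ennreal_mult'[of 2 "\<alpha> / 2 * exp (- (\<alpha> / 2) * s)"] by simp
          finally show ?thesis using True by simp
        qed (simp add: k0)
        then have "(\<integral>\<^sup>+s. k s * (h n (\<omega>, s) * h n (\<omega>, s)) \<partial>lborel)
          \<le> (\<integral>\<^sup>+s. 2 * (ennreal (\<alpha> / 2 * exp (- (\<alpha> / 2) * s)) * indicator {0..} s) * (?J * ?J) \<partial>lborel)"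
          by (intro nn_integral_mono)
        also have "\<dots> = 2 * (\<integral>\<^sup>+s. ennreal (\<alpha> / 2 * exp (- (\<alpha> / 2) * s)) * indicator {0..} s \<partial>lborel) * (?J * ?J)"
          by (subst nn_integral_multc) (auto simp: nn_integral_cmult)
        also have "\<dots> = 2 * (?J * ?J)"
          using nn_integral_exp_tail[of "\<alpha> / 2" 0] a by simp
        finally show "(\<integral>\<^sup>+s. k s * (h n (\<omega>, s) * h n (\<omega>, s)) \<partial>lborel) \<le> 2 * (?J * ?J)" .
      qed
      also have "\<dots> = 2 * (\<integral>\<^sup>+\<omega>. disc \<beta> (fe n y) \<omega> * disc \<beta> (fe n y) \<omega> \<partial>P z)"
        using dm by (intro nn_integral_cmult) measurable
      also have "\<dots> \<le> 2 * (2 * ennreal C2 * (\<integral>\<^sup>+\<omega>. disc \<beta> (fe n y) \<omega> \<partial>P z))"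
        using b by (intro mult_left_mono disc_second_moment[OF fe_measurable D2]) auto
      also have "\<dots> \<le> 2 * (2 * ennreal C2 * ennreal C1)"
        by (intro mult_left_mono D1) auto
      also have "\<dots> = ennreal (2 * (2 * C2 * C1))"
        using d1 d2 by (simp add: ennreal_mult mult.assoc)
      finally show ?case .
    qed
    then show ?thesis by blast
  qed
  then obtain C where C: "\<forall>\<^sub>F n in sequentially. (\<integral>\<^sup>+x. h n x * h n x \<partial>(P z \<Otimes>\<^sub>M E)) \<le> ennreal C" by blast
  have "(\<lambda>n. \<integral>\<^sup>+x. h n x \<partial>(P z \<Otimes>\<^sub>M E)) \<longlonglongrightarrow> (\<integral>\<^sup>+x. l x \<partial>(P z \<Otimes>\<^sub>M E))"
    by (rule Q.nn_integral_tendsto_of_second_moment[OF hm lm lim C])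
  then have "(\<integral>\<^sup>+x. l x \<partial>(P z \<Otimes>\<^sub>M E)) = u \<alpha> z y"
    unfolding hI using u_lim[OF a, of y z] LIMSEQ_unique by blast
  then show ?thesis unfolding lI .
qed

end

section \<open>Inverse local times\<close>

text \<open>The value 0 at infinity lets paths with an infinite exponent drop out of every
  expectation.\<close>

definition ehat :: "ennreal \<Rightarrow> ennreal" where
  "ehat v = (if v = \<top> then 0 else ennreal (exp (- enn2real v)))"

lemma ehat_simps [simp]: "ehat 0 = 1" "ehat \<top> = 0"
  by (auto simp: ehat_def)

lemma ehat_ennreal: "0 \<le> v \<Longrightarrow> ehat (ennreal v) = ennreal (exp (- v))"
  by (simp add: ehat_def)

lemma ehat_add: "ehat (v + w) = ehat v * ehat w"
proof (cases "v = \<top> \<or> w = \<top>")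
  case False
  then obtain a b where "v = ennreal a" "0 \<le> a" "w = ennreal b" "0 \<le> b"
    by (cases v; cases w) auto
  then show ?thesis
    by (simp add: ehat_ennreal ennreal_mult[symmetric] exp_add[symmetric] add.commute flip: ennreal_plus)
qed auto

lemma ehat_measurable [measurable]: "ehat \<in> borel_measurable borel"
  unfolding ehat_def[abs_def] by measurable

lemma ehat_le_1: "ehat v \<le> 1"
  unfolding ehat_def by simp

lemma ehat_antimono: "v \<le> w \<Longrightarrow> ehat w \<le> ehat v"
  unfolding ehat_def by (auto simp: top_unique intro!: ennreal_leI enn2real_mono simp: less_top[symmetric])

lemma ehat_pos: "v \<noteq> \<top> \<Longrightarrow> 0 < ehat v"
  unfolding ehat_def by simp

text \<open>Passage times are identified through the events of lying before a real time, since these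
  translate into statements about local times.\<close>

lemma ennreal_eq_if_less_iff:
  fixes v w :: ennreal
  assumes "\<And>s. 0 \<le> s \<Longrightarrow> v < ennreal s \<longleftrightarrow> w < ennreal s"
  shows "v = w"
proof -
  have le: "a \<le> b" if "\<And>s. 0 \<le> s \<Longrightarrow> b < ennreal s \<Longrightarrow> a < ennreal s" for a b :: ennreal
  proof (rule ennreal_le_epsilon)
    fix e :: real assume e: "b < \<top>" "0 < e"
    then have "b < ennreal (enn2real b + e)" by (cases b) (simp_all add: ennreal_less_iff flip: ennreal_plus)
    from that[OF _ this] e show "a \<le> b + ennreal e" by (simp add: less_imp_le)
  qed
  show ?thesis using le[of v w] le[of w v] assms by auto
qed

lemma nn_integral_shift_atLeast:
  fixes H :: "real \<Rightarrow> ennreal"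
  assumes [measurable]: "H \<in> borel_measurable borel"
  shows "(\<integral>\<^sup>+r. H (r - c) * indicator {c..} r \<partial>lborel) = (\<integral>\<^sup>+r. H r * indicator {0..} r \<partial>lborel)"
  by (subst nn_integral_real_affine[where c=1 and t=c]) (auto intro!: nn_integral_cong simp: indicator_def)

context local_time_process
begin

text \<open>The infimum over rational times makes \<open>tau\<close> a stopping time; on the paths where the local time is
  continuous and increasing it is the inverse local time.\<close>

definition tau :: "'s \<Rightarrow> real \<Rightarrow> 'w \<Rightarrow> ennreal" where
  "tau y r \<omega> = Inf (ennreal ` {q. q \<in> \<rat> \<and> 0 \<le> q \<and> ennreal r < ell y q \<omega>})"

lemma tau_less: "tau y r \<omega> < v \<longleftrightarrow> (\<exists>q\<in>{q. q \<in> \<rat> \<and> 0 \<le> q \<and> ennreal q < v}. ennreal r < ell y q \<omega>)"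
  unfolding tau_def Inf_less_iff by auto

lemma countable_rats: "countable {q :: real. q \<in> \<rat> \<and> 0 \<le> q \<and> ennreal q < v}"
  by (rule countable_subset[OF _ countable_rat]) auto

lemma tau_stops: "stops (tau y r)"
proof (rule stopsI)
  fix v
  have "Measurable.pred (F v) (\<lambda>\<omega>. \<exists>q\<in>{q. q \<in> \<rat> \<and> 0 \<le> q \<and> ennreal q < v}. ennreal r < ell y q \<omega>)"
  proof (rule measurable_pred_countable(2)[OF countable_rats])
    fix q assume "q \<in> {q. q \<in> \<rat> \<and> 0 \<le> q \<and> ennreal q < v}"
    then have [measurable]: "ell y q \<in> borel_measurable (F v)" by (intro ell_measurable_F) auto
    show "Measurable.pred (F v) (\<lambda>\<omega>. ennreal r < ell y q \<omega>)" by measurable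
  qed
  then show "{\<omega> \<in> space W. tau y r \<omega> < v} \<in> sets (F v)"
    by (simp add: tau_less pred_def)
qed

lemma tau_comp:
  assumes [measurable]: "r \<in> borel_measurable K" "\<pi> \<in> measurable K (F \<top>)"
  shows "(\<lambda>x. tau y (r x) (\<pi> x)) \<in> borel_measurable K"
proof (rule borel_measurableI_less)
  fix v
  have "Measurable.pred K (\<lambda>x. \<exists>q\<in>{q. q \<in> \<rat> \<and> 0 \<le> q \<and> ennreal q < v}. ennreal (r x) < ell y q (\<pi> x))"
  proof (rule measurable_pred_countable(2)[OF countable_rats])
    fix q
    have [measurable]: "ell y q \<in> borel_measurable (F \<top>)" by (intro ell_measurable_F) auto
    show "Measurable.pred K (\<lambda>x. ennreal (r x) < ell y q (\<pi> x))" by measurable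
  qed
  then show "{x \<in> space K. tau y (r x) (\<pi> x) < v} \<in> sets K"
    by (simp add: tau_less pred_def)
qed

lemma ell_comp:
  assumes T: "T \<in> borel_measurable K" and \<pi>: "\<pi> \<in> measurable K (F \<top>)"
  shows "(\<lambda>x. ell y (enn2real (T x)) (\<pi> x)) \<in> borel_measurable K"
proof -
  have "(\<lambda>x. (enn2real (T x), \<pi> x)) \<in> measurable K (borel \<Otimes>\<^sub>M F \<top>)"
    using assms by (intro measurable_Pair measurable_compose[OF T borel_measurable_enn2real]) auto
  from measurable_compose[OF this ell_progressive[of \<top> y]] show ?thesis by simp
qed

lemma theta_comp:
  assumes T: "T \<in> borel_measurable K" and \<pi>: "\<pi> \<in> measurable K (F \<top>)"
  shows "(\<lambda>x. \<theta> (enn2real (T x)) (\<pi> x)) \<in> measurable K (F \<top>)"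
proof -
  have \<pi>W: "\<pi> x \<in> space W" if "x \<in> space K" for x using measurable_space[OF \<pi> that] by simp
  show ?thesis
  proof (rule measurable_sigma_sets[OF sets_F])
    fix A' assume "A' \<in> {X s -` A \<inter> space W |s A. 0 \<le> s \<and> ennreal s \<le> \<top> \<and> A \<in> sets cemetery_borel}"
    then obtain s A where sA: "A' = X s -` A \<inter> space W" "0 \<le> s" "A \<in> sets cemetery_borel" by blast
    have "(\<lambda>x. (s + enn2real (T x), \<pi> x)) \<in> measurable K (borel \<Otimes>\<^sub>M F \<top>)"
      using assms by (intro measurable_Pair borel_measurable_add measurable_compose[OF T borel_measurable_enn2real]) auto
    from measurable_compose[OF this X_jointly[of \<top>]]
    have "(\<lambda>x. X (s + enn2real (T x)) (\<pi> x)) \<in> measurable K cemetery_borel" using sA(2) by simp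
    from measurable_sets[OF this sA(3)]
    show "(\<lambda>x. \<theta> (enn2real (T x)) (\<pi> x)) -` A' \<inter> space K \<in> sets K"
      by (rule back_subst[of "\<lambda>A. A \<in> sets K"]) (use sA shift \<pi>W in auto)
  qed (use shift \<pi>W in auto)
qed

lemma id_comp: "(\<lambda>\<omega>. \<omega>) \<in> measurable (P z) (F \<top>)"
  by (rule measurable_F_P[of _ \<top>]) simp

lemma good_left_limit:
  assumes g: "good y \<omega>" and r: "0 \<le> r" and s: "r < LT y s \<omega>" "0 \<le> s"
  obtains q where "q \<in> \<rat>" "0 \<le> q" "q < s" "r < LT y q \<omega>"
proof -
  have "s \<noteq> 0" using s(1) r goodD(6)[OF g] by auto
  then have s0: "0 < s" using s by simp
  have "continuous_on {0..s} (\<lambda>t. LT y t \<omega>)" by (rule goodD(4)[OF g])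
  then obtain d where d: "d > 0" "\<And>t. t \<in> {0..s} \<Longrightarrow> dist t s < d \<Longrightarrow> dist (LT y t \<omega>) (LT y s \<omega>) < LT y s \<omega> - r"
    using s s0 unfolding continuous_on_iff by (metis atLeastAtMost_iff diff_gt_0_iff_gt order_refl)
  obtain q where q: "q \<in> \<rat>" "max 0 (s - d) < q" "q < s"
    using Rats_dense_in_real[of "max 0 (s - d)" s] s0 d by auto
  have "dist (LT y q \<omega>) (LT y s \<omega>) < LT y s \<omega> - r" using q by (intro d(2)) (auto simp: dist_real_def)
  then have "r < LT y q \<omega>" by (auto simp: dist_real_def)
  then show thesis using that q by auto
qed

text \<open>Continuity makes both sides strict: if the level r is exceeded at s, it was already
  exceeded at a rational time before s. Identities between times and levels are reduced to this
  equivalence.\<close>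

lemma tau_less_iff:
  assumes g: "good y \<omega>" and r: "0 \<le> r" and s: "0 \<le> s"
  shows "tau y r \<omega> < ennreal s \<longleftrightarrow> r < LT y s \<omega>"
proof
  assume "tau y r \<omega> < ennreal s"
  then obtain q where q: "0 \<le> q" "ennreal q < ennreal s" "ennreal r < ell y q \<omega>" unfolding tau_less by auto
  then have "r < LT y q \<omega>" using goodD(2)[OF g q(1)] r by (simp add: ennreal_less_iff)
  also have "\<dots> \<le> LT y s \<omega>" using q by (intro goodD(5)[OF g]) (auto simp: ennreal_less_iff)
  finally show "r < LT y s \<omega>" .
next
  assume "r < LT y s \<omega>"
  then obtain q where q: "q \<in> \<rat>" "0 \<le> q" "q < s" "r < LT y q \<omega>" using good_left_limit[OF g r _ s] by blast
  then have "ennreal r < ell y q \<omega>" using goodD(2)[OF g q(2)] r by (simp add: ennreal_less_iff)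
  then show "tau y r \<omega> < ennreal s" unfolding tau_less using q by (auto intro!: bexI[of _ q] ennreal_lessI)
qed

lemma tau_mono: "r \<le> r' \<Longrightarrow> tau y r \<omega> \<le> tau y r' \<omega>"
  unfolding tau_def by (intro Inf_superset_mono image_mono) (auto intro: le_less_trans ennreal_leI)

text \<open>Overshoot is excluded by \<open>tau_less_iff\<close>, undershoot because continuity
  would keep the local time below r a little longer.\<close>

lemma LT_tau:
  assumes g: "good y \<omega>" and r: "0 \<le> r" and fin: "tau y r \<omega> < \<top>"
  shows "LT y (enn2real (tau y r \<omega>)) \<omega> = r"
proof -
  let ?s = "enn2real (tau y r \<omega>)"
  have s: "tau y r \<omega> = ennreal ?s" using fin by simp
  have "\<not> r < LT y ?s \<omega>" using tau_less_iff[OF g r, of ?s] s by simp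
  moreover have "\<not> LT y ?s \<omega> < r"
  proof
    assume l: "LT y ?s \<omega> < r"
    have "continuous_on {0..?s + 1} (\<lambda>t. LT y t \<omega>)" by (rule goodD(4)[OF g])
    then obtain d where d: "d > 0" "\<And>t. t \<in> {0..?s + 1} \<Longrightarrow> dist t ?s < d \<Longrightarrow> dist (LT y t \<omega>) (LT y ?s \<omega>) < r - LT y ?s \<omega>"
      using l unfolding continuous_on_iff
      by (metis atLeastAtMost_iff diff_gt_0_iff_gt enn2real_nonneg le_add_same_cancel1 zero_le_one)
    let ?t = "?s + min 1 (d / 2)"
    have "dist (LT y ?t \<omega>) (LT y ?s \<omega>) < r - LT y ?s \<omega>" using d(1) by (intro d(2)) (auto simp: dist_real_def)
    then have "LT y ?t \<omega> < r" by (auto simp: dist_real_def)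
    moreover have "tau y r \<omega> < ennreal ?t"
      using d(1) enn2real_nonneg[of "tau y r \<omega>"] by (subst s) (intro ennreal_lessI, linarith, auto)
    then have "r < LT y ?t \<omega>" using tau_less_iff[OF g r, of ?t] d(1) by simp
    ultimately show False by simp
  qed
  ultimately show ?thesis by simp
qed

text \<open>The inverse is the right continuous one: \<open>tau y r\<close> is the last time at
  which the local time equals r, hence a point of growth to the right.\<close>

lemma X_tau:
  assumes g: "good y \<omega>" and r: "0 \<le> r" and fin: "tau y r \<omega> < \<top>"
  shows "X (enn2real (tau y r \<omega>)) \<omega> = Some y"
proof (rule growth_point[OF g])
  fix \<delta> :: real assume d: "0 < \<delta>"
  let ?s = "enn2real (tau y r \<omega>)"
  have "tau y r \<omega> = ennreal ?s" using fin by simp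
  also have "\<dots> < ennreal (?s + \<delta>)" using d by (intro ennreal_lessI) (auto simp: add_nonneg_pos)
  finally show "LT y ?s \<omega> < LT y (?s + \<delta>) \<omega>"
    using tau_less_iff[OF g r, of "?s + \<delta>"] LT_tau[OF assms] d by simp
qed simp

text \<open>At time v the level r still lacks \<open>r - LT y v \<omega>\<close>, and this is what
  the shifted path has to exceed.\<close>

lemma tau_shift:
  assumes g: "good y \<omega>" and v: "0 \<le> v" and r: "LT y v \<omega> \<le> r"
  shows "tau y r \<omega> = ennreal v + tau y (r - LT y v \<omega>) (\<theta> v \<omega>)"
proof (rule ennreal_eq_if_less_iff)
  fix s :: real assume s: "0 \<le> s"
  have r0: "0 \<le> r" using r goodD(7)[OF g, of v] by simp
  note g' = good_shift(1)[OF g v]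
  show "tau y r \<omega> < ennreal s \<longleftrightarrow> ennreal v + tau y (r - LT y v \<omega>) (\<theta> v \<omega>) < ennreal s"
  proof (cases "s \<le> v")
    case True
    have "LT y s \<omega> \<le> r" using goodD(5)[OF g s True] r by simp
    then have "\<not> tau y r \<omega> < ennreal s" using tau_less_iff[OF g r0 s] by simp
    moreover have "ennreal s \<le> ennreal v + tau y (r - LT y v \<omega>) (\<theta> v \<omega>)"
      using ennreal_leI[OF True] by (simp add: add_increasing2)
    ultimately show ?thesis by simp
  next
    case False
    define t where "t = s - v"
    have t: "0 \<le> t" "s = v + t" using False by (auto simp: t_def)
    have "tau y r \<omega> < ennreal s \<longleftrightarrow> r - LT y v \<omega> < LT y t (\<theta> v \<omega>)"
      using tau_less_iff[OF g r0 s] good_shift(2)[OF g v t(1)] t(2) by auto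
    also have "\<dots> \<longleftrightarrow> tau y (r - LT y v \<omega>) (\<theta> v \<omega>) < ennreal t"
      using tau_less_iff[OF g' _ t(1), of "r - LT y v \<omega>"] r by simp
    also have "\<dots> \<longleftrightarrow> ennreal v + tau y (r - LT y v \<omega>) (\<theta> v \<omega>) < ennreal s"
      unfolding t(2) using v t(1) by (simp add: ennreal_add_left_cancel_less ennreal_plus)
    finally show ?thesis .
  qed
qed

lemma AE_X_tau: "0 \<le> r \<Longrightarrow> AE \<omega> in P z. tau y r \<omega> < \<top> \<longrightarrow> X (enn2real (tau y r \<omega>)) \<omega> = Some y"
  using AE_good[of y z] by eventually_elim (auto intro: X_tau)

section \<open>Additive functionals and killing weights\<close>

definition Aw :: "(real \<times> 's) list \<Rightarrow> real \<Rightarrow> 'w \<Rightarrow> ennreal" where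
  "Aw l s \<omega> = (\<Sum>k\<leftarrow>l. ennreal (fst k) * ell (snd k) s \<omega>)"

text \<open>The survival probability at \<open>T\<close> under killing at rate \<open>\<alpha> dt + dA\<close>.\<close>

definition wt :: "real \<Rightarrow> (real \<times> 's) list \<Rightarrow> ennreal \<Rightarrow> 'w \<Rightarrow> ennreal" where
  "wt \<alpha> l T \<omega> = ehat (ennreal \<alpha> * T + Aw l (enn2real T) \<omega>)"

definition goods :: "(real \<times> 's) list \<Rightarrow> 'w \<Rightarrow> bool" where
  "goods l \<omega> \<longleftrightarrow> \<omega> \<in> space W \<and> (\<forall>k\<in>set l. good (snd k) \<omega>)"

lemma Aw_simps: "Aw [] s \<omega> = 0" "Aw (k # l) s \<omega> = ennreal (fst k) * ell (snd k) s \<omega> + Aw l s \<omega>"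
  by (auto simp: Aw_def)

lemma AE_goods: "AE \<omega> in P z. goods l \<omega>"
proof -
  have "AE \<omega> in P z. \<forall>k\<in>set l. good (snd k) \<omega>"
    by (rule AE_finite_allI) (use AE_good in \<open>auto elim: eventually_mono\<close>)
  then show ?thesis using AE_space[of "P z"] unfolding goods_def by eventually_elim auto
qed

lemma Aw_comp:
  assumes "T \<in> borel_measurable K" "\<pi> \<in> measurable K (F \<top>)"
  shows "(\<lambda>x. Aw l (enn2real (T x)) (\<pi> x)) \<in> borel_measurable K"
  using ell_comp[OF assms] by (induct l) (auto simp: Aw_simps)

lemma wt_comp:
  assumes "T \<in> borel_measurable K" "\<pi> \<in> measurable K (F \<top>)"
  shows "(\<lambda>x. wt \<alpha> l (T x) (\<pi> x)) \<in> borel_measurable K"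
  using assms Aw_comp[OF assms, of l] unfolding wt_def by measurable

lemma wt_top: "0 < \<alpha> \<Longrightarrow> wt \<alpha> l \<top> \<omega> = 0"
  by (simp add: wt_def ennreal_mult_top)

text \<open>A positive \<alpha> makes the weight vanish at \<open>T \<omega> = \<top>\<close>, which
  agrees with the default 0 supplied to \<open>progressive_at_stopping\<close>.\<close>

lemma wt_measurable_pre:
  assumes T: "stops T" and a: "0 < \<alpha>"
  shows "(\<lambda>\<omega>. wt \<alpha> l (T \<omega>) \<omega>) \<in> borel_measurable (pre T)"
proof -
  have "(\<lambda>x. if 0 \<le> fst x \<and> ennreal (fst x) < v then wt \<alpha> l (ennreal (fst x)) (snd x) else 0) \<in> borel_measurable (borel \<Otimes>\<^sub>M F v)" for v
  proof -
    have A: "(\<lambda>x. if 0 \<le> fst x \<and> ennreal (fst x) < v then Aw l (fst x) (snd x) else 0) \<in> borel_measurable (borel \<Otimes>\<^sub>M F v)"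
    proof (induct l)
      case (Cons k l)
      have "(\<lambda>x. ennreal (fst k) * (if 0 \<le> fst x \<and> ennreal (fst x) < v then ell (snd k) (fst x) (snd x) else 0)
          + (if 0 \<le> fst x \<and> ennreal (fst x) < v then Aw l (fst x) (snd x) else 0)) \<in> borel_measurable (borel \<Otimes>\<^sub>M F v)"
        using Cons ell_progressive[of v "snd k"] by measurable
      then show ?case by (rule measurable_cong[THEN iffD1, rotated]) (auto simp: Aw_simps)
    qed (simp add: Aw_simps cong: if_cong)
    have "(\<lambda>x. if 0 \<le> fst x \<and> ennreal (fst x) < v then ehat (ennreal \<alpha> * ennreal (fst x) +
        (if 0 \<le> fst x \<and> ennreal (fst x) < v then Aw l (fst x) (snd x) else 0)) else 0) \<in> borel_measurable (borel \<Otimes>\<^sub>M F v)"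
      using A by measurable
    then show ?thesis by (rule measurable_cong[THEN iffD1, rotated]) (auto simp: wt_def)
  qed
  from progressive_at_stopping[OF T this]
  show ?thesis by (rule measurable_cong[THEN iffD1, rotated]) (auto simp: less_top[symmetric] wt_top[OF a])
qed

text \<open>Time and \<open>Aw l\<close> are additive along the path, so the weight is a
  multiplicative functional; at infinite \<open>T\<close> both sides vanish because \<alpha> is
  positive.\<close>

lemma wt_shift:
  assumes g: "goods l \<omega>" and v: "0 \<le> v" and a: "0 < \<alpha>"
  shows "wt \<alpha> l (ennreal v + T) \<omega> = wt \<alpha> l (ennreal v) \<omega> * wt \<alpha> l T (\<theta> v \<omega>)"
proof (cases "T = \<top>")
  case True
  then show ?thesis using wt_top[OF a] by simp
next
  case False
  then obtain t where t: "T = ennreal t" "0 \<le> t" by (cases T) auto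
  have "Aw l (v + t) \<omega> = Aw l v \<omega> + Aw l t (\<theta> v \<omega>)"
    using g
  proof (induct l)
    case (Cons k l)
    then have gk: "good (snd k) \<omega>" and gl: "goods l \<omega>" by (auto simp: goods_def)
    have "ell (snd k) (v + t) \<omega> = ell (snd k) v \<omega> + ell (snd k) t (\<theta> v \<omega>)"
      using goodD(2)[OF gk] goodD(2)[OF good_shift(1)[OF gk v]] good_shift(2)[OF gk v t(2)]
        goodD(7)[OF gk] goodD(7)[OF good_shift(1)[OF gk v]] v t by (simp add: ennreal_plus)
    then show ?case using Cons(1)[OF gl] by (simp add: Aw_simps distrib_left ac_simps)
  qed (simp add: Aw_simps)
  then have "ennreal \<alpha> * (ennreal v + T) + Aw l (enn2real (ennreal v + T)) \<omega>
    = (ennreal \<alpha> * ennreal v + Aw l v \<omega>) + (ennreal \<alpha> * T + Aw l t (\<theta> v \<omega>))"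
    using t v by (simp add: enn2real_plus distrib_left ac_simps)
  then show ?thesis unfolding wt_def using t v by (simp add: ehat_add)
qed

lemma wt_le_1: "wt \<alpha> l T \<omega> \<le> 1"
  unfolding wt_def by (rule ehat_le_1)

text \<open>Substituting \<open>r = L\<^sub>s\<close> at \<open>y\<close>, \<open>G\<close> is the local time at \<open>y\<close> up to the killing time, averaged over the killing.
  Hence \<open>R\<close> is the potential density of the killed process.\<close>

definition G :: "real \<Rightarrow> (real \<times> 's) list \<Rightarrow> 's \<Rightarrow> 'w \<Rightarrow> ennreal" where
  "G \<alpha> l y \<omega> = (\<integral>\<^sup>+r. wt \<alpha> l (tau y r \<omega>) \<omega> * indicator {0..} r \<partial>lborel)"

definition R :: "real \<Rightarrow> (real \<times> 's) list \<Rightarrow> 's \<Rightarrow> 's \<Rightarrow> ennreal" where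
  "R \<alpha> l z y = (\<integral>\<^sup>+\<omega>. G \<alpha> l y \<omega> \<partial>P z)"

lemma wt_tau_comp:
  assumes "r \<in> borel_measurable K" "\<pi> \<in> measurable K (F \<top>)"
  shows "(\<lambda>x. wt \<alpha> l (tau y (r x) (\<pi> x)) (\<pi> x)) \<in> borel_measurable K"
  by (intro wt_comp tau_comp assms)

lemma const_comp: "\<omega> \<in> space W \<Longrightarrow> (\<lambda>_. \<omega>) \<in> measurable K (F \<top>)"
  by (rule measurable_const) simp

lemma G_measurable: "G \<alpha> l y \<in> borel_measurable (F \<top>)"
proof -
  have [measurable]: "(\<lambda>x. wt \<alpha> l (tau y (snd x) (fst x)) (fst x)) \<in> borel_measurable (F \<top> \<Otimes>\<^sub>M lborel)"
    by (intro wt_tau_comp) auto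
  show ?thesis unfolding G_def[abs_def]
    by (intro lborel.borel_measurable_nn_integral) (simp add: case_prod_beta)
qed

lemma G_comp: "\<pi> \<in> measurable K (F \<top>) \<Longrightarrow> (\<lambda>x. G \<alpha> l y (\<pi> x)) \<in> borel_measurable K"
  by (rule measurable_compose[OF _ G_measurable])

text \<open>Exchange level and time: \<open>tau y r \<omega> < s\<close> means that r lies below the
  local time at s. Integrating the exponential density over s first gives the weight at
  \<open>tau y r\<close>; integrating over r first gives the local time at s, whose discounted
  expectation is known.\<close>

lemma R_Nil:
  assumes a: "0 < \<alpha>"
  shows "R \<alpha> [] z y = u \<alpha> z y"
proof -
  have "G \<alpha> [] y \<omega> = (\<integral>\<^sup>+s. ennreal (\<alpha> * exp (- \<alpha> * s)) * indicator {0..} s * ell y s \<omega> \<partial>lborel)"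
    if g: "good y \<omega>" for \<omega>
  proof -
    have w: "\<omega> \<in> space W" using goodD(1)[OF g] .
    define K where "K r s = (if 0 \<le> r \<and> 0 \<le> s \<and> tau y r \<omega> < ennreal s then ennreal (\<alpha> * exp (- \<alpha> * s)) else 0)" for r s
    have [measurable]: "(\<lambda>x. tau y (fst x) \<omega>) \<in> borel_measurable (lborel \<Otimes>\<^sub>M (lborel :: real measure))"
      by (intro tau_comp const_comp[OF w]) auto
    have K: "case_prod K \<in> borel_measurable (lborel \<Otimes>\<^sub>M lborel)" unfolding K_def case_prod_beta by measurable
    have "G \<alpha> [] y \<omega> = (\<integral>\<^sup>+r. \<integral>\<^sup>+s. K r s \<partial>lborel \<partial>lborel)"
      unfolding G_def
    proof (rule nn_integral_cong)
      fix r :: real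
      show "wt \<alpha> [] (tau y r \<omega>) \<omega> * indicator {0..} r = (\<integral>\<^sup>+s. K r s \<partial>lborel)"
      proof (cases "0 \<le> r \<and> tau y r \<omega> < \<top>")
        case True
        define v where "v = enn2real (tau y r \<omega>)"
        have v: "tau y r \<omega> = ennreal v" "0 \<le> v" using True by (auto simp: v_def)
        have "(\<integral>\<^sup>+s. K r s \<partial>lborel) = (\<integral>\<^sup>+s. ennreal (\<alpha> * exp (- \<alpha> * s)) * indicator {v..} s \<partial>lborel)"
          using AE_lborel_singleton[of v] True v
          by (intro nn_integral_cong_AE, elim AE_mp, intro AE_I2) (auto simp: K_def indicator_def ennreal_less_iff)
        also have "\<dots> = ennreal (exp (- \<alpha> * v))" by (rule nn_integral_exp_tail[OF a])
        also have "\<dots> = wt \<alpha> [] (tau y r \<omega>) \<omega>"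
          using v a by (simp add: wt_def Aw_simps ehat_ennreal ennreal_mult[symmetric])
        finally show ?thesis using True by simp
      next
        case False
        then have "K r s = 0" for s by (auto simp: K_def dest: order.strict_trans2[OF _ top_greatest])
        moreover have "wt \<alpha> [] (tau y r \<omega>) \<omega> * indicator {0..} r = 0"
          using False wt_top[OF a] by (auto simp: less_top[symmetric] indicator_def)
        ultimately show ?thesis by simp
      qed
    qed
    also have "\<dots> = (\<integral>\<^sup>+s. \<integral>\<^sup>+r. K r s \<partial>lborel \<partial>lborel)" by (rule lborel_pair.Fubini'[symmetric, OF K])
    also have "\<dots> = (\<integral>\<^sup>+s. ennreal (\<alpha> * exp (- \<alpha> * s)) * indicator {0..} s * ell y s \<omega> \<partial>lborel)"
    proof (rule nn_integral_cong)
      fix s :: real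
      show "(\<integral>\<^sup>+r. K r s \<partial>lborel) = ennreal (\<alpha> * exp (- \<alpha> * s)) * indicator {0..} s * ell y s \<omega>"
      proof (cases "0 \<le> s")
        case True
        have "(\<integral>\<^sup>+r. K r s \<partial>lborel) = (\<integral>\<^sup>+r. ennreal (\<alpha> * exp (- \<alpha> * s)) * indicator {0..<LT y s \<omega>} r \<partial>lborel)"
          using tau_less_iff[OF g _ True] True by (intro nn_integral_cong) (auto simp: K_def indicator_def)
        also have "\<dots> = ennreal (\<alpha> * exp (- \<alpha> * s)) * ennreal (LT y s \<omega>)"
          using goodD(7)[OF g, of s] by (simp add: nn_integral_cmult)
        finally show ?thesis using True goodD(2)[OF g True] by simp
      qed (simp add: K_def)
    qed
    finally show ?thesis .
  qed
  then have "R \<alpha> [] z y = (\<integral>\<^sup>+\<omega>. \<integral>\<^sup>+s. ennreal (\<alpha> * exp (- \<alpha> * s)) * indicator {0..} s * ell y s \<omega> \<partial>lborel \<partial>P z)"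
    unfolding R_def using AE_good[of y z] by (intro nn_integral_cong_AE) (auto elim!: eventually_mono)
  then show ?thesis using expected_discounted_local_time[OF a] by simp
qed

end

section \<open>Potential densities of killed processes\<close>

lemma nn_integral_exp_rise:
  assumes "0 \<le> lam" "0 \<le> L"
  shows "(\<integral>\<^sup>+q. ennreal (lam * exp (- lam * (L - q))) * indicator {0..<L} q \<partial>lborel) = ennreal (1 - exp (- lam * L))"
proof -
  have "(\<integral>\<^sup>+q. ennreal (lam * exp (- lam * (L - q))) * indicator {0..<L} q \<partial>lborel)
    = (\<integral>\<^sup>+q. ennreal (lam * exp (- lam * (L - q))) * indicator {0..L} q \<partial>lborel)"
    using AE_lborel_singleton[of L] by (intro nn_integral_cong_AE, elim AE_mp, intro AE_I2) (auto simp: indicator_def)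
  also have "\<dots> = ennreal (exp (- lam * (L - L)) - exp (- lam * (L - 0)))"
  proof (rule nn_integral_FTC_Icc)
    fix x
    show "((\<lambda>q. exp (- lam * (L - q))) has_real_derivative lam * exp (- lam * (L - x))) (at x)"
      by (auto intro!: derivative_eq_intros)
  qed (use assms in auto)
  finally show ?thesis by simp
qed

context local_time_process
begin

lemma wt_Cons:
  assumes "good x \<omega>" "0 \<le> lam" "0 \<le> t"
  shows "wt \<alpha> ((lam, x) # l) (ennreal t) \<omega> = ennreal (exp (- lam * LT x t \<omega>)) * wt \<alpha> l (ennreal t) \<omega>"
  using goodD(2)[OF assms(1,3)] goodD(7)[OF assms(1), of t] assms(2,3) unfolding wt_def
  by (simp add: Aw_simps ehat_add ehat_ennreal ennreal_mult[symmetric] mult_ac)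

lemma tau_less_of_LT:
  assumes g: "good y \<omega>" and v: "0 \<le> v" and r: "LT y v \<omega> < r"
  shows "ennreal v < tau y r \<omega>"
proof (rule ccontr)
  assume "\<not> ennreal v < tau y r \<omega>"
  then have le: "tau y r \<omega> \<le> ennreal v" by simp
  then have fin: "tau y r \<omega> < \<top>" using ennreal_less_top le_less_trans by blast
  have r0: "0 \<le> r" using r goodD(7)[OF g, of v] by simp
  have "enn2real (tau y r \<omega>) \<le> v" using le v by (metis enn2real_ennreal enn2real_mono ennreal_less_top)
  then have "LT y (enn2real (tau y r \<omega>)) \<omega> \<le> LT y v \<omega>" by (intro goodD(5)[OF g]) auto
  then show False using LT_tau[OF g r0 fin] r by simp
qed

lemma LT_measurable_path:
  assumes w: "\<omega> \<in> space W" and "r \<in> borel_measurable K"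
  shows "(\<lambda>x. LT z (enn2real (tau y (r x) \<omega>)) \<omega>) \<in> borel_measurable K"
  unfolding LT_def
  by (intro borel_measurable_enn2real ell_comp tau_comp const_comp w assms)

text \<open>The extra killing at x up to \<open>tau y r\<close> removes the fraction
  \<open>1 - exp (- lam * L)\<close>, with \<open>L\<close> the local time at x by then; this is the
  integral of \<open>lam * exp (- lam * (L - q))\<close> over levels \<open>q < L\<close>. The
  integrand charges the new killing only after \<open>tau x q\<close>, so for fixed q the future
  beyond that time is a \<open>G\<close> for the longer list.\<close>

lemma G_first_entrance:
  assumes a: "0 < \<alpha>" and lam: "0 \<le> lam" and gy: "good y \<omega>" and gx: "good x \<omega>" and gl: "goods l \<omega>"
  shows "G \<alpha> l y \<omega> = G \<alpha> ((lam, x) # l) y \<omega>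
    + (\<integral>\<^sup>+q. ennreal lam * (wt \<alpha> l (tau x q \<omega>) \<omega> * G \<alpha> ((lam, x) # l) y (\<theta> (enn2real (tau x q \<omega>)) \<omega>)) * indicator {0..} q \<partial>lborel)"
proof -
  let ?l = "(lam, x) # l"
  have w: "\<omega> \<in> space W" using goodD(1)[OF gy] .
  \<comment> \<open>r is a level at y and q a level at x; \<open>tau x q\<close> comes before
    \<open>tau y r\<close> exactly if q lies below the local time at x by then.\<close>
  define K where "K r q = (if 0 \<le> r \<and> 0 \<le> q \<and> tau x q \<omega> < tau y r \<omega> \<and> tau y r \<omega> < \<top>
      then wt \<alpha> l (tau y r \<omega>) \<omega> * ennreal (lam * exp (- lam * (LT x (enn2real (tau y r \<omega>)) \<omega> - q))) else 0)" for r q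
  have [measurable]: "(\<lambda>p. tau y (fst p) \<omega>) \<in> borel_measurable (lborel \<Otimes>\<^sub>M (lborel :: real measure))"
    "(\<lambda>p. tau x (snd p) \<omega>) \<in> borel_measurable ((lborel :: real measure) \<Otimes>\<^sub>M lborel)"
    "(\<lambda>p. wt \<alpha> l (tau y (fst p) \<omega>) \<omega>) \<in> borel_measurable (lborel \<Otimes>\<^sub>M (lborel :: real measure))"
    "(\<lambda>p. LT x (enn2real (tau y (fst p) \<omega>)) \<omega>) \<in> borel_measurable (lborel \<Otimes>\<^sub>M (lborel :: real measure))"
    by (intro tau_comp wt_tau_comp LT_measurable_path const_comp[OF w] w; simp)+
  have K: "case_prod K \<in> borel_measurable (lborel \<Otimes>\<^sub>M lborel)" unfolding K_def case_prod_beta by measurable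
  have Kq [measurable]: "(\<lambda>r. \<integral>\<^sup>+q. K r q \<partial>lborel) \<in> borel_measurable lborel"
    using K by (intro lborel.borel_measurable_nn_integral) 
  have wm: "(\<lambda>r. wt \<alpha> l' (tau y r \<omega>') \<omega>') \<in> borel_measurable borel" if "\<omega>' \<in> space W" for l' \<omega>'
    by (intro wt_tau_comp const_comp[OF that]) simp
  note [measurable] = wm[OF w]
  have A: "wt \<alpha> l (tau y r \<omega>) \<omega> * indicator {0..} r = wt \<alpha> ?l (tau y r \<omega>) \<omega> * indicator {0..} r + (\<integral>\<^sup>+q. K r q \<partial>lborel)" for r
  proof (cases "0 \<le> r \<and> tau y r \<omega> < \<top>")
    case True
    define s where "s = enn2real (tau y r \<omega>)"
    have s: "tau y r \<omega> = ennreal s" "0 \<le> s" using True by (auto simp: s_def)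
    let ?L = "LT x s \<omega>"
    have L0: "0 \<le> ?L" by (rule goodD(7)[OF gx])
    have "(\<integral>\<^sup>+q. K r q \<partial>lborel) = (\<integral>\<^sup>+q. wt \<alpha> l (tau y r \<omega>) \<omega> * (ennreal (lam * exp (- lam * (?L - q))) * indicator {0..<?L} q) \<partial>lborel)"
      using True s tau_less_iff[OF gx _ s(2)] by (intro nn_integral_cong) (auto simp: K_def indicator_def)
    also have "\<dots> = wt \<alpha> l (tau y r \<omega>) \<omega> * ennreal (1 - exp (- lam * ?L))"
      by (subst nn_integral_cmult) (simp_all add: nn_integral_exp_rise[OF lam L0, simplified])
    finally have "wt \<alpha> ?l (tau y r \<omega>) \<omega> + (\<integral>\<^sup>+q. K r q \<partial>lborel)
      = wt \<alpha> l (tau y r \<omega>) \<omega> * (ennreal (exp (- lam * ?L)) + ennreal (1 - exp (- lam * ?L)))"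
      unfolding s(1) wt_Cons[OF gx lam s(2)] by (simp add: distrib_left mult.commute)
    also have "ennreal (exp (- lam * ?L)) + ennreal (1 - exp (- lam * ?L)) = 1"
      using lam L0 by (simp flip: ennreal_plus)
    finally show ?thesis using True by simp
  next
    case False
    then have "K r q = 0" for q by (auto simp: K_def)
    then have z: "(\<integral>\<^sup>+q. K r q \<partial>lborel) = 0" by simp
    have zz: "wt \<alpha> l' (tau y r \<omega>) \<omega> * indicator {0..} r = 0" for l'
      using False wt_top[OF a] by (auto simp: less_top[symmetric] indicator_def)
    show ?thesis by (simp only: z zz add_0_left)
  qed
  \<comment> \<open>Integration over r at fixed q: levels at y reached after \<open>tau x q\<close>
    are counted from the local time \<open>?c\<close> collected before.\<close>
  have C: "(\<integral>\<^sup>+r. K r q \<partial>lborel) = ennreal lam * (wt \<alpha> l (tau x q \<omega>) \<omega> * G \<alpha> ?l y (\<theta> (enn2real (tau x q \<omega>)) \<omega>)) * indicator {0..} q" for q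
  proof (cases "0 \<le> q \<and> tau x q \<omega> < \<top>")
    case True
    define v where "v = enn2real (tau x q \<omega>)"
    have v: "tau x q \<omega> = ennreal v" "0 \<le> v" using True by (auto simp: v_def)
    have Lxv: "LT x v \<omega> = q" using LT_tau[OF gx, of q] True by (simp add: v_def)
    let ?c = "LT y v \<omega>"
    have c0: "0 \<le> ?c" by (rule goodD(7)[OF gy])
    have wv: "\<theta> v \<omega> \<in> space W" using shift[OF v(2) w] by simp
    note gxv = good_shift(1)[OF gx v(2)]
    define H where "H r = wt \<alpha> ?l (tau y r (\<theta> v \<omega>)) (\<theta> v \<omega>)" for r
    have H [measurable]: "H \<in> borel_measurable borel" unfolding H_def[abs_def] by (rule wm[OF wv])
    \<comment> \<open>The level \<open>r = ?c\<close> is left out: there \<open>tau y r\<close> may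
      coincide with \<open>tau x q\<close>, in which case \<open>K\<close> vanishes while
      \<open>H 0\<close> need not. A single level is a null set.\<close>
    have eqK: "K r q = ennreal lam * wt \<alpha> l (tau x q \<omega>) \<omega> * (H (r - ?c) * indicator {?c..} r)" if rc: "r \<noteq> ?c" for r
    proof (cases "r < ?c")
      case lt: True
      have "\<not> tau x q \<omega> < tau y r \<omega>" if "0 \<le> r"
        using tau_less_iff[OF gy that v(2)] lt v by simp
      then have "K r q = 0" by (auto simp: K_def)
      then show ?thesis using lt by simp
    next
      case False
      then have rc: "?c < r" using rc by simp
      have ts: "tau y r \<omega> = ennreal v + tau y (r - ?c) (\<theta> v \<omega>)" using rc by (intro tau_shift[OF gy v(2)]) simp
      have lt: "tau x q \<omega> < tau y r \<omega>" using tau_less_of_LT[OF gy v(2) rc] v by simp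
      show ?thesis
      proof (cases "tau y (r - ?c) (\<theta> v \<omega>) = \<top>")
        case True
        then show ?thesis using ts by (simp add: K_def H_def wt_top[OF a])
      next
        case False
        define t where "t = enn2real (tau y (r - ?c) (\<theta> v \<omega>))"
        have t: "tau y (r - ?c) (\<theta> v \<omega>) = ennreal t" "0 \<le> t" using False by (auto simp: t_def less_top)
        have s: "tau y r \<omega> = ennreal (v + t)" using ts t v by simp
        have "K r q = wt \<alpha> l (ennreal (v + t)) \<omega> * ennreal (lam * exp (- lam * (LT x (v + t) \<omega> - q)))"
          using lt s True rc c0 t(2) v(2) by (simp add: K_def del: ennreal_plus)
        also have "LT x (v + t) \<omega> - q = LT x t (\<theta> v \<omega>)" using good_shift(2)[OF gx v(2) t(2)] Lxv by simp
        also have "wt \<alpha> l (ennreal (v + t)) \<omega> = wt \<alpha> l (ennreal v) \<omega> * wt \<alpha> l (ennreal t) (\<theta> v \<omega>)"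
          using wt_shift[OF gl v(2) a, of "ennreal t"] v t by simp
        also have "ennreal (lam * exp (- lam * LT x t (\<theta> v \<omega>))) = ennreal lam * ennreal (exp (- lam * LT x t (\<theta> v \<omega>)))"
          using lam by (simp add: ennreal_mult)
        finally show ?thesis using rc v unfolding H_def t(1) wt_Cons[OF gxv lam t(2)] by (simp add: mult_ac)
      qed
    qed
    have "(\<integral>\<^sup>+r. K r q \<partial>lborel) = (\<integral>\<^sup>+r. ennreal lam * wt \<alpha> l (tau x q \<omega>) \<omega> * (H (r - ?c) * indicator {?c..} r) \<partial>lborel)"
      using AE_lborel_singleton[of ?c] eqK by (intro nn_integral_cong_AE) (auto elim!: eventually_mono)
    also have "\<dots> = ennreal lam * wt \<alpha> l (tau x q \<omega>) \<omega> * (\<integral>\<^sup>+r. H r * indicator {0..} r \<partial>lborel)"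
      by (subst nn_integral_cmult) (simp_all add: nn_integral_shift_atLeast)
    also have "(\<integral>\<^sup>+r. H r * indicator {0..} r \<partial>lborel) = G \<alpha> ?l y (\<theta> v \<omega>)" by (simp add: G_def H_def)
    finally show ?thesis using True by (simp add: v_def mult_ac)
  next
    case False
    then have "K r q = 0" for r by (auto simp: K_def dest: order.strict_trans2[OF _ top_greatest])
    moreover have zz: "wt \<alpha> l (tau x q \<omega>) \<omega> * indicator {0..} q = 0"
      using False wt_top[OF a] by (auto simp: less_top[symmetric] indicator_def)
    have "ennreal lam * (wt \<alpha> l (tau x q \<omega>) \<omega> * c) * indicator {0..} q
      = ennreal lam * c * (wt \<alpha> l (tau x q \<omega>) \<omega> * indicator {0..} q)" for c
      by (simp only: mult_ac)
    then have "ennreal lam * (wt \<alpha> l (tau x q \<omega>) \<omega> * c) * indicator {0..} q = 0" for c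
      by (simp only: zz mult_zero_right)
    ultimately show ?thesis by simp
  qed
  have "G \<alpha> l y \<omega> = (\<integral>\<^sup>+r. wt \<alpha> ?l (tau y r \<omega>) \<omega> * indicator {0..} r + (\<integral>\<^sup>+q. K r q \<partial>lborel) \<partial>lborel)"
    unfolding G_def A ..
  also have "\<dots> = G \<alpha> ?l y \<omega> + (\<integral>\<^sup>+r. \<integral>\<^sup>+q. K r q \<partial>lborel \<partial>lborel)"
    unfolding G_def by (intro nn_integral_add) measurable
  also have "(\<integral>\<^sup>+r. \<integral>\<^sup>+q. K r q \<partial>lborel \<partial>lborel) = (\<integral>\<^sup>+q. \<integral>\<^sup>+r. K r q \<partial>lborel \<partial>lborel)"
    by (rule lborel_pair.Fubini'[symmetric, OF K])
  finally show ?thesis unfolding C .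
qed

lemma nn_integral_wt_swap:
  "(\<integral>\<^sup>+q. indicator {0..} q * (\<integral>\<^sup>+\<omega>. wt \<alpha> l (tau x q \<omega>) \<omega> \<partial>P z) \<partial>lborel) = R \<alpha> l z x"
proof -
  interpret Pz: prob_space "P z" by (rule prob_space_P)
  interpret pair_sigma_finite "P z" "lborel :: real measure" ..
  have id2: "fst \<in> measurable (P z \<Otimes>\<^sub>M (lborel :: real measure)) (F \<top>)"
    by (rule measurable_compose[OF measurable_fst id_comp])
  have [measurable]: "(\<lambda>p. wt \<alpha> l (tau x (snd p) (fst p)) (fst p)) \<in> borel_measurable (P z \<Otimes>\<^sub>M lborel)"
    by (intro wt_tau_comp id2) simp
  have "(\<integral>\<^sup>+q. indicator {0..} q * (\<integral>\<^sup>+\<omega>. wt \<alpha> l (tau x q \<omega>) \<omega> \<partial>P z) \<partial>lborel)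
    = (\<integral>\<^sup>+q. \<integral>\<^sup>+\<omega>. wt \<alpha> l (tau x q \<omega>) \<omega> * indicator {0..} q \<partial>P z \<partial>lborel)"
    by (intro nn_integral_cong, subst nn_integral_multc) (auto intro!: wt_tau_comp id_comp simp: mult.commute)
  also have "\<dots> = (\<integral>\<^sup>+\<omega>. \<integral>\<^sup>+q. wt \<alpha> l (tau x q \<omega>) \<omega> * indicator {0..} q \<partial>lborel \<partial>P z)"
    by (rule Fubini') (simp add: case_prod_beta)
  finally show ?thesis unfolding R_def G_def .
qed

lemma wt_tau_strong_markov:
  assumes a: "0 < \<alpha>" and q: "0 \<le> q" and H: "H \<in> borel_measurable (F \<top>)"
  shows "(\<integral>\<^sup>+\<omega>. wt \<alpha> l (tau x q \<omega>) \<omega> * H (\<theta> (enn2real (tau x q \<omega>)) \<omega>) \<partial>P z)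
    = (\<integral>\<^sup>+\<omega>. wt \<alpha> l (tau x q \<omega>) \<omega> \<partial>P z) * (\<integral>\<^sup>+\<omega>. H \<omega> \<partial>P x)"
  by (rule strong_markov_at[OF tau_stops wt_measurable_pre[OF tau_stops a] H AE_X_tau[OF q]])
    (simp add: wt_top[OF a])

text \<open>Expectation of the pathwise identity: at \<open>tau x q\<close> the process restarts
  from x, so the integral over q factorises. Written as a sum, the equation makes sense in the
  extended reals.\<close>

lemma R_Cons:
  assumes a: "0 < \<alpha>" and lam: "0 \<le> lam"
  shows "R \<alpha> l z y = R \<alpha> ((lam, x) # l) z y + ennreal lam * R \<alpha> l z x * R \<alpha> ((lam, x) # l) x y"
proof -
  let ?l = "(lam, x) # l"
  interpret Pz: prob_space "P z" by (rule prob_space_P)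
  interpret pair_sigma_finite "P z" "lborel :: real measure" ..
  have id2: "fst \<in> measurable (P z \<Otimes>\<^sub>M (lborel :: real measure)) (F \<top>)"
    by (rule measurable_compose[OF measurable_fst id_comp])
  let ?D = "\<lambda>\<omega> q. ennreal lam * (wt \<alpha> l (tau x q \<omega>) \<omega> * G \<alpha> ?l y (\<theta> (enn2real (tau x q \<omega>)) \<omega>)) * indicator {0..} q"
  have [measurable]: "(\<lambda>p. wt \<alpha> l (tau x (snd p) (fst p)) (fst p)) \<in> borel_measurable (P z \<Otimes>\<^sub>M lborel)"
    "(\<lambda>p. G \<alpha> ?l y (\<theta> (enn2real (tau x (snd p) (fst p))) (fst p))) \<in> borel_measurable (P z \<Otimes>\<^sub>M lborel)"
    by (intro wt_tau_comp id2 G_comp theta_comp tau_comp; simp)+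
  have D: "case_prod ?D \<in> borel_measurable (P z \<Otimes>\<^sub>M lborel)" unfolding case_prod_beta by measurable
  have Gm [measurable]: "G \<alpha> ?l y \<in> borel_measurable (P z)" by (rule measurable_F_P[OF G_measurable])
  have "R \<alpha> l z y = (\<integral>\<^sup>+\<omega>. G \<alpha> ?l y \<omega> + (\<integral>\<^sup>+q. ?D \<omega> q \<partial>lborel) \<partial>P z)"
    unfolding R_def using AE_good[of y z] AE_good[of x z] AE_goods[of l z]
    by (intro nn_integral_cong_AE, eventually_elim) (intro G_first_entrance[OF a lam], auto)
  also have "\<dots> = R \<alpha> ?l z y + (\<integral>\<^sup>+\<omega>. \<integral>\<^sup>+q. ?D \<omega> q \<partial>lborel \<partial>P z)"
    unfolding R_def using D by (intro nn_integral_add Gm lborel.borel_measurable_nn_integral)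
  also have "(\<integral>\<^sup>+\<omega>. \<integral>\<^sup>+q. ?D \<omega> q \<partial>lborel \<partial>P z) = (\<integral>\<^sup>+q. \<integral>\<^sup>+\<omega>. ?D \<omega> q \<partial>P z \<partial>lborel)"
    by (rule Fubini'[symmetric, OF D])
  also have "\<dots> = (\<integral>\<^sup>+q. (indicator {0..} q * (\<integral>\<^sup>+\<omega>. wt \<alpha> l (tau x q \<omega>) \<omega> \<partial>P z)) * (ennreal lam * R \<alpha> ?l x y) \<partial>lborel)"
  proof (rule nn_integral_cong)
    fix q :: real
    have m: "(\<lambda>\<omega>. wt \<alpha> l (tau x q \<omega>) \<omega> * G \<alpha> ?l y (\<theta> (enn2real (tau x q \<omega>)) \<omega>)) \<in> borel_measurable (P z)"
      by (intro borel_measurable_times_ennreal wt_tau_comp G_comp theta_comp tau_comp id_comp) auto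
    have "(\<integral>\<^sup>+\<omega>. ?D \<omega> q \<partial>P z) = ennreal lam * (\<integral>\<^sup>+\<omega>. wt \<alpha> l (tau x q \<omega>) \<omega> * G \<alpha> ?l y (\<theta> (enn2real (tau x q \<omega>)) \<omega>) \<partial>P z) * indicator {0..} q"
      using m by (subst nn_integral_multc) (auto simp: nn_integral_cmult)
    then show "(\<integral>\<^sup>+\<omega>. ?D \<omega> q \<partial>P z) = (indicator {0..} q * (\<integral>\<^sup>+\<omega>. wt \<alpha> l (tau x q \<omega>) \<omega> \<partial>P z)) * (ennreal lam * R \<alpha> ?l x y)"
      using wt_tau_strong_markov[OF a _ G_measurable[of \<alpha> ?l y], where q=q and l=l and x=x and z=z]
      by (cases "0 \<le> q") (auto simp: R_def mult_ac)
  qed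
  also have "\<dots> = R \<alpha> l z x * (ennreal lam * R \<alpha> ?l x y)"
  proof -
    have "(\<lambda>q. \<integral>\<^sup>+\<omega>. wt \<alpha> l (tau x q \<omega>) \<omega> \<partial>P z) \<in> borel_measurable lborel"
    proof (rule Pz.borel_measurable_nn_integral)
      have "(\<lambda>p. wt \<alpha> l (tau x (fst p) (snd p)) (snd p)) \<in> borel_measurable (lborel \<Otimes>\<^sub>M P z)"
        by (intro wt_tau_comp measurable_compose[OF measurable_snd id_comp]) simp
      then show "(\<lambda>(q, \<omega>). wt \<alpha> l (tau x q \<omega>) \<omega>) \<in> borel_measurable (lborel \<Otimes>\<^sub>M P z)" by (simp add: case_prod_beta)
    qed
    then show ?thesis by (subst nn_integral_multc) (auto simp: nn_integral_wt_swap)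
  qed
  finally show ?thesis by (simp add: mult_ac)
qed

section \<open>Regeneration at inverse local times\<close>

definition wbar :: "real \<Rightarrow> (real \<times> 's) list \<Rightarrow> 's \<Rightarrow> real \<Rightarrow> 's \<Rightarrow> ennreal" where
  "wbar \<alpha> l y r z = (\<integral>\<^sup>+\<omega>. wt \<alpha> l (tau y r \<omega>) \<omega> \<partial>P z)"

lemma wbar_le_1: "wbar \<alpha> l y r z \<le> 1"
proof -
  have "wbar \<alpha> l y r z \<le> (\<integral>\<^sup>+\<omega>. 1 \<partial>P z)" unfolding wbar_def by (intro nn_integral_mono wt_le_1)
  then show ?thesis by simp
qed

lemma R_eq_wbar: "R \<alpha> l z y = (\<integral>\<^sup>+r. indicator {0..} r * wbar \<alpha> l y r z \<partial>lborel)"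
  using nn_integral_wt_swap[where \<alpha>=\<alpha> and l=l and x=y and z=z] by (simp add: wbar_def)

lemma tau_add:
  assumes g: "good y \<omega>" and s: "0 \<le> s" "0 \<le> t" and fin: "tau y s \<omega> < \<top>"
  shows "tau y (s + t) \<omega> = tau y s \<omega> + tau y t (\<theta> (enn2real (tau y s \<omega>)) \<omega>)"
  using tau_shift[OF g, of "enn2real (tau y s \<omega>)" "s + t"] LT_tau[OF g s(1) fin] fin s by simp

lemma wt_tau_add:
  assumes a: "0 < \<alpha>" and g: "good y \<omega>" and gl: "goods l \<omega>" and s: "0 \<le> s" "0 \<le> t"
  shows "wt \<alpha> l (tau y (s + t) \<omega>) \<omega> = wt \<alpha> l (tau y s \<omega>) \<omega>
    * wt \<alpha> l (tau y t (\<theta> (enn2real (tau y s \<omega>)) \<omega>)) (\<theta> (enn2real (tau y s \<omega>)) \<omega>)"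
proof (cases "tau y s \<omega> = \<top>")
  case True
  then have "tau y (s + t) \<omega> = \<top>" using tau_mono[of s "s + t" y \<omega>] s by (simp add: top_unique)
  then show ?thesis using True by (simp add: wt_top[OF a])
next
  case False
  then have fin: "tau y s \<omega> < \<top>" by (simp add: less_top)
  then have e: "tau y s \<omega> = ennreal (enn2real (tau y s \<omega>))" by simp
  show ?thesis using wt_shift[OF gl _ a, of "enn2real (tau y s \<omega>)"] tau_add[OF g s fin] e by simp
qed

text \<open>The path is at y when it passes level s there, and starts afresh; the initial point z
  affects only the first factor.\<close>

lemma wbar_add:
  assumes a: "0 < \<alpha>" and s: "0 \<le> s" "0 \<le> t"
  shows "wbar \<alpha> l y (s + t) z = wbar \<alpha> l y s z * wbar \<alpha> l y t y"
proof -
  have "wbar \<alpha> l y (s + t) z = (\<integral>\<^sup>+\<omega>. wt \<alpha> l (tau y s \<omega>) \<omega>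
    * wt \<alpha> l (tau y t (\<theta> (enn2real (tau y s \<omega>)) \<omega>)) (\<theta> (enn2real (tau y s \<omega>)) \<omega>) \<partial>P z)"
    unfolding wbar_def using AE_good[of y z] AE_goods[of l z]
    by (intro nn_integral_cong_AE, eventually_elim) (intro wt_tau_add[OF a _ _ s], auto)
  also have "\<dots> = wbar \<alpha> l y s z * wbar \<alpha> l y t y"
    unfolding wbar_def by (rule wt_tau_strong_markov[OF a s(1)]) (intro wt_tau_comp; simp)
  finally show ?thesis .
qed

text \<open>The case \<open>s = 0\<close> of \<open>wbar_add\<close>, integrated over levels: the
  path first has to survive until local time at y begins to grow.\<close>

lemma R_factor:
  assumes a: "0 < \<alpha>"
  shows "R \<alpha> l z y = wbar \<alpha> l y 0 z * R \<alpha> l y y"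
proof -
  have "R \<alpha> l z y = (\<integral>\<^sup>+r. wbar \<alpha> l y 0 z * (indicator {0..} r * wbar \<alpha> l y r y) \<partial>lborel)"
    unfolding R_eq_wbar[of \<alpha> l z y]
  proof (rule nn_integral_cong)
    fix r :: real
    have "wbar \<alpha> l y r z = wbar \<alpha> l y 0 z * wbar \<alpha> l y r y" if "0 \<le> r"
      using wbar_add[OF a order_refl that, of l y z] by (simp only: add_0_left)
    then show "indicator {0..} r * wbar \<alpha> l y r z = wbar \<alpha> l y 0 z * (indicator {0..} r * wbar \<alpha> l y r y)"
      by (cases "0 \<le> r") (simp_all only: indicator_simps atLeast_iff mult_1_left mult_zero_left mult_zero_right not_le simp_thms)
  qed
  also have "\<dots> = wbar \<alpha> l y 0 z * R \<alpha> l y y"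
  proof -
    interpret Py: prob_space "P y" by (rule prob_space_P)
    have "(\<lambda>q. wbar \<alpha> l y q y) \<in> borel_measurable lborel"
      unfolding wbar_def
    proof (rule Py.borel_measurable_nn_integral)
      have "(\<lambda>p. wt \<alpha> l (tau y (fst p) (snd p)) (snd p)) \<in> borel_measurable (lborel \<Otimes>\<^sub>M P y)"
        by (intro wt_tau_comp measurable_compose[OF measurable_snd id_comp]) simp
      then show "(\<lambda>(q, \<omega>). wt \<alpha> l (tau y q \<omega>) \<omega>) \<in> borel_measurable (lborel \<Otimes>\<^sub>M P y)" by (simp add: case_prod_beta)
    qed
    then show ?thesis unfolding R_eq_wbar[of \<alpha> l y y] by (intro nn_integral_cmult) (simp add: borel_measurable_times_ennreal)
  qed
  finally show ?thesis .
qed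

text \<open>The \<open>\<alpha>\<close>-potential density of the process killed when its local time at \<open>a\<close> starts to grow.\<close>

definition UG :: "real \<Rightarrow> 's \<Rightarrow> 's \<Rightarrow> 'w \<Rightarrow> ennreal" where
  "UG \<alpha> a y \<omega> = (\<integral>\<^sup>+q. wt \<alpha> [] (tau y q \<omega>) \<omega> * (if 0 \<le> q \<and> tau y q \<omega> < tau a 0 \<omega> then 1 else 0) \<partial>lborel)"

definition U :: "real \<Rightarrow> 's \<Rightarrow> 's \<Rightarrow> 's \<Rightarrow> ennreal" where
  "U \<alpha> a z y = (\<integral>\<^sup>+\<omega>. UG \<alpha> a y \<omega> \<partial>P z)"

lemma UG_measurable: "UG \<alpha> a y \<in> borel_measurable (F \<top>)"
proof -
  have [measurable]: "(\<lambda>x. wt \<alpha> [] (tau y (snd x) (fst x)) (fst x)) \<in> borel_measurable (F \<top> \<Otimes>\<^sub>M lborel)"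
    "(\<lambda>x. tau y (snd x) (fst x)) \<in> borel_measurable (F \<top> \<Otimes>\<^sub>M lborel)"
    "(\<lambda>x. tau a 0 (fst x)) \<in> borel_measurable (F \<top> \<Otimes>\<^sub>M (lborel :: real measure))"
    by (intro wt_tau_comp tau_comp; simp)+
  show ?thesis unfolding UG_def[abs_def]
    by (intro lborel.borel_measurable_nn_integral) (simp add: case_prod_beta)
qed

text \<open>Split the levels q at y by whether \<open>tau y q\<close> comes before
  \<open>tau b 0\<close>. The remaining ones are collected by the path restarted at b.\<close>

lemma u_decomp:
  assumes a: "0 < \<alpha>"
  shows "u \<alpha> z y = U \<alpha> b z y + wbar \<alpha> [] b 0 z * u \<alpha> b y"
proof -
  have eq: "G \<alpha> [] y \<omega> = UG \<alpha> b y \<omega> + wt \<alpha> [] (tau b 0 \<omega>) \<omega> * G \<alpha> [] y (\<theta> (enn2real (tau b 0 \<omega>)) \<omega>)"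
    if gy: "good y \<omega>" and gl: "goods [] \<omega>" for \<omega>
  proof -
    have w: "\<omega> \<in> space W" using goodD(1)[OF gy] .
    have wm: "(\<lambda>r. wt \<alpha> [] (tau y r \<omega>') \<omega>') \<in> borel_measurable borel" if "\<omega>' \<in> space W" for \<omega>'
      by (intro wt_tau_comp const_comp[OF that]) simp
    note [measurable] = wm[OF w]
    have [measurable]: "(\<lambda>r. tau y r \<omega>) \<in> borel_measurable borel" by (intro tau_comp const_comp[OF w]) simp
    let ?I = "\<lambda>q. wt \<alpha> [] (tau y q \<omega>) \<omega> * (if 0 \<le> q \<and> \<not> tau y q \<omega> < tau b 0 \<omega> then 1 else 0)"
    have "G \<alpha> [] y \<omega> = (\<integral>\<^sup>+q. wt \<alpha> [] (tau y q \<omega>) \<omega> * (if 0 \<le> q \<and> tau y q \<omega> < tau b 0 \<omega> then 1 else 0) + ?I q \<partial>lborel)"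
      unfolding G_def by (intro nn_integral_cong) (auto simp: indicator_def)
    also have "\<dots> = UG \<alpha> b y \<omega> + (\<integral>\<^sup>+q. ?I q \<partial>lborel)"
      unfolding UG_def by (intro nn_integral_add) measurable
    also have "(\<integral>\<^sup>+q. ?I q \<partial>lborel) = wt \<alpha> [] (tau b 0 \<omega>) \<omega> * G \<alpha> [] y (\<theta> (enn2real (tau b 0 \<omega>)) \<omega>)"
    proof (cases "tau b 0 \<omega> = \<top>")
      case True
      have "?I q = 0" for q using True wt_top[OF a] by (auto simp: less_top[symmetric])
      then have "(\<integral>\<^sup>+q. ?I q \<partial>lborel) = 0" by (simp only: nn_integral_const) simp
      then show ?thesis using True by (simp add: wt_top[OF a])
    next
      case False
      define v where "v = enn2real (tau b 0 \<omega>)"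
      have v: "tau b 0 \<omega> = ennreal v" "0 \<le> v" using False by (auto simp: v_def less_top)
      let ?c = "LT y v \<omega>"
      have c0: "0 \<le> ?c" by (rule goodD(7)[OF gy])
      have wv: "\<theta> v \<omega> \<in> space W" using shift[OF v(2) w] by simp
      define H where "H r = wt \<alpha> [] (tau y r (\<theta> v \<omega>)) (\<theta> v \<omega>)" for r
      have H [measurable]: "H \<in> borel_measurable borel" unfolding H_def[abs_def] by (rule wm[OF wv])
      have "?I q = wt \<alpha> [] (tau b 0 \<omega>) \<omega> * (H (q - ?c) * indicator {?c..} q)" for q
      proof (cases "?c \<le> q")
        case True
        have "tau y q \<omega> = ennreal v + tau y (q - ?c) (\<theta> v \<omega>)" by (rule tau_shift[OF gy v(2) True])
        then have "wt \<alpha> [] (tau y q \<omega>) \<omega> = wt \<alpha> [] (tau b 0 \<omega>) \<omega> * H (q - ?c)"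
          using wt_shift[OF gl v(2) a] v by (simp add: H_def)
        moreover have "\<not> tau y q \<omega> < tau b 0 \<omega>"
          using tau_less_iff[OF gy _ v(2), of q] v True c0 by simp
        ultimately show ?thesis using True c0 by simp
      next
        case False
        then have "tau y q \<omega> < tau b 0 \<omega>" if "0 \<le> q" using tau_less_iff[OF gy that v(2)] v by simp
        then show ?thesis using False by auto
      qed
      then have "(\<integral>\<^sup>+q. ?I q \<partial>lborel) = (\<integral>\<^sup>+q. wt \<alpha> [] (tau b 0 \<omega>) \<omega> * (H (q - ?c) * indicator {?c..} q) \<partial>lborel)"
        by (simp only:)
      also have "\<dots> = wt \<alpha> [] (tau b 0 \<omega>) \<omega> * (\<integral>\<^sup>+r. H r * indicator {0..} r \<partial>lborel)"
        by (subst nn_integral_cmult) (simp_all add: nn_integral_shift_atLeast)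
      finally show ?thesis by (simp add: G_def H_def v_def)
    qed
    finally show ?thesis .
  qed
  have m: "UG \<alpha> b y \<in> borel_measurable (P z)" by (rule measurable_F_P[OF UG_measurable])
  have m2: "(\<lambda>\<omega>. wt \<alpha> [] (tau b 0 \<omega>) \<omega> * G \<alpha> [] y (\<theta> (enn2real (tau b 0 \<omega>)) \<omega>)) \<in> borel_measurable (P z)"
    by (intro borel_measurable_times_ennreal wt_tau_comp G_comp theta_comp tau_comp id_comp) auto
  have "u \<alpha> z y = R \<alpha> [] z y" by (simp add: R_Nil[OF a])
  also have "\<dots> = (\<integral>\<^sup>+\<omega>. UG \<alpha> b y \<omega> + wt \<alpha> [] (tau b 0 \<omega>) \<omega> * G \<alpha> [] y (\<theta> (enn2real (tau b 0 \<omega>)) \<omega>) \<partial>P z)"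
    unfolding R_def using AE_good[of y z] AE_goods[of "[]" z]
    by (intro nn_integral_cong_AE, eventually_elim) (intro eq, auto)
  also have "\<dots> = U \<alpha> b z y + wbar \<alpha> [] b 0 z * R \<alpha> [] b y"
    unfolding U_def nn_integral_add[OF m m2] wt_tau_strong_markov[OF a order_refl G_measurable] wbar_def R_def ..
  finally show ?thesis by (simp add: R_Nil[OF a])
qed

end

section \<open>Hitting times\<close>

text \<open>The preimages under the two functions differ by subsets of a null set, and the
  completion measures these.\<close>

lemma measurable_completion_AE:
  assumes g': "g' \<in> measurable M K" and eq: "AE x in M. g x = g' x" and sp: "\<And>x. x \<in> space M \<Longrightarrow> g x \<in> space K"
  shows "g \<in> measurable (completion M) K"
proof (rule measurableI)
  fix B assume B: "B \<in> sets K"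
  have 1: "Measurable.pred (completion M) (\<lambda>x. g' x \<in> B \<and> g x \<notin> B)"
    by (rule sets_completion_AE) (use eq in \<open>auto elim!: eventually_mono\<close>)
  have 2: "Measurable.pred (completion M) (\<lambda>x. g x \<in> B \<and> g' x \<notin> B)"
    by (rule sets_completion_AE) (use eq in \<open>auto elim!: eventually_mono\<close>)
  have 3: "Measurable.pred (completion M) (\<lambda>x. g' x \<in> B)"
    using measurable_completion[OF g'] B by measurable
  have "Measurable.pred (completion M) (\<lambda>x. (g' x \<in> B \<and> \<not> (g' x \<in> B \<and> g x \<notin> B)) \<or> (g x \<in> B \<and> g' x \<notin> B))"
    by (intro pred_intros_logic 1 2 3)
  then have "Measurable.pred (completion M) (\<lambda>x. g x \<in> B)"
    by (rule measurable_cong[THEN iffD1, rotated]) auto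
  then show "g -` B \<inter> space (completion M) \<in> sets (completion M)"
    by (simp add: pred_def Int_def vimage_def conj_commute)
qed (use sp in simp)

lemma integral_completion_AE:
  fixes g g' :: "'a \<Rightarrow> real"
  assumes g': "g' \<in> borel_measurable M" and eq: "AE x in M. g x = g' x"
  shows "(\<integral>x. g x \<partial>completion M) = (\<integral>x. g' x \<partial>M)"
proof -
  have "(\<integral>x. g x \<partial>completion M) = (\<integral>x. g' x \<partial>completion M)"
    by (rule integral_cong_AE[OF measurable_completion_AE[OF g' eq] measurable_completion[OF g'] AE_completion[OF eq]]) simp
  also have "\<dots> = (\<integral>x. g' x \<partial>M)" by (rule integral_completion[OF g'])
  finally show ?thesis .
qed

text \<open>Splitting off \<open>[0, h)\<close> bounds \<open>g h\<close> to first order on both sides; then use \<open>g t = g (t / n) ^ n\<close>.\<close>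

lemma multiplicative_eq_exp:
  fixes g :: "real \<Rightarrow> real"
  assumes meas [measurable]: "g \<in> borel_measurable borel"
    and g01: "\<And>t. 0 \<le> t \<Longrightarrow> 0 \<le> g t" "\<And>t. 0 \<le> t \<Longrightarrow> g t \<le> 1"
    and mult: "\<And>s t. 0 \<le> s \<Longrightarrow> 0 \<le> t \<Longrightarrow> g (s + t) = g s * g t"
    and int: "(\<integral>\<^sup>+r. indicator {0..} r * ennreal (g r) \<partial>lborel) = ennreal \<rho>" and \<rho>: "0 < \<rho>" and t: "0 \<le> t"
  shows "g t = exp (- t / \<rho>)"
proof -
  have bounds: "1 - h / \<rho> \<le> g h \<and> g h * (1 + h / \<rho>) \<le> 1" if h: "0 < h" for h
  proof -
    have "(\<integral>\<^sup>+r. ennreal (g r) * indicator {h..} r \<partial>lborel) = (\<integral>\<^sup>+r. ennreal (g h) * (ennreal (g (r - h)) * indicator {h..} r) \<partial>lborel)"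
    proof (rule nn_integral_cong)
      fix r
      show "ennreal (g r) * indicator {h..} r = ennreal (g h) * (ennreal (g (r - h)) * indicator {h..} r)"
        using mult[of h "r - h"] g01(1)[of h] g01(1)[of "r - h"] h
        by (cases "h \<le> r") (auto simp: ennreal_mult[symmetric])
    qed
    also have "\<dots> = ennreal (g h) * (\<integral>\<^sup>+r. ennreal (g r) * indicator {0..} r \<partial>lborel)"
      using nn_integral_shift_atLeast[of "\<lambda>r. ennreal (g r)" h] by (subst nn_integral_cmult) auto
    finally have tail: "(\<integral>\<^sup>+r. ennreal (g r) * indicator {h..} r \<partial>lborel) = ennreal (g h * \<rho>)"
      using int g01(1)[of h] h \<rho> by (simp add: ennreal_mult mult.commute[of "indicator _ _"])
    have head: "ennreal \<rho> = (\<integral>\<^sup>+r. ennreal (g r) * indicator {0..<h} r \<partial>lborel) + ennreal (g h * \<rho>)"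
      unfolding int[symmetric] tail[symmetric] using h
      by (subst nn_integral_add[symmetric]) (auto intro!: nn_integral_cong simp: indicator_def)
    have up: "(\<integral>\<^sup>+r. ennreal (g r) * indicator {0..<h} r \<partial>lborel) \<le> (\<integral>\<^sup>+r. indicator {0..<h} r \<partial>lborel)"
      by (intro nn_integral_mono) (auto simp: indicator_def g01)
    have mono: "g h \<le> g r" if "0 \<le> r" "r < h" for r
      using mult[of r "h - r"] that g01[of r] g01[of "h - r"] by (simp add: mult_left_le)
    have low: "(\<integral>\<^sup>+r. ennreal (g h) * indicator {0..<h} r \<partial>lborel) \<le> (\<integral>\<^sup>+r. ennreal (g r) * indicator {0..<h} r \<partial>lborel)"
      using mono by (intro nn_integral_mono) (auto simp: indicator_def intro!: ennreal_leI)
    have "ennreal \<rho> \<le> ennreal h + ennreal (g h * \<rho>)"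
      unfolding head using up h by (intro add_right_mono) simp
    then have "\<rho> \<le> h + g h * \<rho>" using h g01(1)[of h] \<rho> by (simp flip: ennreal_plus)
    moreover have "ennreal (g h * h) + ennreal (g h * \<rho>) \<le> ennreal \<rho>"
      unfolding head using low h g01(1)[of h] by (intro add_right_mono) (simp add: nn_integral_cmult ennreal_mult)
    then have "g h * h + g h * \<rho> \<le> \<rho>" using h g01(1)[of h] \<rho> by (simp flip: ennreal_plus)
    ultimately show ?thesis using \<rho> by (simp add: field_simps)
  qed
  \<comment> \<open>\<open>g 0\<close> is idempotent, and the value 0 would make the integral \<rho>
    vanish.\<close>
  have g0: "g 0 = 1"
  proof (rule ccontr)
    assume "g 0 \<noteq> 1"
    moreover have "g 0 * (1 - g 0) = 0" using mult[of 0 0] by (simp add: right_diff_distrib)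
    ultimately have "g 0 = 0" by auto
    then have z: "g r = 0" if "0 \<le> r" for r using mult[of 0 r] that by simp
    have "(\<integral>\<^sup>+r. indicator {0..} r * ennreal (g r) \<partial>lborel) = (\<integral>\<^sup>+r. 0 \<partial>(lborel :: real measure))"
      by (intro nn_integral_cong) (auto simp: indicator_def z)
    then show False using int \<rho> by simp
  qed
  show ?thesis
  proof (cases "t = 0")
    case True
    then show ?thesis using g0 by simp
  next
    case False
    then have t: "0 < t" using t by simp
    have pow: "g (real n * h) = g h ^ n" if "0 \<le> h" for n h
    proof (induct n)
      case (Suc n)
      have "g (real (Suc n) * h) = g (h + real n * h)" by (simp add: distrib_right)
      then show ?case using Suc mult[of h "real n * h"] that by simp
    qed (simp add: g0)
    have gn: "g t = g (t / real n) ^ n" if "0 < n" for n using pow[of "t / real n" n] that t by simp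
    have low: "(\<lambda>n. (1 + (- t / \<rho>) / real n) ^ n) \<longlonglongrightarrow> exp (- t / \<rho>)" by (rule tendsto_exp_limit_sequentially)
    have up: "(\<lambda>n. inverse ((1 + (t / \<rho>) / real n) ^ n)) \<longlonglongrightarrow> inverse (exp (t / \<rho>))"
      by (intro tendsto_inverse tendsto_exp_limit_sequentially) simp
    have "exp (- t / \<rho>) \<le> g t"
    proof (rule LIMSEQ_le_const2[OF low])
      \<comment> \<open>Beyond N the base is nonnegative, as monotonicity of the power
        requires.\<close>
      obtain N :: nat where N: "t / \<rho> < real N" using reals_Archimedean2 by blast
      show "\<exists>N. \<forall>n\<ge>N. (1 + (- t / \<rho>) / real n) ^ n \<le> g t"
      proof (intro exI[of _ "Suc N"] allI impI)
        fix n assume n: "Suc N \<le> n"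
        then have n0: "0 < n" by simp
        have "t / \<rho> < real n" using N n by linarith
        then have "(t / \<rho>) / real n \<le> 1" using n0 \<rho> by (simp add: field_simps)
        then have "0 \<le> 1 + (- t / \<rho>) / real n" by simp
        moreover have "1 + (- t / \<rho>) / real n \<le> g (t / real n)"
          using bounds[of "t / real n"] t n0 by (simp add: field_simps)
        ultimately show "(1 + (- t / \<rho>) / real n) ^ n \<le> g t"
          unfolding gn[OF n0] by (rule power_mono[rotated])
      qed
    qed
    moreover have "g t \<le> inverse (exp (t / \<rho>))"
    proof (rule LIMSEQ_le_const[OF up])
      show "\<exists>N. \<forall>n\<ge>N. g t \<le> inverse ((1 + (t / \<rho>) / real n) ^ n)"
      proof (intro exI[of _ 1] allI impI)
        fix n :: nat assume "1 \<le> n"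
        then have n0: "0 < n" by simp
        have pos: "0 < 1 + (t / \<rho>) / real n" using t \<rho> n0 by (simp add: add_pos_nonneg)
        have "g (t / real n) * (1 + (t / \<rho>) / real n) \<le> 1"
          using bounds[of "t / real n"] t n0 by (simp add: field_simps)
        then have "g (t / real n) \<le> inverse (1 + (t / \<rho>) / real n)" using pos by (simp add: field_simps)
        then show "g t \<le> inverse ((1 + (t / \<rho>) / real n) ^ n)"
          unfolding gn[OF n0] power_inverse[symmetric] using g01(1)[of "t / real n"] t by (intro power_mono) auto
      qed
    qed
    ultimately show ?thesis by (simp add: exp_minus)
  qed
qed

locale ray_knight = local_time_process m p W X \<theta> P f
  for m :: "'s::{metric_space, second_countable_topology} measure"
    and p :: "real \<Rightarrow> 's \<Rightarrow> 's \<Rightarrow> real"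
    and W :: "'w measure"
    and X :: "real \<Rightarrow> 'w \<Rightarrow> 's option"
    and \<theta> :: "real \<Rightarrow> 'w \<Rightarrow> 'w"
    and P :: "'s \<Rightarrow> 'w measure"
    and f :: "real \<Rightarrow> 's \<Rightarrow> 's \<Rightarrow> real" +
  fixes a :: 's
  assumes pot_inf: "potential_density p 0 a a = \<infinity>"
    and hit: "\<And>y. AE \<omega> in P y. hitting_time X a \<omega> < \<infinity>"
begin

definition gam :: "real \<Rightarrow> real" where "gam \<alpha> = enn2real (u \<alpha> a a)"

text \<open>If it vanished, \<open>p t a a\<close> would be 0 for almost every positive t, and then
  the 0-potential would vanish as well instead of being infinite.\<close>

lemma gam_pos: assumes al: "0 < \<alpha>" shows "0 < gam \<alpha>"
proof (rule ccontr)
  assume "\<not> 0 < gam \<alpha>"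
  then have "gam \<alpha> = 0" by (simp add: gam_def less_le)
  then have z: "u \<alpha> a a = 0" using u_real[OF al, of a a] by (simp add: gam_def)
  have [measurable]: "(\<lambda>t. if 0 < t then p t a a else 0) \<in> borel_measurable borel"
  proof -
    have "(\<lambda>t. (t, a, a)) \<in> measurable (restrict_space borel {0<..}) (restrict_space borel {0<..} \<Otimes>\<^sub>M borel \<Otimes>\<^sub>M borel)"
      by (intro measurable_Pair) auto
    from measurable_compose[OF this p_measurable] have "(\<lambda>t. p t a a) \<in> borel_measurable (restrict_space borel {0<..})" by simp
    then show ?thesis by (subst (asm) measurable_restrict_space_iff[where c=0]) auto
  qed
  have e: "(\<integral>\<^sup>+t\<in>{0<..}. ennreal (exp (- \<beta> * t) * p t a a) \<partial>lborel)
    = (\<integral>\<^sup>+t. ennreal (exp (- \<beta> * t) * (if 0 < t then p t a a else 0)) \<partial>lborel)" for \<beta>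
    by (intro nn_integral_cong) (auto simp: indicator_def)
  have "(\<integral>\<^sup>+t. ennreal (exp (- \<alpha> * t) * (if 0 < t then p t a a else 0)) \<partial>lborel) = 0"
    using z e[of \<alpha>] by (simp add: potential_density_def)
  then have "AE t in lborel. ennreal (exp (- \<alpha> * t) * (if 0 < t then p t a a else 0)) = 0"
    by (subst (asm) nn_integral_0_iff_AE) auto
  then have "AE t in lborel. ennreal (exp (- 0 * t) * (if 0 < t then p t a a else 0)) = 0"
    by eventually_elim (auto simp: ennreal_eq_0_iff mult_le_0_iff)
  then have "(\<integral>\<^sup>+t. ennreal (exp (- 0 * t) * (if 0 < t then p t a a else 0)) \<partial>lborel) = 0"
    by (subst nn_integral_0_iff_AE) auto
  then have "u 0 a a = 0" using e[of 0] by (simp add: potential_density_def)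
  then show False using pot_inf by simp
qed

lemma u_gam: "0 < \<alpha> \<Longrightarrow> u \<alpha> a a = ennreal (gam \<alpha>)"
  using u_real[of \<alpha> a a] by (simp add: gam_def)

lemma u_wbar: "0 < \<alpha> \<Longrightarrow> u \<alpha> z a = wbar \<alpha> [] a 0 z * ennreal (gam \<alpha>)"
  using R_factor[of \<alpha> "[]" z a] by (simp add: R_Nil u_gam)

lemma tau_0_shift:
  assumes g: "good a \<omega>" and v: "0 \<le> v" and le: "ennreal v \<le> tau a 0 \<omega>"
  shows "tau a 0 \<omega> = ennreal v + tau a 0 (\<theta> v \<omega>)"
proof -
  have "LT a v \<omega> \<le> 0" using tau_less_iff[OF g order_refl v] le by (simp add: not_less[symmetric])
  then have "LT a v \<omega> = 0" using goodD(7)[OF g, of v] by simp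
  then show ?thesis using tau_shift[OF g v, of 0] by simp
qed

text \<open>A level set of the 1-potential rather than a ball: by \<open>u_wbar\<close> the ratio of
  \<open>u 1 x a\<close> to \<open>gam 1\<close> is the expected discount up to
  \<open>tau a 0\<close>, so this discount is at least \<open>1 - eps n\<close> even on the
  closure.\<close>

definition near_set :: "nat \<Rightarrow> 's set" where
  "near_set n = {z. gam 1 * (1 - eps n) < enn2real (u 1 z a)}"

definition near_time :: "nat \<Rightarrow> 'w \<Rightarrow> ennreal" where
  "near_time n \<omega> = Inf (ennreal ` {q. q \<in> \<rat> \<and> 0 \<le> q \<and> X q \<omega> \<in> Some ` near_set n})"

lemma u1_cont: "continuous_on UNIV (\<lambda>z. enn2real (u 1 z a))"
proof -
  have "continuous_on UNIV ((\<lambda>(y, z). enn2real (u 1 y z)) \<circ> (\<lambda>z. (z, a)))"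
    by (intro continuous_on_compose continuous_intros continuous_on_subset[OF pot_cont[OF zero_less_one]]) auto
  then show ?thesis by (simp add: o_def)
qed

lemma near_set_open: "open (near_set n)"
  unfolding near_set_def by (intro open_Collect_less u1_cont continuous_on_const)

lemma near_set_closure: "closure (near_set n) \<subseteq> {z. gam 1 * (1 - eps n) \<le> enn2real (u 1 z a)}"
  by (rule closure_minimal) (auto simp: near_set_def intro!: closed_Collect_le u1_cont continuous_on_const)

lemma a_near: "a \<in> near_set n"
  using gam_pos[of 1] by (simp add: near_set_def gam_def[symmetric])

lemma near_time_less: "near_time n \<omega> < v \<longleftrightarrow> (\<exists>q\<in>{q. q \<in> \<rat> \<and> 0 \<le> q \<and> ennreal q < v}. X q \<omega> \<in> Some ` near_set n)"
  unfolding near_time_def Inf_less_iff by auto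

lemma near_time_stops: "stops (near_time n)"
proof (rule stopsI)
  fix v
  have "{\<omega> \<in> space W. near_time n \<omega> < v} = (\<Union>q\<in>{q. q \<in> \<rat> \<and> 0 \<le> q \<and> ennreal q < v}. {\<omega> \<in> space W. X q \<omega> \<in> Some ` near_set n})"
    by (auto simp: near_time_less)
  also have "\<dots> \<in> sets (F v)"
    by (intro sets.countable_UN'[OF countable_rats]) (auto intro!: X_sets_F borel_open near_set_open simp: less_imp_le)
  finally show "{\<omega> \<in> space W. near_time n \<omega> < v} \<in> sets (F v)" .
qed

lemma near_time_le_hitting:
  assumes w: "\<omega> \<in> space W" shows "near_time n \<omega> \<le> hitting_time X a \<omega>"
  unfolding hitting_time_def
proof (rule Inf_greatest, clarify)
  fix s assume s: "0 \<le> s" "X s \<omega> = Some a"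
  obtain \<delta> where d: "\<delta> > 0" "\<And>r. s < r \<Longrightarrow> r < s + \<delta> \<Longrightarrow> X r \<omega> \<in> Some ` near_set n"
    using eventually_in_open[OF s(1) w s(2) near_set_open a_near] by blast
  show "near_time n \<omega> \<le> ennreal s"
  proof (rule ennreal_le_epsilon)
    fix e :: real assume e: "0 < e"
    obtain q where q: "q \<in> \<rat>" "s < q" "q < s + min \<delta> e" using Rats_dense_in_real[of s "s + min \<delta> e"] d e by auto
    then have "near_time n \<omega> \<le> ennreal q"
      unfolding near_time_def using s d(2)[of q] by (intro Inf_lower imageI) auto
    also have "\<dots> \<le> ennreal (s + e)" using q by (intro ennreal_leI) auto
    finally show "near_time n \<omega> \<le> ennreal s + ennreal e" using s e by simp
  qed
qed

lemma hitting_le_tau: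
  assumes g: "good a \<omega>" shows "hitting_time X a \<omega> \<le> tau a 0 \<omega>"
proof (cases "tau a 0 \<omega> = \<top>")
  case False
  then have fin: "tau a 0 \<omega> < \<top>" by (simp add: less_top)
  have "hitting_time X a \<omega> \<le> ennreal (enn2real (tau a 0 \<omega>))"
    unfolding hitting_time_def using X_tau[OF g order_refl fin] by (intro Inf_lower imageI) auto
  then show ?thesis using fin by simp
qed simp

text \<open>The infimum over rational times need not be attained; right continuity still places the
  path in the closure of the open set, where the bound on the potential holds with
  \<open>\<le>\<close>.\<close>

lemma near_time_state:
  assumes w: "\<omega> \<in> space W" and fin: "near_time n \<omega> < \<top>"
  obtains x where "X (enn2real (near_time n \<omega>)) \<omega> = Some x" "gam 1 * (1 - eps n) \<le> enn2real (u 1 x a)"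
proof -
  let ?s = "enn2real (near_time n \<omega>)"
  have s: "near_time n \<omega> = ennreal ?s" using fin by simp
  have "X ?s \<omega> \<in> Some ` closure (near_set n)"
  proof (cases "X ?s \<omega> \<in> Some ` near_set n")
    case True
    then show ?thesis using closure_subset by blast
  next
    case False
    show ?thesis
    proof (rule in_closure[OF _ w])
      fix \<delta> :: real assume d: "0 < \<delta>"
      have "near_time n \<omega> < ennreal (?s + \<delta>)" using d by (subst s) (intro ennreal_lessI, auto simp: add_nonneg_pos)
      then obtain q where q: "q \<in> \<rat>" "0 \<le> q" "ennreal q < ennreal (?s + \<delta>)" "X q \<omega> \<in> Some ` near_set n"
        unfolding near_time_less by auto
      have "near_time n \<omega> \<le> ennreal q" unfolding near_time_def using q by (intro Inf_lower imageI) auto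
      then have "?s \<le> q" using q(2) s by (metis ennreal_le_iff)
      moreover have "q \<noteq> ?s" using q(4) False by auto
      moreover have "q < ?s + \<delta>" using q(2,3) by (simp add: ennreal_less_iff del: ennreal_plus)
      ultimately show "\<exists>s>?s. s < ?s + \<delta> \<and> X s \<omega> \<in> Some ` near_set n" using q(4) by (intro exI[of _ q]) auto
    qed simp
  qed
  then show thesis using that near_set_closure by blast
qed

text \<open>Approximating the hitting time of the point by hitting times of open sets, which are stopping times,
  avoids measurability of hitting times of points. On the approximating set the expected discount
  until the local time starts to grow is almost \<open>1\<close>.\<close>

theorem AE_hitting_eq_tau: "AE \<omega> in P z. hitting_time X a \<omega> = tau a 0 \<omega>"
proof -
  interpret Pz: prob_space "P z" by (rule prob_space_P)
  have wt1: "wt 1 [] T \<omega> = ehat T" for T \<omega> by (simp add: wt_def Aw_simps)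
  have ST: "near_time n \<omega> \<le> tau a 0 \<omega>" if "good a \<omega>" for n \<omega>
    using near_time_le_hitting[OF goodD(1)[OF that]] hitting_le_tau[OF that] by (rule order_trans)
  have nm: "near_time n \<in> borel_measurable (P z)" for n by (rule measurable_F_P[OF stops_measurable[OF near_time_stops]])
  define T where "T \<omega> = (SUP n. near_time n \<omega>)" for \<omega>
  have Tm [measurable]: "T \<in> borel_measurable (P z)" unfolding T_def using nm by measurable
  have tm [measurable]: "tau a 0 \<in> borel_measurable (P z)" by (rule measurable_F_P[OF stops_measurable[OF tau_stops]])
  \<comment> \<open>\<open>tau a 0\<close> is \<open>near_time n\<close> plus the same time for the
    shifted path, whose expected discount is at least \<open>1 - eps n\<close>. As \<open>T\<close>
    is no earlier than \<open>near_time n\<close>, its discount is the smaller one.\<close>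
  have main: "ennreal (1 - eps n) * (\<integral>\<^sup>+\<omega>. ehat (T \<omega>) \<partial>P z) \<le> (\<integral>\<^sup>+\<omega>. ehat (tau a 0 \<omega>) \<partial>P z)" for n
  proof -
    let ?S = "near_time n"
    have Z: "(\<lambda>\<omega>. ehat (?S \<omega>)) \<in> borel_measurable (pre ?S)"
      by (rule measurable_compose[OF stops_measurable_pre[OF near_time_stops] ehat_measurable])
    have H: "(\<lambda>\<omega>. ehat (tau a 0 \<omega>)) \<in> borel_measurable (F \<top>)"
      by (rule measurable_compose[OF stops_measurable[OF tau_stops] ehat_measurable])
    have "ennreal (1 - eps n) * (\<integral>\<^sup>+\<omega>. ehat (T \<omega>) \<partial>P z) = (\<integral>\<^sup>+\<omega>. ennreal (1 - eps n) * ehat (T \<omega>) \<partial>P z)"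
      by (intro nn_integral_cmult[symmetric]) measurable
    also have "\<dots> \<le> (\<integral>\<^sup>+\<omega>. ehat (?S \<omega>) * (indicator (alive ?S) \<omega> * at_state (\<lambda>x. \<integral>\<^sup>+\<omega>'. ehat (tau a 0 \<omega>') \<partial>P x) (Xat ?S \<omega>)) \<partial>P z)"
    proof (rule nn_integral_mono)
      fix \<omega> assume "\<omega> \<in> space (P z)"
      then have w: "\<omega> \<in> space W" by simp
      have le: "ehat (T \<omega>) \<le> ehat (?S \<omega>)" unfolding T_def by (intro ehat_antimono SUP_upper) simp
      show "ennreal (1 - eps n) * ehat (T \<omega>) \<le> ehat (?S \<omega>) * (indicator (alive ?S) \<omega> * at_state (\<lambda>x. \<integral>\<^sup>+\<omega>'. ehat (tau a 0 \<omega>') \<partial>P x) (Xat ?S \<omega>))"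
      proof (cases "?S \<omega> < \<top>")
        case True
        obtain x where x: "X (enn2real (?S \<omega>)) \<omega> = Some x" "gam 1 * (1 - eps n) \<le> enn2real (u 1 x a)"
          using near_time_state[OF w True] by blast
        have "ennreal (1 - eps n) \<le> (\<integral>\<^sup>+\<omega>'. ehat (tau a 0 \<omega>') \<partial>P x)"
        proof -
          let ?h = "wbar 1 [] a 0 x"
          have h: "?h = (\<integral>\<^sup>+\<omega>'. ehat (tau a 0 \<omega>') \<partial>P x)" by (simp add: wbar_def wt1)
          have "?h \<noteq> \<top>" using wbar_le_1[of 1 "[]" a 0 x] by (auto simp: top_unique)
          then obtain r where r: "?h = ennreal r" "0 \<le> r" by (cases ?h) auto
          have "u 1 x a = ennreal (r * gam 1)" using u_wbar[of 1 x] r gam_pos[of 1] by (simp add: ennreal_mult)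
          then have "gam 1 * (1 - eps n) \<le> r * gam 1" using x(2) r gam_pos[of 1] by simp
          then have "1 - eps n \<le> r" using gam_pos[of 1] by (simp add: mult.commute)
          then show ?thesis using h r by (metis ennreal_leI)
        qed
        moreover have "Xat ?S \<omega> = Some x" "\<omega> \<in> alive ?S" using x True w by (auto simp: Xat_def alive_def)
        ultimately show ?thesis using le by (simp add: mult.commute mult_mono)
      next
        case False
        then have "ehat (T \<omega>) = 0" using le by (simp add: less_top[symmetric])
        then show ?thesis by simp
      qed
    qed
    also have "\<dots> = (\<integral>\<^sup>+\<omega>. ehat (?S \<omega>) * (indicator (alive ?S) \<omega> * ehat (tau a 0 (\<theta> (enn2real (?S \<omega>)) \<omega>))) \<partial>P z)"
      by (rule strong_markov_functional[OF near_time_stops Z H, symmetric])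
    also have "\<dots> \<le> (\<integral>\<^sup>+\<omega>. ehat (tau a 0 \<omega>) \<partial>P z)"
    proof (rule nn_integral_mono_AE)
      show "AE \<omega> in P z. ehat (?S \<omega>) * (indicator (alive ?S) \<omega> * ehat (tau a 0 (\<theta> (enn2real (?S \<omega>)) \<omega>))) \<le> ehat (tau a 0 \<omega>)"
        using AE_good[of a z]
      proof eventually_elim
        case (elim \<omega>)
        then have g: "good a \<omega>" by simp
        show ?case
        proof (cases "\<omega> \<in> alive ?S")
          case True
          then have fin: "?S \<omega> < \<top>" using aliveD by blast
          then have s: "?S \<omega> = ennreal (enn2real (?S \<omega>))" by simp
          have "tau a 0 \<omega> = ?S \<omega> + tau a 0 (\<theta> (enn2real (?S \<omega>)) \<omega>)"
            using tau_0_shift[OF g, of "enn2real (?S \<omega>)"] ST[OF g, of n] s by simp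
          then show ?thesis using True by (simp add: ehat_add)
        qed simp
      qed
    qed
    finally show ?thesis .
  qed
  have le1: "(\<integral>\<^sup>+\<omega>. ehat (T \<omega>) \<partial>P z) \<le> 1"
  proof -
    have "(\<integral>\<^sup>+\<omega>. ehat (T \<omega>) \<partial>P z) \<le> (\<integral>\<^sup>+\<omega>. 1 \<partial>P z)" by (intro nn_integral_mono ehat_le_1)
    then show ?thesis by simp
  qed
  have "(\<lambda>n. ennreal (1 - eps n) * (\<integral>\<^sup>+\<omega>. ehat (T \<omega>) \<partial>P z)) \<longlonglongrightarrow> ennreal 1 * (\<integral>\<^sup>+\<omega>. ehat (T \<omega>) \<partial>P z)"
  proof (intro tendsto_mult_ennreal tendsto_ennrealI tendsto_const)
    show "(\<lambda>n. 1 - eps n) \<longlonglongrightarrow> 1" unfolding eps_def by real_asymp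
  qed (use le1 in \<open>auto simp: top_unique\<close>)
  then have ge: "(\<integral>\<^sup>+\<omega>. ehat (T \<omega>) \<partial>P z) \<le> (\<integral>\<^sup>+\<omega>. ehat (tau a 0 \<omega>) \<partial>P z)"
    using main by (intro LIMSEQ_le_const2) auto
  \<comment> \<open>With \<open>ge\<close>, this order forces the two discounts to agree almost
    everywhere, and the hitting time is caught between \<open>T\<close> and
    \<open>tau a 0\<close>.\<close>
  have AEle: "AE \<omega> in P z. ehat (tau a 0 \<omega>) \<le> ehat (T \<omega>)"
    using AE_good[of a z] by eventually_elim (auto simp: T_def intro!: ehat_antimono SUP_least ST)
  have "(\<integral>\<^sup>+\<omega>. ehat (T \<omega>) - ehat (tau a 0 \<omega>) \<partial>P z) = (\<integral>\<^sup>+\<omega>. ehat (T \<omega>) \<partial>P z) - (\<integral>\<^sup>+\<omega>. ehat (tau a 0 \<omega>) \<partial>P z)"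
  proof (rule nn_integral_diff)
    have "(\<integral>\<^sup>+\<omega>. ehat (tau a 0 \<omega>) \<partial>P z) \<le> (\<integral>\<^sup>+\<omega>. ehat (T \<omega>) \<partial>P z)" by (rule nn_integral_mono_AE[OF AEle])
    then show "(\<integral>\<^sup>+\<omega>. ehat (tau a 0 \<omega>) \<partial>P z) \<noteq> \<infinity>" using le1 by (auto simp: top_unique)
  qed (use AEle in auto)
  also have "\<dots> = 0" using ge le1 by (simp add: diff_eq_0_ennreal top.not_eq_extremum le_less_trans)
  finally have "AE \<omega> in P z. ehat (T \<omega>) - ehat (tau a 0 \<omega>) = 0"
    by (subst (asm) nn_integral_0_iff_AE) auto
  then show ?thesis
    using AEle AE_good[of a z]
  proof eventually_elim
    case (elim \<omega>)
    then have g: "good a \<omega>" by simp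
    have eq: "ehat (T \<omega>) = ehat (tau a 0 \<omega>)"
      using elim ehat_le_1[of "T \<omega>"] by (intro antisym) (auto simp: diff_eq_0_iff_ennreal top_unique)
    have "T \<omega> = tau a 0 \<omega>"
    proof (cases "T \<omega>"; cases "tau a 0 \<omega>")
      fix r r' assume "T \<omega> = ennreal r" "0 \<le> r" "tau a 0 \<omega> = ennreal r'" "0 \<le> r'"
      then show ?thesis using eq by (simp add: ehat_ennreal)
    qed (use eq in \<open>auto simp: ehat_ennreal\<close>)
    moreover have "T \<omega> \<le> hitting_time X a \<omega>"
      unfolding T_def by (intro SUP_least near_time_le_hitting goodD(1)[OF g])
    ultimately show ?case using hitting_le_tau[OF g] by (intro antisym) auto
  qed
qed

lemma AE_tau_finite: "AE \<omega> in P z. tau a 0 \<omega> < \<top>"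
  using AE_hitting_eq_tau[of z] hit[of z] by eventually_elim auto

end

section \<open>Laplace transforms at inverse local times\<close>

lemma tendsto_sum_list:
  fixes g :: "'b \<Rightarrow> 'a \<Rightarrow> real"
  assumes "\<And>k. k \<in> set l \<Longrightarrow> ((\<lambda>n. g k n) \<longlongrightarrow> G k) F"
  shows "((\<lambda>n. \<Sum>k\<leftarrow>l. g k n) \<longlongrightarrow> (\<Sum>k\<leftarrow>l. G k)) F"
  using assms by (induct l) (auto intro!: tendsto_add)

context ray_knight
begin

definition nonneg :: "(real \<times> 's) list \<Rightarrow> bool" where "nonneg l \<longleftrightarrow> (\<forall>k\<in>set l. 0 \<le> fst k)"

text \<open>Real-valued versions, so that the equations can be subtracted; a positive \<alpha> and
  nonnegative masses keep the potentials finite.\<close>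

definition rr :: "real \<Rightarrow> (real \<times> 's) list \<Rightarrow> 's \<Rightarrow> 's \<Rightarrow> real" where "rr \<alpha> l z y = enn2real (R \<alpha> l z y)"

definition uu :: "real \<Rightarrow> 's \<Rightarrow> 's \<Rightarrow> real" where "uu \<alpha> z y = enn2real (u \<alpha> z y)"

definition ww :: "real \<Rightarrow> (real \<times> 's) list \<Rightarrow> 's \<Rightarrow> real" where "ww \<alpha> l z = enn2real (wbar \<alpha> l a 0 z)"

definition UU :: "real \<Rightarrow> 's \<Rightarrow> 's \<Rightarrow> real" where "UU \<alpha> z y = enn2real (U \<alpha> a z y)"

lemma R_le_u: "0 < \<alpha> \<Longrightarrow> nonneg l \<Longrightarrow> R \<alpha> l z y \<le> u \<alpha> z y"
proof (induct l)
  case (Cons k l)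
  have "R \<alpha> (k # l) z y \<le> R \<alpha> l z y"
    using R_Cons[of \<alpha> "fst k" l z y "snd k"] Cons(2,3) by (simp add: nonneg_def)
  also have "\<dots> \<le> u \<alpha> z y" using Cons by (simp add: nonneg_def)
  finally show ?case .
qed (simp add: R_Nil)

lemma R_rr: "0 < \<alpha> \<Longrightarrow> nonneg l \<Longrightarrow> R \<alpha> l z y = ennreal (rr \<alpha> l z y)"
  using R_le_u[of \<alpha> l z y] pot_finite[of \<alpha> z y] by (simp add: rr_def le_less_trans)

lemma rr_nonneg [simp]: "0 \<le> rr \<alpha> l z y" by (simp add: rr_def)

lemma wbar_ww: "wbar \<alpha> l a 0 z = ennreal (ww \<alpha> l z)"
  using wbar_le_1[of \<alpha> l a 0 z] by (simp add: ww_def le_less_trans)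

lemma ww_nonneg [simp]: "0 \<le> ww \<alpha> l z" by (simp add: ww_def)

lemma ww_le_1: "ww \<alpha> l z \<le> 1"
  using wbar_le_1[of \<alpha> l a 0 z] unfolding wbar_ww by simp

lemma rr_Cons:
  assumes "0 < \<alpha>" "nonneg (k # l)"
  shows "rr \<alpha> l z y = rr \<alpha> (k # l) z y + fst k * rr \<alpha> l z (snd k) * rr \<alpha> (k # l) (snd k) y"
proof -
  have n: "nonneg l" "0 \<le> fst k" using assms(2) by (auto simp: nonneg_def)
  have "ennreal (rr \<alpha> l z y) = ennreal (rr \<alpha> (k # l) z y + fst k * rr \<alpha> l z (snd k) * rr \<alpha> (k # l) (snd k) y)"
    using R_Cons[OF assms(1) n(2), of l z y "snd k"] n assms
    by (simp add: R_rr ennreal_mult ennreal_plus)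
  then show ?thesis using n by (subst (asm) ennreal_inj) auto
qed

text \<open>The resolvent equation for the killing measure with masses \<open>fst k\<close> at \<open>snd k\<close>, built up one
  point at a time.\<close>

lemma rr_linear:
  assumes al: "0 < \<alpha>" and "nonneg l"
  shows "rr \<alpha> l z y = uu \<alpha> z y - (\<Sum>j\<leftarrow>l. fst j * uu \<alpha> z (snd j) * rr \<alpha> l (snd j) y)"
  using assms(2)
proof (induct l arbitrary: z y)
  case Nil
  then show ?case using al by (simp add: rr_def uu_def R_Nil)
next
  case (Cons k l)
  then have nl: "nonneg l" by (simp add: nonneg_def)
  define c where "c = fst k * rr \<alpha> (k # l) (snd k) y"
  have step: "rr \<alpha> (k # l) z' y = rr \<alpha> l z' y - rr \<alpha> l z' (snd k) * c" for z'
    using rr_Cons[OF al Cons(2), of z' y] by (simp add: c_def mult_ac)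
  have s: "(\<Sum>j\<leftarrow>l. fst j * uu \<alpha> z (snd j) * rr \<alpha> (k # l) (snd j) y)
    = (\<Sum>j\<leftarrow>l. fst j * uu \<alpha> z (snd j) * rr \<alpha> l (snd j) y) - (\<Sum>j\<leftarrow>l. fst j * uu \<alpha> z (snd j) * rr \<alpha> l (snd j) (snd k)) * c"
    unfolding step by (simp add: right_diff_distrib sum_list_subtractf sum_list_mult_const[symmetric] mult.assoc)
  have s12: "(\<Sum>j\<leftarrow>l. fst j * uu \<alpha> z (snd j) * rr \<alpha> l (snd j) y) = uu \<alpha> z y - rr \<alpha> l z y"
    "(\<Sum>j\<leftarrow>l. fst j * uu \<alpha> z (snd j) * rr \<alpha> l (snd j) (snd k)) = uu \<alpha> z (snd k) - rr \<alpha> l z (snd k)"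
    using Cons(1)[OF nl, of z y] Cons(1)[OF nl, of z "snd k"] by auto
  have "fst k * uu \<alpha> z (snd k) * rr \<alpha> (k # l) (snd k) y = uu \<alpha> z (snd k) * c" by (simp add: c_def)
  then show ?case using step[of z] s[unfolded s12 left_diff_distrib]
    unfolding list.map sum_list.Cons by linarith
qed

text \<open>Symmetry turns \<open>u \<alpha> a y\<close> into \<open>u \<alpha> y a\<close>, which
  is \<open>ww \<alpha> [] y * gam \<alpha>\<close>. The part of the potential that runs through the
  base point therefore has rank one.\<close>

lemma u_decomp_real:
  assumes al: "0 < \<alpha>"
  shows "uu \<alpha> z y = UU \<alpha> z y + ww \<alpha> [] z * gam \<alpha> * ww \<alpha> [] y" "U \<alpha> a z y = ennreal (UU \<alpha> z y)"
proof -
  have ay: "u \<alpha> a y = ennreal (ww \<alpha> [] y * gam \<alpha>)"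
    using u_wbar[OF al, of y] gam_pos[OF al] by (simp add: u_sym[of \<alpha> a y] wbar_ww ennreal_mult)
  have d: "u \<alpha> z y = U \<alpha> a z y + ennreal (ww \<alpha> [] z) * ennreal (ww \<alpha> [] y * gam \<alpha>)"
    using u_decomp[OF al, of z y a] unfolding wbar_ww ay .
  then have "U \<alpha> a z y \<le> u \<alpha> z y" by simp
  then show U: "U \<alpha> a z y = ennreal (UU \<alpha> z y)" using pot_finite[OF al, of z y] by (simp add: UU_def le_less_trans)
  have "u \<alpha> z y = ennreal (UU \<alpha> z y + ww \<alpha> [] z * gam \<alpha> * ww \<alpha> [] y)"
    unfolding d U using gam_pos[OF al] by (simp add: ennreal_mult[symmetric] UU_def mult_ac flip: ennreal_plus)
  then show "uu \<alpha> z y = UU \<alpha> z y + ww \<alpha> [] z * gam \<alpha> * ww \<alpha> [] y"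
    using gam_pos[OF al] by (simp add: uu_def UU_def del: ennreal_plus)
qed

lemma UU_nonneg [simp]: "0 \<le> UU \<alpha> z y" by (simp add: UU_def)

lemma ww_Nil_a: "0 < \<alpha> \<Longrightarrow> ww \<alpha> [] a = 1"
proof -
  assume al: "0 < \<alpha>"
  have "ennreal (gam \<alpha>) = ennreal (ww \<alpha> [] a * gam \<alpha>)"
    using u_wbar[OF al, of a] gam_pos[OF al] by (simp add: u_gam[OF al] wbar_ww ennreal_mult)
  then show ?thesis using gam_pos[OF al] by (simp add: ennreal_inj)
qed

lemma UU_a: "0 < \<alpha> \<Longrightarrow> UU \<alpha> a y = 0"
proof -
  assume al: "0 < \<alpha>"
  have "uu \<alpha> a y = ww \<alpha> [] y * gam \<alpha>"
    using u_wbar[OF al, of y] gam_pos[OF al] by (simp add: uu_def u_sym[of \<alpha> a y] wbar_ww ennreal_mult[symmetric])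
  then show ?thesis using u_decomp_real(1)[OF al, of a y] ww_Nil_a[OF al] by simp
qed

text \<open>Insert the rank-one splitting into the resolvent equation with target \<open>a\<close>,
  and write \<open>rr \<alpha> l z a\<close> as \<open>ww \<alpha> l z\<close> times \<rho>. At
  \<open>z = a\<close> the \<open>UU\<close> part is zero and a scalar equation for \<rho> remains;
  dividing it by \<open>\<rho> * gam \<alpha>\<close> gives the third claim. For general z it serves
  to eliminate \<open>gam \<alpha>\<close>, which gives the second.\<close>

lemma ww_equations:
  assumes al: "0 < \<alpha>" and nl: "nonneg l"
  shows "0 < rr \<alpha> l a a"
    and "ww \<alpha> l z = ww \<alpha> [] z - (\<Sum>k\<leftarrow>l. fst k * UU \<alpha> z (snd k) * ww \<alpha> l (snd k))"
    and "inverse (rr \<alpha> l a a) = inverse (gam \<alpha>) + (\<Sum>k\<leftarrow>l. fst k * ww \<alpha> [] (snd k) * ww \<alpha> l (snd k))"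
proof -
  define \<rho> where "\<rho> = rr \<alpha> l a a"
  define S where "S = (\<Sum>k\<leftarrow>l. fst k * ww \<alpha> [] (snd k) * ww \<alpha> l (snd k))"
  define V where "V z = (\<Sum>k\<leftarrow>l. fst k * UU \<alpha> z (snd k) * ww \<alpha> l (snd k))" for z
  have fac: "rr \<alpha> l z a = ww \<alpha> l z * \<rho>" for z
  proof -
    have "ennreal (rr \<alpha> l z a) = ennreal (ww \<alpha> l z * \<rho>)"
      using R_factor[OF al, of l z a] by (simp add: R_rr[OF al nl] wbar_ww \<rho>_def ennreal_mult)
    then show ?thesis by (simp add: ennreal_inj \<rho>_def)
  qed
  have eq: "ww \<alpha> l z * \<rho> = ww \<alpha> [] z * gam \<alpha> - (\<rho> * V z + ww \<alpha> [] z * gam \<alpha> * \<rho> * S)" for z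
  proof -
    have "(\<Sum>k\<leftarrow>l. fst k * uu \<alpha> z (snd k) * rr \<alpha> l (snd k) a) = \<rho> * V z + ww \<alpha> [] z * gam \<alpha> * \<rho> * S"
      unfolding fac u_decomp_real(1)[OF al, of z] V_def S_def
      by (simp add: sum_list_const_mult[symmetric] sum_list_addf[symmetric] algebra_simps)
    moreover have "uu \<alpha> z a = ww \<alpha> [] z * gam \<alpha>"
      using u_wbar[OF al, of z] gam_pos[OF al] by (simp add: uu_def wbar_ww ennreal_mult[symmetric])
    ultimately show ?thesis using rr_linear[OF al nl, of z a] fac[of z] by simp
  qed
  have Va: "V a = 0" unfolding V_def by (simp add: UU_a[OF al] sum_list_0)
  have "ww \<alpha> l a * \<rho> = \<rho>" using fac[of a] by (simp add: \<rho>_def)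
  then have main: "\<rho> = gam \<alpha> - gam \<alpha> * \<rho> * S" using eq[of a] Va ww_Nil_a[OF al] by simp
  have ne: "\<rho> \<noteq> 0" using main gam_pos[OF al] by auto
  then show pos: "0 < rr \<alpha> l a a" using rr_nonneg[of \<alpha> l a a] unfolding \<rho>_def by linarith
  have "gam \<alpha> = \<rho> * (1 + gam \<alpha> * S)" using main by (simp add: algebra_simps)
  then have "inverse \<rho> = inverse (gam \<alpha>) + S" using ne gam_pos[OF al] by (simp add: field_simps)
  then show "inverse (rr \<alpha> l a a) = inverse (gam \<alpha>) + (\<Sum>k\<leftarrow>l. fst k * ww \<alpha> [] (snd k) * ww \<alpha> l (snd k))"
    by (simp add: \<rho>_def S_def)
  \<comment> \<open>Here the factor that explodes as \<alpha> tends to 0 drops out.\<close>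
  have "ww \<alpha> [] z * gam \<alpha> - ww \<alpha> [] z * gam \<alpha> * \<rho> * S = ww \<alpha> [] z * \<rho>"
    using main by (metis mult.assoc right_diff_distrib)
  then have "ww \<alpha> l z * \<rho> = (ww \<alpha> [] z - V z) * \<rho>" using eq[of z] by (simp add: algebra_simps)
  then show "ww \<alpha> l z = ww \<alpha> [] z - (\<Sum>k\<leftarrow>l. fst k * UU \<alpha> z (snd k) * ww \<alpha> l (snd k))"
    using ne by (simp add: V_def)
qed

text \<open>Passage through levels at \<open>a\<close> regenerates, so this is a multiplicative
  function of t. Its integral over the half-line is the killed potential
  \<open>rr \<alpha> l a a\<close>, and this fixes the rate.\<close>

lemma wbar_exp:
  assumes al: "0 < \<alpha>" and nl: "nonneg l" and t: "0 \<le> t"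
  shows "wbar \<alpha> l a t a = ennreal (exp (- t / rr \<alpha> l a a))"
proof -
  interpret Pa: prob_space "P a" by (rule prob_space_P)
  define g where "g t = enn2real (wbar \<alpha> l a t a)" for t
  have gw: "wbar \<alpha> l a t a = ennreal (g t)" for t
    using wbar_le_1[of \<alpha> l a t a] by (simp add: g_def le_less_trans)
  have wm: "(\<lambda>q. wbar \<alpha> l a q a) \<in> borel_measurable borel"
    unfolding wbar_def
  proof (rule Pa.borel_measurable_nn_integral)
    have "(\<lambda>p. wt \<alpha> l (tau a (fst p) (snd p)) (snd p)) \<in> borel_measurable (borel \<Otimes>\<^sub>M P a)"
      by (intro wt_tau_comp measurable_compose[OF measurable_snd id_comp]) simp
    then show "(\<lambda>(q, \<omega>). wt \<alpha> l (tau a q \<omega>) \<omega>) \<in> borel_measurable (borel \<Otimes>\<^sub>M P a)" by (simp add: case_prod_beta)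
  qed
  have "g t = exp (- t / rr \<alpha> l a a)"
  proof (rule multiplicative_eq_exp[OF _ _ _ _ _ ww_equations(1)[OF al nl] t])
    show "g \<in> borel_measurable borel" unfolding g_def using wm by measurable
    show "0 \<le> g s" for s by (simp add: g_def)
    show "g s \<le> 1" for s using wbar_le_1[of \<alpha> l a s a] unfolding gw by simp
    show "g (s + s') = g s * g s'" if "0 \<le> s" "0 \<le> s'" for s s'
      using wbar_add[OF al that, of l a a] by (simp add: g_def enn2real_mult)
    show "(\<integral>\<^sup>+r. indicator {0..} r * ennreal (g r) \<partial>lborel) = ennreal (rr \<alpha> l a a)"
      unfolding gw[symmetric] R_eq_wbar[symmetric] by (rule R_rr[OF al nl])
  qed
  then show ?thesis using gw by simp
qed

section \<open>Vanishing discount\<close>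

lemma eps_to_0: "eps \<longlonglongrightarrow> 0"
  unfolding eps_def by real_asymp

lemma eps_antimono: "k \<le> k' \<Longrightarrow> eps k' \<le> eps k"
  unfolding eps_def by (intro divide_left_mono) auto

lemma ehat_eps_lim: "T < \<top> \<Longrightarrow> (\<lambda>k. ehat (ennreal (eps k) * T)) \<longlonglongrightarrow> 1"
proof -
  assume "T < \<top>"
  then obtain t where t: "T = ennreal t" "0 \<le> t" by (cases T) auto
  have "ehat (ennreal (eps k) * T) = ennreal (exp (- (eps k * t)))" for k
    using t ehat_ennreal[of "eps k * t"] by (simp add: ennreal_mult less_imp_le)
  moreover have "(\<lambda>k. ennreal (exp (- (eps k * t)))) \<longlonglongrightarrow> ennreal (exp (- (0 * t)))"
    by (intro tendsto_ennrealI tendsto_intros eps_to_0)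
  ultimately show ?thesis by simp
qed

lemma wt_split: "wt \<alpha> l T \<omega> = ehat (ennreal \<alpha> * T) * wt 0 l T \<omega>"
  by (simp add: wt_def ehat_add)

text \<open>Finiteness matters: at \<open>T = \<top>\<close> the weights on the left are 0, whereas
  the conventions \<open>0 * \<top> = 0\<close> and \<open>enn2real \<top> = 0\<close> make
  \<open>wt 0 l \<top> \<omega>\<close> equal to 1.\<close>

lemma wt_eps_lim: "T < \<top> \<Longrightarrow> (\<lambda>k. wt (eps k) l T \<omega>) \<longlonglongrightarrow> wt 0 l T \<omega>"
  unfolding wt_split[of "eps _"]
  using tendsto_mult_ennreal[OF ehat_eps_lim tendsto_const, of T "wt 0 l T \<omega>"] wt_le_1[of 0 l T \<omega>]
  by (auto simp: top_unique)

lemma wt_antimono: "\<alpha> \<le> \<beta> \<Longrightarrow> wt \<beta> l T \<omega> \<le> wt \<alpha> l T \<omega>"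
  unfolding wt_def by (intro ehat_antimono add_right_mono mult_right_mono ennreal_leI) auto

lemma wbar_eps_lim:
  assumes "AE \<omega> in P z. tau a r \<omega> < \<top>"
  shows "(\<lambda>k. wbar (eps k) l a r z) \<longlonglongrightarrow> wbar 0 l a r z"
  unfolding wbar_def
proof (rule nn_integral_dominated_convergence[where w="\<lambda>_. 1"])
  show "AE \<omega> in P z. (\<lambda>k. wt (eps k) l (tau a r \<omega>) \<omega>) \<longlonglongrightarrow> wt 0 l (tau a r \<omega>) \<omega>"
    using assms by eventually_elim (rule wt_eps_lim)
qed (auto intro!: wt_tau_comp id_comp wt_le_1)

text \<open>By monotone convergence the potentials at \<open>a\<close> increase to
  \<open>u 0 a a\<close>, which is infinite.\<close>

lemma gam_lim: "(\<lambda>k. inverse (gam (eps k))) \<longlonglongrightarrow> 0"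
proof -
  let ?I = "\<lambda>\<alpha> t. ennreal (exp (- \<alpha> * t) * p t a a) * indicator {0<..} t"
  have m: "?I \<alpha> \<in> borel_measurable borel" for \<alpha>
  proof -
    have "(\<lambda>t. (t, a, a)) \<in> measurable (restrict_space borel {0<..}) (restrict_space borel {0<..} \<Otimes>\<^sub>M borel \<Otimes>\<^sub>M borel)"
      by (intro measurable_Pair) auto
    from measurable_compose[OF this p_measurable] have [measurable]: "(\<lambda>t. p t a a) \<in> borel_measurable (restrict_space borel {0<..})" by simp
    have [measurable]: "(\<lambda>t. t) \<in> borel_measurable (restrict_space borel {0<..})" by (rule measurable_restrict_space1) simp
    have "(\<lambda>t. ennreal (exp (- \<alpha> * t) * p t a a)) \<in> borel_measurable (restrict_space borel {0<..})" by measurable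
    then have "(\<lambda>t. if t \<in> {0<..} then ennreal (exp (- \<alpha> * t) * p t a a) else 0) \<in> borel_measurable borel"
      by (subst (asm) measurable_restrict_space_iff[where c=0]) auto
    then show ?thesis by (rule measurable_cong[THEN iffD1, rotated]) (auto simp: indicator_def)
  qed
  have inc: "incseq (\<lambda>k. ?I (eps k))"
    unfolding incseq_def le_fun_def
  proof (intro allI impI)
    fix k k' :: nat and t assume "k \<le> k'"
    then show "?I (eps k) t \<le> ?I (eps k') t"
      using p_nonneg[of t a a] eps_antimono[of k k']
      by (cases "0 < t") (auto intro!: ennreal_leI mult_right_mono)
  qed
  have sup: "(SUP k. ?I (eps k) t) = ?I 0 t" for t
  proof -
    have "incseq (\<lambda>k. ?I (eps k) t)" using inc by (auto simp: incseq_def le_fun_def)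
    from LIMSEQ_SUP[OF this] have "(\<lambda>k. ?I (eps k) t) \<longlonglongrightarrow> (SUP k. ?I (eps k) t)" .
    moreover have "(\<lambda>k. ?I (eps k) t) \<longlonglongrightarrow> ?I 0 t"
    proof (cases "0 < t")
      case True
      have "(\<lambda>k. ennreal (exp (- eps k * t) * p t a a)) \<longlonglongrightarrow> ennreal (exp (- 0 * t) * p t a a)"
        by (intro tendsto_ennrealI tendsto_intros eps_to_0)
      then show ?thesis using True by simp
    qed simp
    ultimately show ?thesis by (rule LIMSEQ_unique)
  qed
  have "incseq (\<lambda>k. u (eps k) a a)"
    unfolding potential_density_def using inc by (auto simp: incseq_def le_fun_def intro!: nn_integral_mono)
  from LIMSEQ_SUP[OF this] have "(\<lambda>k. u (eps k) a a) \<longlonglongrightarrow> (SUP k. u (eps k) a a)" .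
  also have "(SUP k. u (eps k) a a) = u 0 a a"
    unfolding potential_density_def using nn_integral_monotone_convergence_SUP[OF inc, of lborel] m sup by simp
  finally have "(\<lambda>k. ennreal (gam (eps k))) \<longlonglongrightarrow> \<top>" using pot_inf by (simp add: u_gam)
  then have "filterlim (\<lambda>k. gam (eps k)) at_top sequentially" by (simp add: ennreal_tendsto_top_eq_at_top)
  then show ?thesis by (rule tendsto_inverse_0_at_top)
qed

text \<open>The probability of a finite \<open>tau a t\<close> is the limit of its expected
  discounts. These are \<open>exp (- t / gam (eps k))\<close> by \<open>wbar_exp\<close> for the
  empty list, and \<open>gam (eps k)\<close> tends to infinity.\<close>

lemma AE_tau_t_finite:
  assumes t: "0 \<le> t" shows "AE \<omega> in P a. tau a t \<omega> < \<top>"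
proof -
  interpret Pa: prob_space "P a" by (rule prob_space_P)
  have tm [measurable]: "tau a t \<in> borel_measurable (P a)" by (rule measurable_F_P[OF stops_measurable[OF tau_stops]])
  have S: "{\<omega> \<in> space (P a). tau a t \<omega> < \<top>} \<in> sets (P a)" by measurable
  have "(\<lambda>k. wbar (eps k) [] a t a) \<longlonglongrightarrow> (\<integral>\<^sup>+\<omega>. indicator {\<omega> \<in> space (P a). tau a t \<omega> < \<top>} \<omega> \<partial>P a)"
    unfolding wbar_def
  proof (rule nn_integral_dominated_convergence[where w="\<lambda>_. 1"])
    show "AE \<omega> in P a. (\<lambda>k. wt (eps k) [] (tau a t \<omega>) \<omega>) \<longlonglongrightarrow> indicator {\<omega> \<in> space (P a). tau a t \<omega> < \<top>} \<omega>"
    proof (rule AE_I2)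
      fix \<omega> assume w: "\<omega> \<in> space (P a)"
      show "(\<lambda>k. wt (eps k) [] (tau a t \<omega>) \<omega>) \<longlonglongrightarrow> indicator {\<omega> \<in> space (P a). tau a t \<omega> < \<top>} \<omega>"
      proof (cases "tau a t \<omega> < \<top>")
        case True
        then show ?thesis using wt_eps_lim[OF True, of "[]" \<omega>] w by (simp add: wt_def Aw_simps)
      next
        case False
        then show ?thesis by (simp add: less_top[symmetric] wt_top)
      qed
    qed
  qed (use S in \<open>auto intro!: wt_tau_comp id_comp wt_le_1 borel_measurable_indicator\<close>)
  moreover have "(\<lambda>k. wbar (eps k) [] a t a) \<longlonglongrightarrow> 1"
  proof -
    have "rr (eps k) [] a a = gam (eps k)" for k by (simp add: rr_def gam_def R_Nil)
    then have "wbar (eps k) [] a t a = ennreal (exp (- t * inverse (gam (eps k))))" for k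
      using wbar_exp[OF eps_pos _ t, of "[]" k] by (simp add: nonneg_def divide_inverse)
    moreover have "(\<lambda>k. ennreal (exp (- t * inverse (gam (eps k))))) \<longlonglongrightarrow> ennreal (exp (- t * 0))"
      by (intro tendsto_ennrealI tendsto_intros gam_lim)
    ultimately show ?thesis by simp
  qed
  ultimately have "(\<integral>\<^sup>+\<omega>. indicator {\<omega> \<in> space (P a). tau a t \<omega> < \<top>} \<omega> \<partial>P a) = 1"
    by (rule LIMSEQ_unique)
  then have "emeasure (P a) {\<omega> \<in> space (P a). tau a t \<omega> < \<top>} = 1"
    unfolding nn_integral_indicator[OF S] .
  then show ?thesis using S by (subst Pa.AE_iff_emeasure_eq_1) (simp_all add: pred_def)
qed

lemma ww_eps_lim: "(\<lambda>k. ww (eps k) l z) \<longlonglongrightarrow> ww 0 l z"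
  using wbar_eps_lim[OF AE_tau_finite, of l z] unfolding wbar_ww by (simp add: tendsto_ennreal_iff)

lemma ww_0_Nil: "ww 0 [] z = 1"
  by (simp add: ww_def wbar_def wt_def Aw_simps)

lemma U_eps_lim: "(\<lambda>k. U (eps k) a z y) \<longlonglongrightarrow> U 0 a z y"
proof -
  have m: "(\<lambda>q. wt \<alpha> [] (tau y q \<omega>) \<omega> * (if 0 \<le> q \<and> tau y q \<omega> < tau a 0 \<omega> then 1 else 0)) \<in> borel_measurable lborel"
    if "\<omega> \<in> space W" for \<alpha> \<omega>
  proof -
    have [measurable]: "(\<lambda>q. wt \<alpha> [] (tau y q \<omega>) \<omega>) \<in> borel_measurable lborel"
      "(\<lambda>q. tau y q \<omega>) \<in> borel_measurable lborel"
      by (intro wt_tau_comp tau_comp const_comp that; simp)+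
    show ?thesis by measurable
  qed
  have inc: "incseq (\<lambda>k q. wt (eps k) [] (tau y q \<omega>) \<omega> * (if 0 \<le> q \<and> tau y q \<omega> < tau a 0 \<omega> then 1 else 0))" for \<omega>
    by (auto simp: incseq_def le_fun_def intro!: mult_right_mono wt_antimono eps_antimono)
  have sup: "(SUP k. wt (eps k) [] (tau y q \<omega>) \<omega> * (if 0 \<le> q \<and> tau y q \<omega> < tau a 0 \<omega> then 1 else 0))
    = wt 0 [] (tau y q \<omega>) \<omega> * (if 0 \<le> q \<and> tau y q \<omega> < tau a 0 \<omega> then 1 else 0)" for q \<omega>
  proof (cases "0 \<le> q \<and> tau y q \<omega> < tau a 0 \<omega>")
    case True
    then have fin: "tau y q \<omega> < \<top>" using order.strict_trans2[OF _ top_greatest] by blast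
    have "incseq (\<lambda>k. wt (eps k) [] (tau y q \<omega>) \<omega>)" by (auto simp: incseq_def intro!: wt_antimono eps_antimono)
    from LIMSEQ_unique[OF LIMSEQ_SUP[OF this] wt_eps_lim[OF fin]] show ?thesis using True by simp
  next
    case False
    then have "(if 0 \<le> q \<and> tau y q \<omega> < tau a 0 \<omega> then 1 else (0 :: ennreal)) = 0" by (rule if_not_P)
    then show ?thesis by (simp only: mult_zero_right) simp
  qed
  have UG: "UG 0 a y \<omega> = (SUP k. UG (eps k) a y \<omega>)" if "\<omega> \<in> space W" for \<omega>
    unfolding UG_def using nn_integral_monotone_convergence_SUP[OF inc m[OF that]] unfolding sup .
  have incU: "incseq (\<lambda>k. UG (eps k) a y)"
    unfolding UG_def by (auto simp: incseq_def le_fun_def intro!: nn_integral_mono mult_right_mono wt_antimono eps_antimono)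
  have "U 0 a z y = (\<integral>\<^sup>+\<omega>. (SUP k. UG (eps k) a y \<omega>) \<partial>P z)"
    unfolding U_def using UG by (intro nn_integral_cong) auto
  also have "\<dots> = (SUP k. U (eps k) a z y)"
    unfolding U_def by (rule nn_integral_monotone_convergence_SUP[OF incU measurable_F_P[OF UG_measurable]])
  finally have e: "U 0 a z y = (SUP k. U (eps k) a z y)" .
  have "incseq (\<lambda>k. U (eps k) a z y)" unfolding U_def using incU by (auto simp: incseq_def le_fun_def intro!: nn_integral_mono)
  from LIMSEQ_SUP[OF this] show ?thesis unfolding e .
qed

text \<open>The weight at a finite time with finite local times is positive, so its expectation
  cannot vanish. \<open>U_0_finite\<close> divides by this number.\<close>

lemma ww_pos: "0 < ww 1 l x"
proof (rule ccontr)
  interpret Px: prob_space "P x" by (rule prob_space_P)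
  assume "\<not> 0 < ww 1 l x"
  then have "ww 1 l x = 0" using ww_nonneg[of 1 l x] by linarith
  then have z: "(\<integral>\<^sup>+\<omega>. wt 1 l (tau a 0 \<omega>) \<omega> \<partial>P x) = 0" using wbar_ww[of 1 l x] by (simp add: wbar_def)
  have "(\<lambda>\<omega>. wt 1 l (tau a 0 \<omega>) \<omega>) \<in> borel_measurable (P x)" by (intro wt_tau_comp id_comp) simp
  then have "AE \<omega> in P x. wt 1 l (tau a 0 \<omega>) \<omega> = 0" using z by (subst (asm) nn_integral_0_iff_AE) auto
  then have "AE \<omega> in P x. False"
    using AE_goods[of l x] AE_tau_finite[of x]
  proof eventually_elim
    case (elim \<omega>)
    have "Aw l (enn2real (tau a 0 \<omega>)) \<omega> \<noteq> \<top>"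
      using elim(2) by (induct l) (auto simp: Aw_simps goods_def goodD(2) ennreal_mult_eq_top_iff)
    then have "0 < wt 1 l (tau a 0 \<omega>) \<omega>" unfolding wt_def using elim(3) by (intro ehat_pos) auto
    then show ?case using elim(1) by simp
  qed
  then show False by simp
qed

text \<open>A monotone limit might be infinite; a unit mass at x gives a uniform bound. Since
  \<open>ww (eps k) ?l z\<close> is nonnegative, its equation bounds
  \<open>UU (eps k) z x * ww (eps k) ?l x\<close> by 1, and the second factor is at least its value
  at discount 1.\<close>

lemma U_0_finite: "U 0 a z x = ennreal (UU 0 z x)"
proof -
  let ?l = "[(1, x)]"
  have nl: "nonneg ?l" by (simp add: nonneg_def)
  have "U (eps k) a z x \<le> ennreal (1 / ww 1 ?l x)" for k
  proof -
    have "wbar 1 ?l a 0 x \<le> wbar (eps k) ?l a 0 x"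
      unfolding wbar_def by (intro nn_integral_mono wt_antimono) (simp add: eps_def)
    then have mono: "ww 1 ?l x \<le> ww (eps k) ?l x" unfolding wbar_ww by simp
    have "ww (eps k) ?l z = ww (eps k) [] z - UU (eps k) z x * ww (eps k) ?l x"
      using ww_equations(2)[OF eps_pos nl, of k z] by simp
    then have "UU (eps k) z x * ww (eps k) ?l x \<le> 1"
      using ww_nonneg[of "eps k" ?l z] ww_le_1[of "eps k" "[]" z] by linarith
    moreover have "UU (eps k) z x * ww 1 ?l x \<le> UU (eps k) z x * ww (eps k) ?l x"
      by (intro mult_left_mono mono) simp
    ultimately have "UU (eps k) z x \<le> 1 / ww 1 ?l x" using ww_pos[of ?l x] by (simp add: field_simps)
    then show ?thesis unfolding u_decomp_real(2)[OF eps_pos] by (rule ennreal_leI)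
  qed
  then have "U 0 a z x \<le> ennreal (1 / ww 1 ?l x)" by (intro LIMSEQ_le_const2[OF U_eps_lim]) auto
  then have "U 0 a z x < \<top>" using ennreal_less_top le_less_trans by blast
  then show ?thesis by (simp add: UU_def)
qed

lemma UU_eps_lim: "(\<lambda>k. UU (eps k) z y) \<longlonglongrightarrow> UU 0 z y"
  using U_eps_lim[of z y] unfolding u_decomp_real(2)[OF eps_pos] U_0_finite by (simp add: tendsto_ennreal_iff)

text \<open>At discount 0 the weight for the empty list is 1, so \<open>UG\<close> measures the
  levels q below the local time at y by \<open>tau a 0\<close>, that is, this local time itself. The
  hitting time of \<open>a\<close> may be replaced by \<open>tau a 0\<close>.\<close>

lemma killed_density: "killed_potential_density f X P a z y = UU 0 z y"
proof -
  let ?L = "\<lambda>\<omega>. LT y (enn2real (tau a 0 \<omega>)) \<omega>"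
  have Lm [measurable]: "?L \<in> borel_measurable (P z)"
  proof -
    have "(\<lambda>\<omega>. ell y (enn2real (tau a 0 \<omega>)) \<omega>) \<in> borel_measurable (P z)"
      by (rule ell_comp[OF tau_comp[OF _ id_comp] id_comp]) simp
    then show ?thesis unfolding LT_def by (rule borel_measurable_enn2real)
  qed
  have "killed_potential_density f X P a z y = (\<integral>\<omega>. ?L \<omega> \<partial>P z)"
    unfolding killed_potential_density_def
  proof (rule integral_completion_AE[OF Lm])
    show "AE \<omega> in P z. local_time f X y (enn2real (hitting_time X a \<omega>)) \<omega> = ?L \<omega>"
      using AE_good[of y z] AE_hitting_eq_tau[of z] by eventually_elim auto
  qed
  also have "\<dots> = enn2real (\<integral>\<^sup>+\<omega>. ennreal (?L \<omega>) \<partial>P z)"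
    by (rule integral_eq_nn_integral[OF Lm]) (simp add: LT_def)
  also have "(\<integral>\<^sup>+\<omega>. ennreal (?L \<omega>) \<partial>P z) = U 0 a z y"
    unfolding U_def
  proof (rule nn_integral_cong_AE)
    show "AE \<omega> in P z. ennreal (?L \<omega>) = UG 0 a y \<omega>"
      using AE_good[of y z] AE_tau_finite[of z]
    proof eventually_elim
      case (elim \<omega>)
      define s where "s = enn2real (tau a 0 \<omega>)"
      have s: "tau a 0 \<omega> = ennreal s" "0 \<le> s" using elim by (auto simp: s_def)
      have g: "good y \<omega>" using elim by simp
      have "UG 0 a y \<omega> = (\<integral>\<^sup>+q. indicator {0..<LT y s \<omega>} q \<partial>lborel)"
        unfolding UG_def using tau_less_iff[OF g _ s(2)]
        by (intro nn_integral_cong) (auto simp: s wt_def Aw_simps indicator_def)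
      also have "\<dots> = ennreal (LT y s \<omega>)" using goodD(7)[OF g, of s] by simp
      finally show ?case by (simp add: s_def)
    qed
  qed
  finally show ?thesis by (simp add: UU_def)
qed

lemma AE_inverse_local_time:
  assumes t: "0 \<le> t" shows "AE \<omega> in P z. inverse_local_time f X a t \<omega> = tau a t \<omega>"
  using AE_good[of a z]
proof eventually_elim
  case (elim \<omega>)
  then have g: "good a \<omega>" by simp
  show ?case
  proof (rule ennreal_eq_if_less_iff)
    fix s :: real assume s: "0 \<le> s"
    have "inverse_local_time f X a t \<omega> < ennreal s \<longleftrightarrow> (\<exists>s'. 0 \<le> s' \<and> t < LT a s' \<omega> \<and> ennreal s' < ennreal s)"
      unfolding inverse_local_time_def Inf_less_iff using elim by auto
    also have "\<dots> \<longleftrightarrow> t < LT a s \<omega>"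
    proof
      assume "\<exists>s'. 0 \<le> s' \<and> t < LT a s' \<omega> \<and> ennreal s' < ennreal s"
      then obtain s' where s': "0 \<le> s'" "t < LT a s' \<omega>" "s' < s" by (auto simp: ennreal_less_iff)
      then show "t < LT a s \<omega>" using goodD(5)[OF g, of s' s] by simp
    next
      assume "t < LT a s \<omega>"
      then obtain q where "0 \<le> q" "q < s" "t < LT a q \<omega>" using good_left_limit[OF g t _ s] by blast
      then show "\<exists>s'. 0 \<le> s' \<and> t < LT a s' \<omega> \<and> ennreal s' < ennreal s" by (auto intro!: ennreal_lessI)
    qed
    finally show "inverse_local_time f X a t \<omega> < ennreal s \<longleftrightarrow> tau a t \<omega> < ennreal s"
      using tau_less_iff[OF g t s] by simp
  qed
qed

text \<open>Limit of \<open>ww_equations\<close> along \<open>eps k\<close>: the weights for the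
  empty list tend to 1 because \<open>tau a 0\<close> is finite, and
  \<open>inverse (gam (eps k))\<close> tends to 0, so only finite quantities remain. The function
  \<open>ww 0 l\<close> is the link to the Gaussian half.\<close>

theorem inverse_local_time_laplace:
  assumes nl: "nonneg l" and t: "0 \<le> t"
  shows "ww 0 l z = 1 - (\<Sum>k\<leftarrow>l. fst k * killed_potential_density f X P a z (snd k) * ww 0 l (snd k))"
    and "(\<integral>\<^sup>+\<omega>. ehat (Aw l (enn2real (tau a t \<omega>)) \<omega>) \<partial>P a) = ennreal (exp (- t * (\<Sum>k\<leftarrow>l. fst k * ww 0 l (snd k))))"
proof -
  have hl: "(\<lambda>k. ww (eps k) [] z) \<longlonglongrightarrow> 1" for z using ww_eps_lim[of "[]" z] by (simp add: ww_0_Nil)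
  have "(\<lambda>k. ww (eps k) [] z - (\<Sum>j\<leftarrow>l. fst j * UU (eps k) z (snd j) * ww (eps k) l (snd j)))
    \<longlonglongrightarrow> 1 - (\<Sum>j\<leftarrow>l. fst j * UU 0 z (snd j) * ww 0 l (snd j))"
    by (intro tendsto_diff tendsto_sum_list tendsto_mult tendsto_const hl UU_eps_lim ww_eps_lim)
  then have "(\<lambda>k. ww (eps k) l z) \<longlonglongrightarrow> 1 - (\<Sum>j\<leftarrow>l. fst j * UU 0 z (snd j) * ww 0 l (snd j))"
    by (simp add: ww_equations(2)[OF eps_pos nl, of _ z, symmetric])
  from LIMSEQ_unique[OF ww_eps_lim this]
  show "ww 0 l z = 1 - (\<Sum>k\<leftarrow>l. fst k * killed_potential_density f X P a z (snd k) * ww 0 l (snd k))"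
    by (simp add: killed_density)
  let ?\<kappa> = "\<Sum>k\<leftarrow>l. fst k * ww 0 l (snd k)"
  have "(\<lambda>k. inverse (gam (eps k)) + (\<Sum>j\<leftarrow>l. fst j * ww (eps k) [] (snd j) * ww (eps k) l (snd j)))
    \<longlonglongrightarrow> 0 + (\<Sum>j\<leftarrow>l. fst j * 1 * ww 0 l (snd j))"
    by (intro tendsto_add tendsto_sum_list tendsto_mult tendsto_const hl gam_lim ww_eps_lim)
  then have lim: "(\<lambda>k. inverse (rr (eps k) l a a)) \<longlonglongrightarrow> ?\<kappa>"
    by (simp add: ww_equations(3)[OF eps_pos nl])
  have "wbar (eps k) l a t a = ennreal (exp (- t * inverse (rr (eps k) l a a)))" for k
    using wbar_exp[OF eps_pos nl t, of k] by (simp add: divide_inverse)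
  moreover have "(\<lambda>k. ennreal (exp (- t * inverse (rr (eps k) l a a)))) \<longlonglongrightarrow> ennreal (exp (- t * ?\<kappa>))"
    by (intro tendsto_ennrealI tendsto_intros lim)
  ultimately have "(\<lambda>k. wbar (eps k) l a t a) \<longlonglongrightarrow> ennreal (exp (- t * ?\<kappa>))" by simp
  from LIMSEQ_unique[OF wbar_eps_lim[OF AE_tau_t_finite[OF t]] this]
  show "(\<integral>\<^sup>+\<omega>. ehat (Aw l (enn2real (tau a t \<omega>)) \<omega>) \<partial>P a) = ennreal (exp (- t * ?\<kappa>))"
    by (simp add: wbar_def wt_def)
qed

end

section \<open>Squares of Gaussian processes\<close>

lemma normal_density_char:
  assumes \<sigma>: "0 < \<sigma>"
  shows "(CLINT x|lborel. normal_density \<mu> \<sigma> x *\<^sub>R iexp (\<gamma> * x)) = iexp (\<gamma> * \<mu>) * exp (- (\<gamma>\<^sup>2 * \<sigma>\<^sup>2) / 2)"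
proof -
  have std: "(CLINT x|lborel. std_normal_density x *\<^sub>R iexp (t * x)) = exp (- (t\<^sup>2) / 2)" for t
    using fun_cong[OF char_std_normal_distribution, of t] unfolding char_def
    by (subst (asm) integral_density) (auto simp: exp_of_real)
  have "(CLINT x|lborel. normal_density \<mu> \<sigma> x *\<^sub>R iexp (\<gamma> * x))
    = \<bar>\<sigma>\<bar> *\<^sub>R (CLINT x|lborel. normal_density \<mu> \<sigma> (\<mu> + \<sigma> * x) *\<^sub>R iexp (\<gamma> * (\<mu> + \<sigma> * x)))"
    using \<sigma> by (intro lborel_integral_real_affine) simp
  also have "\<dots> = (CLINT x|lborel. iexp (\<gamma> * \<mu>) * (std_normal_density x *\<^sub>R iexp (\<gamma> * \<sigma> * x)))"
    unfolding integral_scaleR_right[symmetric]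
  proof (rule Bochner_Integration.integral_cong[OF refl])
    fix x
    have "\<sigma> * normal_density \<mu> \<sigma> (\<mu> + \<sigma> * x) = std_normal_density x"
      using \<sigma> by (simp add: normal_density_def real_sqrt_mult power_mult_distrib field_simps)
    moreover have "iexp (\<gamma> * (\<mu> + \<sigma> * x)) = iexp (\<gamma> * \<mu>) * iexp (\<gamma> * \<sigma> * x)"
      by (simp add: exp_add[symmetric] algebra_simps)
    ultimately show "\<bar>\<sigma>\<bar> *\<^sub>R (normal_density \<mu> \<sigma> (\<mu> + \<sigma> * x) *\<^sub>R iexp (\<gamma> * (\<mu> + \<sigma> * x)))
      = iexp (\<gamma> * \<mu>) * (std_normal_density x *\<^sub>R iexp (\<gamma> * \<sigma> * x))"
      using \<sigma> by (simp add: scaleR_conv_of_real flip: of_real_mult mult.assoc)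
  qed
  also have "\<dots> = iexp (\<gamma> * \<mu>) * exp (- ((\<gamma> * \<sigma>)\<^sup>2) / 2)"
    by (subst integral_mult_right_zero) (simp only: std)
  finally show ?thesis by (simp add: power_mult_distrib)
qed

text \<open>The left-hand integrand is a multiple of the normal density with mean
  \<open>- \<beta> / (1 + \<alpha>)\<close> and variance \<open>1 / (1 + \<alpha>)\<close>.\<close>

lemma gaussian_quadratic_integral:
  fixes \<alpha> \<beta> \<gamma> :: real
  assumes \<alpha>: "0 \<le> \<alpha>"
  shows "(CLINT x|lborel. std_normal_density x *\<^sub>R (iexp (\<gamma> * x) * of_real (exp (- (\<alpha> * x\<^sup>2 + 2 * \<beta> * x) / 2))))
    = of_real (exp (\<beta>\<^sup>2 / (2 * (1 + \<alpha>)) - \<gamma>\<^sup>2 / (2 * (1 + \<alpha>))) / sqrt (1 + \<alpha>)) * iexp (- \<gamma> * \<beta> / (1 + \<alpha>))"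
proof -
  define \<sigma> where "\<sigma> = 1 / sqrt (1 + \<alpha>)"
  define \<mu> where "\<mu> = - \<beta> / (1 + \<alpha>)"
  have \<sigma>: "0 < \<sigma>" "\<sigma>\<^sup>2 = 1 / (1 + \<alpha>)" using \<alpha> by (auto simp: \<sigma>_def power_divide)
  have dens: "std_normal_density x * exp (- (\<alpha> * x\<^sup>2 + 2 * \<beta> * x) / 2) = exp (\<beta>\<^sup>2 / (2 * (1 + \<alpha>))) * \<sigma> * normal_density \<mu> \<sigma> x" for x
  proof -
    have e: "- x\<^sup>2 / 2 + - (\<alpha> * x\<^sup>2 + 2 * \<beta> * x) / 2 = \<beta>\<^sup>2 / (2 * (1 + \<alpha>)) + - (x - \<mu>)\<^sup>2 / (2 * \<sigma>\<^sup>2)"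
    proof -
      define d where "d = 1 + \<alpha>"
      have d: "0 < d" "\<alpha> = d - 1" using \<alpha> by (auto simp: d_def)
      have "(x - \<mu>)\<^sup>2 / (2 * \<sigma>\<^sup>2) = d * (x + \<beta> / d)\<^sup>2 / 2"
        using d(1) unfolding \<sigma>(2) \<mu>_def d_def[symmetric] by simp
      also have "d * (x + \<beta> / d)\<^sup>2 = d * x\<^sup>2 + 2 * \<beta> * x + \<beta>\<^sup>2 / d"
        using d(1) by (simp add: power2_eq_square field_simps)
      finally show ?thesis unfolding d_def[symmetric] d(2) by (simp add: field_simps)
    qed
    have "std_normal_density x * exp (- (\<alpha> * x\<^sup>2 + 2 * \<beta> * x) / 2) = 1 / sqrt (2 * pi) * exp (- x\<^sup>2 / 2 + - (\<alpha> * x\<^sup>2 + 2 * \<beta> * x) / 2)"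
      by (simp add: std_normal_density_def exp_add[symmetric])
    also have "\<dots> = 1 / sqrt (2 * pi) * (exp (\<beta>\<^sup>2 / (2 * (1 + \<alpha>))) * exp (- (x - \<mu>)\<^sup>2 / (2 * \<sigma>\<^sup>2)))"
      unfolding e by (simp only: exp_add)
    also have "\<dots> = exp (\<beta>\<^sup>2 / (2 * (1 + \<alpha>))) * \<sigma> * normal_density \<mu> \<sigma> x"
      using \<sigma>(1) by (simp add: normal_density_def real_sqrt_mult)
    finally show ?thesis .
  qed
  have eq: "std_normal_density x *\<^sub>R (iexp (\<gamma> * x) * of_real (exp (- (\<alpha> * x\<^sup>2 + 2 * \<beta> * x) / 2)))
    = of_real (exp (\<beta>\<^sup>2 / (2 * (1 + \<alpha>))) * \<sigma>) * (normal_density \<mu> \<sigma> x *\<^sub>R iexp (\<gamma> * x))" for x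
  proof -
    have "std_normal_density x *\<^sub>R (iexp (\<gamma> * x) * of_real (exp (- (\<alpha> * x\<^sup>2 + 2 * \<beta> * x) / 2)))
      = of_real (std_normal_density x * exp (- (\<alpha> * x\<^sup>2 + 2 * \<beta> * x) / 2)) * iexp (\<gamma> * x)"
      by (simp only: scaleR_conv_of_real of_real_mult mult_ac)
    also have "\<dots> = of_real (exp (\<beta>\<^sup>2 / (2 * (1 + \<alpha>))) * \<sigma>) * (normal_density \<mu> \<sigma> x *\<^sub>R iexp (\<gamma> * x))"
      unfolding dens[of x] by (simp only: scaleR_conv_of_real of_real_mult mult_ac)
    finally show ?thesis .
  qed
  then have "(CLINT x|lborel. std_normal_density x *\<^sub>R (iexp (\<gamma> * x) * of_real (exp (- (\<alpha> * x\<^sup>2 + 2 * \<beta> * x) / 2))))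
    = of_real (exp (\<beta>\<^sup>2 / (2 * (1 + \<alpha>))) * \<sigma>) * (iexp (\<gamma> * \<mu>) * exp (- (\<gamma>\<^sup>2 * \<sigma>\<^sup>2) / 2))"
    by (simp only: eq integral_mult_right_zero normal_density_char[OF \<sigma>(1)])
  also have "\<dots> = of_real (exp (\<beta>\<^sup>2 / (2 * (1 + \<alpha>)) - \<gamma>\<^sup>2 / (2 * (1 + \<alpha>))) / sqrt (1 + \<alpha>)) * iexp (- \<gamma> * \<beta> / (1 + \<alpha>))"
  proof -
    have "exp (\<beta>\<^sup>2 / (2 * (1 + \<alpha>))) * \<sigma> * exp (- (\<gamma>\<^sup>2 * \<sigma>\<^sup>2) / 2) = exp (\<beta>\<^sup>2 / (2 * (1 + \<alpha>)) - \<gamma>\<^sup>2 / (2 * (1 + \<alpha>))) / sqrt (1 + \<alpha>)"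
      unfolding \<sigma>(2) by (simp add: \<sigma>_def exp_diff exp_minus field_simps)
    moreover have "\<gamma> * \<mu> = - \<gamma> * \<beta> / (1 + \<alpha>)" by (simp add: \<mu>_def)
    moreover have "of_real (exp (\<beta>\<^sup>2 / (2 * (1 + \<alpha>))) * \<sigma>) * (iexp (\<gamma> * \<mu>) * exp (- (\<gamma>\<^sup>2 * \<sigma>\<^sup>2) / 2))
      = of_real (exp (\<beta>\<^sup>2 / (2 * (1 + \<alpha>))) * \<sigma> * exp (- (\<gamma>\<^sup>2 * \<sigma>\<^sup>2) / 2)) * iexp (\<gamma> * \<mu>)"
      by (simp only: of_real_mult mult_ac)
    ultimately show ?thesis by (simp only:)
  qed
  finally show ?thesis .
qed

text \<open>The degenerate case has no density and is treated apart, but with mean 0 it obeys the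
  same formula with variance 0.\<close>

lemma normal_rv_centered:
  assumes "prob_space N" and Z: "normal_rv N Z" and mean: "(\<integral>v. Z v \<partial>N) = 0"
  shows "Z \<in> borel_measurable N" "integrable N Z" "integrable N (\<lambda>v. (Z v)\<^sup>2)"
    "(CLINT v|N. iexp (Z v)) = exp (- (\<integral>v. (Z v)\<^sup>2 \<partial>N) / 2)"
proof -
  interpret prob_space N by fact
  show m [measurable]: "Z \<in> borel_measurable N" using Z by (simp add: normal_rv_def)
  have "integrable N Z \<and> integrable N (\<lambda>v. (Z v)\<^sup>2) \<and> (CLINT v|N. iexp (Z v)) = exp (- (\<integral>v. (Z v)\<^sup>2 \<partial>N) / 2)"
  proof (cases "\<exists>\<mu>. AE v in N. Z v = \<mu>")
    case True
    then obtain \<mu> where ae: "AE v in N. Z v = \<mu>" by blast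
    have "(\<integral>v. Z v \<partial>N) = (\<integral>v. \<mu> \<partial>N)" using ae by (intro integral_cong_AE) auto
    then have "\<mu> = 0" using mean by (simp add: prob_space)
    then have ae: "AE v in N. Z v = 0" using ae by simp
    have "integrable N Z" using integrable_cong_AE[of Z N "\<lambda>_. 0"] ae by simp
    moreover have "integrable N (\<lambda>v. (Z v)\<^sup>2)" using integrable_cong_AE[of "\<lambda>v. (Z v)\<^sup>2" N "\<lambda>_. 0"] ae by auto
    moreover have "(\<integral>v. (Z v)\<^sup>2 \<partial>N) = (\<integral>v. 0 \<partial>N)" using ae by (intro integral_cong_AE) auto
    moreover have "(CLINT v|N. iexp (Z v)) = (CLINT v|N. 1)" using ae by (intro integral_cong_AE) auto
    ultimately show ?thesis by (simp add: prob_space)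
  next
    case False
    then obtain \<mu> \<sigma> where s: "0 < \<sigma>" and D: "distributed N lborel Z (\<lambda>z. ennreal (normal_density \<mu> \<sigma> z))"
      using Z by (auto simp: normal_rv_def)
    have mu: "\<mu> = 0" using normal_distributed_expectation[OF s D] mean by simp
    have D: "distributed N lborel Z (\<lambda>z. ennreal (normal_density 0 \<sigma> z))" using D mu by simp
    have i1: "integrable N Z"
      using distributed_integrable[OF D, of "\<lambda>x. x"] integrable_normal_moment[OF s, of 0 1] by simp
    have i2: "integrable N (\<lambda>v. (Z v)\<^sup>2)"
      using distributed_integrable[OF D, of "\<lambda>x. x\<^sup>2"] integrable_normal_moment[OF s, of 0 2] by simp
    have var: "(\<integral>v. (Z v)\<^sup>2 \<partial>N) = \<sigma>\<^sup>2"
      using normal_distributed_variance[OF s D] mean by simp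
    have d: "distr N lborel Z = density lborel (\<lambda>z. ennreal (normal_density 0 \<sigma> z))"
      using D by (simp add: distributed_def)
    have "(CLINT v|N. iexp (Z v)) = (CLINT z|distr N lborel Z. iexp z)"
      by (subst integral_distr) auto
    also have "\<dots> = (CLINT z|lborel. normal_density 0 \<sigma> z *\<^sub>R iexp (1 * z))"
      unfolding d by (subst integral_density) auto
    also have "\<dots> = exp (- \<sigma>\<^sup>2 / 2)" unfolding normal_density_char[OF s] by simp
    finally show ?thesis using i1 i2 var by simp
  qed
  then show "integrable N Z" "integrable N (\<lambda>v. (Z v)\<^sup>2)" "(CLINT v|N. iexp (Z v)) = exp (- (\<integral>v. (Z v)\<^sup>2 \<partial>N) / 2)"
    by auto
qed

text \<open>Covariance after weighting by
  \<open>exp (- fst k * (\<eta> (snd k) + s)\<^sup>2 / 2)\<close> for every entry k: one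
  Sherman-Morrison update per entry. It does not depend on the shift s.\<close>

fun tilt_cov :: "('s \<Rightarrow> 's \<Rightarrow> real) \<Rightarrow> (real \<times> 's) list \<Rightarrow> 's \<Rightarrow> 's \<Rightarrow> real" where
  "tilt_cov C [] x z = C x z"
| "tilt_cov C (k # l) x z = tilt_cov C l x z
    - fst k * tilt_cov C l x (snd k) * tilt_cov C l (snd k) z / (1 + fst k * tilt_cov C l (snd k) (snd k))"

text \<open>Under the weighted law \<open>\<eta> x + s\<close> has mean
  \<open>s * tilt_mean C l x\<close>; the start at 1 is the centered family.\<close>

fun tilt_mean :: "('s \<Rightarrow> 's \<Rightarrow> real) \<Rightarrow> (real \<times> 's) list \<Rightarrow> 's \<Rightarrow> real" where
  "tilt_mean C [] x = 1"
| "tilt_mean C (k # l) x = tilt_mean C l x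
    - fst k * tilt_mean C l (snd k) * tilt_cov C l x (snd k) / (1 + fst k * tilt_cov C l (snd k) (snd k))"

text \<open>The total mass of the weighted law is \<open>tilt_const C l\<close> at shift 0, and a
  shift s multiplies it by \<open>exp (- s\<^sup>2 * tilt_exponent C l / 2)\<close>.\<close>

fun tilt_exponent :: "('s \<Rightarrow> 's \<Rightarrow> real) \<Rightarrow> (real \<times> 's) list \<Rightarrow> real" where
  "tilt_exponent C [] = 0"
| "tilt_exponent C (k # l) = tilt_exponent C l
    + fst k * (tilt_mean C l (snd k))\<^sup>2 / (1 + fst k * tilt_cov C l (snd k) (snd k))"

fun tilt_const :: "('s \<Rightarrow> 's \<Rightarrow> real) \<Rightarrow> (real \<times> 's) list \<Rightarrow> real" where
  "tilt_const C [] = 1"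
| "tilt_const C (k # l) = tilt_const C l / sqrt (1 + fst k * tilt_cov C l (snd k) (snd k))"

text \<open>Positivity of the denominators. It holds for nonnegative masses because the diagonal of
  \<open>tilt_cov\<close> consists of variances, which \<open>gaussian_tilt\<close> shows along the
  way.\<close>

fun tilt_ok :: "('s \<Rightarrow> 's \<Rightarrow> real) \<Rightarrow> (real \<times> 's) list \<Rightarrow> bool" where
  "tilt_ok C [] \<longleftrightarrow> True"
| "tilt_ok C (k # l) \<longleftrightarrow> tilt_ok C l \<and> 0 < 1 + fst k * tilt_cov C l (snd k) (snd k)"

lemma tilt_cov_sym:
  assumes "\<And>x z. C x z = C z x" shows "tilt_cov C l x z = tilt_cov C l z x"
  by (induct l arbitrary: x z) (use assms in \<open>simp_all add: mult_ac\<close>)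

text \<open>At the new point the update is a division; elsewhere, with the updated value put on the
  right-hand side, it takes the form of a resolvent equation, which suits the inductions
  below.\<close>

lemma tilt_steps:
  assumes "tilt_ok C (k # l)"
  shows "tilt_cov C (k # l) (snd k) z = tilt_cov C l (snd k) z / (1 + fst k * tilt_cov C l (snd k) (snd k))"
    and "tilt_cov C (k # l) x z = tilt_cov C l x z - fst k * tilt_cov C l x (snd k) * tilt_cov C (k # l) (snd k) z"
    and "tilt_mean C (k # l) (snd k) = tilt_mean C l (snd k) / (1 + fst k * tilt_cov C l (snd k) (snd k))"
    and "tilt_mean C (k # l) x = tilt_mean C l x - fst k * tilt_cov C l x (snd k) * tilt_mean C (k # l) (snd k)"
proof -
  have D: "1 + fst k * tilt_cov C l (snd k) (snd k) \<noteq> 0" using assms by simp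
  show 1: "tilt_cov C (k # l) (snd k) z = tilt_cov C l (snd k) z / (1 + fst k * tilt_cov C l (snd k) (snd k))" for z
    using D by (simp add: field_simps)
  show 2: "tilt_mean C (k # l) (snd k) = tilt_mean C l (snd k) / (1 + fst k * tilt_cov C l (snd k) (snd k))"
    using D by (simp add: field_simps)
  show "tilt_cov C (k # l) x z = tilt_cov C l x z - fst k * tilt_cov C l x (snd k) * tilt_cov C (k # l) (snd k) z"
    unfolding 1 by simp
  show "tilt_mean C (k # l) x = tilt_mean C l x - fst k * tilt_cov C l x (snd k) * tilt_mean C (k # l) (snd k)"
    unfolding 2 by (simp add: mult_ac)
qed

lemma sum_list_split:
  fixes g h :: "'a \<Rightarrow> real"
  assumes "\<And>j. e j = g j - h j * c"
  shows "(\<Sum>j\<leftarrow>l. e j) = (\<Sum>j\<leftarrow>l. g j) - (\<Sum>j\<leftarrow>l. h j) * c"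
  unfolding assms by (simp add: sum_list_subtractf sum_list_mult_const)

text \<open>Expresses the mean by the tilted covariance instead of \<open>C\<close>. Sums of masses
  times tilted covariances appear in \<open>tilt_exponent_eq\<close> and are evaluated by
  this.\<close>

lemma tilt_mean_alt:
  fixes C :: "'a \<Rightarrow> 'a \<Rightarrow> real"
  assumes "tilt_ok C l"
  shows "tilt_mean C l x = 1 - (\<Sum>j\<leftarrow>l. fst j * tilt_cov C l x (snd j))"
  using assms
proof (induct l arbitrary: x)
  case (Cons k l)
  note st = tilt_steps[OF Cons(2)]
  have ok: "tilt_ok C l" using Cons(2) by simp
  \<comment> \<open>\<open>W\<close> satisfies the same one-step relation as the mean; at the new
    point this determines it, and then everywhere.\<close>
  define W where "W x = 1 - (\<Sum>j\<leftarrow>k # l. fst j * tilt_cov C (k # l) x (snd j))" for x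
  have W: "W x = tilt_mean C l x - fst k * tilt_cov C l x (snd k) * W (snd k)" for x
  proof -
    have "(\<Sum>j\<leftarrow>l. fst j * tilt_cov C (k # l) x (snd j)) = (\<Sum>j\<leftarrow>l. fst j * tilt_cov C l x (snd j))
      - (\<Sum>j\<leftarrow>l. fst j * tilt_cov C (k # l) (snd k) (snd j)) * (fst k * tilt_cov C l x (snd k))"
    proof (rule sum_list_split)
      fix j :: "real \<times> 'a"
      show "fst j * tilt_cov C (k # l) x (snd j) = fst j * tilt_cov C l x (snd j)
        - fst j * tilt_cov C (k # l) (snd k) (snd j) * (fst k * tilt_cov C l x (snd k))"
        unfolding st(2)[of x "snd j"] by (simp add: algebra_simps del: tilt_cov.simps)
    qed
    then have "(\<Sum>j\<leftarrow>l. fst j * tilt_cov C (k # l) x (snd j)) = (1 - tilt_mean C l x)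
      - (1 - fst k * tilt_cov C (k # l) (snd k) (snd k) - W (snd k)) * (fst k * tilt_cov C l x (snd k))"
      using Cons(1)[OF ok, of x] by (simp add: W_def del: tilt_cov.simps)
    moreover have "fst k * tilt_cov C (k # l) x (snd k)
      = fst k * (tilt_cov C l x (snd k) - fst k * tilt_cov C l x (snd k) * tilt_cov C (k # l) (snd k) (snd k))"
      unfolding st(2)[of x "snd k"] ..
    ultimately have "W x = 1 - (fst k * (tilt_cov C l x (snd k) - fst k * tilt_cov C l x (snd k) * tilt_cov C (k # l) (snd k) (snd k))
      + ((1 - tilt_mean C l x) - (1 - fst k * tilt_cov C (k # l) (snd k) (snd k) - W (snd k)) * (fst k * tilt_cov C l x (snd k))))"
      unfolding W_def[of x] list.map sum_list.Cons by (simp only:)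
    then show ?thesis by (simp add: algebra_simps del: tilt_cov.simps)
  qed
  have D: "0 < 1 + fst k * tilt_cov C l (snd k) (snd k)" using Cons(2) by simp
  have "W (snd k) * (1 + fst k * tilt_cov C l (snd k) (snd k)) = tilt_mean C l (snd k)"
    using W[of "snd k"] by (simp add: algebra_simps)
  then have "W (snd k) = tilt_mean C (k # l) (snd k)" using D st(3) by (simp add: field_simps)
  then show ?case using W[of x] st(4)[of x] by (simp only: W_def)
qed simp

lemma tilt_cov_linear:
  assumes "tilt_ok C l"
  shows "tilt_cov C l x z = C x z - (\<Sum>j\<leftarrow>l. fst j * C x (snd j) * tilt_cov C l (snd j) z)"
  using assms
proof (induct l arbitrary: x z)
  case (Cons k l)
  have ok: "tilt_ok C l" using Cons(2) by simp
  define c where "c = fst k * tilt_cov C (k # l) (snd k) z"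
  have st: "tilt_cov C (k # l) y z = tilt_cov C l y z - tilt_cov C l y (snd k) * c" for y
    using tilt_steps(2)[OF Cons(2), of y z] by (simp add: c_def mult_ac del: tilt_cov.simps)
  have IH: "(\<Sum>j\<leftarrow>l. fst j * C x (snd j) * tilt_cov C l (snd j) y) = C x y - tilt_cov C l x y" for y
    using Cons(1)[OF ok, of x y] by simp
  have "(\<Sum>j\<leftarrow>l. fst j * C x (snd j) * tilt_cov C (k # l) (snd j) z) = (\<Sum>j\<leftarrow>l. fst j * C x (snd j) * tilt_cov C l (snd j) z)
    - (\<Sum>j\<leftarrow>l. fst j * C x (snd j) * tilt_cov C l (snd j) (snd k)) * c"
    by (rule sum_list_split) (simp add: st algebra_simps del: tilt_cov.simps)
  moreover have "fst k * C x (snd k) * tilt_cov C (k # l) (snd k) z = C x (snd k) * c" by (simp add: c_def del: tilt_cov.simps)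
  ultimately show ?case
    unfolding list.map sum_list.Cons st[of x] by (simp only: IH) (simp add: algebra_simps del: tilt_cov.simps)
qed simp

text \<open>The system satisfied by the tilted mean is the one satisfied by \<open>ww 0 l\<close>,
  with \<open>C\<close> in place of the killed potential density.\<close>

lemma tilt_mean_linear:
  assumes "tilt_ok C l"
  shows "tilt_mean C l x = 1 - (\<Sum>j\<leftarrow>l. fst j * C x (snd j) * tilt_mean C l (snd j))"
  using assms
proof (induct l arbitrary: x)
  case (Cons k l)
  have ok: "tilt_ok C l" using Cons(2) by simp
  define c where "c = fst k * tilt_mean C (k # l) (snd k)"
  have st: "tilt_mean C (k # l) y = tilt_mean C l y - tilt_cov C l y (snd k) * c" for y
    using tilt_steps(4)[OF Cons(2), of y] by (simp add: c_def mult_ac del: tilt_mean.simps)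
  have IH: "(\<Sum>j\<leftarrow>l. fst j * C x (snd j) * tilt_mean C l (snd j)) = 1 - tilt_mean C l x" using Cons(1)[OF ok, of x] by simp
  have IHA: "(\<Sum>j\<leftarrow>l. fst j * C x (snd j) * tilt_cov C l (snd j) y) = C x y - tilt_cov C l x y" for y
    using tilt_cov_linear[OF ok, of x y] by simp
  have "(\<Sum>j\<leftarrow>l. fst j * C x (snd j) * tilt_mean C (k # l) (snd j)) = (\<Sum>j\<leftarrow>l. fst j * C x (snd j) * tilt_mean C l (snd j))
    - (\<Sum>j\<leftarrow>l. fst j * C x (snd j) * tilt_cov C l (snd j) (snd k)) * c"
    by (rule sum_list_split) (simp add: st algebra_simps del: tilt_mean.simps)
  moreover have "fst k * C x (snd k) * tilt_mean C (k # l) (snd k) = C x (snd k) * c" by (simp add: c_def del: tilt_mean.simps)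
  ultimately show ?case
    unfolding list.map sum_list.Cons st[of x] by (simp only: IH IHA) (simp add: algebra_simps del: tilt_mean.simps)
qed simp

text \<open>Adding an entry changes all the old means. By symmetry of the covariance
  \<open>tilt_mean_alt\<close> sums these changes, and the total is the new term of the
  recursion.\<close>

lemma tilt_exponent_eq:
  fixes C :: "'a \<Rightarrow> 'a \<Rightarrow> real"
  assumes "tilt_ok C l" and sym: "\<And>x z. C x z = C z x"
  shows "tilt_exponent C l = (\<Sum>j\<leftarrow>l. fst j * tilt_mean C l (snd j))"
  using assms(1)
proof (induct l)
  case (Cons k l)
  note st = tilt_steps[OF Cons(2)]
  have ok: "tilt_ok C l" using Cons(2) by simp
  define w where "w = tilt_mean C (k # l) (snd k)"
  have "(\<Sum>j\<leftarrow>l. fst j * tilt_mean C (k # l) (snd j)) = (\<Sum>j\<leftarrow>l. fst j * tilt_mean C l (snd j))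
    - (\<Sum>j\<leftarrow>l. fst j * tilt_cov C l (snd k) (snd j)) * (fst k * w)"
  proof (rule sum_list_split)
    fix j :: "real \<times> 'a"
    have e: "tilt_mean C (k # l) (snd j) = tilt_mean C l (snd j) - tilt_cov C l (snd k) (snd j) * (fst k * w)"
      using st(4)[of "snd j"] tilt_cov_sym[of C, OF sym, of l "snd j" "snd k"] by (simp add: w_def mult_ac del: tilt_mean.simps)
    show "fst j * tilt_mean C (k # l) (snd j) = fst j * tilt_mean C l (snd j) - fst j * tilt_cov C l (snd k) (snd j) * (fst k * w)"
      unfolding e by (simp add: algebra_simps)
  qed
  also have "(\<Sum>j\<leftarrow>l. fst j * tilt_cov C l (snd k) (snd j)) = 1 - tilt_mean C l (snd k)"
    using tilt_mean_alt[OF ok, of "snd k"] by simp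
  also have "(\<Sum>j\<leftarrow>l. fst j * tilt_mean C l (snd j)) = tilt_exponent C l" using Cons(1)[OF ok] by simp
  finally have "(\<Sum>j\<leftarrow>k # l. fst j * tilt_mean C (k # l) (snd j)) = tilt_exponent C l + fst k * tilt_mean C l (snd k) * w"
    unfolding list.map sum_list.Cons w_def[symmetric] by (simp add: algebra_simps)
  also have "\<dots> = tilt_exponent C (k # l)" unfolding w_def st(3) by (simp add: power2_eq_square)
  finally show ?case ..
qed simp

text \<open>One factor at a time, \<open>exp (- \<lambda> Y\<^sup>2 / 2)\<close> is the average of \<open>iexp (sqrt \<lambda> g Y)\<close> over a
  standard normal \<open>g\<close>, so that weighting by it keeps the family Gaussian.\<close>

lemma gaussian_tilt:
  fixes \<eta> :: "'a \<Rightarrow> 'g \<Rightarrow> real" and C :: "'a \<Rightarrow> 'a \<Rightarrow> real" and s :: real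
  assumes N: "prob_space N" and m: "\<And>x. \<eta> x \<in> borel_measurable N" and I: "finite I"
    and sym: "\<And>x z. C x z = C z x"
    and char: "\<And>b. (CLINT v|N. iexp (\<Sum>x\<in>I. b x * \<eta> x v)) = exp (- (\<Sum>x\<in>I. \<Sum>z\<in>I. b x * b z * C x z) / 2)"
    and l: "snd ` set l \<subseteq> I" "\<And>k. k \<in> set l \<Longrightarrow> 0 \<le> fst k"
  shows "tilt_ok C l \<and> 0 < tilt_const C l \<and>
    (\<forall>b. (CLINT v|N. of_real (exp (- (\<Sum>k\<leftarrow>l. fst k * (\<eta> (snd k) v + s)\<^sup>2) / 2)) * iexp (\<Sum>x\<in>I. b x * \<eta> x v))
      = of_real (tilt_const C l * exp (- s\<^sup>2 * tilt_exponent C l / 2) * exp (- (\<Sum>x\<in>I. \<Sum>z\<in>I. b x * b z * tilt_cov C l x z) / 2))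
        * iexp (\<Sum>x\<in>I. b x * (s * (tilt_mean C l x - 1))))"
  using l
proof (induct l)
  case Nil
  then show ?case using char by simp
next
  case (Cons k l)
  interpret prob_space N by (rule N)
  define lam0 where "lam0 = fst k"
  define y where "y = snd k"
  have k: "k = (lam0, y)" by (simp add: lam0_def y_def)
  have y: "y \<in> I" using Cons(2) by (simp add: y_def)
  have lam: "0 \<le> lam0" using Cons(3)[of k] by (simp add: lam0_def)
  have dd: "(\<Sum>x\<in>I. \<Sum>z\<in>I. if x = y then if z = y then c else 0 else 0) = c" for c :: real
  proof -
    have "(\<Sum>z\<in>I. if x = y then if z = y then c else 0 else 0) = (if x = y then c else 0)" for x
      using I y by (cases "x = y") auto
    then show ?thesis using I y by simp
  qed
  define V where "V = tilt_cov C l"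
  define w where "w = tilt_mean C l y"
  define K where "K = tilt_const C l * exp (- s\<^sup>2 * tilt_exponent C l / 2)"
  define Gw where "Gw v = exp (- (\<Sum>k\<leftarrow>l. fst k * (\<eta> (snd k) v + s)\<^sup>2) / 2)" for v
  define Q where "Q b = (\<Sum>x\<in>I. \<Sum>z\<in>I. b x * b z * V x z)" for b
  define L where "L b = (\<Sum>x\<in>I. b x * (s * (tilt_mean C l x - 1)))" for b
  define Z where "Z b v = (\<Sum>x\<in>I. b x * \<eta> x v)" for b v
  have IH: "tilt_ok C l" "0 < tilt_const C l"
    "\<And>b. (CLINT v|N. of_real (Gw v) * iexp (Z b v)) = of_real (K * exp (- Q b / 2)) * iexp (L b)"
    using Cons(1) Cons(2,3) by (auto simp: Gw_def Z_def Q_def L_def K_def V_def)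
  have Kpos: "0 < K" using IH(2) by (simp add: K_def)
  have Gm [measurable]: "Gw \<in> borel_measurable N"
  proof -
    have "(\<lambda>v. \<Sum>k\<leftarrow>l. fst k * (\<eta> (snd k) v + s)\<^sup>2) \<in> borel_measurable N"
      using m by (induct l) auto
    then show ?thesis unfolding Gw_def[abs_def] by measurable
  qed
  have Zm [measurable]: "Z b \<in> borel_measurable N" for b unfolding Z_def[abs_def] using m by measurable
  have G01: "0 \<le> Gw v" "Gw v \<le> 1" for v
  proof -
    have "0 \<le> (\<Sum>k\<leftarrow>l. fst k * (\<eta> (snd k) v + s)\<^sup>2)"
    proof (rule sum_list_nonneg)
      fix r assume "r \<in> set (map (\<lambda>k. fst k * (\<eta> (snd k) v + s)\<^sup>2) l)"
      then obtain k' where k': "k' \<in> set l" "r = fst k' * (\<eta> (snd k') v + s)\<^sup>2" by auto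
      then show "0 \<le> r" using Cons(3)[of k'] by simp
    qed
    then show "0 \<le> Gw v" "Gw v \<le> 1" by (auto simp: Gw_def)
  qed
  have Gi: "integrable N (\<lambda>v. of_real (Gw v) * iexp (Z b v))" for b
    by (rule integrable_const_bound[where B=1]) (auto simp: norm_mult G01)
  \<comment> \<open>\<open>V y y\<close> acts as a variance under the weighted law: the modulus of
    the transform cannot exceed the total mass \<open>K\<close>.\<close>
  have Vyy: "0 \<le> V y y"
  proof -
    have GK: "(\<integral>v. Gw v \<partial>N) = K"
    proof -
      have "(CLINT v|N. of_real (Gw v) * iexp (Z (\<lambda>_. 0) v)) = of_real (\<integral>v. Gw v \<partial>N)"
        by (simp add: Z_def)
      then show ?thesis using IH(3)[of "\<lambda>_. 0"] by (simp add: Q_def L_def)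
    qed
    let ?b = "\<lambda>x. if x = y then 1 else (0::real)"
    have e: "?b x * ?b z * V x z = (if x = y then if z = y then V y y else 0 else 0)" for x z by auto
    have "Q ?b = V y y" unfolding Q_def e by (rule dd)
    then have "cmod (CLINT v|N. of_real (Gw v) * iexp (Z ?b v)) = K * exp (- V y y / 2)"
      using Kpos unfolding IH(3) by (simp add: norm_mult)
    moreover have "cmod (CLINT v|N. of_real (Gw v) * iexp (Z ?b v)) \<le> (\<integral>v. cmod (of_real (Gw v) * iexp (Z ?b v)) \<partial>N)"
      by (rule integral_norm_bound)
    moreover have "(\<integral>v. cmod (of_real (Gw v) * iexp (Z ?b v)) \<partial>N) = K" using G01 by (simp add: norm_mult GK)
    ultimately have "K * exp (- V y y / 2) \<le> K" by simp
    then show ?thesis using Kpos by simp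
  qed
  define D where "D = 1 + lam0 * V y y"
  have D: "0 < D" using Vyy lam by (simp add: D_def add_pos_nonneg)
  have ok: "tilt_ok C (k # l)" using IH(1) D by (simp add: k D_def V_def)
  have cpos: "0 < tilt_const C (k # l)" using IH(2) D by (simp add: k D_def V_def)
  have Vsym: "V x z = V z x" for x z unfolding V_def by (rule tilt_cov_sym[OF sym])
  have main: "(CLINT v|N. of_real (exp (- (\<Sum>k\<leftarrow>k # l. fst k * (\<eta> (snd k) v + s)\<^sup>2) / 2)) * iexp (Z b v))
    = of_real (tilt_const C (k # l) * exp (- s\<^sup>2 * tilt_exponent C (k # l) / 2) * exp (- (\<Sum>x\<in>I. \<Sum>z\<in>I. b x * b z * tilt_cov C (k # l) x z) / 2))
        * iexp (\<Sum>x\<in>I. b x * (s * (tilt_mean C (k # l) x - 1)))" for b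
  proof -
    define B where "B = (\<Sum>x\<in>I. b x * V x y)"
    \<comment> \<open>Coefficients of the exponent as a polynomial in the auxiliary normal g:
      \<alpha> comes from the variance at y, \<beta> from the covariance of \<open>\<eta> y\<close>
      with the test combination, \<gamma> from the tilted mean of
      \<open>\<eta> y + s\<close>.\<close>
    define \<alpha> where "\<alpha> = lam0 * V y y"
    define \<beta> where "\<beta> = sqrt lam0 * B"
    define \<gamma> where "\<gamma> = sqrt lam0 * s * w"
    define M where "M = density lborel std_normal_density"
    have "prob_space M" unfolding M_def by (rule prob_space_normal_density) simp
    then interpret M: prob_space M .
    interpret NM: pair_prob_space N M ..
    have sM [measurable_cong]: "sets M = sets borel" by (simp add: M_def)
    have Mint: "(CLINT g|M. h g) = (CLINT g|lborel. std_normal_density g *\<^sub>R h g)" if "h \<in> borel_measurable borel" for h :: "real \<Rightarrow> complex"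
      unfolding M_def using that by (subst integral_density) auto
    let ?Y = "\<lambda>v. \<eta> y v + s"
    let ?h = "\<lambda>v g. of_real (Gw v) * iexp (Z b v) * iexp (sqrt lam0 * ?Y v * g)"
    have [measurable]: "\<eta> y \<in> borel_measurable N" by (rule m)
    have hs: "of_real (exp (- (lam0 * (?Y v)\<^sup>2) / 2)) = (CLINT g|M. iexp (sqrt lam0 * ?Y v * g))" for v
      using normal_density_char[of 1 0 "sqrt lam0 * ?Y v"] lam by (simp add: Mint power_mult_distrib)
    have hi: "integrable (N \<Otimes>\<^sub>M M) (\<lambda>(v, g). ?h v g)"
      by (rule NM.P.integrable_const_bound[where B=1]) (auto simp: norm_mult G01 case_prod_beta)
    have "(CLINT v|N. of_real (exp (- (\<Sum>k\<leftarrow>k # l. fst k * (\<eta> (snd k) v + s)\<^sup>2) / 2)) * iexp (Z b v)) = (CLINT v|N. CLINT g|M. ?h v g)"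
    proof (rule Bochner_Integration.integral_cong[OF refl])
      fix v
      have "exp (- (\<Sum>k\<leftarrow>k # l. fst k * (\<eta> (snd k) v + s)\<^sup>2) / 2) = Gw v * exp (- (lam0 * (?Y v)\<^sup>2) / 2)"
        by (simp add: Gw_def k exp_add[symmetric] add_divide_distrib diff_divide_distrib)
      then show "of_real (exp (- (\<Sum>k\<leftarrow>k # l. fst k * (\<eta> (snd k) v + s)\<^sup>2) / 2)) * iexp (Z b v) = (CLINT g|M. ?h v g)"
        using hs[of v] by (simp only: integral_mult_right_zero of_real_mult mult_ac)
    qed
    also have "\<dots> = (CLINT g|M. CLINT v|N. ?h v g)" by (rule NM.Fubini_integral[symmetric, OF hi])
    also have "\<dots> = (CLINT g|M. (of_real (K * exp (- Q b / 2)) * iexp (L b)) * (iexp (\<gamma> * g) * of_real (exp (- (\<alpha> * g\<^sup>2 + 2 * \<beta> * g) / 2))))"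
    proof (rule Bochner_Integration.integral_cong[OF refl])
      fix g
      define c where "c = sqrt lam0 * g"
      \<comment> \<open>For fixed g the oscillating factor moves the test vector by \<open>c\<close>
        at the coordinate y, so the induction hypothesis applies again; the shift s leaves the
        constant phase \<open>iexp (c * s)\<close>.\<close>
      define b' where "b' x = b x + (if x = y then c else 0)" for x
      have Zb: "Z b' v = Z b v + c * \<eta> y v" for v
      proof -
        have "b' x * \<eta> x v = b x * \<eta> x v + (if x = y then c * \<eta> y v else 0)" for x by (auto simp: b'_def distrib_right)
        then show ?thesis unfolding Z_def using I y by (simp add: sum.distrib sum.delta)
      qed
      have Lb: "L b' = L b + c * (s * (w - 1))"
      proof -
        have "b' x * (s * (tilt_mean C l x - 1)) = b x * (s * (tilt_mean C l x - 1)) + (if x = y then c * (s * (w - 1)) else 0)" for x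
          by (auto simp: b'_def w_def distrib_right)
        then show ?thesis unfolding L_def using I y by (simp add: sum.distrib sum.delta)
      qed
      have Qb: "Q b' = Q b + 2 * c * B + c\<^sup>2 * V y y"
      proof -
        have "b' x * b' z * V x z = b x * b z * V x z + (if z = y then c * (b x * V x y) else 0)
          + (if x = y then c * (b z * V z y) else 0) + (if x = y then if z = y then c\<^sup>2 * V y y else 0 else 0)" for x z
          using Vsym[of y z] by (auto simp: b'_def algebra_simps power2_eq_square)
        then have "Q b' = Q b + (\<Sum>x\<in>I. c * (b x * V x y)) + (\<Sum>z\<in>I. c * (b z * V z y)) + c\<^sup>2 * V y y"
          unfolding Q_def using I y
          by (simp add: sum.distrib sum.delta dd) (subst sum.swap, simp add: sum.delta)
        then show ?thesis by (simp add: B_def sum_distrib_left[symmetric])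
      qed
      have "(CLINT v|N. ?h v g) = (CLINT v|N. iexp (c * s) * (of_real (Gw v) * iexp (Z b' v)))"
        unfolding Zb
        by (intro Bochner_Integration.integral_cong refl)
          (simp add: c_def exp_add[symmetric] algebra_simps)
      also have "\<dots> = iexp (c * s) * (of_real (K * exp (- Q b' / 2)) * iexp (L b'))"
        unfolding integral_mult_right_zero IH(3) ..
      also have "\<dots> = (of_real (K * exp (- Q b / 2)) * iexp (L b)) * (iexp (\<gamma> * g) * of_real (exp (- (\<alpha> * g\<^sup>2 + 2 * \<beta> * g) / 2)))"
      proof -
        have c2: "c\<^sup>2 = lam0 * g\<^sup>2" using lam by (simp add: c_def power_mult_distrib)
        have cB: "2 * c * B = 2 * \<beta> * g" by (simp add: c_def \<beta>_def)
        have "- Q b' / 2 = - Q b / 2 + - (\<alpha> * g\<^sup>2 + 2 * \<beta> * g) / 2"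
          unfolding Qb c2 cB \<alpha>_def by (simp add: algebra_simps add_divide_distrib diff_divide_distrib)
        then have 1: "exp (- Q b' / 2) = exp (- Q b / 2) * exp (- (\<alpha> * g\<^sup>2 + 2 * \<beta> * g) / 2)" by (simp only: exp_add)
        have "c * s + L b' = L b + \<gamma> * g" unfolding Lb by (simp add: c_def \<gamma>_def algebra_simps)
        then have "\<i> * of_real (c * s) + \<i> * of_real (L b') = \<i> * of_real (L b) + \<i> * of_real (\<gamma> * g)"
          by (metis distrib_left of_real_add)
        then have 2: "iexp (c * s) * iexp (L b') = iexp (L b) * iexp (\<gamma> * g)" by (simp only: exp_add[symmetric])
        have "iexp (c * s) * (of_real (K * exp (- Q b' / 2)) * iexp (L b')) = of_real (K * exp (- Q b' / 2)) * (iexp (c * s) * iexp (L b'))"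
          by (simp only: mult_ac)
        also have "\<dots> = (of_real (K * exp (- Q b / 2)) * iexp (L b)) * (iexp (\<gamma> * g) * of_real (exp (- (\<alpha> * g\<^sup>2 + 2 * \<beta> * g) / 2)))"
          unfolding 1 2 by (simp only: of_real_mult mult_ac)
        finally show ?thesis .
      qed
      finally show "(CLINT v|N. ?h v g) = (of_real (K * exp (- Q b / 2)) * iexp (L b)) * (iexp (\<gamma> * g) * of_real (exp (- (\<alpha> * g\<^sup>2 + 2 * \<beta> * g) / 2)))" .
    qed
    also have "\<dots> = (of_real (K * exp (- Q b / 2)) * iexp (L b)) * (of_real (exp (\<beta>\<^sup>2 / (2 * (1 + \<alpha>)) - \<gamma>\<^sup>2 / (2 * (1 + \<alpha>))) / sqrt (1 + \<alpha>)) * iexp (- \<gamma> * \<beta> / (1 + \<alpha>)))"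
    proof -
      have "0 \<le> \<alpha>" using lam Vyy by (simp add: \<alpha>_def)
      then show ?thesis unfolding integral_mult_right_zero
        by (subst Mint) (measurable, simp only: gaussian_quadratic_integral)
    qed
    also have "\<dots> = of_real (tilt_const C (k # l) * exp (- s\<^sup>2 * tilt_exponent C (k # l) / 2) * exp (- (\<Sum>x\<in>I. \<Sum>z\<in>I. b x * b z * tilt_cov C (k # l) x z) / 2))
        * iexp (\<Sum>x\<in>I. b x * (s * (tilt_mean C (k # l) x - 1)))"
    proof -
      have D\<alpha>: "1 + \<alpha> = D" by (simp add: D_def \<alpha>_def)
      have b2: "\<beta>\<^sup>2 = lam0 * B\<^sup>2" "\<gamma>\<^sup>2 = lam0 * s\<^sup>2 * w\<^sup>2" "\<gamma> * \<beta> = lam0 * s * w * B"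
        using lam by (auto simp: \<beta>_def \<gamma>_def power_mult_distrib)
      have Q': "(\<Sum>x\<in>I. \<Sum>z\<in>I. b x * b z * tilt_cov C (k # l) x z) = Q b - lam0 * B\<^sup>2 / D"
      proof -
        have "b x * b z * tilt_cov C (k # l) x z = b x * b z * V x z - lam0 / D * ((b x * V x y) * (b z * V z y))" for x z
          using Vsym[of y z] by (simp add: k V_def[symmetric] D_def[symmetric] algebra_simps)
        then have "(\<Sum>x\<in>I. \<Sum>z\<in>I. b x * b z * tilt_cov C (k # l) x z)
          = Q b - lam0 / D * (\<Sum>x\<in>I. \<Sum>z\<in>I. (b x * V x y) * (b z * V z y))"
          by (simp only: sum_subtractf sum_distrib_left[symmetric] Q_def)
        also have "(\<Sum>x\<in>I. \<Sum>z\<in>I. (b x * V x y) * (b z * V z y)) = B\<^sup>2"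
          by (simp only: B_def power2_eq_square sum_product)
        finally show ?thesis by simp
      qed
      have L': "(\<Sum>x\<in>I. b x * (s * (tilt_mean C (k # l) x - 1))) = L b + - (lam0 * s * w * B) / D"
      proof -
        have "b x * (s * (tilt_mean C (k # l) x - 1)) = b x * (s * (tilt_mean C l x - 1)) - lam0 * s * w / D * (b x * V x y)" for x
          by (simp add: k V_def[symmetric] w_def[symmetric] D_def[symmetric] algebra_simps)
        then have "(\<Sum>x\<in>I. b x * (s * (tilt_mean C (k # l) x - 1))) = L b - lam0 * s * w / D * B"
          by (simp only: sum_subtractf sum_distrib_left[symmetric] L_def B_def)
        then show ?thesis by simp
      qed
      have E': "tilt_exponent C (k # l) = tilt_exponent C l + lam0 * w\<^sup>2 / D" "tilt_const C (k # l) = tilt_const C l / sqrt D"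
        by (simp_all add: k V_def[symmetric] w_def[symmetric] D_def[symmetric])
      have r: "K * exp (- Q b / 2) * (exp (\<beta>\<^sup>2 / (2 * D) - \<gamma>\<^sup>2 / (2 * D)) / sqrt D)
        = tilt_const C (k # l) * exp (- s\<^sup>2 * tilt_exponent C (k # l) / 2) * exp (- (Q b - lam0 * B\<^sup>2 / D) / 2)"
      proof -
        have "- s\<^sup>2 * tilt_exponent C l / 2 + - Q b / 2 + (\<beta>\<^sup>2 / (2 * D) - \<gamma>\<^sup>2 / (2 * D))
          = - s\<^sup>2 * tilt_exponent C (k # l) / 2 + - (Q b - lam0 * B\<^sup>2 / D) / 2"
          unfolding E' b2 by (simp add: algebra_simps add_divide_distrib diff_divide_distrib)
        then have "exp (- s\<^sup>2 * tilt_exponent C l / 2) * exp (- Q b / 2) * exp (\<beta>\<^sup>2 / (2 * D) - \<gamma>\<^sup>2 / (2 * D))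
          = exp (- s\<^sup>2 * tilt_exponent C (k # l) / 2) * exp (- (Q b - lam0 * B\<^sup>2 / D) / 2)"
          by (simp only: exp_add[symmetric])
        then show ?thesis unfolding K_def E'(2) by (simp only: times_divide_eq_right times_divide_eq_left mult.assoc)
      qed
      have "- \<gamma> * \<beta> / D = - (lam0 * s * w * B) / D" using b2(3) by simp
      then have "\<i> * of_real (L b) + \<i> * of_real (- \<gamma> * \<beta> / D) = \<i> * of_real (L b + - (lam0 * s * w * B) / D)"
        by (simp only: of_real_add distrib_left)
      then have i: "iexp (L b) * iexp (- \<gamma> * \<beta> / D) = iexp (L b + - (lam0 * s * w * B) / D)" by (simp only: exp_add[symmetric])
      have "(of_real (K * exp (- Q b / 2)) * iexp (L b)) * (of_real (exp (\<beta>\<^sup>2 / (2 * D) - \<gamma>\<^sup>2 / (2 * D)) / sqrt D) * iexp (- \<gamma> * \<beta> / D))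
        = of_real (K * exp (- Q b / 2) * (exp (\<beta>\<^sup>2 / (2 * D) - \<gamma>\<^sup>2 / (2 * D)) / sqrt D)) * (iexp (L b) * iexp (- \<gamma> * \<beta> / D))"
        by (simp only: of_real_mult mult_ac)
      then show ?thesis unfolding D\<alpha> Q' L' r i .
    qed
    finally show ?thesis .
  qed
  show ?case using ok cpos main unfolding Z_def by blast
qed

text \<open>A list may name a point several times; merging the masses turns list sums into sums over
  a finite set, to which the quadratic form of \<open>C\<close> applies.\<close>

lemma sum_list_by_points:
  fixes h :: "'a \<Rightarrow> real"
  assumes "finite I" "snd ` set l \<subseteq> I"
  shows "(\<Sum>j\<leftarrow>l. fst j * h (snd j)) = (\<Sum>x\<in>I. (\<Sum>j\<leftarrow>l. if snd j = x then fst j else 0) * h x)"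
  using assms(2)
proof (induct l)
  case (Cons k l)
  have "(\<Sum>x\<in>I. (if snd k = x then fst k else 0) * h x) = (\<Sum>x\<in>I. if snd k = x then fst k * h (snd k) else 0)"
    by (intro sum.cong) auto
  also have "\<dots> = fst k * h (snd k)" using assms(1) Cons(2) by simp
  finally show ?case using Cons by (simp add: distrib_right sum.distrib)
qed simp

text \<open>At the zero test vector \<open>gaussian_tilt\<close> gives the total mass as a product
  in which s enters only through one exponential. What remains is that the given solution w is the
  tilted mean.\<close>

theorem gaussian_square_laplace:
  fixes \<eta> :: "'a \<Rightarrow> 'g \<Rightarrow> real"
  assumes G: "centered_gaussian_process N \<eta> C" and l: "\<And>k. k \<in> set l \<Longrightarrow> 0 \<le> fst k"
    and w: "\<And>x. w x = 1 - (\<Sum>j\<leftarrow>l. fst j * C x (snd j) * w (snd j))"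
  shows "(\<integral>v. exp (- (\<Sum>k\<leftarrow>l. fst k * (\<eta> (snd k) v + s)\<^sup>2) / 2) \<partial>N)
    = exp (- s\<^sup>2 * (\<Sum>k\<leftarrow>l. fst k * w (snd k)) / 2) * (\<integral>v. exp (- (\<Sum>k\<leftarrow>l. fst k * (\<eta> (snd k) v)\<^sup>2) / 2) \<partial>N)"
proof -
  have N: "prob_space N" and nrv: "\<And>I c. finite I \<Longrightarrow> normal_rv N (\<lambda>v. \<Sum>x\<in>I. c x * \<eta> x v)"
    and mean: "\<And>x. (\<integral>v. \<eta> x v \<partial>N) = 0" and cov: "\<And>x y. (\<integral>v. \<eta> x v * \<eta> y v \<partial>N) = C x y"
    using G by (auto simp: centered_gaussian_process_def gaussian_process_def)
  interpret prob_space N by (rule N)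
  have n1: "normal_rv N (\<eta> x)" for x using nrv[of "{x}" "\<lambda>_. 1"] by simp
  note e1 = normal_rv_centered[OF N n1 mean]
  have m [measurable]: "\<eta> x \<in> borel_measurable N" for x by (rule e1(1))
  have ip: "integrable N (\<lambda>v. \<eta> x v * \<eta> y v)" for x y
  proof (rule Bochner_Integration.integrable_bound)
    show "integrable N (\<lambda>v. (\<eta> x v)\<^sup>2 + (\<eta> y v)\<^sup>2)" by (intro Bochner_Integration.integrable_add e1(3))
    have "\<bar>p * q\<bar> \<le> \<bar>p\<^sup>2 + q\<^sup>2\<bar>" for p q :: real
    proof -
      have "2 * (\<bar>p\<bar> * \<bar>q\<bar>) \<le> p\<^sup>2 + q\<^sup>2" using sum_squares_bound[of "\<bar>p\<bar>" "\<bar>q\<bar>"] by simp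
      moreover have "0 \<le> \<bar>p\<bar> * \<bar>q\<bar>" by simp
      ultimately show ?thesis unfolding abs_mult by linarith
    qed
    then show "AE v in N. norm (\<eta> x v * \<eta> y v) \<le> norm ((\<eta> x v)\<^sup>2 + (\<eta> y v)\<^sup>2)" by simp
  qed measurable
  have sym: "C x z = C z x" for x z using cov[of x z] cov[of z x] by (simp add: mult.commute)
  have sq: "(\<integral>v. (\<Sum>x\<in>I. b x * \<eta> x v)\<^sup>2 \<partial>N) = (\<Sum>x\<in>I. \<Sum>z\<in>I. b x * b z * C x z)" if "finite I" for I b
  proof -
    have "(\<Sum>x\<in>I. b x * \<eta> x v)\<^sup>2 = (\<Sum>x\<in>I. \<Sum>z\<in>I. b x * b z * (\<eta> x v * \<eta> z v))" for v
      by (simp add: power2_eq_square sum_product mult_ac)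
    then show ?thesis using ip by (simp add: Bochner_Integration.integral_sum cov[symmetric])
  qed
  have char: "(CLINT v|N. iexp (\<Sum>x\<in>I. b x * \<eta> x v)) = exp (- (\<Sum>x\<in>I. \<Sum>z\<in>I. b x * b z * C x z) / 2)" if I: "finite I" for I b
  proof -
    have "(\<integral>v. (\<Sum>x\<in>I. b x * \<eta> x v) \<partial>N) = 0" using e1(2) mean by (simp add: Bochner_Integration.integral_sum)
    from normal_rv_centered(4)[OF N nrv[OF I] this] show ?thesis by (simp only: sq[OF I])
  qed
  define I where "I = snd ` set l"
  have I: "finite I" "snd ` set l \<subseteq> I" by (auto simp: I_def)
  note T = gaussian_tilt[OF N m I(1) sym char[OF I(1)] I(2) l]
  have ok: "tilt_ok C l" using T by blast
  have val: "(\<integral>v. exp (- (\<Sum>k\<leftarrow>l. fst k * (\<eta> (snd k) v + s)\<^sup>2) / 2) \<partial>N) = tilt_const C l * exp (- s\<^sup>2 * tilt_exponent C l / 2)" for s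
  proof -
    have "(CLINT v|N. of_real (exp (- (\<Sum>k\<leftarrow>l. fst k * (\<eta> (snd k) v + s)\<^sup>2) / 2)) * iexp (\<Sum>x\<in>I. 0 * \<eta> x v))
      = of_real (tilt_const C l * exp (- s\<^sup>2 * tilt_exponent C l / 2) * exp (- (\<Sum>x\<in>I. \<Sum>z\<in>I. 0 * 0 * tilt_cov C l x z) / 2))
        * iexp (\<Sum>x\<in>I. 0 * (s * (tilt_mean C l x - 1)))"
      by (rule T[THEN conjunct2, THEN conjunct2, THEN spec[where x = "\<lambda>_. 0"]])
    then have "complex_of_real (\<integral>v. exp (- (\<Sum>k\<leftarrow>l. fst k * (\<eta> (snd k) v + s)\<^sup>2) / 2) \<partial>N) = of_real (tilt_const C l * exp (- s\<^sup>2 * tilt_exponent C l / 2))"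
      unfolding integral_complex_of_real[symmetric] by simp
    then show ?thesis by (simp only: of_real_eq_iff)
  qed
  \<comment> \<open>The difference d of two solutions satisfies \<open>d = - C M d\<close>, with
    \<open>M\<close> the diagonal of merged masses. Pairing with \<open>M d\<close> shows that minus
    the sum of \<open>M x * (d x)\<^sup>2\<close> is a value of the positive semidefinite form
    \<open>C\<close>; hence \<open>M d = 0\<close>, and then \<open>d = 0\<close>.\<close>
  have weq: "w x = tilt_mean C l x" for x
  proof -
    define d where "d x = w x - tilt_mean C l x" for x
    define M where "M x = (\<Sum>j\<leftarrow>l. if snd j = x then fst j else 0)" for x
    have M0: "0 \<le> M x" for x unfolding M_def using l by (intro sum_list_nonneg) auto
    have d: "d x = - (\<Sum>z\<in>I. M z * (C x z * d z))" for x
    proof -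
      have "d x = - (\<Sum>j\<leftarrow>l. fst j * (C x (snd j) * d (snd j)))"
        unfolding d_def w[of x] tilt_mean_linear[OF ok, of x]
        by (simp add: right_diff_distrib sum_list_subtractf mult.assoc)
      then show ?thesis unfolding sum_list_by_points[OF I, of "\<lambda>z. C x z * d z"] M_def .
    qed
    have "0 \<le> (\<Sum>x\<in>I. \<Sum>z\<in>I. (M x * d x) * (M z * d z) * C x z)"
      unfolding sq[OF I(1), symmetric] by (rule integral_nonneg_AE) simp
    also have "\<dots> = (\<Sum>x\<in>I. - (M x * (d x)\<^sup>2))"
    proof (rule sum.cong[OF refl])
      fix x
      have "(\<Sum>z\<in>I. (M x * d x) * (M z * d z) * C x z) = (M x * d x) * (\<Sum>z\<in>I. M z * (C x z * d z))"
        by (simp add: sum_distrib_left mult_ac)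
      also have "\<dots> = (M x * d x) * (- d x)" using d[of x] by simp
      finally show "(\<Sum>z\<in>I. (M x * d x) * (M z * d z) * C x z) = - (M x * (d x)\<^sup>2)" by (simp add: power2_eq_square)
    qed
    finally have "(\<Sum>x\<in>I. M x * (d x)\<^sup>2) \<le> 0" by (simp add: sum_negf)
    moreover have "0 \<le> (\<Sum>x\<in>I. M x * (d x)\<^sup>2)" using M0 by (intro sum_nonneg) auto
    ultimately have "(\<Sum>x\<in>I. M x * (d x)\<^sup>2) = 0" by simp
    then have z: "M z * d z = 0" if "z \<in> I" for z
      using that I(1) M0 by (subst (asm) sum_nonneg_eq_0_iff) auto
    have "(\<Sum>z\<in>I. M z * (C x z * d z)) = 0"
    proof (rule sum.neutral, rule ballI)
      fix i assume "i \<in> I"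
      have "M i * (C x i * d i) = C x i * (M i * d i)" by simp
      then show "M i * (C x i * d i) = 0" using z[OF \<open>i \<in> I\<close>] by simp
    qed
    then have "d x = 0" using d[of x] by simp
    then show ?thesis by (simp add: d_def)
  qed
  have ex: "tilt_exponent C l = (\<Sum>k\<leftarrow>l. fst k * w (snd k))"
    unfolding tilt_exponent_eq[OF ok sym] weq ..
  show ?thesis using val[of s] val[of 0] by (simp add: ex)
qed

section \<open>Uniqueness of Laplace transforms\<close>

text \<open>The multipliers of the space \<open>V\<close> of functions whose products with all monomials have equal
  integrals form an algebra that contains the coordinates, so they are dense by Stone--Weierstrass.\<close>

lemma eq_moments_imp_eq_measure:
  fixes D1 D2 :: "(nat \<Rightarrow> real) measure"
  assumes D1: "prob_space D1" "sets D1 = sets borel" "AE y in D1. \<forall>i. y i \<in> {0..1}"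
    and D2: "prob_space D2" "sets D2 = sets borel" "AE y in D2. \<forall>i. y i \<in> {0..1}"
    and eq: "\<And>l. (\<integral>y. (\<Prod>k\<leftarrow>l. y k) \<partial>D1) = (\<integral>y. (\<Prod>k\<leftarrow>l. y k) \<partial>D2)"
  shows "D1 = D2"
proof -
  interpret D1: prob_space D1 by (rule D1(1))
  interpret D2: prob_space D2 by (rule D2(1))
  define S :: "(nat \<Rightarrow> real) set" where "S = (\<Pi>\<^sub>E i\<in>UNIV. {0..1})"
  have inS: "y \<in> S \<longleftrightarrow> (\<forall>i. y i \<in> {0..1})" for y unfolding S_def PiE_UNIV_domain Pi_iff by simp
  have S1: "AE y in D1. y \<in> S" and S2: "AE y in D2. y \<in> S" unfolding inS using D1(3) D2(3) by auto
  have mD [simp]: "measurable D1 M = measurable borel M" "measurable D2 M = measurable borel M" for M :: "real measure"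
    by (intro measurable_cong_sets D1(2) D2(2) refl)+
  have coord [measurable]: "(\<lambda>y::nat \<Rightarrow> real. y k) \<in> borel_measurable borel" for k
    by (intro borel_measurable_continuous_onI continuous_on_product_coordinates)
  have mono_m [measurable]: "(\<lambda>y::nat \<Rightarrow> real. \<Prod>k\<leftarrow>l. y k) \<in> borel_measurable borel" for l
    by (induct l) simp_all
  have mono_b: "\<bar>\<Prod>k\<leftarrow>l. y k\<bar> \<le> 1" if "y \<in> S" for y :: "nat \<Rightarrow> real" and l
  proof (induct l)
    case (Cons j l)
    have "\<bar>y j\<bar> \<le> 1" using that[unfolded inS, rule_format, of j] by simp
    then show ?case using mult_mono[OF _ Cons, of "\<bar>y j\<bar>" 1] by (simp add: abs_mult)
  qed simp
  have int: "integrable D1 g" "integrable D2 g"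
    if "g \<in> borel_measurable borel" "\<And>y. y \<in> S \<Longrightarrow> \<bar>g y\<bar> \<le> B" for g :: "_ \<Rightarrow> real" and B
  proof -
    have "AE y in D1. norm (g y) \<le> B" "AE y in D2. norm (g y) \<le> B"
      using S1 S2 that(2) by auto
    then show "integrable D1 g" "integrable D2 g"
      using D1.integrable_const_bound[of g B] D2.integrable_const_bound[of g B] that(1) by simp_all
  qed
  define V where "V = {h :: (nat \<Rightarrow> real) \<Rightarrow> real. h \<in> borel_measurable borel \<and> (\<exists>B. \<forall>y\<in>S. \<bar>h y\<bar> \<le> B) \<and>
    (\<forall>l. (\<integral>y. (\<Prod>k\<leftarrow>l. y k) * h y \<partial>D1) = (\<integral>y. (\<Prod>k\<leftarrow>l. y k) * h y \<partial>D2))}"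
  have one: "(\<lambda>y. 1) \<in> V" unfolding V_def using eq by auto
  have cV: "(\<lambda>y. c * h y) \<in> V" if h: "h \<in> V" for c h
  proof -
    obtain B where B: "\<forall>y\<in>S. \<bar>h y\<bar> \<le> B" using h unfolding V_def by blast
    have "\<bar>c * h y\<bar> \<le> \<bar>c\<bar> * B" if "y \<in> S" for y
      unfolding abs_mult using B that by (intro mult_left_mono) auto
    moreover have "(\<integral>y. (\<Prod>k\<leftarrow>l. y k) * (c * h y) \<partial>D1) = (\<integral>y. (\<Prod>k\<leftarrow>l. y k) * (c * h y) \<partial>D2)" for l
      using h unfolding V_def mult.left_commute[of _ c] by simp
    ultimately show ?thesis using h unfolding V_def by auto
  qed
  have aV: "(\<lambda>y. h y + h' y) \<in> V" if h: "h \<in> V" "h' \<in> V" for h h'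
  proof -
    obtain B B' where B: "\<forall>y\<in>S. \<bar>h y\<bar> \<le> B" "\<forall>y\<in>S. \<bar>h' y\<bar> \<le> B'" using h unfolding V_def by blast
    have m [measurable]: "h \<in> borel_measurable borel" "h' \<in> borel_measurable borel" using h by (auto simp: V_def)
    have b: "\<bar>(\<Prod>k\<leftarrow>l. y k) * g y\<bar> \<le> C"
      if y: "y \<in> S" and g: "\<forall>y\<in>S. \<bar>g y\<bar> \<le> C" for y :: "nat \<Rightarrow> real" and l g C
    proof -
      have "\<bar>\<Prod>k\<leftarrow>l. y k\<bar> * \<bar>g y\<bar> \<le> 1 * C"
        using g y mono_b[OF y, of l] by (intro mult_mono) auto
      then show ?thesis by (simp only: abs_mult mult_1)
    qed
    have "\<bar>h y + h' y\<bar> \<le> B + B'" if "y \<in> S" for y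
      using abs_triangle_ineq[of "h y" "h' y"] B(1)[rule_format, OF that] B(2)[rule_format, OF that] by linarith
    moreover have "(\<integral>y. (\<Prod>k\<leftarrow>l. y k) * (h y + h' y) \<partial>D1) = (\<integral>y. (\<Prod>k\<leftarrow>l. y k) * (h y + h' y) \<partial>D2)" for l
    proof -
      have i: "integrable D1 (\<lambda>y. (\<Prod>k\<leftarrow>l. y k) * h y)" "integrable D2 (\<lambda>y. (\<Prod>k\<leftarrow>l. y k) * h y)"
        by (rule int[OF borel_measurable_times[OF mono_m m(1)] b[OF _ B(1)]], assumption)+
      have i': "integrable D1 (\<lambda>y. (\<Prod>k\<leftarrow>l. y k) * h' y)" "integrable D2 (\<lambda>y. (\<Prod>k\<leftarrow>l. y k) * h' y)"
        by (rule int[OF borel_measurable_times[OF mono_m m(2)] b[OF _ B(2)]], assumption)+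
      show ?thesis using h i i' by (simp add: distrib_left V_def)
    qed
    ultimately show ?thesis unfolding V_def by auto
  qed
  have xV: "(\<lambda>y. y j * h y) \<in> V" if h: "h \<in> V" for j h
  proof -
    obtain B where B: "\<forall>y\<in>S. \<bar>h y\<bar> \<le> B" using h unfolding V_def by blast
    have m [measurable]: "h \<in> borel_measurable borel" using h by (auto simp: V_def)
    have "\<bar>y j * h y\<bar> \<le> 1 * B" if "y \<in> S" for y
      unfolding abs_mult using B that by (intro mult_mono) (auto simp: inS)
    moreover have "(\<integral>y. (\<Prod>k\<leftarrow>l. y k) * (y j * h y) \<partial>D1) = (\<integral>y. (\<Prod>k\<leftarrow>l. y k) * (y j * h y) \<partial>D2)" for l
    proof -
      have "(\<integral>y. (\<Prod>k\<leftarrow>j # l. y k) * h y \<partial>D1) = (\<integral>y. (\<Prod>k\<leftarrow>j # l. y k) * h y \<partial>D2)"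
        using h unfolding V_def by blast
      then show ?thesis by (simp add: mult_ac)
    qed
    moreover have "(\<lambda>y. y j * h y) \<in> borel_measurable borel" by measurable
    ultimately show ?thesis unfolding V_def by blast
  qed
  define R where "R = {g. continuous_on S g \<and> (\<forall>h\<in>V. (\<lambda>y. g y * h y) \<in> V)}"
  have sep: "\<exists>g\<in>R. g y \<noteq> g z" if yz: "y \<noteq> z" for y z
  proof -
    obtain j where j: "y j \<noteq> z j" using yz by blast
    have "continuous_on S (\<lambda>y. y j)"
      by (rule continuous_on_subset[OF continuous_on_product_coordinates subset_UNIV])
    then have "(\<lambda>y. y j) \<in> R" unfolding R_def mem_Collect_eq using xV by (intro conjI ballI)
    then show ?thesis by (rule rev_bexI) (rule j)
  qed
  interpret R: function_ring_on R S
  proof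
    show "compact S" unfolding S_def compactin_euclidean_iff[symmetric] euclidean_product_topology[symmetric]
      compactin_PiE by simp
  next
    fix g g' assume g: "g \<in> R" "g' \<in> R"
    then have c: "continuous_on S g" "continuous_on S g'"
      and v: "\<And>h. h \<in> V \<Longrightarrow> (\<lambda>y. g y * h y) \<in> V" "\<And>h. h \<in> V \<Longrightarrow> (\<lambda>y. g' y * h y) \<in> V"
      unfolding R_def by simp_all
    show "(\<lambda>y. g y + g' y) \<in> R" unfolding R_def mem_Collect_eq distrib_right
      by (intro conjI ballI continuous_on_add c aV v)
    show "(\<lambda>y. g y * g' y) \<in> R" unfolding R_def mem_Collect_eq mult.assoc
      by (intro conjI ballI continuous_on_mult c v)
  next
    show "(\<lambda>_. c) \<in> R" for c unfolding R_def mem_Collect_eq by (intro conjI ballI continuous_on_const cV)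
  qed (use sep in \<open>simp_all add: R_def\<close>)
  have cont: "(\<integral>y. g y \<partial>D1) = (\<integral>y. g y \<partial>D2)" if g: "continuous_on UNIV g" for g :: "(nat \<Rightarrow> real) \<Rightarrow> real"
  proof -
    have gS: "continuous_on S g" using continuous_on_subset[OF g] by simp
    have gm [measurable]: "g \<in> borel_measurable borel" by (rule borel_measurable_continuous_onI[OF g])
    have "bounded (g ` S)" by (intro compact_imp_bounded compact_continuous_image gS R.compact)
    then obtain B where B: "\<And>y. y \<in> S \<Longrightarrow> \<bar>g y\<bar> \<le> B" by (auto simp: bounded_iff)
    have "\<bar>(\<integral>y. g y \<partial>D1) - (\<integral>y. g y \<partial>D2)\<bar> \<le> 0 + e" if e: "0 < e" for e
    proof -
      obtain h where h: "h \<in> R" "\<And>y. y \<in> S \<Longrightarrow> \<bar>g y - h y\<bar> < e / 2"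
        using R.Stone_Weierstrass_basic[OF gS, of "e / 2"] e by auto
      have "\<And>k. k \<in> V \<Longrightarrow> (\<lambda>y. h y * k y) \<in> V" using h(1) unfolding R_def by simp
      from this[OF one] have hV: "h \<in> V" by simp
      obtain B' where B': "\<And>y. y \<in> S \<Longrightarrow> \<bar>h y\<bar> \<le> B'" using hV unfolding V_def by blast
      have hm [measurable]: "h \<in> borel_measurable borel" using hV unfolding V_def by blast
      have heq: "(\<integral>y. h y \<partial>D1) = (\<integral>y. h y \<partial>D2)"
      proof -
        have "(\<integral>y. (\<Prod>k\<leftarrow>[]. y k) * h y \<partial>D1) = (\<integral>y. (\<Prod>k\<leftarrow>[]. y k) * h y \<partial>D2)"
          using hV unfolding V_def by blast
        then show ?thesis by simp
      qed
      have "\<bar>(\<integral>y. g y \<partial>D1) - (\<integral>y. h y \<partial>D1)\<bar> \<le> e / 2"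
      proof -
        have ae: "AE y in D1. \<bar>g y - h y\<bar> \<le> e / 2"
          using S1 by eventually_elim (rule less_imp_le[OF h(2)])
        have "\<bar>\<integral>y. g y - h y \<partial>D1\<bar> \<le> (\<integral>y. \<bar>g y - h y\<bar> \<partial>D1)" by (rule integral_abs_bound)
        also have "\<dots> \<le> (\<integral>y. e / 2 \<partial>D1)"
          by (intro integral_mono_AE integrable_abs Bochner_Integration.integrable_diff int[OF gm B] int[OF hm B'] ae) simp_all
        finally show ?thesis using int(1)[OF gm B] int(1)[OF hm B'] by (simp add: D1.prob_space)
      qed
      moreover have "\<bar>(\<integral>y. g y \<partial>D2) - (\<integral>y. h y \<partial>D2)\<bar> \<le> e / 2"
      proof -
        have ae: "AE y in D2. \<bar>g y - h y\<bar> \<le> e / 2"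
          using S2 by eventually_elim (rule less_imp_le[OF h(2)])
        have "\<bar>\<integral>y. g y - h y \<partial>D2\<bar> \<le> (\<integral>y. \<bar>g y - h y\<bar> \<partial>D2)" by (rule integral_abs_bound)
        also have "\<dots> \<le> (\<integral>y. e / 2 \<partial>D2)"
          by (intro integral_mono_AE integrable_abs Bochner_Integration.integrable_diff int[OF gm B] int[OF hm B'] ae) simp_all
        finally show ?thesis using int(2)[OF gm B] int(2)[OF hm B'] by (simp add: D2.prob_space)
      qed
      ultimately show ?thesis using heq by linarith
    qed
    then have "\<bar>(\<integral>y. g y \<partial>D1) - (\<integral>y. g y \<partial>D2)\<bar> \<le> 0" by (rule field_le_epsilon)
    then show ?thesis by simp
  qed
  have closed_eq: "measure D1 A = measure D2 A" if A: "closed A" for A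
  proof (cases "A = {}")
    case False
    \<comment> \<open>These continuous functions decrease to the indicator of the closed set
      \<open>A\<close>, and closed sets form an intersection-stable generator.\<close>
    define g where "g n y = max 0 (1 - real n * infdist y A)" for n and y :: "nat \<Rightarrow> real"
    have gc: "continuous_on UNIV (g n)" for n unfolding g_def by (intro continuous_intros)
    have gm: "g n \<in> borel_measurable borel" for n by (rule borel_measurable_continuous_onI[OF gc])
    have Am: "A \<in> sets borel" using A by simp
    have gl: "(\<lambda>n. g n y) \<longlonglongrightarrow> indicator A y" for y
    proof (cases "y \<in> A")
      case False
      then have d: "0 < infdist y A" using infdist_pos_not_in_closed[OF A \<open>A \<noteq> {}\<close>] by auto
      obtain n0 where n0: "1 / infdist y A \<le> real n0" using real_arch_simple by blast
      have "g n y = 0" if "n0 \<le> n" for n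
      proof -
        have "1 / infdist y A \<le> real n" using n0 that by linarith
        then show ?thesis using d by (simp add: g_def field_simps)
      qed
      then have "eventually (\<lambda>n. g n y = indicator A y) sequentially"
        using False by (auto simp: eventually_sequentially)
      then show ?thesis by (rule tendsto_eventually)
    qed (simp add: g_def)
    have gb: "norm (g n y) \<le> 1" for n y using infdist_nonneg[of y A] by (simp add: g_def)
    have "(\<lambda>n. \<integral>y. g n y \<partial>D1) \<longlonglongrightarrow> (\<integral>y. indicator A y \<partial>D1)"
      by (rule integral_dominated_convergence[where w = "\<lambda>_. 1"]) (use gl gb gm Am in auto)
    moreover have "(\<lambda>n. \<integral>y. g n y \<partial>D2) \<longlonglongrightarrow> (\<integral>y. indicator A y \<partial>D2)"
      by (rule integral_dominated_convergence[where w = "\<lambda>_. 1"]) (use gl gb gm Am in auto)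
    ultimately have "(\<integral>y. indicat_real A y \<partial>D1) = (\<integral>y. indicator A y \<partial>D2)"
      unfolding cont[OF gc] by (rule LIMSEQ_unique)
    then show ?thesis using Am D1(2) D2(2) by simp
  qed simp
  show "D1 = D2"
  proof (rule measure_eqI_generator_eq[where E = "Collect closed" and \<Omega> = UNIV and A = "\<lambda>_. UNIV"])
    show "Int_stable (Collect closed)" by (auto simp: Int_stable_def)
    show "emeasure D1 Y = emeasure D2 Y" if "Y \<in> Collect closed" for Y
      using that closed_eq by (simp add: D1.emeasure_eq_measure D2.emeasure_eq_measure)
    show "sets D1 = sigma_sets UNIV (Collect closed)" "sets D2 = sigma_sets UNIV (Collect closed)"
      unfolding D1(2) D2(2) borel_eq_closed by simp_all
  qed auto
qed

text \<open>The map \<open>y \<mapsto> exp (- y)\<close> carries the variables into the compact unit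
  cube and their Laplace transforms into mixed moments. Lists with repetition amount to integer
  masses, and these already give all moments.\<close>

lemma eq_laplace_imp_eq_integral:
  fixes Y1 :: "'a \<Rightarrow> nat \<Rightarrow> real" and Y2 :: "'b \<Rightarrow> nat \<Rightarrow> real"
  assumes M1: "prob_space M1" and m1: "\<And>i. (\<lambda>\<omega>. Y1 \<omega> i) \<in> borel_measurable M1" and n1: "\<And>\<omega> i. 0 \<le> Y1 \<omega> i"
    and M2: "prob_space M2" and m2: "\<And>i. (\<lambda>\<omega>. Y2 \<omega> i) \<in> borel_measurable M2" and n2: "\<And>\<omega> i. 0 \<le> Y2 \<omega> i"
    and eq: "\<And>l. (\<integral>\<omega>. exp (- (\<Sum>i\<leftarrow>l. Y1 \<omega> i)) \<partial>M1) = (\<integral>\<omega>. exp (- (\<Sum>i\<leftarrow>l. Y2 \<omega> i)) \<partial>M2)"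
    and F: "F \<in> borel_measurable (Pi\<^sub>M UNIV (\<lambda>_. borel))"
  shows "(\<integral>\<omega>. F (Y1 \<omega>) \<partial>M1) = (\<integral>\<omega>. F (Y2 \<omega>) \<partial>M2 :: real)"
proof -
  interpret M1: prob_space M1 by (rule M1)
  interpret M2: prob_space M2 by (rule M2)
  note bo = sets_PiM_equal_borel[where 'a = nat and 'b = real]
  have mb: "measurable M (Pi\<^sub>M UNIV (\<lambda>_. borel)) = measurable M (borel :: (nat \<Rightarrow> real) measure)" for M :: "'z measure"
    by (rule measurable_cong_sets[OF refl bo])
  have mb': "borel_measurable (Pi\<^sub>M UNIV (\<lambda>_. borel)) = (borel_measurable borel :: ((nat \<Rightarrow> real) \<Rightarrow> real) set)"
    by (rule measurable_cong_sets[OF bo refl])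
  define Z1 where "Z1 \<omega> i = exp (- Y1 \<omega> i)" for \<omega> i
  define Z2 where "Z2 \<omega> i = exp (- Y2 \<omega> i)" for \<omega> i
  have Z1: "Z1 \<in> measurable M1 borel" unfolding mb[symmetric] Z1_def
    by (rule measurable_PiM_single') (use m1 in measurable)
  have Z2: "Z2 \<in> measurable M2 borel" unfolding mb[symmetric] Z2_def
    by (rule measurable_PiM_single') (use m2 in measurable)
  have coord [measurable]: "(\<lambda>y::nat \<Rightarrow> real. y k) \<in> borel_measurable borel" for k
    by (intro borel_measurable_continuous_onI continuous_on_product_coordinates)
  have mono_m: "(\<lambda>y::nat \<Rightarrow> real. \<Prod>k\<leftarrow>l. y k) \<in> borel_measurable borel" for l
    by (induct l) simp_all
  have p1: "(\<Prod>k\<leftarrow>l. Z1 \<omega> k) = exp (- (\<Sum>i\<leftarrow>l. Y1 \<omega> i))" for l \<omega>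
    by (induct l) (simp_all add: Z1_def exp_add[symmetric])
  have p2: "(\<Prod>k\<leftarrow>l. Z2 \<omega> k) = exp (- (\<Sum>i\<leftarrow>l. Y2 \<omega> i))" for l \<omega>
    by (induct l) (simp_all add: Z2_def exp_add[symmetric])
  have cube: "{y::nat \<Rightarrow> real. \<forall>i. y i \<in> {0..1}} \<in> sets borel"
  proof -
    have "(\<Inter>i. {y::nat \<Rightarrow> real. y i \<in> {0..1}}) \<in> sets borel"
      using measurable_sets[OF coord, of "{0..1}"] by (intro sets.countable_INT') (auto simp: vimage_def)
    moreover have "(\<Inter>i. {y::nat \<Rightarrow> real. y i \<in> {0..1}}) = {y. \<forall>i. y i \<in> {0..1}}" by blast
    ultimately show ?thesis by simp
  qed
  have D: "distr M1 borel Z1 = distr M2 borel Z2"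
  proof (rule eq_moments_imp_eq_measure)
    show "prob_space (distr M1 borel Z1)" by (rule M1.prob_space_distr[OF Z1])
    show "prob_space (distr M2 borel Z2)" by (rule M2.prob_space_distr[OF Z2])
    show "AE y in distr M1 borel Z1. \<forall>i. y i \<in> {0..1}"
      using cube n1 by (subst AE_distr_iff[OF Z1]) (auto simp: Z1_def)
    show "AE y in distr M2 borel Z2. \<forall>i. y i \<in> {0..1}"
      using cube n2 by (subst AE_distr_iff[OF Z2]) (auto simp: Z2_def)
    show "(\<integral>y. (\<Prod>k\<leftarrow>l. y k) \<partial>distr M1 borel Z1) = (\<integral>y. (\<Prod>k\<leftarrow>l. y k) \<partial>distr M2 borel Z2)" for l
      using eq[of l] by (simp add: integral_distr[OF Z1 mono_m] integral_distr[OF Z2 mono_m] p1 p2)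
  qed simp_all
  have lnm: "(\<lambda>y i. - ln (y i)) \<in> measurable (borel :: (nat \<Rightarrow> real) measure) (borel :: (nat \<Rightarrow> real) measure)"
    unfolding mb[symmetric] by (rule measurable_PiM_single') (use coord in measurable)
  \<comment> \<open>\<open>- ln\<close> undoes the exponential in each coordinate, so
    \<open>F\<close> of the original variables is a measurable function of the transformed
    ones.\<close>
  have Fm: "(\<lambda>y. F (\<lambda>i. - ln (y i))) \<in> borel_measurable borel"
    using measurable_compose[OF lnm F[unfolded mb']] .
  have "(\<integral>\<omega>. F (Y1 \<omega>) \<partial>M1) = (\<integral>y. F (\<lambda>i. - ln (y i)) \<partial>distr M1 borel Z1)"
    by (subst integral_distr[OF Z1 Fm]) (simp add: Z1_def)
  also have "\<dots> = (\<integral>\<omega>. F (Y2 \<omega>) \<partial>M2)"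
    unfolding D by (subst integral_distr[OF Z2 Fm]) (simp add: Z2_def)
  finally show ?thesis .
qed

context ray_knight
begin

text \<open>The left side becomes a single expectation on the product of the Gaussian space with
  \<open>P a\<close>, so independence is built in. The two families of nonnegative variables are
  then compared by their Laplace transforms.\<close>

theorem second_ray_knight:
  fixes H :: "(nat \<Rightarrow> real) \<Rightarrow> real" and \<eta> :: "'s \<Rightarrow> 'g \<Rightarrow> real" and x :: "nat \<Rightarrow> 's"
  assumes G: "centered_gaussian_process N \<eta> (killed_potential_density f X P a)" and t: "0 \<le> t"
    and H: "H \<in> borel_measurable (Pi\<^sub>M UNIV (\<lambda>_. borel))" and b: "bounded (range H)"
  shows "(\<integral>v. (\<integral>\<omega>. H (\<lambda>i. local_time f X (x i) (enn2real (inverse_local_time f X a t \<omega>)) \<omega>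
                          + 1 / 2 * (\<eta> (x i) v)\<^sup>2) \<partial>completion (P a)) \<partial>N)
       = (\<integral>v. H (\<lambda>i. 1 / 2 * (\<eta> (x i) v + sqrt (2 * t))\<^sup>2) \<partial>N)"
proof -
  have N: "prob_space N" and nrv: "\<And>I c. finite I \<Longrightarrow> normal_rv N (\<lambda>v. \<Sum>x\<in>I. c x * \<eta> x v)"
    using G by (auto simp: centered_gaussian_process_def gaussian_process_def)
  have n1: "normal_rv N (\<eta> y)" for y using nrv[of "{y}" "\<lambda>_. 1"] by simp
  have m\<eta> [measurable]: "\<eta> y \<in> borel_measurable N" for y using n1[of y] by (simp add: normal_rv_def)
  interpret N: prob_space N by (rule N)
  interpret Pa: prob_space "P a" by (rule prob_space_P)
  interpret NP: pair_prob_space N "P a" ..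
  define T where "T \<omega> = enn2real (tau a t \<omega>)" for \<omega>
  define L where "L i \<omega> = enn2real (ell (x i) (T \<omega>) \<omega>)" for i \<omega>
  have mL [measurable]: "L i \<in> borel_measurable (P a)" for i
    unfolding L_def T_def by (intro borel_measurable_enn2real ell_comp tau_comp id_comp measurable_const) simp_all
  have T0: "0 \<le> T \<omega>" for \<omega> by (simp add: T_def)
  have g: "AE \<omega> in P a. \<forall>i. good (x i) \<omega> \<and> (\<forall>s\<ge>0. local_time f X (x i) s \<omega> = LT (x i) s \<omega>)"
    unfolding AE_all_countable by (intro allI AE_good)
  have L: "ell y (T \<omega>) \<omega> = ennreal (LT y (T \<omega>) \<omega>)" "0 \<le> LT y (T \<omega>) \<omega>" if "good y \<omega>" for y \<omega>
    using goodD(2)[OF that T0] goodD(7)[OF that] by auto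
  have HmY: "(\<lambda>z. H (Y z)) \<in> borel_measurable M" if "\<And>i. (\<lambda>z. Y z i) \<in> borel_measurable M" for Y and M :: "'z measure"
    by (rule measurable_compose[OF _ H], rule measurable_PiM_single') (use that in auto)
  \<comment> \<open>The completion is removed at fixed v by an almost surely equal version that is
    measurable for \<open>P a\<close>, which Fubini on the product needs.\<close>
  have inner: "(\<integral>\<omega>. H (\<lambda>i. local_time f X (x i) (enn2real (inverse_local_time f X a t \<omega>)) \<omega> + 1 / 2 * (\<eta> (x i) v)\<^sup>2) \<partial>completion (P a))
    = (\<integral>\<omega>. H (\<lambda>i. L i \<omega> + 1 / 2 * (\<eta> (x i) v)\<^sup>2) \<partial>P a)" for v
  proof (rule integral_completion_AE)
    show "(\<lambda>\<omega>. H (\<lambda>i. L i \<omega> + 1 / 2 * (\<eta> (x i) v)\<^sup>2)) \<in> borel_measurable (P a)"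
      by (rule HmY) measurable
    show "AE \<omega> in P a. H (\<lambda>i. local_time f X (x i) (enn2real (inverse_local_time f X a t \<omega>)) \<omega> + 1 / 2 * (\<eta> (x i) v)\<^sup>2)
      = H (\<lambda>i. L i \<omega> + 1 / 2 * (\<eta> (x i) v)\<^sup>2)"
      using g AE_inverse_local_time[OF t, of a]
    proof eventually_elim
      case (elim \<omega>)
      have "local_time f X (x i) (enn2real (inverse_local_time f X a t \<omega>)) \<omega> = L i \<omega>" for i
      proof -
        have "good (x i) \<omega>" "local_time f X (x i) (T \<omega>) \<omega> = LT (x i) (T \<omega>) \<omega>" using elim(1) T0 by auto
        then show ?thesis using L[of "x i" \<omega>] by (simp add: elim(2) L_def T_def)
      qed
      then show ?case by simp
    qed
  qed
  obtain B where B: "\<And>y. \<bar>H y\<bar> \<le> B" using b by (auto simp: bounded_iff)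
  define Y1 where "Y1 z i = L i (snd z) + 1 / 2 * (\<eta> (x i) (fst z))\<^sup>2" for z and i :: nat
  define Y2 where "Y2 v i = 1 / 2 * (\<eta> (x i) v + sqrt (2 * t))\<^sup>2" for v and i :: nat
  have mY1 [measurable]: "(\<lambda>z. Y1 z i) \<in> borel_measurable (N \<Otimes>\<^sub>M P a)" for i unfolding Y1_def by measurable
  have mY2 [measurable]: "(\<lambda>v. Y2 v i) \<in> borel_measurable N" for i unfolding Y2_def by measurable
  have sum_m [measurable]: "(\<lambda>z. \<Sum>i\<leftarrow>l. Y z i) \<in> borel_measurable M"
    if "\<And>i. (\<lambda>z. Y z i) \<in> borel_measurable M" for Y :: "_ \<Rightarrow> nat \<Rightarrow> real" and M :: "'z measure" and l
    by (induct l) (use that in simp_all)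
  have laplace: "(\<integral>z. exp (- (\<Sum>i\<leftarrow>l. Y1 z i)) \<partial>(N \<Otimes>\<^sub>M P a)) = (\<integral>v. exp (- (\<Sum>i\<leftarrow>l. Y2 v i)) \<partial>N)" for l
  proof -
    \<comment> \<open>Unit masses: a repeated index in l stands for a larger integer mass at its
      point.\<close>
    define k where "k = map (\<lambda>i. (1 :: real, x i)) l"
    have k: "nonneg k" by (auto simp: nonneg_def k_def)
    define w where "w = ww 0 k"
    define \<kappa> where "\<kappa> = (\<Sum>j\<leftarrow>k. fst j * w (snd j))"
    have k2: "(\<Sum>j\<leftarrow>k. fst j * h (snd j)) = (\<Sum>i\<leftarrow>l. h (x i))" for h :: "'s \<Rightarrow> real"
      by (simp add: k_def o_def)
    have Lsum: "0 \<le> (\<Sum>i\<leftarrow>l'. L i \<omega>)" for \<omega> l' by (induct l') (simp_all add: L_def)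
    have ae: "AE \<omega> in P a. ehat (Aw k (enn2real (tau a t \<omega>)) \<omega>) = ennreal (exp (- (\<Sum>i\<leftarrow>l. L i \<omega>)))"
      using g
    proof eventually_elim
      case (elim \<omega>)
      have "Aw (map (\<lambda>i. (1 :: real, x i)) l') (T \<omega>) \<omega> = ennreal (\<Sum>i\<leftarrow>l'. L i \<omega>)" for l'
      proof (induct l')
        case (Cons i l')
        have "ell (x i) (T \<omega>) \<omega> = ennreal (L i \<omega>)" "0 \<le> L i \<omega>" using L[of "x i" \<omega>] elim by (auto simp: L_def)
        then show ?case using Cons Lsum[of \<omega> l'] by (simp add: Aw_simps ennreal_plus[symmetric] del: ennreal_plus)
      qed (simp add: Aw_simps)
      then show ?case using Lsum by (simp add: k_def T_def[symmetric] ehat_ennreal)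
    qed
    have "(\<integral>\<^sup>+\<omega>. ennreal (exp (- (\<Sum>i\<leftarrow>l. L i \<omega>))) \<partial>P a) = ennreal (exp (- t * \<kappa>))"
      using inverse_local_time_laplace(2)[OF k t] nn_integral_cong_AE[OF ae] by (simp add: \<kappa>_def w_def)
    then have EL: "(\<integral>\<omega>. exp (- (\<Sum>i\<leftarrow>l. L i \<omega>)) \<partial>P a) = exp (- t * \<kappa>)"
      by (subst integral_eq_nn_integral) auto
    have split: "exp (- (\<Sum>i\<leftarrow>l. Y1 (v, \<omega>) i)) = exp (- (\<Sum>i\<leftarrow>l. (\<eta> (x i) v)\<^sup>2) / 2) * exp (- (\<Sum>i\<leftarrow>l. L i \<omega>))" for v \<omega>
      by (induct l) (simp_all add: Y1_def exp_add[symmetric] field_simps)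
    have Y0: "0 \<le> (\<Sum>i\<leftarrow>l. Y1 z i)" for z by (intro sum_list_nonneg) (auto simp: Y1_def L_def)
    have "integrable (N \<Otimes>\<^sub>M P a) (\<lambda>z. exp (- (\<Sum>i\<leftarrow>l. Y1 z i)))"
      by (rule NP.integrable_const_bound[where B = 1]) (use Y0 in simp, measurable)
    from NP.integral_fst'[OF this]
    have "(\<integral>z. exp (- (\<Sum>i\<leftarrow>l. Y1 z i)) \<partial>(N \<Otimes>\<^sub>M P a)) = (\<integral>v. \<integral>\<omega>. exp (- (\<Sum>i\<leftarrow>l. Y1 (v, \<omega>) i)) \<partial>P a \<partial>N)" by simp
    also have "\<dots> = exp (- t * \<kappa>) * (\<integral>v. exp (- (\<Sum>i\<leftarrow>l. (\<eta> (x i) v)\<^sup>2) / 2) \<partial>N)"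
      unfolding split by (simp add: EL)
    also have "\<dots> = (\<integral>v. exp (- (\<Sum>i\<leftarrow>l. (\<eta> (x i) v + sqrt (2 * t))\<^sup>2) / 2) \<partial>N)"
    proof -
      have kn: "\<And>j. j \<in> set k \<Longrightarrow> 0 \<le> fst j" by (auto simp: k_def)
      have wk: "w z = 1 - (\<Sum>j\<leftarrow>k. fst j * killed_potential_density f X P a z (snd j) * w (snd j))" for z
        unfolding w_def by (rule inverse_local_time_laplace(1)[OF k t])
      \<comment> \<open>The shift \<open>sqrt (2 * t)\<close> is chosen so that half its square is
        t, the factor with which \<kappa> enters on the local time side.\<close>
      show ?thesis using gaussian_square_laplace[OF G kn wk, of "sqrt (2 * t)"] t
        by (simp add: k2[of "\<lambda>y. (\<eta> y _)\<^sup>2"] k2[of "\<lambda>y. (\<eta> y _ + sqrt (2 * t))\<^sup>2"] \<kappa>_def)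
    qed
    also have "\<dots> = (\<integral>v. exp (- (\<Sum>i\<leftarrow>l. Y2 v i)) \<partial>N)"
    proof -
      have "(\<Sum>i\<leftarrow>l. (\<eta> (x i) v + sqrt (2 * t))\<^sup>2) / 2 = (\<Sum>i\<leftarrow>l. Y2 v i)" for v
        by (induct l) (simp_all add: Y2_def field_simps)
      then show ?thesis by simp
    qed
    finally show ?thesis .
  qed
  have "integrable (N \<Otimes>\<^sub>M P a) (\<lambda>z. H (Y1 z))"
    by (rule NP.integrable_const_bound[where B = B]) (use B in simp, rule HmY[OF mY1])
  from NP.integral_fst'[OF this]
  have "(\<integral>v. \<integral>\<omega>. H (\<lambda>i. L i \<omega> + 1 / 2 * (\<eta> (x i) v)\<^sup>2) \<partial>P a \<partial>N) = (\<integral>z. H (Y1 z) \<partial>(N \<Otimes>\<^sub>M P a))"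
    by (simp add: Y1_def[abs_def])
  also have "\<dots> = (\<integral>v. H (Y2 v) \<partial>N)"
    by (rule eq_laplace_imp_eq_integral[OF NP.prob_space_axioms mY1 _ N mY2 _ laplace H]) (simp_all add: Y1_def Y2_def L_def)
  finally show ?thesis unfolding inner by (simp add: Y2_def[abs_def])
qed

end

theorem mainTheorem1:
  fixes m :: "'s::{metric_space, second_countable_topology} measure"
    and p :: "real \<Rightarrow> 's \<Rightarrow> 's \<Rightarrow> real"
    and W :: "'w measure"
    and X :: "real \<Rightarrow> 'w \<Rightarrow> 's option"
    and \<theta> :: "real \<Rightarrow> 'w \<Rightarrow> 'w"
    and P :: "'s \<Rightarrow> 'w measure"
    and f :: "real \<Rightarrow> 's \<Rightarrow> 's \<Rightarrow> real"
    and a :: 's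
    and N :: "'g measure"
    and \<eta> :: "'s \<Rightarrow> 'g \<Rightarrow> real"
    and t :: real
    and x :: "nat \<Rightarrow> 's"
    and F :: "(nat \<Rightarrow> real) \<Rightarrow> real"
  assumes "locally_compact_space (euclidean :: 's topology)"
    and "symmetric_markov_process m p W X \<theta> P"
    and "\<And>\<alpha> y z. 0 < \<alpha> \<Longrightarrow> potential_density p \<alpha> y z < \<infinity>"
    and "\<And>\<alpha>. 0 < \<alpha> \<Longrightarrow> continuous_on UNIV (\<lambda>(y, z). enn2real (potential_density p \<alpha> y z))"
    and "potential_density p 0 a a = \<infinity>"
    and "\<And>y. AE \<omega> in P a. hitting_time X y \<omega> < \<infinity>"
    and "\<And>y. AE \<omega> in P y. hitting_time X a \<omega> < \<infinity>"
    and "approximate_deltas m f"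
    and "\<And>y z. AE \<omega> in P z. \<forall>K. uniform_limit {0..K}
           (\<lambda>\<epsilon> s. occupation f X \<epsilon> y s \<omega>) (\<lambda>s. local_time f X y s \<omega>) (at_right 0)"
    and "centered_gaussian_process N \<eta> (killed_potential_density f X P a)"
    and "0 < t"
    and "F \<in> borel_measurable (Pi\<^sub>M UNIV (\<lambda>_. borel))"
    and "bounded (range F)"
  shows "(\<integral>v. (\<integral>\<omega>. F (\<lambda>i. local_time f X (x i) (enn2real (inverse_local_time f X a t \<omega>)) \<omega>
                          + 1 / 2 * (\<eta> (x i) v)\<^sup>2) \<partial>completion (P a)) \<partial>N)
       = (\<integral>v. F (\<lambda>i. 1 / 2 * (\<eta> (x i) v + sqrt (2 * t))\<^sup>2) \<partial>N)"
proof -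
  interpret symmetric_markov_process m p W X \<theta> P by fact
  interpret ray_knight m p W X \<theta> P f a by unfold_locales (fact assms)+
  show ?thesis using assms(11) by (intro second_ray_knight assms(10,12,13)) simp
qed

end
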